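(* For each integer $\ell \geq 4$ there is an algorithm which, given a graph $G$ that contains no long theta and no hole of length four (as induced subgraphs), decides whether $G$ contains a long ban-the-bomb as an induced subgraph, in time $\mathcal{O}(|G|^{2\ell+1})$.
   Context: Graphs are finite and simple; $|G|$ is the number of vertices. A hole is an induced cycle of length at least four; it is long if its length is at least $\ell$. A theta is a graph consisting of two non-adjacent vertices $u,v$ and three $uv$-paths $P_1,P_2,P_3$ with pairwise disjoint interiors (and no other edges); it is long if $|E(P_i)|+|E(P_j)|\geq \ell$ for all distinct $i,j$. A ban-the-bomb is a graph consisting of a hole $C$ and a vertex $v$ such that there is a path $x \text{-} y \text{-} z$ of $C$ and a vertex $w \in V(C)$ with $w$ non-adjacent to $x, y$, where $v$ is adjacent to $w,x,z$ and $v$ has no neighbours in $V(C)\setminus\{w,x,y,z\}$. A ban-the-bomb is long if every hole in it is long. *)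

theory Defs
  imports
    "Graph_Theory.Digraph_Component"
    "Graph_Theory.Vertex_Walk"
    "HOL-Library.Landau_Symbols"
begin

section \<open>Holes, thetas and ban-the-bombs\<close>

text \<open>
  A finite simple graph is a \<^locale>\<open>graph\<close>, i.e. a finite symmetric digraph without
  loops or parallel arcs; two vertices are adjacent iff one dominates the other.
\<close>

text \<open>The list enumerates the vertices of the induced cycle in cyclic order, so its length is
  the length of the hole.\<close>

definition hole :: "('a, 'b) pre_digraph \<Rightarrow> 'a list \<Rightarrow> bool" where
  "hole G C \<longleftrightarrow>
     4 \<le> length C \<and> distinct C \<and> set C \<subseteq> verts G \<and>
     (\<forall>i < length C. \<forall>j < length C.
        (C ! i \<rightarrow>\<^bsub>G\<^esub> C ! j) \<longleftrightarrow> j = Suc i mod length C \<or> i = Suc j mod length C)"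

definition path_between :: "('a, 'b) pre_digraph \<Rightarrow> 'a \<Rightarrow> 'a \<Rightarrow> 'a list \<Rightarrow> bool" where
  "path_between G u v P \<longleftrightarrow> vpath P G \<and> hd P = u \<and> last P = v"

definition path_interior :: "'a list \<Rightarrow> 'a set" where
  "path_interior P = set P - {hd P, last P}"

definition path_edges :: "'a list \<Rightarrow> ('a \<times> 'a) set" where
  "path_edges P = set (vwalk_arcs P) \<union> (set (vwalk_arcs P))\<inverse>"

definition theta :: "('a, 'b) pre_digraph \<Rightarrow> 'a \<Rightarrow> 'a \<Rightarrow> 'a list \<Rightarrow> 'a list \<Rightarrow> 'a list \<Rightarrow> bool" where
  "theta H u v P\<^sub>1 P\<^sub>2 P\<^sub>3 \<longleftrightarrow>
     u \<noteq> v \<and> \<not> (u \<rightarrow>\<^bsub>H\<^esub> v) \<and>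
     path_between H u v P\<^sub>1 \<and> path_between H u v P\<^sub>2 \<and> path_between H u v P\<^sub>3 \<and>
     path_interior P\<^sub>1 \<inter> path_interior P\<^sub>2 = {} \<and>
     path_interior P\<^sub>1 \<inter> path_interior P\<^sub>3 = {} \<and>
     path_interior P\<^sub>2 \<inter> path_interior P\<^sub>3 = {} \<and>
     verts H = set P\<^sub>1 \<union> set P\<^sub>2 \<union> set P\<^sub>3 \<and>
     arcs_ends H = path_edges P\<^sub>1 \<union> path_edges P\<^sub>2 \<union> path_edges P\<^sub>3"

definition long_theta :: "nat \<Rightarrow> ('a, 'b) pre_digraph \<Rightarrow> bool" where
  "long_theta l H \<longleftrightarrow>
     (\<exists>u v P\<^sub>1 P\<^sub>2 P\<^sub>3. theta H u v P\<^sub>1 P\<^sub>2 P\<^sub>3 \<and>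
        l \<le> vwalk_length P\<^sub>1 + vwalk_length P\<^sub>2 \<and>
        l \<le> vwalk_length P\<^sub>1 + vwalk_length P\<^sub>3 \<and>
        l \<le> vwalk_length P\<^sub>2 + vwalk_length P\<^sub>3)"

text \<open>
  Since \<open>C\<close> is induced, \<open>x-y-z\<close> is a path of \<open>C\<close> iff it is a path of \<open>H\<close> on vertices of \<open>C\<close>.
  Whether \<open>v\<close> is adjacent to \<open>y\<close>, and \<open>w\<close> to \<open>z\<close>, is left open. The conditions imply that \<open>w\<close>
  is distinct from \<open>x\<close>, \<open>y\<close> and \<open>z\<close>.
\<close>

definition ban_the_bomb :: "('a, 'b) pre_digraph \<Rightarrow> bool" where
  "ban_the_bomb H \<longleftrightarrow>
     (\<exists>C v x y z w.
        hole H C \<and> v \<notin> set C \<and> verts H = insert v (set C) \<and>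
        {x, y, z, w} \<subseteq> set C \<and>
        x \<noteq> z \<and> (x \<rightarrow>\<^bsub>H\<^esub> y) \<and> (y \<rightarrow>\<^bsub>H\<^esub> z) \<and>
        \<not> (w \<rightarrow>\<^bsub>H\<^esub> x) \<and> \<not> (w \<rightarrow>\<^bsub>H\<^esub> y) \<and>
        (v \<rightarrow>\<^bsub>H\<^esub> w) \<and> (v \<rightarrow>\<^bsub>H\<^esub> x) \<and> (v \<rightarrow>\<^bsub>H\<^esub> z) \<and>
        (\<forall>c \<in> set C - {w, x, y, z}. \<not> (v \<rightarrow>\<^bsub>H\<^esub> c)))"

definition long_ban_the_bomb :: "nat \<Rightarrow> ('a, 'b) pre_digraph \<Rightarrow> bool" where
  "long_ban_the_bomb l H \<longleftrightarrow> ban_the_bomb H \<and> (\<forall>C. hole H C \<longrightarrow> l \<le> length C)"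

definition contains_induced :: "(('a, 'b) pre_digraph \<Rightarrow> bool) \<Rightarrow> ('a, 'b) pre_digraph \<Rightarrow> bool" where
  "contains_induced P G \<longleftrightarrow> (\<exists>H. induced_subgraph H G \<and> P H)"


section \<open>Random access machines\<close>

text \<open>
  Algorithms are programs of a word RAM with unit-cost instructions. A configuration consists
  of the registers, which instructions name directly, and the memory, which is accessed by
  indirect addressing only. As a program is a finite object, it uses a fixed number of registers.
\<close>

datatype program =
    Skip
  | Const nat nat
  | Add nat nat nat
  | Sub nat nat nat
  | Mul nat nat nat
  | Load nat nat
  | Store nat nat
  | Seq program program
  | IfNZ nat program program
  | WhileNZ nat program

type_synonym config = "(nat \<Rightarrow> nat) \<times> (nat \<Rightarrow> nat)"

text \<open>
  \<open>exec W p c t c'\<close>: the program \<open>p\<close>, started in \<open>c\<close>, halts in \<open>c'\<close> after exactly \<open>t\<close> steps,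
  and no value it computes exceeds \<open>W\<close>. A computation that would produce a larger value is
  stuck, so that it does not halt. Each instruction and each evaluation of a branching or loop
  condition takes one step.
\<close>

inductive exec :: "nat \<Rightarrow> program \<Rightarrow> config \<Rightarrow> nat \<Rightarrow> config \<Rightarrow> bool" for W :: nat where
  Skip: "exec W Skip c 1 c"
| Const: "k \<le> W \<Longrightarrow> exec W (Const i k) (R, M) 1 (R(i := k), M)"
| Add: "R j + R k \<le> W \<Longrightarrow> exec W (Add i j k) (R, M) 1 (R(i := R j + R k), M)"
| Sub: "R j - R k \<le> W \<Longrightarrow> exec W (Sub i j k) (R, M) 1 (R(i := R j - R k), M)"
| Mul: "R j * R k \<le> W \<Longrightarrow> exec W (Mul i j k) (R, M) 1 (R(i := R j * R k), M)"
| Load: "exec W (Load i j) (R, M) 1 (R(i := M (R j)), M)"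
| Store: "exec W (Store i j) (R, M) 1 (R, M(R i := R j))"
| Seq: "exec W p c t c' \<Longrightarrow> exec W q c' t' c'' \<Longrightarrow> exec W (Seq p q) c (t + t') c''"
| IfTrue: "fst c i \<noteq> 0 \<Longrightarrow> exec W p c t c' \<Longrightarrow> exec W (IfNZ i p q) c (Suc t) c'"
| IfFalse: "fst c i = 0 \<Longrightarrow> exec W q c t c' \<Longrightarrow> exec W (IfNZ i p q) c (Suc t) c'"
| WhileTrue: "fst c i \<noteq> 0 \<Longrightarrow> exec W p c t c' \<Longrightarrow> exec W (WhileNZ i p) c' t' c'' \<Longrightarrow>
    exec W (WhileNZ i p) c (Suc (t + t')) c''"
| WhileFalse: "fst c i = 0 \<Longrightarrow> exec W (WhileNZ i p) c 1 c"

inductive_cases exec_elims: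
  "exec W Skip c t c'"
  "exec W (Const i k) c t c'"
  "exec W (Add i j k) c t c'"
  "exec W (Sub i j k) c t c'"
  "exec W (Mul i j k) c t c'"
  "exec W (Load i j) c t c'"
  "exec W (Store i j) c t c'"
  "exec W (Seq p q) c t c'"
  "exec W (IfNZ i p q) c t c'"
  "exec W (WhileNZ i p) c t c'"

lemma exec_deterministic:
  assumes "exec W p c t c'" and "exec W p c u d"
  shows "t = u \<and> c' = d"
  using assms
proof (induction arbitrary: u d rule: exec.induct)
  case (Seq p c t c' q t' c'')
  from Seq.prems show ?case
    by (rule exec_elims(8)) (metis Seq.IH)
next
  case (WhileTrue c i p t c' t' c'')
  from WhileTrue.prems show ?case
    by (rule exec_elims(10)) (metis WhileTrue.IH, use WhileTrue.hyps in simp)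
next
  case (IfTrue c i p t c' q)
  from IfTrue.prems show ?case
    by (rule exec_elims(9)) (metis IfTrue.IH, use IfTrue.hyps in simp)
next
  case (IfFalse c i q t c' p)
  from IfFalse.prems show ?case
    by (rule exec_elims(9)) (use IfFalse.hyps in simp, metis IfFalse.IH)
next
  case (WhileFalse c i p)
  from WhileFalse.prems show ?case
    by (rule exec_elims(10)) (use WhileFalse.hyps in simp_all)
qed (erule exec_elims; simp)+

text \<open>
  The input is the number of vertices, in register 0, together with the adjacency matrix,
  stored row by row in the memory; everything else is 0. The vertices of an input graph are
  \<open>0, \<dots>, n - 1\<close>.
\<close>

definition input_config :: "nat \<Rightarrow> (nat, 'b) pre_digraph \<Rightarrow> config" where
  "input_config n G =
     ((\<lambda>_. 0)(0 := n),
      \<lambda>a. if a < n * n \<and> ((a div n) \<rightarrow>\<^bsub>G\<^esub> (a mod n)) then 1 else 0)"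

text \<open>
  The word length is \<open>O(log n)\<close>: values are bounded by a polynomial in the number \<open>n\<close> of
  vertices that depends on the program only. The answer is returned in register 0. Nothing is
  required for graphs that violate the promise \<open>Pre\<close>.
\<close>

definition decides_in_time ::
    "program \<Rightarrow> ((nat, nat \<times> nat) pre_digraph \<Rightarrow> bool) \<Rightarrow> ((nat, nat \<times> nat) pre_digraph \<Rightarrow> bool) \<Rightarrow>
     (nat \<Rightarrow> nat) \<Rightarrow> bool" where
  "decides_in_time p Pre Q T \<longleftrightarrow>
     (\<exists>k. \<forall>n G. graph G \<longrightarrow> verts G = {..<n} \<longrightarrow> Pre G \<longrightarrow>
        (\<exists>t R M. exec (k * (n + 1) ^ k) p (input_config n G) t (R, M) \<and> t \<le> T n \<and>
           R 0 = (if Q G then 1 else 0)))"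

end

(*
  Let k = l - 3. As there is no hole of length four, v is adjacent to y in a long ban-the-bomb, so
  it is given by two anticomplete induced paths (arms) starting in the common neighbours x and z
  of v and y, whose last vertices only are adjacent to w. Guess v, y, w and the first k + 1
  vertices of both arms (2 l - 1 vertices in total). It remains to decide in quadratic time
  whether the arms extend disjointly and without edges between them, inside the set R of
  vertices that are not adjacent to the guessed beginnings, to two neighbours of w.

  With W and U the vertices of R that are not adjacent, respectively adjacent, to w, this asks for
  a non-adjacent linked pair in U, where a and b are linked if W contains disjoint anticomplete
  connected sets A and B around the two sources with a attached to A only and b to B only. As there
  is no long theta, no vertex is attached to three pairwise anticomplete connected sets that
  contain the two sources and w respectively. Therefore, if a and b are linked, every other
  reachable vertex of U is linked to a or to b. Together with the absence of holes of length four
  it follows that it suffices to test, for one arbitrary reachable vertex c of U with a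
  reachable non-neighbour in U, whether c is linked to a vertex of this kind. For that,
  fix an induced path from c to a source and search from the sources while
  avoiding a prefix of this path, which shrinks whenever the search finds a vertex attached to an
  earlier part of it. The search settles the question in quadratic time.

  If w is adjacent to z, one arm is the single vertex z, and reachability decides the extension.
*)
theory Submission
  imports Defs
begin

section \<open>Connected sets and induced paths\<close>

text \<open>The constants come from thetas. A vertex attached to three such sets would form a theta
  with v; two of its paths use the guessed beginnings and have at least k + 1 edges each, and the
  path through w has at least 2. The sums k + 3 and 2k + 2 reach l, since l = k + 3 and k \<ge> 1.
  One vertex more than this requires is guessed on each arm, so that the source, the last guessed
  vertex but one, keeps a single neighbour in R. All exchange arguments have one form: a walk is
  stopped at its first vertex that sees one of two opposite sets. This vertex cannot see both, as
  the walk would lead on to w as a third set; so the walk can be appended to the set that is seen.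
  The search keeps, at the end of the blocked prefix, two continuations into opposite sets: a new
  vertex takes one, the path from c the other. When nothing is left to lower, both sides of a missed
  link would leave the searched set through neighbours of the last vertex of the prefix, which would
  then be attached to three sets, the third running back along the prefix to w.\<close>

locale adjacency =
  fixes adj :: "'a \<Rightarrow> 'a \<Rightarrow> bool"
  assumes adj_sym: "adj a b \<Longrightarrow> adj b a"
    and adj_irrefl: "\<not> adj a a"
begin

definition sep :: "'a set \<Rightarrow> 'a set \<Rightarrow> bool" where
  "sep X Y \<longleftrightarrow> (\<forall>x\<in>X. \<forall>y\<in>Y. x \<noteq> y \<and> \<not> adj x y \<and> \<not> adj y x)"

definition inside :: "'a set \<Rightarrow> 'a \<Rightarrow> 'a \<Rightarrow> bool" where
  "inside S a b \<longleftrightarrow> a \<in> S \<and> b \<in> S \<and> adj a b"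

text \<open>The empty set counts as connected: the stretch of a walk before its first hit may be
  empty.\<close>

definition cn :: "'a set \<Rightarrow> bool" where
  "cn S \<longleftrightarrow> (\<forall>x\<in>S. \<forall>y\<in>S. (inside S)\<^sup>*\<^sup>* x y)"

definition touches :: "'a \<Rightarrow> 'a set \<Rightarrow> bool" where
  "touches x S \<longleftrightarrow> (\<exists>s\<in>S. adj x s)"

lemma sep_sym: "sep X Y \<Longrightarrow> sep Y X"
  unfolding sep_def by blast

lemma sep_Un_left: "sep (X \<union> Y) Z \<longleftrightarrow> sep X Z \<and> sep Y Z"
  unfolding sep_def by blast

lemma sep_Un_right: "sep Z (X \<union> Y) \<longleftrightarrow> sep Z X \<and> sep Z Y"
  unfolding sep_def by blast

lemma sep_mono: "sep X Y \<Longrightarrow> X' \<subseteq> X \<Longrightarrow> Y' \<subseteq> Y \<Longrightarrow> sep X' Y'"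
  unfolding sep_def by blast

lemma sep_touchesI: "X \<inter> Y = {} \<Longrightarrow> (\<And>x. x \<in> X \<Longrightarrow> \<not> touches x Y) \<Longrightarrow> sep X Y"
  unfolding sep_def touches_def using adj_sym by (metis disjoint_iff)

lemma touches_Un: "touches x (S \<union> T) \<longleftrightarrow> touches x S \<or> touches x T"
  unfolding touches_def by blast

lemma touches_mono: "touches x S \<Longrightarrow> S \<subseteq> T \<Longrightarrow> touches x T"
  unfolding touches_def by blast

lemma touches_mem: "adj x s \<Longrightarrow> s \<in> S \<Longrightarrow> touches x S"
  unfolding touches_def by blast

lemma touches_singleton: "touches x {s} \<longleftrightarrow> adj x s"
  unfolding touches_def by blast

lemma not_touches_sep: "sep X Y \<Longrightarrow> x \<in> X \<Longrightarrow> \<not> touches x Y"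
  unfolding sep_def touches_def by blast

lemma inside_rtranclp_mono: "(inside S)\<^sup>*\<^sup>* x y \<Longrightarrow> S \<subseteq> T \<Longrightarrow> (inside T)\<^sup>*\<^sup>* x y"
  by (erule rtranclp_mono[THEN predicate2D, rotated]) (auto simp: inside_def)

lemma inside_rtranclp_sym: "(inside S)\<^sup>*\<^sup>* x y \<Longrightarrow> (inside S)\<^sup>*\<^sup>* y x"
proof (induction rule: rtranclp_induct)
  case (step y z)
  from step.hyps(2) have "inside S z y"
    unfolding inside_def by (simp add: adj_sym)
  then show ?case
    using step.IH by (rule converse_rtranclp_into_rtranclp)
qed simp

lemma inside_rtranclp_mem: "(inside S)\<^sup>*\<^sup>* x y \<Longrightarrow> x \<in> S \<Longrightarrow> y \<in> S"
  by (induction rule: rtranclp_induct) (auto simp: inside_def)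

lemma cn_empty: "cn {}" and cn_singleton: "cn {x}"
  unfolding cn_def by auto

lemma cnI_base:
  assumes "\<And>x. x \<in> S \<Longrightarrow> (inside S)\<^sup>*\<^sup>* b x"
  shows "cn S"
  unfolding cn_def using assms inside_rtranclp_sym rtranclp_trans by metis

lemma cn_Un:
  assumes "cn A" "cn B" "a \<in> A" "touches a B"
  shows "cn (A \<union> B)"
proof (rule cnI_base)
  obtain b where b: "b \<in> B" "adj a b"
    using assms(4) unfolding touches_def by blast
  then have ab: "inside (A \<union> B) a b"
    using assms(3) unfolding inside_def by blast
  show "(inside (A \<union> B))\<^sup>*\<^sup>* a x" if "x \<in> A \<union> B" for x
  proof (cases "x \<in> A")
    case True
    then have "(inside A)\<^sup>*\<^sup>* a x"
      using assms(1,3) unfolding cn_def by blast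
    then show ?thesis by (rule inside_rtranclp_mono) blast
  next
    case False
    then have "(inside B)\<^sup>*\<^sup>* b x"
      using assms(2) b that unfolding cn_def by blast
    then have "(inside (A \<union> B))\<^sup>*\<^sup>* b x" by (rule inside_rtranclp_mono) blast
    with ab show ?thesis by (rule converse_rtranclp_into_rtranclp)
  qed
qed

lemma cn_insert:
  assumes "cn A" "touches x A"
  shows "cn (insert x A)"
  using cn_Un[OF cn_singleton[of x] assms(1) _ assms(2)] by simp

lemma cn_reach: "cn S \<Longrightarrow> x \<in> S \<Longrightarrow> y \<in> S \<Longrightarrow> S \<subseteq> T \<Longrightarrow> (inside T)\<^sup>*\<^sup>* x y"
  unfolding cn_def using inside_rtranclp_mono by blast

text \<open>\<open>F\<close> is the stretch of the walk before its first vertex \<open>q\<close>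
  with \<open>Q\<close>. It is kept as a set, since later arguments need only its connectedness,
  with and without \<open>q\<close>, and the contact of \<open>q\<close> with it.\<close>

lemma first_hit:
  assumes "(inside S)\<^sup>*\<^sup>* x z" "x \<in> S" "Q z"
  shows "\<exists>F q. F \<subseteq> S \<and> q \<in> S \<and> Q q \<and> (\<forall>f\<in>F. \<not> Q f) \<and> cn F \<and> cn (insert q F) \<and>
    (F = {} \<and> q = x \<or> x \<in> F \<and> touches q F)"
  using assms
proof (induction rule: converse_rtranclp_induct)
  case base
  show ?case
    by (rule exI[of _ "{}"], rule exI[of _ z]) (use base in \<open>simp add: cn_empty cn_singleton\<close>)
next
  case (step x y)
  show ?case
  proof (cases "Q x")
    case True
    show ?thesis
      by (rule exI[of _ "{}"], rule exI[of _ x]) (use True step in \<open>simp add: cn_empty cn_singleton\<close>)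
  next
    case False
    have xy: "x \<in> S" "y \<in> S" "adj x y" "adj y x"
      using step.hyps(1) adj_sym unfolding inside_def by auto
    obtain F q where F: "F \<subseteq> S" "q \<in> S" "Q q" "\<forall>f\<in>F. \<not> Q f" "cn F" "cn (insert q F)"
      "F = {} \<and> q = y \<or> y \<in> F \<and> touches q F"
      using step.IH xy step.prems by blast
    have "cn (insert x F)"
      using F(5,7) xy cn_insert[of F x] cn_singleton[of x] unfolding touches_def by auto
    moreover have "cn (insert x (insert q F))"
      by (rule cn_insert[OF F(6)]) (use F(7) xy in \<open>auto simp: touches_def\<close>)
    moreover have "touches q (insert x F)"
      using F(7) xy unfolding touches_def by auto
    ultimately show ?thesis
      by (intro exI[of _ "insert x F"] exI[of _ q])
        (use F False xy in \<open>auto simp: insert_commute\<close>)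
  qed
qed

text \<open>
  A walk from \<open>c\<close> through \<open>S\<close> to \<open>X\<close> first sees \<open>X\<close> at a vertex \<open>t\<close>. The sets \<open>E\<close> and \<open>G\<close> consist
  of the vertices of this walk up to \<open>t\<close>, without \<open>t\<close> and without \<open>c\<close> respectively, so that both
  are empty if \<open>t = c\<close>.
\<close>

lemma approach:
  assumes "c \<notin> X" "r \<in> S" "adj c r" "(inside S)\<^sup>*\<^sup>* r z" "z \<in> X"
  obtains E G t where "t \<in> insert c S" "t \<notin> X" "touches t X" "E \<subseteq> insert c S" "E \<inter> X = {}"
    "\<And>e. e \<in> E \<Longrightarrow> \<not> touches e X" "G \<subseteq> S" "G \<subseteq> insert t E" "G \<inter> X = {}"
    "\<And>A. cn A \<Longrightarrow> touches t A \<Longrightarrow> cn (A \<union> G) \<and> touches c (A \<union> G)"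
    "\<And>Z. cn Z \<Longrightarrow> touches c Z \<Longrightarrow> cn (Z \<union> E) \<and> touches t (Z \<union> E)"
proof (cases "touches c X")
  case True
  show thesis
    by (rule that[of c "{}" "{}"]) (use True assms in auto)
next
  case False
  \<comment> \<open>Seeing \<open>X\<close> already counts as a hit, so the walk stops before it
    could enter \<open>X\<close>.\<close>
  define Q where "Q x \<longleftrightarrow> x \<in> X \<or> touches x X" for x
  obtain F q where F: "F \<subseteq> S" "q \<in> S" "Q q" "\<forall>f\<in>F. \<not> Q f" "cn F" "cn (insert q F)"
    "F = {} \<and> q = r \<or> r \<in> F \<and> touches q F"
    using first_hit[OF assms(4,2), of Q] assms(5) unfolding Q_def by blast
  have rX: "r \<notin> X"
    using False assms(3) unfolding touches_def by blast
  have qX: "q \<notin> X"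
  proof
    assume "q \<in> X"
    then obtain f where "f \<in> F" "adj q f"
      using F(7) rX unfolding touches_def by blast
    then have "touches f X"
      using \<open>q \<in> X\<close> adj_sym touches_mem by blast
    then show False
      using F(4) \<open>f \<in> F\<close> Q_def by blast
  qed
  have tq: "touches q X"
    using F(3) qX Q_def by blast
  have cr: "touches c (insert q F)" "adj r c"
    using F(7) assms(3) adj_sym unfolding touches_def by auto
  show thesis
  proof (rule that[of q "insert c F" "insert q F"])
    show "cn (A \<union> insert q F) \<and> touches c (A \<union> insert q F)" if "cn A" "touches q A" for A
      using cn_Un[OF F(6) that(1) _ that(2)] cr(1) by (auto simp: touches_def Un_commute)
    show "cn (Z \<union> insert c F) \<and> touches q (Z \<union> insert c F)" if "cn Z" "touches c Z" for Z
    proof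
      have "cn (insert c F)"
        using F(5,7) assms(3) cn_insert[of F c] cn_singleton[of c] unfolding touches_def by auto
      then show "cn (Z \<union> insert c F)"
        using cn_Un[of "insert c F" Z c] that by (auto simp: Un_commute)
      show "touches q (Z \<union> insert c F)"
        using F(7) cr(2) unfolding touches_def by auto
    qed
  qed (use F qX tq False assms(1) in \<open>auto simp: Q_def\<close>)
qed

end

section \<open>Linked pairs\<close>

text \<open>\<open>claw\<close> distils the absence of long thetas: in the application,
  \<open>t\<close> and a fixed vertex outside \<open>insert w (W \<union> U)\<close>, which is
  joined to both sources by the guessed beginnings and adjacent to \<open>w\<close>, would be the
  ends of a long theta.\<close>

locale linkage = adjacency +
  fixes W U :: "'a set" and w s\<^sub>1 s\<^sub>2 :: 'a
  assumes W_U: "W \<inter> U = {}" and w_notin: "w \<notin> W" "w \<notin> U"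
    and w_W: "x \<in> W \<Longrightarrow> \<not> adj w x" and w_U: "u \<in> U \<Longrightarrow> adj w u"
    and sources: "s\<^sub>1 \<in> W" "s\<^sub>2 \<in> W" "s\<^sub>1 \<noteq> s\<^sub>2"
    and claw: "\<lbrakk>t \<in> W \<union> U; cn X\<^sub>1; X\<^sub>1 \<subseteq> W; s\<^sub>1 \<in> X\<^sub>1; cn X\<^sub>2; X\<^sub>2 \<subseteq> W; s\<^sub>2 \<in> X\<^sub>2;
      cn X\<^sub>3; X\<^sub>3 \<subseteq> insert w (W \<union> U); w \<in> X\<^sub>3; sep X\<^sub>1 X\<^sub>2; sep X\<^sub>1 X\<^sub>3; sep X\<^sub>2 X\<^sub>3;
      touches t X\<^sub>1; touches t X\<^sub>2; touches t X\<^sub>3\<rbrakk> \<Longrightarrow> False"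
begin

definition srcs :: "'a \<Rightarrow> 'a \<Rightarrow> bool" where
  "srcs a b \<longleftrightarrow> a = s\<^sub>1 \<and> b = s\<^sub>2 \<or> a = s\<^sub>2 \<and> b = s\<^sub>1"

text \<open>Which source lies on which side is left open by \<open>srcs\<close>, so that
  \<open>A\<close> and \<open>B\<close> are interchangeable and one of two symmetric cases follows
  from the other by \<open>sides_sym\<close>.\<close>

definition sides :: "'a set \<Rightarrow> 'a set \<Rightarrow> bool" where
  "sides A B \<longleftrightarrow> cn A \<and> A \<subseteq> W \<and> cn B \<and> B \<subseteq> W \<and> sep A B \<and> (\<exists>a\<in>A. \<exists>b\<in>B. srcs a b)"

definition linked :: "'a \<Rightarrow> 'a \<Rightarrow> bool" where
  "linked c u \<longleftrightarrow> c \<in> U \<and> u \<in> U \<and> (\<exists>A B. sides A B \<and>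
     touches c A \<and> \<not> touches c B \<and> touches u B \<and> \<not> touches u A)"

text \<open>Only sources inside \<open>S\<close> start a walk: once a path is blocked, the source at
  its end may lie outside \<open>S\<close>.\<close>

definition reach :: "'a set \<Rightarrow> 'a set" where
  "reach S = {x. \<exists>s\<in>{s\<^sub>1, s\<^sub>2} \<inter> S. (inside S)\<^sup>*\<^sup>* s x}"

definition U' :: "'a set" where
  "U' = {u \<in> U. touches u (reach W)}"

lemma srcs_sym: "srcs a b \<Longrightarrow> srcs b a"
  unfolding srcs_def by blast

lemma sides_sym: "sides A B \<Longrightarrow> sides B A"
  unfolding sides_def using srcs_sym sep_sym by blast

lemma sidesD: "sides A B \<Longrightarrow> cn A" "sides A B \<Longrightarrow> A \<subseteq> W" "sides A B \<Longrightarrow> sep A B"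
  "sides A B \<Longrightarrow> cn B" "sides A B \<Longrightarrow> B \<subseteq> W"
  unfolding sides_def by blast+

lemma sides_extend:
  assumes "sides A B" "A \<subseteq> A'" "B \<subseteq> B'" "cn A'" "cn B'" "A' \<subseteq> W" "B' \<subseteq> W" "sep A' B'"
  shows "sides A' B'"
  using assms unfolding sides_def by blast

lemma claw_sides:
  assumes "sides A B" "t \<in> W \<union> U" "cn X" "X \<subseteq> insert w (W \<union> U)" "w \<in> X" "sep A X" "sep B X"
    "touches t A" "touches t B" "touches t X"
  shows False
proof -
  obtain a b where "a \<in> A" "b \<in> B" "srcs a b"
    using assms(1) unfolding sides_def by blast
  then show False
    using claw[of t A B X] claw[of t B A X] assms sep_sym[of A B] sidesD[OF assms(1)]
    unfolding srcs_def by metis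
qed

lemma sep_w: "A \<subseteq> W \<Longrightarrow> sep A {w}"
  unfolding sep_def using w_W w_notin adj_sym by blast

text \<open>The claw with third set \<open>{w}\<close>: every vertex of \<open>U\<close> is adjacent
  to \<open>w\<close>.\<close>

lemma not_touches_both:
  assumes "sides A B" "u \<in> U"
  shows "\<not> (touches u A \<and> touches u B)"
  using claw_sides[OF assms(1), of u "{w}"] assms w_U adj_sym sidesD[OF assms(1)]
  by (auto simp: cn_singleton sep_w touches_singleton)

lemma linkedI:
  assumes "sides A B" "c \<in> U" "u \<in> U" "touches c A" "touches u B"
  shows "linked c u"
  unfolding linked_def using assms not_touches_both by blast

lemma reach_sub: "reach S \<subseteq> S"
  unfolding reach_def using inside_rtranclp_mem by blast

lemma reach_mono: "S \<subseteq> S' \<Longrightarrow> reach S \<subseteq> reach S'"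
  unfolding reach_def using inside_rtranclp_mono by blast

lemma reachI: "s \<in> {s\<^sub>1, s\<^sub>2} \<Longrightarrow> s \<in> A \<Longrightarrow> cn A \<Longrightarrow> A \<subseteq> S \<Longrightarrow> A \<subseteq> reach S"
  unfolding reach_def using cn_reach by blast

lemma reach_source: "s \<in> {s\<^sub>1, s\<^sub>2} \<Longrightarrow> s \<in> S \<Longrightarrow> s \<in> reach S"
  unfolding reach_def by blast

lemma reach_step: "x \<in> reach S \<Longrightarrow> adj x y \<Longrightarrow> y \<in> S \<Longrightarrow> y \<in> reach S"
proof -
  assume a: "x \<in> reach S" "adj x y" "y \<in> S"
  then have "inside S x y"
    using reach_sub unfolding inside_def by blast
  then show ?thesis
    using a unfolding reach_def by (auto intro: rtranclp.rtrancl_into_rtrancl)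
qed

lemma approach_reach:
  assumes "c \<notin> X" "touches c (reach S)" "{s\<^sub>1, s\<^sub>2} \<inter> S \<subseteq> X"
  obtains E G t where "t \<in> insert c S" "t \<notin> X" "touches t X" "E \<subseteq> insert c S" "E \<inter> X = {}"
    "\<And>e. e \<in> E \<Longrightarrow> \<not> touches e X" "G \<subseteq> S" "G \<subseteq> insert t E" "G \<inter> X = {}"
    "\<And>A. cn A \<Longrightarrow> touches t A \<Longrightarrow> cn (A \<union> G) \<and> touches c (A \<union> G)"
    "\<And>Z. cn Z \<Longrightarrow> touches c Z \<Longrightarrow> cn (Z \<union> E) \<and> touches t (Z \<union> E)"
proof -
  obtain r s where "adj c r" "s \<in> {s\<^sub>1, s\<^sub>2} \<inter> S" "(inside S)\<^sup>*\<^sup>* s r"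
    using assms(2) unfolding touches_def reach_def by blast
  moreover from this have "r \<in> S"
    using inside_rtranclp_mem by blast
  ultimately show thesis
    using approach[of c X r S s] that inside_rtranclp_sym assms(1,3) by (smt (verit) subsetD)
qed

lemma sep_avoid: "E \<inter> X = {} \<Longrightarrow> (\<And>e. e \<in> E \<Longrightarrow> \<not> touches e X) \<Longrightarrow> sep E X"
  by (rule sep_touchesI)

text \<open>A walk from \<open>c\<close> to a source is followed up to its first vertex
  \<open>t\<close> that sees \<open>A \<union> B\<close>. If \<open>t\<close> sees just one side,
  the walk is added to that side, which then carries \<open>c\<close>, while the other side keeps
  its own end.\<close>

lemma linked_trans:
  assumes "linked a b" "c \<in> U'"
  shows "linked c a \<or> linked c b"
proof -
  obtain A B where AB: "sides A B" "touches a A" "touches b B"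
    and ab: "a \<in> U" "b \<in> U"
    using assms(1) unfolding linked_def by blast
  note AB' = sidesD[OF AB(1)]
  have c: "c \<in> U" "touches c (reach W)"
    using assms(2) unfolding U'_def by auto
  have "c \<notin> A \<union> B" "{s\<^sub>1, s\<^sub>2} \<inter> W \<subseteq> A \<union> B"
    using c W_U AB(1) unfolding sides_def srcs_def by blast+
  then obtain E G t where t: "t \<in> insert c W" "t \<notin> A \<union> B" "touches t (A \<union> B)"
    and E: "E \<subseteq> insert c W" "E \<inter> (A \<union> B) = {}" "\<And>e. e \<in> E \<Longrightarrow> \<not> touches e (A \<union> B)"
    and G: "G \<subseteq> W" "G \<subseteq> insert t E" "G \<inter> (A \<union> B) = {}"
    and AG: "\<And>A. cn A \<Longrightarrow> touches t A \<Longrightarrow> cn (A \<union> G) \<and> touches c (A \<union> G)"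
    and ZE: "\<And>Z. cn Z \<Longrightarrow> touches c Z \<Longrightarrow> cn (Z \<union> E) \<and> touches t (Z \<union> E)"
    by (rule approach_reach[OF _ c(2)]) blast
  have *: "linked c v" if AB: "sides A B" "touches t A" "\<not> touches t B" "touches v B" "v \<in> U"
    and "E \<inter> B = {}" "\<And>e. e \<in> E \<Longrightarrow> \<not> touches e B" "G \<inter> B = {}" for A B v
  proof (rule linkedI)
    note AB' = sidesD[OF AB(1)]
    have "sep G B"
      by (rule sep_avoid) (use that G(2) in auto)
    then show "sides (A \<union> G) B"
      using AB' AG[OF AB'(1) AB(2)] G(1) by (intro sides_extend[OF AB(1)]) (auto simp: sep_Un_left)
    show "touches c (A \<union> G)"
      using AG[OF AB'(1) AB(2)] by blast
  qed (use c that in auto)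
  \<comment> \<open>Otherwise \<open>t\<close> is the centre of a claw: since \<open>c\<close> is
    adjacent to \<open>w\<close>, the walk from \<open>c\<close> to \<open>t\<close> joins
    \<open>w\<close> to \<open>t\<close> away from both sides.\<close>
  have "\<not> (touches t A \<and> touches t B)"
  proof
    assume tt: "touches t A \<and> touches t B"
    have Z: "cn ({w} \<union> E)" "touches t ({w} \<union> E)"
      using ZE[of "{w}"] c(1) w_U adj_sym by (auto simp: cn_singleton touches_singleton)
    have "sep E (A \<union> B)"
      by (rule sep_avoid) (use E in auto)
    then have "sep A ({w} \<union> E)" "sep B ({w} \<union> E)"
      unfolding sep_Un_right sep_Un_left using AB' sep_w sep_sym by blast+
    then show False
      using claw_sides[OF AB(1) _ Z(1) _ _ _ _ _ _ Z(2)] tt t(1) E(1) c(1) by blast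
  qed
  then consider "touches t A" "\<not> touches t B" | "touches t B" "\<not> touches t A"
    using t(3) by (auto simp: touches_Un)
  then show ?thesis
  proof cases
    case 1
    then have "linked c b"
      using *[of A B b] AB ab E G by (auto simp: touches_Un Int_Un_distrib)
    then show ?thesis ..
  next
    case 2
    then have "linked c a"
      using *[of B A a] AB sides_sym ab E G by (auto simp: touches_Un Int_Un_distrib)
    then show ?thesis ..
  qed
qed

lemma linked_in_U':
  assumes "linked a b"
  shows "a \<in> U'" "b \<in> U'" "a \<noteq> b"
proof -
  obtain A B where "sides A B" "touches a A" "touches b B" "\<not> touches b A" "a \<in> U" "b \<in> U"
    using assms unfolding linked_def by blast
  moreover from this have "A \<subseteq> reach W" "B \<subseteq> reach W"
    using reachI unfolding sides_def srcs_def by blast+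
  ultimately show "a \<in> U'" "b \<in> U'" "a \<noteq> b"
    unfolding U'_def using touches_mono by blast+
qed

text \<open>Both members of a non-adjacent linked pair lie in \<open>K\<close>, so an empty
  \<open>K\<close> settles the question negatively.\<close>

definition K :: "'a set" where
  "K = {u \<in> U'. \<exists>x\<in>U'. x \<noteq> u \<and> \<not> adj u x}"

text \<open>
  If all linked pairs were adjacent, two linked vertices \<open>a, b\<close> of \<open>K\<close> and non-neighbours
  \<open>a', b'\<close> of them would form a hole \<open>a - b - a' - b'\<close>.
\<close>

lemma linked_nonadjacent_iff:
  assumes no_C4: "\<And>a b c d. \<lbrakk>adj a b; adj b c; adj c d; adj d a; \<not> adj a c; \<not> adj b d; a \<noteq> c; b \<noteq> d\<rbrakk> \<Longrightarrow> False"
    and "c \<in> K"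
  shows "(\<exists>a b. linked a b \<and> \<not> adj a b) \<longleftrightarrow> (\<exists>u\<in>K. linked c u)"
proof
  assume "\<exists>a b. linked a b \<and> \<not> adj a b"
  then obtain a b where ab: "linked a b" "\<not> adj a b" by blast
  then have "a \<in> K" "b \<in> K"
    unfolding K_def using linked_in_U'[OF ab(1)] adj_sym by fastforce+
  then show "\<exists>u\<in>K. linked c u"
    using linked_trans[OF ab(1), of c] \<open>c \<in> K\<close> unfolding K_def by blast
next
  assume "\<exists>u\<in>K. linked c u"
  then obtain b where b: "b \<in> K" "linked c b" by blast
  show "\<exists>a b. linked a b \<and> \<not> adj a b"
  proof (rule ccontr)
    assume "\<not> ?thesis"
    then have L: "adj x y" if "linked x y" for x y
      using that by blast
    \<comment> \<open>If linked vertices are always adjacent, a non-neighbour cannot be the linked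
      one, so each use of \<open>linked_trans\<close> below leaves only the other
      alternative.\<close>
    obtain c' b' where c': "c' \<in> U'" "c' \<noteq> c" "\<not> adj c c'" and b': "b' \<in> U'" "b' \<noteq> b" "\<not> adj b b'"
      using b(1) \<open>c \<in> K\<close> unfolding K_def by blast
    have 1: "linked c' b"
      using linked_trans[OF b(2) c'(1)] L c' adj_sym by blast
    have 2: "linked b' c"
      using linked_trans[OF b(2) b'(1)] L b' adj_sym by blast
    have 3: "linked b' c'"
      using linked_trans[OF 1 b'(1)] L b' adj_sym by blast
    show False
      using no_C4[of c b c' b'] L[OF b(2)] L[OF 1] L[OF 2] L[OF 3] b' c' adj_sym by blast
  qed
qed

end

section \<open>Searching for a vertex linked to a fixed one\<close>

text \<open>
  The path \<open>p\<close> leads from \<open>c = p 0\<close> to the source \<open>root = p m\<close>. If a prefix \<open>p 0, \<dots>, p th\<close> of it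
  is blocked, the sources reach less of \<open>W\<close>; the search starts with \<open>th = m - 1\<close> and lowers \<open>th\<close>
  whenever a vertex adjacent to an earlier \<open>p i\<close> is discovered, similarly to an augmenting path
  algorithm.
\<close>

locale path_linkage = linkage +
  fixes p :: "nat \<Rightarrow> 'a" and m :: nat and root other :: 'a
  assumes srcs: "srcs root other" and p_m: "p m = root" and m: "1 \<le> m"
    and p_0: "p 0 \<in> U" and p_W: "1 \<le> i \<Longrightarrow> i \<le> m \<Longrightarrow> p i \<in> W"
    and p_adj: "i \<le> m \<Longrightarrow> j \<le> m \<Longrightarrow> adj (p i) (p j) \<longleftrightarrow> j = Suc i \<or> i = Suc j"
    and p_inj: "inj_on p {..m}"
    and p_other: "i \<le> m \<Longrightarrow> \<not> adj (p i) other"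
    and pendant: "x \<in> W \<union> U \<Longrightarrow> adj root x \<Longrightarrow> x = p (m - 1)"
begin

definition T :: "nat \<Rightarrow> 'a set" where
  "T th = p ` {..th}"

definition S :: "nat \<Rightarrow> 'a set" where
  "S th = {x \<in> W. x \<notin> T th \<and> \<not> touches x (T th)}"

text \<open>The contact with the prefix is \<open>p th\<close> alone, so \<open>x\<close> can
  prolong the prefix at its end as an induced path.\<close>

definition attached :: "nat \<Rightarrow> 'a \<Rightarrow> bool" where
  "attached th x \<longleftrightarrow> x \<in> W \<and> x \<notin> T th \<and> (\<forall>i\<le>th. adj x (p i) \<longleftrightarrow> i = th)"

text \<open>The invariant that makes lowering safe: the prefix can be prolonged at its end through
  \<open>r\<^sub>1\<close> or through \<open>r\<^sub>2\<close>, towards different sources. Whichever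
  side a new vertex joins, the other still leads from \<open>p 0\<close> to a source.\<close>

definition stage :: "nat \<Rightarrow> bool" where
  "stage th \<longleftrightarrow> th < m \<and> (\<exists>X\<^sub>1 X\<^sub>2 r\<^sub>1 r\<^sub>2. sides X\<^sub>1 X\<^sub>2 \<and> X\<^sub>1 \<subseteq> S th \<and> X\<^sub>2 \<subseteq> S th \<and>
     attached th r\<^sub>1 \<and> attached th r\<^sub>2 \<and> touches r\<^sub>1 X\<^sub>1 \<and> \<not> touches r\<^sub>1 X\<^sub>2 \<and>
     touches r\<^sub>2 X\<^sub>2 \<and> \<not> touches r\<^sub>2 X\<^sub>1)"

lemma p_image_W: "1 \<le> i \<Longrightarrow> j \<le> m \<Longrightarrow> p ` {i..j} \<subseteq> W"
  using p_W by auto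

lemma T_sub: "th \<le> m \<Longrightarrow> T th \<subseteq> insert (p 0) W"
proof -
  assume "th \<le> m"
  then have "p i \<in> insert (p 0) W" if "i \<le> th" for i
    using p_W[of i] that by (cases "i = 0") auto
  then show ?thesis
    unfolding T_def by blast
qed

lemma T_sub': "th \<le> m \<Longrightarrow> T th \<subseteq> W \<union> U"
  using T_sub p_0 by blast

lemma p0_T: "p 0 \<in> T th"
  unfolding T_def by blast

lemma cn_p: "j \<le> m \<Longrightarrow> cn (p ` {i..j})"
proof (induction j)
  case 0
  show ?case
    by (cases "i = 0") (auto simp: cn_singleton cn_empty)
next
  case (Suc j)
  show ?case
  proof (cases "i \<le> j")
    case True
    then have "p ` {i..Suc j} = insert (p (Suc j)) (p ` {i..j})"
      by (auto simp: atLeastAtMostSuc_conv)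
    moreover have "touches (p (Suc j)) (p ` {i..j})"
      by (rule touches_mem[of _ "p j"]) (use True Suc.prems p_adj in auto)
    ultimately show ?thesis
      using Suc cn_insert by simp
  next
    case False
    then show ?thesis
      by (cases "i = Suc j") (auto simp: cn_singleton cn_empty)
  qed
qed

lemma cn_T: "th \<le> m \<Longrightarrow> cn (T th)"
  unfolding T_def atMost_atLeast0 by (rule cn_p)

lemma w_p0: "adj w (p 0)"
  using w_U p_0 by blast

lemma w_T: "touches w (T th)"
  using w_p0 p0_T touches_mem by blast

text \<open>\<open>w\<close> sees \<open>p 0\<close>, so it forms a connected set with the prefix;
  this is the third set of claws centred at a vertex attached to the prefix.\<close>

lemma cn_wT: "th \<le> m \<Longrightarrow> cn ({w} \<union> T th)"
  using cn_Un[OF cn_singleton[of w] cn_T[of th], of w] w_T by simp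

lemma S_W: "S th \<subseteq> W"
  unfolding S_def by blast

lemma S_T: "sep (S th) (T th)"
  by (rule sep_touchesI) (auto simp: S_def)

lemma S_I: "A \<subseteq> W \<Longrightarrow> sep A (T th) \<Longrightarrow> A \<subseteq> S th"
  unfolding S_def sep_def touches_def by blast

text \<open>The gap is two because \<open>p (Suc j)\<close> is adjacent to the end of the
  prefix.\<close>

lemma p_sep: "j' \<le> m \<Longrightarrow> j + 2 \<le> i \<Longrightarrow> sep (p ` {i..j'}) (T j)"
proof -
  assume "j' \<le> m" "j + 2 \<le> i"
  then have "p a \<noteq> p b" "\<not> adj (p a) (p b)" "\<not> adj (p b) (p a)" if "a \<in> {i..j'}" "b \<le> j" for a b
    using that p_adj[of a b] p_adj[of b a] inj_onD[OF p_inj, of a b] by auto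
  then show ?thesis
    unfolding sep_def T_def by blast
qed

lemma p_notin_T: "i \<le> m \<Longrightarrow> th < i \<Longrightarrow> p i \<notin> T th"
  unfolding T_def using inj_onD[OF p_inj, of i] by fastforce

lemma attached_p: "th < m \<Longrightarrow> attached th (p (Suc th))"
proof -
  assume a: "th < m"
  have "\<forall>i\<le>th. adj (p (Suc th)) (p i) \<longleftrightarrow> i = th"
  proof (intro allI impI)
    fix i
    assume "i \<le> th"
    then show "adj (p (Suc th)) (p i) \<longleftrightarrow> i = th"
      using p_adj[of "Suc th" i] a by (cases "i = th") linarith+
  qed
  moreover have "p (Suc th) \<in> W" "p (Suc th) \<notin> T th"
    using a by (intro p_W p_notin_T; simp)+
  ultimately show ?thesis
    unfolding attached_def by blast
qed

lemma S_wT: "A \<subseteq> S th \<Longrightarrow> sep A ({w} \<union> T th)"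
  unfolding sep_Un_right using sep_w[of A] sep_mono[OF S_T, of A th "T th"] S_W by blast

lemma T_wWU: "th \<le> m \<Longrightarrow> {w} \<union> T th \<subseteq> insert w (W \<union> U)"
  using T_sub' by blast

lemma S_mono: "f \<le> th \<Longrightarrow> S th \<subseteq> S f"
  unfolding S_def T_def touches_def by auto

lemma attached_touches: "attached th r \<Longrightarrow> touches r (T th)"
  unfolding attached_def T_def touches_def by blast

lemma attached_sep: "attached th r \<Longrightarrow> f < th \<Longrightarrow> sep {r} (T f)"
proof (rule sep_touchesI)
  assume "attached th r" "f < th"
  then show "{r} \<inter> T f = {}" "\<And>x. x \<in> {r} \<Longrightarrow> \<not> touches x (T f)"
    unfolding attached_def T_def touches_def by fastforce+
qed

text \<open>Through its contact \<open>p th\<close>, the vertex \<open>r\<close> sees the connected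
  set \<open>{w} \<union> T th\<close>; a second side would complete a claw.\<close>

lemma claw_attached:
  assumes "sides A B" "th \<le> m" "B \<subseteq> S th" "sep A ({w} \<union> T th)" "attached th r" "touches r A"
  shows "\<not> touches r B"
  using claw_sides[OF assms(1) _ cn_wT[OF assms(2)] T_wWU[OF assms(2)] _ assms(4) S_wT[OF assms(3)] assms(6)]
    assms(5) attached_touches touches_Un unfolding attached_def by blast

text \<open>
  In a stage, \<open>r\<^sub>2\<close> has no neighbour on a walk within \<open>S th\<close> that first sees \<open>X\<^sub>1 \<union> X\<^sub>2\<close> at a
  neighbour of \<open>X\<^sub>1\<close>.
\<close>

lemma stage_extend:
  assumes "sides X\<^sub>1 X\<^sub>2" "X\<^sub>1 \<subseteq> S th" "X\<^sub>2 \<subseteq> S th" "th \<le> m"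
    and "attached th r\<^sub>2" "touches r\<^sub>2 X\<^sub>2" "\<not> touches r\<^sub>2 X\<^sub>1"
    and "cn (X\<^sub>1 \<union> G)" "G \<subseteq> S th" "sep G X\<^sub>2"
  shows "sides (X\<^sub>1 \<union> G) X\<^sub>2" "\<not> touches r\<^sub>2 (X\<^sub>1 \<union> G)" "r\<^sub>2 \<notin> X\<^sub>1 \<union> G"
    "sides (X\<^sub>1 \<union> G) ({r\<^sub>2} \<union> X\<^sub>2)"
proof -
  note D = sidesD[OF assms(1)]
  show 1: "sides (X\<^sub>1 \<union> G) X\<^sub>2"
    using assms D subset_trans[OF assms(9) S_W] by (intro sides_extend[OF assms(1)]) (auto simp: sep_Un_left)
  show 2: "\<not> touches r\<^sub>2 (X\<^sub>1 \<union> G)"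
    using claw_attached[OF sides_sym[OF 1] assms(4) _ S_wT[OF assms(3)] assms(5,6)] assms(2,9) by blast
  show 3: "r\<^sub>2 \<notin> X\<^sub>1 \<union> G"
    using attached_touches[OF assms(5)] assms(2,9) unfolding S_def by blast
  have "sep {r\<^sub>2} (X\<^sub>1 \<union> G)"
    by (rule sep_touchesI) (use 2 3 in auto)
  then have "sep (X\<^sub>1 \<union> G) ({r\<^sub>2} \<union> X\<^sub>2)"
    unfolding sep_Un_right[of _ "{r\<^sub>2}"] using sidesD(3)[OF 1] sep_sym[of "{r\<^sub>2}"] by blast
  then show "sides (X\<^sub>1 \<union> G) ({r\<^sub>2} \<union> X\<^sub>2)"
    using assms(5) sidesD[OF 1] cn_insert[OF _ assms(6)] unfolding attached_def
    by (intro sides_extend[OF 1]) auto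
qed

text \<open>The extended side \<open>X\<^sub>1 \<union> G\<close> serves \<open>u\<close>; the other
  side is continued from \<open>X\<^sub>2\<close> through \<open>r\<^sub>2\<close> and backwards
  along \<open>p th\<close>, ..., \<open>p 1\<close> towards \<open>p 0\<close>.\<close>

lemma sink_aux:
  assumes "sides X\<^sub>1 X\<^sub>2" "X\<^sub>1 \<subseteq> S th" "X\<^sub>2 \<subseteq> S th" "th < m"
    and "attached th r\<^sub>2" "touches r\<^sub>2 X\<^sub>2" "\<not> touches r\<^sub>2 X\<^sub>1"
    and "cn (X\<^sub>1 \<union> G)" "G \<subseteq> S th" "sep G X\<^sub>2" "touches u (X\<^sub>1 \<union> G)" "u \<in> U"
  shows "linked (p 0) u"
proof -
  note E = stage_extend[OF assms(1-3) less_imp_le[OF assms(4)] assms(5-10)]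
  note D = sidesD[OF E(4)]
  define A where "A = {r\<^sub>2} \<union> X\<^sub>2 \<union> p ` {1..th}"
  have r: "adj r\<^sub>2 (p th)"
    using assms(5) unfolding attached_def by blast
  have "cn A"
  proof (cases "th = 0")
    case False
    then have "touches r\<^sub>2 (p ` {1..th})"
      by (intro touches_mem[OF r]) auto
    then show ?thesis
      unfolding A_def using assms(4) cn_p by (intro cn_Un[OF D(4), where a = r\<^sub>2]) auto
  qed (use D A_def in auto)
  moreover have "sep (X\<^sub>1 \<union> G) (p ` {1..th})"
    by (rule sep_mono[OF S_T[of th]]) (use assms in \<open>auto simp: T_def\<close>)
  then have "sep (X\<^sub>1 \<union> G) A"
    unfolding A_def sep_Un_right[of _ "{r\<^sub>2} \<union> X\<^sub>2"] using D(3) by blast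
  ultimately have "sides (X\<^sub>1 \<union> G) A"
    using D assms(4) p_image_W[of 1 th]
    by (intro sides_extend[OF E(4)]) (auto simp: A_def)
  moreover have "touches (p 0) A"
  \<comment> \<open>For \<open>th = 0\<close> the segment of the path is empty, and
    \<open>p 0\<close> sees \<open>r\<^sub>2\<close> itself.\<close>
  proof (cases "th = 0")
    case True
    then show ?thesis
      using r adj_sym A_def touches_mem[of "p 0" r\<^sub>2] by auto
  next
    case False
    then show ?thesis
      using p_adj[of 0 1] assms(4) A_def by (intro touches_mem[of _ "p 1"]) auto
  qed
  ultimately show ?thesis
    using linkedI[OF sides_sym] p_0 assms(11,12) by blast
qed

text \<open>As in \<open>linked_trans\<close>, the walk from \<open>u\<close> first sees
  \<open>X\<^sub>1 \<union> X\<^sub>2\<close> at a vertex that sees one side only, since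
  \<open>u\<close> is adjacent to \<open>w\<close>. Either side is then covered by
  \<open>sink_aux\<close>.\<close>

lemma stage_sink:
  assumes "stage th" "u \<in> U" "touches u (reach (S th))" "u \<noteq> p 0"
  shows "linked (p 0) u"
proof -
  obtain X\<^sub>1 X\<^sub>2 r\<^sub>1 r\<^sub>2 where th: "th < m" and X: "sides X\<^sub>1 X\<^sub>2" "X\<^sub>1 \<subseteq> S th" "X\<^sub>2 \<subseteq> S th"
    and r1: "attached th r\<^sub>1" "touches r\<^sub>1 X\<^sub>1" "\<not> touches r\<^sub>1 X\<^sub>2"
    and r2: "attached th r\<^sub>2" "touches r\<^sub>2 X\<^sub>2" "\<not> touches r\<^sub>2 X\<^sub>1"
    using assms(1) unfolding stage_def by blast
  have "u \<notin> X\<^sub>1 \<union> X\<^sub>2" "{s\<^sub>1, s\<^sub>2} \<inter> S th \<subseteq> X\<^sub>1 \<union> X\<^sub>2"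
    using X W_U assms(2) unfolding sides_def srcs_def by blast+
  then obtain E G t where t: "t \<in> insert u (S th)" "t \<notin> X\<^sub>1 \<union> X\<^sub>2" "touches t (X\<^sub>1 \<union> X\<^sub>2)"
    and E: "E \<subseteq> insert u (S th)" "E \<inter> (X\<^sub>1 \<union> X\<^sub>2) = {}" "\<And>e. e \<in> E \<Longrightarrow> \<not> touches e (X\<^sub>1 \<union> X\<^sub>2)"
    and G: "G \<subseteq> S th" "G \<subseteq> insert t E" "G \<inter> (X\<^sub>1 \<union> X\<^sub>2) = {}"
    and AG: "\<And>A. cn A \<Longrightarrow> touches t A \<Longrightarrow> cn (A \<union> G) \<and> touches u (A \<union> G)"
    and ZE: "\<And>Z. cn Z \<Longrightarrow> touches u Z \<Longrightarrow> cn (Z \<union> E) \<and> touches t (Z \<union> E)"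
    by (rule approach_reach[OF _ assms(3)]) blast
  note D = sidesD[OF X(1)]
  have EX: "sep E (X\<^sub>1 \<union> X\<^sub>2)"
    by (rule sep_avoid) (use E in auto)
  have "\<not> (touches t X\<^sub>1 \<and> touches t X\<^sub>2)"
  proof
    assume tt: "touches t X\<^sub>1 \<and> touches t X\<^sub>2"
    have Z: "cn ({w} \<union> E)" "touches t ({w} \<union> E)"
      using ZE[of "{w}"] assms(2) w_U adj_sym by (auto simp: cn_singleton touches_singleton)
    have "sep X\<^sub>1 ({w} \<union> E)" "sep X\<^sub>2 ({w} \<union> E)"
      using EX D sep_w sep_sym unfolding sep_Un_right by blast+
    then show False
      using claw_sides[OF X(1) _ Z(1) _ _ _ _ _ _ Z(2)] tt t(1) E(1) S_W assms(2) by blast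
  qed
  then consider "touches t X\<^sub>1" "\<not> touches t X\<^sub>2" | "touches t X\<^sub>2" "\<not> touches t X\<^sub>1"
    using t(3) by (auto simp: touches_Un)
  then show ?thesis
  proof cases
    case 1
    have "sep G X\<^sub>2"
      by (rule sep_avoid) (use 1 E(3) G in \<open>auto simp: touches_Un\<close>)
    then show ?thesis
      using sink_aux[OF X th r2] AG[OF D(1) 1(1)] G(1) assms(2) by blast
  next
    case 2
    have "sep G X\<^sub>1"
      by (rule sep_avoid) (use 2 E(3) G in \<open>auto simp: touches_Un\<close>)
    then show ?thesis
      using sink_aux[OF sides_sym[OF X(1)] X(3,2) th r1] AG[OF D(4) 2(1)] G(1) assms(2) by blast
  qed
qed

text \<open>The new pair attached to \<open>p f\<close> consists of \<open>y\<close>, which leads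
  into \<open>X\<^sub>1 \<union> G\<close>, and \<open>p (Suc f)\<close>, which continues along the
  old path and through \<open>r\<^sub>2\<close> into \<open>X\<^sub>2\<close>.\<close>

lemma step_aux:
  assumes "sides X\<^sub>1 X\<^sub>2" "X\<^sub>1 \<subseteq> S th" "X\<^sub>2 \<subseteq> S th" "th < m"
    and "attached th r\<^sub>2" "touches r\<^sub>2 X\<^sub>2" "\<not> touches r\<^sub>2 X\<^sub>1"
    and "cn (X\<^sub>1 \<union> G)" "G \<subseteq> S th" "sep G X\<^sub>2" "touches y (X\<^sub>1 \<union> G)" "attached f y" "f < th"
  shows "stage f"
proof -
  note E = stage_extend[OF assms(1-3) less_imp_le[OF assms(4)] assms(5-10)]
  note D = sidesD[OF E(4)]
  \<comment> \<open>The segment starts at \<open>f + 2\<close>, because \<open>p (Suc f)\<close>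
    becomes the attached vertex and is not part of its side. If \<open>Suc f = th\<close>, the
    segment is empty and \<open>p th\<close> sees \<open>r\<^sub>2\<close>.\<close>
  define A where "A = {r\<^sub>2} \<union> X\<^sub>2 \<union> p ` {f + 2..th}"
  have r: "adj r\<^sub>2 (p th)"
    using assms(5) unfolding attached_def by blast
  have "cn A"
  proof (cases "f + 2 \<le> th")
    case True
    then have "touches r\<^sub>2 (p ` {f + 2..th})"
      by (intro touches_mem[OF r]) auto
    then show ?thesis
      unfolding A_def using assms(4) cn_p by (intro cn_Un[OF D(4), where a = r\<^sub>2]) auto
  qed (use D A_def in auto)
  moreover have S1: "X\<^sub>1 \<union> G \<subseteq> S th"
    using assms(2,9) by blast
  then have "sep (X\<^sub>1 \<union> G) (p ` {f + 2..th})"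
    by (rule sep_mono[OF S_T[of th]]) (auto simp: T_def)
  then have "sep (X\<^sub>1 \<union> G) A"
    unfolding A_def sep_Un_right[of _ "{r\<^sub>2} \<union> X\<^sub>2"] using D(3) by blast
  ultimately have sides: "sides (X\<^sub>1 \<union> G) A"
    using D assms(4) p_image_W[of "f + 2" th]
    by (intro sides_extend[OF E(4)]) (auto simp: A_def)
  have "sep X\<^sub>2 (T f)"
    by (rule sep_mono[OF S_T[of f]]) (use S_mono[of f th] assms(3,13) in auto)
  moreover have "sep (p ` {f + 2..th}) (T f)"
    using p_sep assms(4) by simp
  ultimately have AT: "sep A (T f)"
    unfolding A_def sep_Un_left
    using attached_sep[OF assms(5,13)] by blast
  then have AS: "A \<subseteq> S f"
    using S_I sidesD(5)[OF sides] by blast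
  have fm: "f \<le> m" "f < m"
    using assms by auto
  have XS: "X\<^sub>1 \<union> G \<subseteq> S f"
    using S1 S_mono[of f th] assms(13) by auto
  have "touches (p (Suc f)) A"
  proof (cases "f + 2 \<le> th")
    case True
    then show ?thesis
      using p_adj[of "Suc f" "f + 2"] assms(4) unfolding A_def by (intro touches_mem[of _ "p (f + 2)"]) auto
  next
    case False
    then have "Suc f = th"
      using assms(13) by simp
    then show ?thesis
      using r adj_sym unfolding A_def by (intro touches_mem[of _ r\<^sub>2]) auto
  qed
  moreover have "\<not> touches (p (Suc f)) (X\<^sub>1 \<union> G)"
    by (rule not_touches_sep[of "T th"]) (use S_T[of th] S1 assms(13) in \<open>auto simp: T_def intro: sep_sym sep_mono\<close>)
  moreover have "attached f (p (Suc f))"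
    using attached_p assms by simp
  moreover have "\<not> touches y A"
    by (rule claw_attached[OF sides fm(1) AS S_wT[OF XS] assms(12,11)])
  ultimately show ?thesis
    unfolding stage_def using sides XS AS assms(11,12) fm by blast
qed

text \<open>Here \<open>y\<close> lies in \<open>W\<close> and does not see \<open>w\<close>, but it
  sees \<open>p f\<close>; the third set of the claw therefore runs from the walk over the prefix
  \<open>T f\<close> to \<open>w\<close>.\<close>

lemma stage_step:
  assumes "stage th" "touches y (reach (S th))" "attached f y" "f < th"
  shows "stage f"
proof -
  obtain X\<^sub>1 X\<^sub>2 r\<^sub>1 r\<^sub>2 where th: "th < m" and X: "sides X\<^sub>1 X\<^sub>2" "X\<^sub>1 \<subseteq> S th" "X\<^sub>2 \<subseteq> S th"
    and r1: "attached th r\<^sub>1" "touches r\<^sub>1 X\<^sub>1" "\<not> touches r\<^sub>1 X\<^sub>2"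
    and r2: "attached th r\<^sub>2" "touches r\<^sub>2 X\<^sub>2" "\<not> touches r\<^sub>2 X\<^sub>1"
    using assms(1) unfolding stage_def by blast
  have "y \<notin> S th"
    using assms(3,4) unfolding attached_def S_def T_def touches_def by auto
  then have "y \<notin> X\<^sub>1 \<union> X\<^sub>2" "{s\<^sub>1, s\<^sub>2} \<inter> S th \<subseteq> X\<^sub>1 \<union> X\<^sub>2"
    using X unfolding sides_def srcs_def by blast+
  then obtain E G t where t: "t \<in> insert y (S th)" "t \<notin> X\<^sub>1 \<union> X\<^sub>2" "touches t (X\<^sub>1 \<union> X\<^sub>2)"
    and E: "E \<subseteq> insert y (S th)" "E \<inter> (X\<^sub>1 \<union> X\<^sub>2) = {}" "\<And>e. e \<in> E \<Longrightarrow> \<not> touches e (X\<^sub>1 \<union> X\<^sub>2)"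
    and G: "G \<subseteq> S th" "G \<subseteq> insert t E" "G \<inter> (X\<^sub>1 \<union> X\<^sub>2) = {}"
    and AG: "\<And>A. cn A \<Longrightarrow> touches t A \<Longrightarrow> cn (A \<union> G) \<and> touches y (A \<union> G)"
    and ZE: "\<And>Z. cn Z \<Longrightarrow> touches y Z \<Longrightarrow> cn (Z \<union> E) \<and> touches t (Z \<union> E)"
    by (rule approach_reach[OF _ assms(2)]) blast
  note D = sidesD[OF X(1)]
  have yW: "y \<in> W" "touches y (T f)"
    using assms(3) attached_touches unfolding attached_def by auto
  have EX: "sep E (X\<^sub>1 \<union> X\<^sub>2)"
    by (rule sep_avoid) (use E in auto)
  have fm: "f \<le> m"
    using assms th by simp
  have "\<not> (touches t X\<^sub>1 \<and> touches t X\<^sub>2)"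
  proof
    assume tt: "touches t X\<^sub>1 \<and> touches t X\<^sub>2"
    have "touches y ({w} \<union> T f)"
      using yW unfolding touches_Un by blast
    then have Z: "cn (({w} \<union> T f) \<union> E)" "touches t (({w} \<union> T f) \<union> E)"
      using ZE[OF cn_wT[OF fm]] by blast+
    have "X\<^sub>1 \<subseteq> S f" "X\<^sub>2 \<subseteq> S f"
      using X S_mono[of f th] assms by auto
    then have "sep X\<^sub>1 (({w} \<union> T f) \<union> E)" "sep X\<^sub>2 (({w} \<union> T f) \<union> E)"
      unfolding sep_Un_right[of _ "{w} \<union> T f"] using EX S_wT sep_sym unfolding sep_Un_right by blast+
    then show False
      using claw_sides[OF X(1) _ Z(1) _ _ _ _ _ _ Z(2)] tt t(1) E(1) S_W yW T_wWU[OF fm] by blast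
  qed
  then consider "touches t X\<^sub>1" "\<not> touches t X\<^sub>2" | "touches t X\<^sub>2" "\<not> touches t X\<^sub>1"
    using t(3) by (auto simp: touches_Un)
  then show ?thesis
  proof cases
    case 1
    have "sep G X\<^sub>2"
      by (rule sep_avoid) (use 1 E(3) G in \<open>auto simp: touches_Un\<close>)
    then show ?thesis
      using step_aux[OF X th r2] AG[OF D(1) 1(1)] G(1) assms(3,4) by blast
  next
    case 2
    have "sep G X\<^sub>1"
      by (rule sep_avoid) (use 2 E(3) G in \<open>auto simp: touches_Un\<close>)
    then show ?thesis
      using step_aux[OF sides_sym[OF X(1)] X(3,2) th r1] AG[OF D(4) 2(1)] G(1) assms(3,4) by blast
  qed
qed


section \<open>The initial threshold, at which all of the path but its root is blocked\<close>

lemma source_cases: "x \<in> {s\<^sub>1, s\<^sub>2} \<longleftrightarrow> x = root \<or> x = other"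
  using srcs unfolding srcs_def by blast

lemma root_other: "root \<in> W" "other \<in> W" "root \<noteq> other"
  using srcs sources unfolding srcs_def by blast+

lemma other_notin: "i \<le> m \<Longrightarrow> p i \<noteq> other"
proof
  assume a: "i \<le> m" "p i = other"
  then have "i < m"
    using p_m root_other by (cases "i = m") auto
  then show False
    using a p_adj[of "Suc i" i] p_other[of "Suc i"] by simp
qed

lemma other_S: "th \<le> m \<Longrightarrow> other \<in> S th"
proof -
  assume th: "th \<le> m"
  have "p i \<noteq> other \<and> \<not> adj other (p i)" if "i \<le> th" for i
    using other_notin[of i] p_other[of i] adj_sym[of other "p i"] that th by auto
  then show ?thesis
    unfolding S_def T_def touches_def using root_other by blast
qed

lemma root_not_T: "th < m \<Longrightarrow> root \<notin> T th"
  using p_notin_T[of m th] p_m by simp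

lemma root_not_S: "root \<notin> S (m - 1)"
proof -
  have "adj (p m) (p (m - 1))"
    using p_adj[of m "m - 1"] m by simp
  then have "touches root (T (m - 1))"
    unfolding p_m by (rule touches_mem) (auto simp: T_def)
  then show ?thesis
    unfolding S_def by blast
qed

text \<open>The only neighbour of \<open>root\<close> is \<open>p (m - 1)\<close>, which belongs to
  the blocked prefix. A set inside \<open>S (m - 1)\<close> is therefore anticomplete to the whole
  path, and a connected one around \<open>other\<close> is a side opposite to every final segment of
  the path that omits \<open>p 0\<close>.\<close>

lemma init_sides:
  assumes "1 \<le> i" "i \<le> m" "G \<subseteq> S (m - 1)" "cn ({other} \<union> G)"
  shows "sides (p ` {i..m}) ({other} \<union> G)"
proof -
  have B: "{other} \<union> G \<subseteq> S (m - 1)"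
    using assms(3) other_S[of "m - 1"] by simp
  have "sep {root} ({other} \<union> G)"
  proof (rule sep_touchesI)
    show "{root} \<inter> ({other} \<union> G) = {}"
      using B root_not_S by blast
    have "p (m - 1) \<notin> S (m - 1)"
      unfolding S_def T_def by blast
    then show "\<not> touches x ({other} \<union> G)" if "x \<in> {root}" for x
      using B that pendant S_W unfolding touches_def by blast
  qed
  moreover have "sep (T (m - 1)) ({other} \<union> G)"
    by (rule sep_sym[OF sep_mono[OF S_T B subset_refl]])
  ultimately have "sep ({root} \<union> T (m - 1)) ({other} \<union> G)"
    unfolding sep_Un_left[of "{root}"] by blast
  moreover have "p ` {i..m} \<subseteq> {root} \<union> T (m - 1)"
  proof
    fix x
    assume "x \<in> p ` {i..m}"
    then obtain j where "x = p j" "j \<le> m" by auto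
    then show "x \<in> {root} \<union> T (m - 1)"
      unfolding T_def using p_m by (cases "j = m") auto
  qed
  ultimately have "sep (p ` {i..m}) ({other} \<union> G)"
    by (rule sep_mono) simp
  moreover have "root \<in> p ` {i..m}"
    using p_m assms by auto
  ultimately show ?thesis
    unfolding sides_def using cn_p[of m i] assms(4) p_image_W[OF assms(1)] B S_W srcs by blast
qed

lemma source_S: "{s\<^sub>1, s\<^sub>2} \<inter> S (m - 1) \<subseteq> {other}"
proof
  fix x
  assume "x \<in> {s\<^sub>1, s\<^sub>2} \<inter> S (m - 1)"
  then show "x \<in> {other}"
    using source_cases[of x] root_not_S by blast
qed

text \<open>The two sides are the path without \<open>p 0\<close> and a walk that joins
  \<open>u\<close> to \<open>other\<close>.\<close>

lemma init_sink:
  assumes "u \<in> U" "touches u (reach (S (m - 1)))"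
  shows "linked (p 0) u"
proof -
  have "u \<notin> {other}"
    using assms(1) W_U root_other by blast
  then obtain E G t where t: "touches t {other}" and G: "G \<subseteq> S (m - 1)"
    and AG: "\<And>A. cn A \<Longrightarrow> touches t A \<Longrightarrow> cn (A \<union> G) \<and> touches u (A \<union> G)"
    by (rule approach_reach[OF _ assms(2) source_S]) blast
  have AG': "cn ({other} \<union> G)" "touches u ({other} \<union> G)"
    using AG[OF cn_singleton t] by blast+
  have "touches (p 0) (p ` {1..m})"
    using p_adj[of 0 1] m by (intro touches_mem[of _ "p 1"]) auto
  then show ?thesis
    using linkedI[OF init_sides[OF _ _ G AG'(1)] p_0 assms(1) _ AG'(2)] m by blast
qed

text \<open>The first lowering creates the first stage: \<open>p (Suc f)\<close> continues along the
  path to \<open>root\<close>, and \<open>y\<close> along a walk to \<open>other\<close>.\<close>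

lemma init_step:
  assumes "touches y (reach (S (m - 1)))" "attached f y" "f < m - 1"
  shows "stage f"
proof -
  have f: "f + 2 \<le> m" "f \<le> m" "Suc f \<le> m - 1"
    using assms(3) by auto
  have y: "adj y (p f)"
    using assms(2) unfolding attached_def by blast
  then have "y \<notin> {other}"
    using p_other[OF f(2)] adj_sym by blast
  then obtain E G t where t: "touches t {other}" and G: "G \<subseteq> S (m - 1)"
    and AG: "\<And>A. cn A \<Longrightarrow> touches t A \<Longrightarrow> cn (A \<union> G) \<and> touches y (A \<union> G)"
    by (rule approach_reach[OF _ assms(1) source_S]) blast
  have AG': "cn ({other} \<union> G)" "touches y ({other} \<union> G)"
    using AG[OF cn_singleton t] by blast+
  have sides: "sides (p ` {f + 2..m}) ({other} \<union> G)"
    using init_sides[OF _ f(1) G AG'(1)] by simp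
  have X1: "p ` {f + 2..m} \<subseteq> S f"
    using S_I[OF p_image_W p_sep] by simp
  have B: "{other} \<union> G \<subseteq> S (m - 1)"
    using G other_S[of "m - 1"] by simp
  then have X2: "{other} \<union> G \<subseteq> S f"
    using S_mono[of f "m - 1"] assms(3) by (meson less_imp_le order_trans)
  have "p (Suc f) \<in> T (m - 1)"
    unfolding T_def using f(3) by blast
  then have "\<not> touches (p (Suc f)) ({other} \<union> G)"
    using not_touches_sep[OF sep_sym[OF S_T]] touches_mono[OF _ B] by blast
  moreover have "touches (p (Suc f)) (p ` {f + 2..m})"
    using p_adj[of "Suc f" "f + 2"] f(1) by (intro touches_mem[of _ "p (f + 2)"]) auto
  moreover have "attached f (p (Suc f))"
    using attached_p f by simp
  moreover have "\<not> touches y (p ` {f + 2..m})"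
    by (rule claw_attached[OF sides_sym[OF sides] f(2) X1 S_wT[OF X2] assms(2) AG'(2)])
  moreover have "f < m"
    using f by simp
  ultimately show ?thesis
    unfolding stage_def using sides X1 X2 assms(2) AG'(2) by blast
qed

text \<open>\<open>stage (m - 1)\<close> is false, because \<open>root\<close> is adjacent to
  \<open>p (m - 1)\<close> and so lies outside \<open>S (m - 1)\<close>; the initial threshold is
  therefore a case of its own.\<close>

definition valid :: "nat \<Rightarrow> bool" where
  "valid th \<longleftrightarrow> th = m - 1 \<or> stage th"

lemma valid_less: "valid th \<Longrightarrow> th < m"
  unfolding valid_def stage_def using m by auto

lemma valid_sink:
  "valid th \<Longrightarrow> u \<in> U \<Longrightarrow> touches u (reach (S th)) \<Longrightarrow> u \<noteq> p 0 \<Longrightarrow> linked (p 0) u"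
  unfolding valid_def using init_sink stage_sink by blast

lemma valid_step:
  "valid th \<Longrightarrow> touches y (reach (S th)) \<Longrightarrow> attached f y \<Longrightarrow> f < th \<Longrightarrow> valid f"
  unfolding valid_def using init_step stage_step by blast

end

section \<open>When the search may stop\<close>

context path_linkage
begin

lemma source_not_T: "th < m \<Longrightarrow> x \<in> {s\<^sub>1, s\<^sub>2} \<Longrightarrow> x \<notin> T th"
  unfolding source_cases using root_not_T other_S[of th] by (auto simp: S_def)

lemma touches_S_not_T: "touches x (S th) \<Longrightarrow> x \<notin> T th"
  unfolding S_def touches_def using adj_sym by blast

text \<open>The first vertex \<open>q\<close> outside \<open>S th\<close> on a walk in
  \<open>A\<close> from the source is either that source or sees the reached part, so the hypothesis
  attaches it to \<open>p th\<close>. The walk up to \<open>q\<close> then sees neither the earlier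
  prefix nor \<open>w\<close>.\<close>

lemma boundary:
  assumes "cn A" "A \<subseteq> W" "s \<in> {s\<^sub>1, s\<^sub>2}" "s \<in> A" "\<not> A \<subseteq> S th" "th < m"
    and bdry: "\<And>y. \<lbrakk>y \<in> W; y \<in> {s\<^sub>1, s\<^sub>2} \<or> touches y (reach (S th)); y \<notin> S th\<rbrakk> \<Longrightarrow> attached th y"
  obtains Y where "cn Y" "Y \<subseteq> A" "s \<in> Y" "touches (p th) Y" "sep Y ({w} \<union> p ` {..<th})"
proof -
  obtain z where "z \<in> A" "z \<notin> S th"
    using assms(5) by blast
  then obtain F q where F: "F \<subseteq> A" "q \<in> A" "q \<notin> S th" "\<forall>f\<in>F. f \<in> S th" "cn F" "cn (insert q F)"
    "F = {} \<and> q = s \<or> s \<in> F \<and> touches q F"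
    using first_hit[OF _ assms(4), of z "\<lambda>x. x \<notin> S th"] cn_reach[OF assms(1,4) \<open>z \<in> A\<close> subset_refl]
    by blast
  have "touches q (reach (S th))" if "s \<in> F" "touches q F"
    using reachI[OF assms(3) that(1) F(5), of "S th"] F(4) touches_mono[OF that(2)] by blast
  then have q: "attached th q"
    using bdry[of q] F assms(2,3) by blast
  show thesis
  proof (rule that[of "insert q F"])
    show "touches (p th) (insert q F)"
      using q adj_sym unfolding attached_def by (intro touches_mem[of _ q]) auto
    have "sep F ({w} \<union> p ` {..<th})"
      by (rule sep_mono[OF S_wT[of F th]]) (use F(4) in \<open>auto simp: T_def\<close>)
    moreover have "sep {q} (p ` {..<th})"
    proof (rule sep_touchesI)
      show "{q} \<inter> p ` {..<th} = {}"
        using q unfolding attached_def T_def by auto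
      show "\<not> touches x (p ` {..<th})" if "x \<in> {q}" for x
        using that q unfolding attached_def touches_def by auto
    qed
    moreover have "sep {q} {w}"
      by (rule sep_w) (use F(2) assms(2) in blast)
    ultimately have "sep ({q} \<union> F) ({w} \<union> p ` {..<th})"
      unfolding sep_Un_left sep_Un_right by blast
    then show "sep (insert q F) ({w} \<union> p ` {..<th})"
      by simp
  qed (use F in auto)
qed

text \<open>If \<open>u\<close> were out of reach, both sides of a link would leave
  \<open>S th\<close>: \<open>A\<close> because it is seen by \<open>p 0\<close>, \<open>B\<close>
  because it carries \<open>u\<close>. Both are then seen by \<open>p th\<close>, and
  \<open>p (th - 1)\<close> leads back to \<open>w\<close>, which gives a claw at
  \<open>p th\<close>.\<close>

lemma blocked:
  assumes "th < m" "linked (p 0) u"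
    and bdry: "\<And>y. \<lbrakk>y \<in> W; y \<in> {s\<^sub>1, s\<^sub>2} \<or> touches y (reach (S th)); y \<notin> S th\<rbrakk> \<Longrightarrow> attached th y"
  shows "touches u (reach (S th))"
proof (rule ccontr)
  assume u: "\<not> touches u (reach (S th))"
  obtain A B where AB: "sides A B" "touches (p 0) A" "\<not> touches (p 0) B" "touches u B"
    using assms(2) unfolding linked_def by blast
  obtain a b where ab: "a \<in> A" "b \<in> B" "a \<in> {s\<^sub>1, s\<^sub>2}" "b \<in> {s\<^sub>1, s\<^sub>2}" "srcs a b"
    using AB(1) unfolding sides_def srcs_def by blast
  note D = sidesD[OF AB(1)]
  have "\<not> B \<subseteq> S th"
    using reachI[OF ab(4,2) D(4)] u touches_mono[OF AB(4)] by blast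
  then obtain Y where Y: "cn Y" "Y \<subseteq> B" "b \<in> Y" "touches (p th) Y" "sep Y ({w} \<union> p ` {..<th})"
    by (rule boundary[OF D(4,5) ab(4,2) _ assms(1) bdry])
  have "\<not> A \<subseteq> S th"
    using AB(2) p0_T unfolding S_def touches_def using adj_sym by blast
  then obtain Z where Z: "cn Z" "Z \<subseteq> A" "a \<in> Z" "touches (p th) Z" "sep Z ({w} \<union> p ` {..<th})"
    by (rule boundary[OF D(1,2) ab(3,1) _ assms(1) bdry])
  \<comment> \<open>\<open>p 0\<close> sees no vertex of \<open>B\<close>, whereas
    \<open>p th\<close> sees \<open>Y\<close>.\<close>
  have "th \<noteq> 0"
    using Y(2,4) AB(3) touches_mono by metis
  have ZY: "sides Z Y"
    unfolding sides_def using Z(1-3) Y(1-3) D ab(5) sep_mono[OF D(3) Z(2) Y(2)] by blast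
  have X: "{..<th} = {0..th - 1}"
    using \<open>th \<noteq> 0\<close> by auto
  have "touches w (p ` {..<th})"
    using w_p0 \<open>th \<noteq> 0\<close> by (intro touches_mem[of _ "p 0"]) auto
  then have "cn ({w} \<union> p ` {..<th})"
    using cn_Un[OF cn_singleton[of w] cn_p[of "th - 1" 0], of w] assms(1) X by simp
  moreover have "touches (p th) (p ` {..<th})"
    using p_adj[of th "th - 1"] \<open>th \<noteq> 0\<close> assms(1) by (intro touches_mem[of _ "p (th - 1)"]) auto
  then have "touches (p th) ({w} \<union> p ` {..<th})"
    unfolding touches_Un by blast
  moreover have "p ` {..<th} \<subseteq> T th" "p th \<in> T th"
    unfolding T_def by auto
  moreover have "T th \<subseteq> W \<union> U"
    using T_sub' assms(1) by simp
  ultimately show False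
    using claw_sides[OF ZY _ _ _ _ Z(5) Y(5) Z(4) Y(4)] by blast
qed

end

text \<open>\<open>nu x\<close> is the least index of a path vertex that equals \<open>x\<close> or
  is adjacent to it, and any value above \<open>m\<close> if there is none. It turns membership in
  \<open>S th\<close> into the comparison \<open>th < nu x\<close>.\<close>

locale indexed_path_linkage = path_linkage +
  fixes nu :: "'a \<Rightarrow> nat"
  assumes nu: "x \<in> W \<Longrightarrow> i \<le> m \<Longrightarrow> i < nu x \<Longrightarrow> x \<noteq> p i \<and> \<not> adj x (p i)"
    and nu': "x \<in> W \<Longrightarrow> nu x \<le> m \<Longrightarrow> x = p (nu x) \<or> adj x (p (nu x))"
begin

text \<open>\<open>S th\<close> grows when \<open>th\<close> falls, and the clauses on
  \<open>D\<close> and \<open>P\<close> are monotone in it. Discovered and processed vertices thus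
  keep their status after a lowering, which is what makes the search quadratic.\<close>

definition search_inv :: "'a set \<Rightarrow> 'a set \<Rightarrow> nat \<Rightarrow> bool" where
  "search_inv D P th \<longleftrightarrow> valid th \<and> {s\<^sub>1, s\<^sub>2} \<subseteq> D \<and> D \<subseteq> W \<union> U \<and>
     (\<forall>x\<in>D. x \<in> {s\<^sub>1, s\<^sub>2} \<or> touches x (reach (S th))) \<and> P \<subseteq> reach (S th) \<and>
     (\<forall>x\<in>P. \<forall>y\<in>W \<union> U. adj x y \<longrightarrow> y \<in> D)"

lemma nu_S: "x \<in> W \<Longrightarrow> th < m \<Longrightarrow> th < nu x \<longleftrightarrow> x \<in> S th"
proof
  assume a: "x \<in> W" "th < m" "th < nu x"
  have "x \<noteq> p i \<and> \<not> adj x (p i)" if "i \<le> th" for i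
    using nu[OF a(1), of i] that a by simp
  then show "x \<in> S th"
    unfolding S_def T_def touches_def using a(1) by blast
next
  assume a: "x \<in> W" "th < m" "x \<in> S th"
  show "th < nu x"
  proof (rule ccontr)
    assume "\<not> th < nu x"
    then have "nu x \<le> m" "p (nu x) \<in> T th"
      using a unfolding T_def by auto
    then show False
      using nu'[OF a(1)] a(3) touches_mem[of x "p (nu x)" "T th"] unfolding S_def by auto
  qed
qed

lemma nu_attached:
  assumes "x \<in> W" "th < m" "x \<notin> T th" "nu x \<le> th"
  shows "attached (nu x) x"
proof -
  have "p (nu x) \<in> T th" "T (nu x) \<subseteq> T th"
    unfolding T_def using assms(4) by auto
  then show ?thesis
    using assms nu[OF assms(1)] nu'[OF assms(1)] unfolding attached_def
    by (metis le_neq_implies_less less_le_trans less_imp_le subsetD)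
qed

lemma search_not_T:
  assumes "search_inv D P th" "x \<in> D"
  shows "x \<notin> T th"
proof -
  have th: "th < m"
    using assms(1) valid_less unfolding search_inv_def by blast
  from assms consider "x \<in> {s\<^sub>1, s\<^sub>2}" | "touches x (reach (S th))"
    unfolding search_inv_def by blast
  then show ?thesis
    using source_not_T[OF th, of x] touches_S_not_T[OF touches_mono[OF _ reach_sub], of x th]
    by cases blast+
qed

lemma search_process:
  assumes "search_inv D P th" "x \<in> D" "x \<in> W" "th < nu x"
  shows "search_inv (D \<union> {y \<in> W \<union> U. adj x y}) (insert x P) th"
proof -
  have xS: "x \<in> S th"
    using nu_S assms valid_less unfolding search_inv_def by blast
  have "x \<in> reach (S th)"
  proof (cases "x \<in> {s\<^sub>1, s\<^sub>2}")
    case False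
    then obtain r where "r \<in> reach (S th)" "adj x r"
      using assms unfolding search_inv_def touches_def by blast
    then show ?thesis
      using reach_step[OF _ adj_sym] xS by blast
  qed (use reach_source xS in blast)
  then show ?thesis
    using assms(1) adj_sym unfolding search_inv_def touches_def by blast
qed

lemma search_lower:
  assumes "search_inv D P th" "x \<in> D" "x \<in> W" "nu x < th"
  shows "search_inv D P (nu x)"
proof -
  have v: "valid th"
    using assms(1) unfolding search_inv_def by blast
  note th = valid_less[OF v]
  have att: "attached (nu x) x"
    using nu_attached[OF assms(3) th search_not_T[OF assms(1,2)]] assms(4) by simp
  \<comment> \<open>A source never triggers a lowering: \<open>root\<close> has no neighbour on the
    path before \<open>p (m - 1)\<close>, and \<open>other\<close> has none at all.\<close>
  have "x \<notin> {s\<^sub>1, s\<^sub>2}"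
  proof
    assume "x \<in> {s\<^sub>1, s\<^sub>2}"
    then consider "x = p m" | "x = other"
      unfolding source_cases p_m by blast
    then show False
    proof cases
      case 1
      then show ?thesis
        using att p_adj[of m "nu x"] assms(4) th unfolding attached_def by auto
    next
      case 2
      then show ?thesis
        using att p_other[of "nu x"] adj_sym[of other "p (nu x)"] assms(4) th
        unfolding attached_def by auto
    qed
  qed
  then have "valid (nu x)"
    using valid_step[OF v _ att assms(4)] assms(1,2) unfolding search_inv_def by blast
  moreover have R: "reach (S th) \<subseteq> reach (S (nu x))"
    using reach_mono S_mono assms(4) by simp
  moreover have "touches y (reach (S (nu x)))" if "touches y (reach (S th))" for y
    by (rule touches_mono[OF that R])
  ultimately show ?thesis
    using assms(1) unfolding search_inv_def by blast
qed

text \<open>Once nothing is pending, a discovered vertex of \<open>W\<close> outside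
  \<open>S th\<close> has its first contact exactly at \<open>th\<close>; these are the boundary
  vertices that \<open>blocked\<close> asks for.\<close>

lemma search_final:
  assumes "search_inv D P th" and fin: "\<And>x. x \<in> D \<Longrightarrow> x \<in> W \<Longrightarrow> th \<le> nu x \<and> (th < nu x \<longrightarrow> x \<in> P)"
    and "u \<in> U" "u \<noteq> p 0"
  shows "u \<in> D \<longleftrightarrow> linked (p 0) u"
proof -
  have v: "valid th" and sD: "{s\<^sub>1, s\<^sub>2} \<subseteq> D"
    and D: "\<forall>x\<in>D. x \<in> {s\<^sub>1, s\<^sub>2} \<or> touches x (reach (S th))"
    and closed': "\<forall>x\<in>P. \<forall>y\<in>W \<union> U. adj x y \<longrightarrow> y \<in> D"
    using assms(1) unfolding search_inv_def by - (elim conjE; assumption)+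
  note th = valid_less[OF v]
  have closed: "y \<in> D" if "x \<in> P" "adj x y" "y \<in> W \<union> U" for x y
    using closed' that by blast
  have DS: "x \<in> P" if "x \<in> D" "x \<in> S th" for x
    using fin[OF that(1)] that(2) S_W nu_S[OF _ th] by blast
  have P: "x \<in> P" if xr: "x \<in> reach (S th)" for x
  proof -
    obtain s where s: "s \<in> {s\<^sub>1, s\<^sub>2}" "s \<in> S th" "(inside (S th))\<^sup>*\<^sup>* s x"
      using xr unfolding reach_def by blast
    from s(3) show ?thesis
    proof (induction rule: rtranclp_induct)
      case base
      then show ?case
        using s(1,2) sD DS by blast
    next
      case (step y z)
      then show ?case
        using DS closed S_W unfolding inside_def by blast
    qed
  qed
  have "touches u (reach (S th))" if l: "linked (p 0) u"
  proof (rule blocked[OF th l])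
    fix y
    assume y: "y \<in> W" "y \<in> {s\<^sub>1, s\<^sub>2} \<or> touches y (reach (S th))" "y \<notin> S th"
    then have yD: "y \<in> D"
    proof (elim disjE)
      assume "touches y (reach (S th))"
      then show ?thesis
        using P closed y(1) adj_sym unfolding touches_def by blast
    qed (use sD in blast)
    have "nu y = th"
      using fin[OF yD y(1)] nu_S[OF y(1) th] y(3) by simp
    then show "attached th y"
      using nu_attached[OF y(1) th search_not_T[OF assms(1) yD]] by simp
  qed
  then have "u \<in> D" if "linked (p 0) u"
    using that P closed assms(3) adj_sym unfolding touches_def by blast
  moreover have "linked (p 0) u" if "u \<in> D"
  proof -
    have "u \<notin> {s\<^sub>1, s\<^sub>2}"
      using assms(3) W_U sources by blast
    then show ?thesis
      using valid_sink[OF v assms(3) _ assms(4)] D that by blast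
  qed
  ultimately show ?thesis
    by blast
qed

end

section \<open>A structured language for the machine\<close>

text \<open>
  The store consists of arrays \<open>s a\<close> with cells \<open>0, \<dots>, n + 1\<close>; a variable is the cell \<open>0\<close> of an
  array. No expression exceeds \<open>n + 1\<close>, so that values never leave the word length and
  serve as indices without further checks. The value \<open>Inf = n + 1\<close> stands for an undefined vertex or
  an infinite number. \<open>Adj\<close> reads the adjacency matrix.
\<close>

datatype ex = Zero | One | Inf | Arr nat ex | Adj ex ex | Le ex ex | Cond ex ex ex

text \<open>The only loop runs over \<open>0, ..., n - 1\<close>, so termination is automatic and
  the nesting depth of loops gives the exponent of the running time.\<close>

datatype cmd = Nop | Put nat ex ex | Then cmd cmd | Ite ex cmd cmd | For nat cmd

type_synonym store = "nat \<Rightarrow> nat \<Rightarrow> nat"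

definition put :: "nat \<Rightarrow> nat \<Rightarrow> nat \<Rightarrow> store \<Rightarrow> store" where
  "put a i v s = s(a := (s a)(i := v))"

fun ev :: "nat \<Rightarrow> (nat \<Rightarrow> nat \<Rightarrow> bool) \<Rightarrow> ex \<Rightarrow> store \<Rightarrow> nat" where
  "ev n E Zero s = 0"
| "ev n E One s = 1"
| "ev n E Inf s = Suc n"
| "ev n E (Arr a x) s = s a (ev n E x s)"
| "ev n E (Adj x y) s = of_bool (ev n E x s < n \<and> ev n E y s < n \<and> E (ev n E x s) (ev n E y s))"
| "ev n E (Le x y) s = of_bool (ev n E x s \<le> ev n E y s)"
| "ev n E (Cond b x y) s = (if ev n E b s \<noteq> 0 then ev n E x s else ev n E y s)"

fun den :: "nat \<Rightarrow> (nat \<Rightarrow> nat \<Rightarrow> bool) \<Rightarrow> cmd \<Rightarrow> store \<Rightarrow> store" where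
  "den n E Nop s = s"
| "den n E (Put a x y) s = put a (ev n E x s) (ev n E y s) s"
| "den n E (Then c d) s = den n E d (den n E c s)"
| "den n E (Ite b c d) s = (if ev n E b s \<noteq> 0 then den n E c s else den n E d s)"
| "den n E (For a c) s = fold (\<lambda>j s. den n E c (put a 0 j s)) [0..<n] s"

definition bounded :: "nat \<Rightarrow> store \<Rightarrow> bool" where
  "bounded n s \<longleftrightarrow> (\<forall>a. \<forall>i\<le>Suc n. s a i \<le> Suc n)"

lemma ev_le: "bounded n s \<Longrightarrow> ev n E x s \<le> Suc n"
  by (induction x) (auto simp: bounded_def)

lemma bounded_put: "bounded n s \<Longrightarrow> v \<le> Suc n \<Longrightarrow> bounded n (put a i v s)"
  unfolding bounded_def put_def by auto

lemma bounded_fold: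
  assumes "\<And>j s. j \<in> set js \<Longrightarrow> bounded n s \<Longrightarrow> bounded n (f j s)" "bounded n s"
  shows "bounded n (fold f js s)"
  using assms by (induction js arbitrary: s) auto

lemma bounded_den: "bounded n s \<Longrightarrow> bounded n (den n E c s)"
proof (induction c arbitrary: s)
  case (For a c)
  show ?case
    unfolding den.simps
  proof (rule bounded_fold)
    fix j s
    assume "j \<in> set [0..<n]" "bounded n s"
    then have "bounded n (put a 0 j s)"
      by (simp add: bounded_put)
    then show "bounded n (den n E c (put a 0 j s))"
      by (rule For.IH)
  qed (rule For.prems)
qed (auto simp: bounded_put ev_le)

fun seqs :: "program list \<Rightarrow> program" where
  "seqs [] = Skip"
| "seqs (p # ps) = Seq p (seqs ps)"

text \<open>
  Register 0 holds \<open>n\<close>; cell \<open>i\<close> of array \<open>a\<close> has the address \<open>n * n + a * (n + 2) + i\<close>.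
  Code compiled for \<open>r\<close> uses the registers from \<open>r\<close> on.
\<close>

definition addr :: "nat \<Rightarrow> nat \<Rightarrow> program" where
  "addr a r = seqs [Mul (r + 1) 0 0, Add r r (r + 1), Const (r + 1) a, Const (r + 2) 2,
     Add (r + 2) (r + 2) 0, Mul (r + 1) (r + 1) (r + 2), Add r r (r + 1)]"

text \<open>Comparisons use truncated subtraction: \<open>n - a\<close> is non-zero iff
  \<open>a < n\<close>, and \<open>a - b\<close> is zero iff \<open>a \<le> b\<close>.\<close>

fun cx :: "ex \<Rightarrow> nat \<Rightarrow> program" where
  "cx Zero r = Const r 0"
| "cx One r = Const r 1"
| "cx Inf r = Seq (Const r 1) (Add r r 0)"
| "cx (Arr a x) r = Seq (cx x r) (Seq (addr a r) (Load r r))"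
| "cx (Adj x y) r = Seq (cx x r) (Seq (cx y (r + 1)) (Seq (Sub (r + 2) 0 r) (IfNZ (r + 2)
     (Seq (Sub (r + 2) 0 (r + 1)) (IfNZ (r + 2)
       (Seq (Mul r r 0) (Seq (Add r r (r + 1)) (Load r r))) (Const r 0))) (Const r 0))))"
| "cx (Le x y) r = Seq (cx x r) (Seq (cx y (r + 1)) (Seq (Sub r r (r + 1))
     (IfNZ r (Const r 0) (Const r 1))))"
| "cx (Cond b x y) r = Seq (cx b r) (IfNZ r (cx x r) (cx y r))"

text \<open>In a loop, register \<open>r\<close> counts the rounds, and \<open>r + 1\<close> is
  reloaded with \<open>n\<close> minus the counter before each test. The body is compiled for
  \<open>r + 1\<close>, so it may overwrite the latter but not the counter.\<close>

fun cc :: "cmd \<Rightarrow> nat \<Rightarrow> program" where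
  "cc Nop r = Skip"
| "cc (Put a x y) r = Seq (cx x r) (Seq (addr a r) (Seq (cx y (r + 1)) (Store r (r + 1))))"
| "cc (Then c d) r = Seq (cc c r) (cc d r)"
| "cc (Ite b c d) r = Seq (cx b r) (IfNZ r (cc c r) (cc d r))"
| "cc (For a c) r = Seq (Const r 0) (Seq (Sub (r + 1) 0 r) (WhileNZ (r + 1)
     (Seq (Const (r + 1) 0) (Seq (addr a (r + 1)) (Seq (Store (r + 1) r) (Seq (cc c (r + 1))
       (Seq (Const (r + 1) 1) (Seq (Add r r (r + 1)) (Sub (r + 1) 0 r)))))))))"

text \<open>Only an upper bound on the steps: a conditional is charged for both branches, which
  makes the bound independent of the store.\<close>

fun tx :: "ex \<Rightarrow> nat" where
  "tx Zero = 1"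
| "tx One = 1"
| "tx Inf = 2"
| "tx (Arr a x) = tx x + 9"
| "tx (Adj x y) = tx x + tx y + 8"
| "tx (Le x y) = tx x + tx y + 3"
| "tx (Cond b x y) = tx b + tx x + tx y + 1"

text \<open>A round costs 14 steps besides its body: one for the test, one to load 0, eight for the
  address, one for the store and three to advance the counter. The final 3 pays for the two
  instructions before the loop and its last test.\<close>

fun tc :: "nat \<Rightarrow> cmd \<Rightarrow> nat" where
  "tc n Nop = 1"
| "tc n (Put a x y) = tx x + tx y + 9"
| "tc n (Then c d) = tc n c + tc n d"
| "tc n (Ite b c d) = tx b + tc n c + tc n d + 1"
| "tc n (For a c) = n * (tc n c + 14) + 3"

text \<open>The largest array number that occurs; it determines the largest address and with it the
  word length.\<close>

fun bx :: "ex \<Rightarrow> nat" where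
  "bx (Arr a x) = max a (bx x)"
| "bx (Adj x y) = max (bx x) (bx y)"
| "bx (Le x y) = max (bx x) (bx y)"
| "bx (Cond b x y) = max (bx b) (max (bx x) (bx y))"
| "bx _ = 0"

fun bc :: "cmd \<Rightarrow> nat" where
  "bc Nop = 0"
| "bc (Put a x y) = max a (max (bx x) (bx y))"
| "bc (Then c d) = max (bc c) (bc d)"
| "bc (Ite b c d) = max (bx b) (max (bc c) (bc d))"
| "bc (For a c) = max a (bc c)"

text \<open>A bound replaces the exact step count of \<open>exec\<close>, so that the branches of a
  conditional can be given a common one.\<close>

definition runs :: "nat \<Rightarrow> program \<Rightarrow> config \<Rightarrow> nat \<Rightarrow> config \<Rightarrow> bool" where
  "runs W p c B c' \<longleftrightarrow> (\<exists>t\<le>B. exec W p c t c')"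

lemma runs_last:
  "c = c' \<Longrightarrow> runs W Skip c (Suc B) c'"
  "k \<le> W \<Longrightarrow> R' = R(i := k) \<Longrightarrow> runs W (Const i k) (R, M) (Suc B) (R', M)"
  "R j + R k \<le> W \<Longrightarrow> R' = R(i := R j + R k) \<Longrightarrow> runs W (Add i j k) (R, M) (Suc B) (R', M)"
  "R j - R k \<le> W \<Longrightarrow> R' = R(i := R j - R k) \<Longrightarrow> runs W (Sub i j k) (R, M) (Suc B) (R', M)"
  "R' = R(i := M (R j)) \<Longrightarrow> runs W (Load i j) (R, M) (Suc B) (R', M)"
  "M' = M(R i := R j) \<Longrightarrow> runs W (Store i j) (R, M) (Suc B) (R, M')"
  unfolding runs_def by (auto intro!: exI[of _ 1] exec.intros simp del: One_nat_def)

lemma runs_Seq: "runs W p c B c' \<Longrightarrow> runs W q c' B' c'' \<Longrightarrow> B + B' \<le> B'' \<Longrightarrow> runs W (Seq p q) c B'' c''"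
  unfolding runs_def by (meson exec.Seq add_mono order_trans)

lemma runs_cons:
  "k \<le> W \<Longrightarrow> runs W q (R(i := k), M) B c \<Longrightarrow> runs W (Seq (Const i k) q) (R, M) (Suc B) c"
  "R j + R k \<le> W \<Longrightarrow> runs W q (R(i := R j + R k), M) B c \<Longrightarrow> runs W (Seq (Add i j k) q) (R, M) (Suc B) c"
  "R j - R k \<le> W \<Longrightarrow> runs W q (R(i := R j - R k), M) B c \<Longrightarrow> runs W (Seq (Sub i j k) q) (R, M) (Suc B) c"
  "R j * R k \<le> W \<Longrightarrow> runs W q (R(i := R j * R k), M) B c \<Longrightarrow> runs W (Seq (Mul i j k) q) (R, M) (Suc B) c"
  "runs W q (R, M(R i := R j)) B c \<Longrightarrow> runs W (Seq (Store i j) q) (R, M) (Suc B) c"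
  unfolding runs_def by (metis exec.intros plus_1_eq_Suc Suc_le_mono)+

lemma runs_If: "(R i \<noteq> 0 \<Longrightarrow> runs W p (R, M) B c') \<Longrightarrow> (R i = 0 \<Longrightarrow> runs W q (R, M) B c') \<Longrightarrow>
    Suc B \<le> B' \<Longrightarrow> runs W (IfNZ i p q) (R, M) B' c'"
proof (cases "R i = 0")
  case True
  then show "runs W (IfNZ i p q) (R, M) B' c'"
    if "R i = 0 \<Longrightarrow> runs W q (R, M) B c'" "Suc B \<le> B'"
    using that IfFalse[of "(R, M)" i W q _ c' p] Suc_le_mono order_trans unfolding runs_def
    by (metis fst_conv)
next
  case False
  then show "runs W (IfNZ i p q) (R, M) B' c'"
    if "R i \<noteq> 0 \<Longrightarrow> runs W p (R, M) B c'" "Suc B \<le> B'"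
    using that IfTrue[of "(R, M)" i W p _ c' q] Suc_le_mono order_trans unfolding runs_def
    by (metis fst_conv)
qed

lemma runs_While: "R i \<noteq> 0 \<Longrightarrow> runs W p (R, M) B c' \<Longrightarrow> runs W (WhileNZ i p) c' B' c'' \<Longrightarrow>
    Suc (B + B') \<le> B'' \<Longrightarrow> runs W (WhileNZ i p) (R, M) B'' c''"
  unfolding runs_def by (metis (no_types, lifting) WhileTrue fst_conv add_mono le_trans Suc_le_mono)

lemma runs_While_exit: "R i = 0 \<Longrightarrow> 1 \<le> B \<Longrightarrow> runs W (WhileNZ i p) (R, M) B (R, M)"
  unfolding runs_def using WhileFalse[of "(R, M)" i] by auto

lemma runs_mono: "runs W p c B c' \<Longrightarrow> B \<le> B' \<Longrightarrow> runs W p c B' c'"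
  unfolding runs_def using order_trans by blast

definition rep :: "nat \<Rightarrow> (nat \<Rightarrow> nat \<Rightarrow> bool) \<Rightarrow> store \<Rightarrow> (nat \<Rightarrow> nat) \<Rightarrow> bool" where
  "rep n E s M \<longleftrightarrow> (\<forall>x<n. \<forall>y<n. M (x * n + y) = of_bool (E x y)) \<and>
     (\<forall>a. \<forall>i\<le>Suc n. M (n * n + a * (n + 2) + i) = s a i)"

lemma pair_lt: "x < n \<Longrightarrow> y < n \<Longrightarrow> x * n + y < n * (n::nat)"
proof -
  assume "x < n" "y < n"
  then have "x * n + y < Suc x * n" by simp
  also have "\<dots> \<le> n * n" using \<open>x < n\<close> by (intro mult_right_mono) auto
  finally show ?thesis .
qed

text \<open>Addresses of array cells are distinct, because the offset within an array is below
  \<open>n + 2\<close> and division recovers the array number; and they all lie beyond the adjacency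
  matrix.\<close>

lemma rep_put:
  assumes "rep n E s M" "i \<le> Suc n"
  shows "rep n E (put a i v s) (M(n * n + a * (n + 2) + i := v))"
proof -
  have "x * n + y \<noteq> n * n + a * (n + 2) + i" if "x < n" "y < n" for x y
    using pair_lt[OF that] by simp
  moreover have "b = a \<and> j = i" if "n * n + b * (n + 2) + j = n * n + a * (n + 2) + i" "j \<le> Suc n" for b j
  proof -
    have eq: "j + b * (n + 2) = i + a * (n + 2)"
      using that(1) by linarith
    have "(j + b * (n + 2)) div (n + 2) = b" "(i + a * (n + 2)) div (n + 2) = a"
      using that(2) assms(2) by (subst div_mult_self1; simp)+
    then show ?thesis
      using eq by simp
  qed
  ultimately show ?thesis
    using assms unfolding rep_def put_def by auto
qed

text \<open>A word has to hold the address \<open>n * n + b * (n + 2) + (n + 1)\<close> of the last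
  cell of array \<open>b\<close> and the intermediate values of its computation;
  \<open>Suc b * (n + 2)\<^sup>2\<close> bounds all of them.\<close>

definition fits :: "nat \<Rightarrow> nat \<Rightarrow> nat \<Rightarrow> bool" where
  "fits W n b \<longleftrightarrow> Suc b * (n + 2)\<^sup>2 \<le> W"

lemma fits_mono: "fits W n b \<Longrightarrow> a \<le> b \<Longrightarrow> fits W n a"
  unfolding fits_def by (meson Suc_le_mono le_trans mult_le_mono1)

lemma fitsD:
  assumes "fits W n b"
  shows "n * n \<le> W" "i \<le> Suc n \<Longrightarrow> n * n + i \<le> W" "b \<le> W" "n + 2 \<le> W" "b * (n + 2) \<le> W"
    "i \<le> Suc n \<Longrightarrow> n * n + b * (n + 2) + i \<le> W" "Suc n \<le> W"
proof -
  have "n * n + 2 * n + b * (n + 2) + 3 + b \<le> Suc b * (n + 2)\<^sup>2"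
    by (simp add: power2_eq_square algebra_simps)
  then have *: "n * n + 2 * n + b * (n + 2) + 3 + b \<le> W"
    using assms unfolding fits_def by linarith
  from * show "n * n \<le> W" "b \<le> W" "n + 2 \<le> W" "Suc n \<le> W" "b * (n + 2) \<le> W" by linarith+
  from * show "n * n + i \<le> W" "n * n + b * (n + 2) + i \<le> W" if "i \<le> Suc n"
    using that by linarith+
qed

lemma addr_runs:
  assumes "fits W n a" "R 0 = n" "R r = i" "i \<le> Suc n" "1 \<le> r"
  shows "\<exists>R'. runs W (addr a r) (R, M) 8 (R', M) \<and> R' r = n * n + a * (n + 2) + i \<and> (\<forall>q<r. R' q = R q)"
proof -
  note F = fitsD[OF assms(1)]
  let ?R = "R(r + 1 := a * (2 + n), r + 2 := 2 + n, r := i + n * n + a * (2 + n))"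
  have "runs W (addr a r) (R, M) (Suc (Suc (Suc (Suc (Suc (Suc (Suc (Suc 0)))))))) (?R, M)"
    unfolding addr_def seqs.simps
    apply (rule runs_cons, use assms F in simp)
    apply (rule runs_cons, use assms F(2)[of i] in \<open>simp add: add.commute\<close>)
    apply (rule runs_cons, use F in simp)
    apply (rule runs_cons, use F in simp)
    apply (rule runs_cons, use assms F in simp)
    apply (rule runs_cons, use assms F in \<open>simp add: add.commute\<close>)
    apply (rule runs_cons, use assms F(6)[of i] in \<open>simp add: algebra_simps\<close>)
    apply (rule runs_last(1))
    apply (use assms in \<open>auto simp: fun_eq_iff algebra_simps\<close>)
    done
  then show ?thesis
    using assms(2,5) by (intro exI[of _ ?R]) (auto simp: eval_nat_numeral)
qed

lemma cx_runs:
  assumes "rep n E s M" "bounded n s" "fits W n (bx x)" "R 0 = n" "1 \<le> r"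
  shows "\<exists>R'. runs W (cx x r) (R, M) (tx x) (R', M) \<and> R' r = ev n E x s \<and> (\<forall>q<r. R' q = R q)"
  using assms(3-)
proof (induction x arbitrary: R r)
  case Zero
  then show ?case
    by (intro exI[of _ "R(r := 0)"]) (auto intro!: runs_last)
next
  case One
  then show ?case
    using fitsD(7)[OF One(1)] by (intro exI[of _ "R(r := 1)"]) (auto intro!: runs_last)
next
  case Inf
  have "runs W (cx Inf r) (R, M) (Suc (Suc 0)) (R(r := Suc n), M)"
    unfolding cx.simps
    by (rule runs_cons, use fitsD(7)[OF Inf(1)] in simp, rule runs_last)
      (use Inf fitsD(7)[OF Inf(1)] in auto)
  then show ?case
    by (intro exI[of _ "R(r := Suc n)"]) (auto simp: numeral_2_eq_2 fun_upd_def)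
next
  case (Arr a x)
  have f: "fits W n (bx x)" "fits W n a"
    using fits_mono[OF Arr.prems(1)] by simp_all
  obtain R1 where R1: "runs W (cx x r) (R, M) (tx x) (R1, M)" "R1 r = ev n E x s" "\<forall>q<r. R1 q = R q"
    using Arr.IH[OF f(1), of R r, OF Arr.prems(2,3)] by blast
  obtain R2 where R2: "runs W (addr a r) (R1, M) 8 (R2, M)"
    "R2 r = n * n + a * (n + 2) + ev n E x s" "\<forall>q<r. R2 q = R1 q"
    using addr_runs[of W n a R1 r "ev n E x s" M, OF f(2) _ R1(2) ev_le[OF assms(2)] Arr.prems(3)] R1(3) Arr.prems by auto
  have "M (R2 r) = s a (ev n E x s)"
    using assms(1) ev_le[OF assms(2)] R2(2) unfolding rep_def by simp
  then have "runs W (cx (Arr a x) r) (R, M) (tx (Arr a x)) (R2(r := s a (ev n E x s)), M)"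
    unfolding cx.simps by (intro runs_Seq[OF R1(1) runs_Seq[OF R2(1) runs_last(5)]]) auto
  then show ?case
    using R1 R2 by (intro exI[of _ "R2(r := s a (ev n E x s))"]) (auto simp: fun_upd_def)
next
  case (Adj x y)
  have f: "fits W n (bx x)" "fits W n (bx y)"
    using fits_mono[OF Adj.prems(1)] by simp_all
  obtain R1 where R1: "runs W (cx x r) (R, M) (tx x) (R1, M)" "R1 r = ev n E x s" "\<forall>q<r. R1 q = R q"
    using Adj.IH(1)[OF f(1), of R r, OF Adj.prems(2,3)] by blast
  obtain R2 where R2: "runs W (cx y (r + 1)) (R1, M) (tx y) (R2, M)" "R2 (r + 1) = ev n E y s"
    "\<forall>q<r + 1. R2 q = R1 q"
    using Adj.IH(2)[OF f(2), of R1 "r + 1"] Adj.prems R1(3) by auto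
  define a b where "a = ev n E x s" and "b = ev n E y s"
  have ab: "R2 0 = n" "R2 r = a" "R2 (Suc r) = b"
    using R1 R2 Adj.prems unfolding a_def b_def by auto
  note F = fitsD[OF Adj.prems(1)]
  have W: "n - k \<le> W" for k
    using F(7) by simp
  let ?p = "Seq (Sub (r + 2) 0 r) (IfNZ (r + 2)
     (Seq (Sub (r + 2) 0 (r + 1)) (IfNZ (r + 2)
       (Seq (Mul r r 0) (Seq (Add r r (r + 1)) (Load r r))) (Const r 0))) (Const r 0))"
  consider (lt) "a < n" "b < n" | (ge) "a < n" "\<not> b < n" | (ge') "\<not> a < n"
    by blast
  then have "\<exists>R3. runs W ?p (R2, M) 8 (R3, M) \<and>
     R3 r = of_bool (a < n \<and> b < n \<and> E a b) \<and> (\<forall>q<r. R3 q = R2 q)"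
  proof cases
    case lt
    let ?R = "R2(r + 2 := n - b, r := M (a * n + b))"
    have *: "a * n \<le> W" "a * n + b \<le> W"
      using pair_lt[OF lt] F(1) by auto
    have "runs W ?p (R2, M) (Suc (Suc (Suc (Suc (Suc (Suc (Suc 0))))))) (?R, M)"
      apply (rule runs_cons, use ab W in simp)
      apply (rule runs_If[OF _ _ order_refl])
       apply (rule runs_cons, use ab W in simp)
       apply (rule runs_If[OF _ _ order_refl])
        apply (rule runs_cons, use ab * Adj.prems in simp)
        apply (rule runs_cons, use ab * Adj.prems in simp)
        apply (rule runs_last)
        apply (use ab lt Adj.prems in \<open>auto simp: fun_eq_iff\<close>)
      done
    then show ?thesis
      using lt assms(1) Adj.prems unfolding rep_def
      by (intro exI[of _ ?R] conjI, elim runs_mono) (auto simp: fun_upd_def)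
  next
    case ge
    let ?R = "R2(r + 2 := 0, r := 0)"
    have "runs W ?p (R2, M) (Suc (Suc (Suc (Suc (Suc 0))))) (?R, M)"
      apply (rule runs_cons, use ab W in simp)
      apply (rule runs_If[OF _ _ order_refl])
       apply (rule runs_cons, use ab W in simp)
       apply (rule runs_If[OF _ _ order_refl])
        apply (use ab ge Adj.prems in simp)
       apply (rule runs_last, simp)
       apply (use ab ge Adj.prems in \<open>auto simp: fun_eq_iff\<close>)
      done
    then show ?thesis
      using ge Adj.prems by (intro exI[of _ ?R] conjI, elim runs_mono) (auto simp: fun_upd_def)
  next
    case ge'
    let ?R = "R2(r + 2 := 0, r := 0)"
    have "runs W ?p (R2, M) (Suc (Suc (Suc 0))) (?R, M)"
      apply (rule runs_cons, use ab W in simp)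
      apply (rule runs_If[OF _ _ order_refl])
       apply (use ab ge' Adj.prems in simp)
      apply (rule runs_last, simp)
      apply (use ab ge' Adj.prems in \<open>auto simp: fun_eq_iff\<close>)
      done
    then show ?thesis
      using ge' Adj.prems by (intro exI[of _ ?R] conjI, elim runs_mono) (auto simp: fun_upd_def)
  qed
  then obtain R3 where R3: "runs W ?p (R2, M) 8 (R3, M)"
     "R3 r = of_bool (a < n \<and> b < n \<and> E a b)" "\<forall>q<r. R3 q = R2 q" by blast
  have "runs W (cx (Adj x y) r) (R, M) (tx (Adj x y)) (R3, M)"
    unfolding cx.simps by (rule runs_Seq[OF R1(1) runs_Seq[OF R2(1) R3(1) order_refl]]) simp
  then show ?case
    using R1 R2 R3 a_def b_def by (intro exI[of _ R3]) auto
next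
  case (Le x y)
  have f: "fits W n (bx x)" "fits W n (bx y)"
    using fits_mono[OF Le.prems(1)] by simp_all
  obtain R1 where R1: "runs W (cx x r) (R, M) (tx x) (R1, M)" "R1 r = ev n E x s" "\<forall>q<r. R1 q = R q"
    using Le.IH(1)[OF f(1), of R r, OF Le.prems(2,3)] by blast
  obtain R2 where R2: "runs W (cx y (r + 1)) (R1, M) (tx y) (R2, M)" "R2 (r + 1) = ev n E y s"
    "\<forall>q<r + 1. R2 q = R1 q"
    using Le.IH(2)[OF f(2), of R1 "r + 1"] Le.prems R1(3) by auto
  define a b where "a = ev n E x s" and "b = ev n E y s"
  have ab: "R2 r = a" "R2 (Suc r) = b" "a \<le> W"
    using R1 R2 Le.prems ev_le[OF assms(2), of E x] fitsD(7)[OF Le.prems(1)] unfolding a_def b_def by auto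
  have 3: "runs W (Seq (Sub r r (r + 1)) (IfNZ r (Const r 0) (Const r 1))) (R2, M) (Suc (Suc (Suc 0)))
      (R2(r := of_bool (a \<le> b)), M)"
    apply (rule runs_cons, use ab in simp)
    apply (rule runs_If[OF _ _ order_refl])
     apply (rule runs_last, simp)
     apply (use ab in \<open>simp add: fun_eq_iff\<close>)
    apply (rule runs_last, use fitsD(7)[OF Le.prems(1)] in simp)
    apply (use ab in \<open>simp add: fun_eq_iff\<close>)
    done
  have "runs W (cx (Le x y) r) (R, M) (tx (Le x y)) (R2(r := of_bool (a \<le> b)), M)"
    unfolding cx.simps by (rule runs_Seq[OF R1(1) runs_Seq[OF R2(1) 3 order_refl]]) simp
  then show ?case
    using R1 R2 a_def b_def by (intro exI[of _ "R2(r := of_bool (a \<le> b))"]) (auto simp: fun_upd_def)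
next
  case (Cond b x y)
  have f: "fits W n (bx b)" "fits W n (bx x)" "fits W n (bx y)"
    using fits_mono[OF Cond.prems(1)] by simp_all
  obtain R1 where R1: "runs W (cx b r) (R, M) (tx b) (R1, M)" "R1 r = ev n E b s" "\<forall>q<r. R1 q = R q"
    using Cond.IH(1)[OF f(1), of R r, OF Cond.prems(2,3)] by blast
  obtain R2 where R2: "runs W (cx x r) (R1, M) (tx x) (R2, M)" "R2 r = ev n E x s" "\<forall>q<r. R2 q = R1 q"
    using Cond.IH(2)[OF f(2), of R1 r] Cond.prems R1(3) by auto
  obtain R3 where R3: "runs W (cx y r) (R1, M) (tx y) (R3, M)" "R3 r = ev n E y s" "\<forall>q<r. R3 q = R1 q"
    using Cond.IH(3)[OF f(3), of R1 r] Cond.prems R1(3) by auto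
  show ?case
  proof (cases "ev n E b s = 0")
    case True
    have "runs W (IfNZ r (cx x r) (cx y r)) (R1, M) (tx x + tx y + 1) (R3, M)"
      by (rule runs_If[where B = "tx x + tx y"]) (use True R1 runs_mono[OF R3(1)] in auto)
    then show ?thesis
      using runs_Seq[OF R1(1), of _ _ _ "tx (Cond b x y)"] True R1 R3 by (intro exI[of _ R3]) auto
  next
    case False
    have "runs W (IfNZ r (cx x r) (cx y r)) (R1, M) (tx x + tx y + 1) (R2, M)"
      by (rule runs_If[where B = "tx x + tx y"]) (use False R1 runs_mono[OF R2(1)] in auto)
    then show ?thesis
      using runs_Seq[OF R1(1), of _ _ _ "tx (Cond b x y)"] False R1 R2 by (intro exI[of _ R2]) auto
  qed
qed

lemma cc_runs:
  assumes "rep n E s M" "bounded n s" "fits W n (bc c)" "R 0 = n" "1 \<le> r"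
  shows "\<exists>R' M'. runs W (cc c r) (R, M) (tc n c) (R', M') \<and> rep n E (den n E c s) M' \<and> (\<forall>q<r. R' q = R q)"
  using assms
proof (induction c arbitrary: s R M r)
  case Nop
  then show ?case
    by (intro exI[of _ R] exI[of _ M]) (auto intro!: runs_last)
next
  case (Put a x y)
  have f: "fits W n (bx x)" "fits W n (bx y)" "fits W n a"
    using fits_mono[OF Put.prems(3)] by simp_all
  define i v where "i = ev n E x s" and "v = ev n E y s"
  have i: "i \<le> Suc n"
    using ev_le[OF Put.prems(2)] i_def by simp
  obtain R1 where R1: "runs W (cx x r) (R, M) (tx x) (R1, M)" "R1 r = i" "\<forall>q<r. R1 q = R q"
    using cx_runs[OF Put.prems(1,2) f(1), of R r, OF Put.prems(4,5)] i_def by blast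
  obtain R2 where R2: "runs W (addr a r) (R1, M) 8 (R2, M)"
    "R2 r = n * n + a * (n + 2) + i" "\<forall>q<r. R2 q = R1 q"
    using addr_runs[of W n a R1 r i M, OF f(3) _ R1(2) i Put.prems(5)] R1(3) Put.prems by auto
  obtain R3 where R3: "runs W (cx y (r + 1)) (R2, M) (tx y) (R3, M)" "R3 (r + 1) = v" "\<forall>q<r + 1. R3 q = R2 q"
    using cx_runs[OF Put.prems(1,2) f(2), of R2 "r + 1"] Put.prems R1(3) R2(3) v_def by auto
  have "runs W (Store r (r + 1)) (R3, M) (Suc 0) (R3, M(n * n + a * (n + 2) + i := v))"
    by (rule runs_last) (use R2 R3 in simp)
  then have "runs W (cc (Put a x y) r) (R, M) (tc n (Put a x y)) (R3, M(n * n + a * (n + 2) + i := v))"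
    unfolding cc.simps by (intro runs_Seq[OF R1(1) runs_Seq[OF R2(1) runs_Seq[OF R3(1)]]]) auto
  moreover have "rep n E (put a i v s) (M(n * n + a * (n + 2) + i := v))"
    by (rule rep_put[OF Put.prems(1) i])
  ultimately show ?case
    using R1(3) R2(3) R3(3) unfolding den.simps i_def[symmetric] v_def[symmetric]
    by (intro exI conjI) (assumption | simp)+
next
  case (Then c d)
  have f: "fits W n (bc c)" "fits W n (bc d)"
    using fits_mono[OF Then.prems(3)] by simp_all
  obtain R1 M1 where 1: "runs W (cc c r) (R, M) (tc n c) (R1, M1)" "rep n E (den n E c s) M1" "\<forall>q<r. R1 q = R q"
    using Then.IH(1)[OF Then.prems(1,2) f(1), of R r, OF Then.prems(4,5)] by blast
  obtain R2 M2 where 2: "runs W (cc d r) (R1, M1) (tc n d) (R2, M2)"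
    "rep n E (den n E d (den n E c s)) M2" "\<forall>q<r. R2 q = R1 q"
    using Then.IH(2)[OF 1(2) bounded_den[OF Then.prems(2)] f(2), of R1 r] 1(3) Then.prems by auto
  have "runs W (cc (Then c d) r) (R, M) (tc n (Then c d)) (R2, M2)"
    unfolding cc.simps by (intro runs_Seq[OF 1(1) 2(1)]) simp
  then show ?case
    using 1 2 by (intro exI[of _ R2] exI[of _ M2]) auto
next
  case (Ite b c d)
  have f: "fits W n (bx b)" "fits W n (bc c)" "fits W n (bc d)"
    using fits_mono[OF Ite.prems(3)] by simp_all
  obtain R1 where R1: "runs W (cx b r) (R, M) (tx b) (R1, M)" "R1 r = ev n E b s" "\<forall>q<r. R1 q = R q"
    using cx_runs[OF Ite.prems(1,2) f(1), of R r, OF Ite.prems(4,5)] by blast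
  have R10: "R1 0 = n"
    using R1(3) Ite.prems by auto
  obtain R2 M2 where 2: "runs W (cc c r) (R1, M) (tc n c) (R2, M2)" "rep n E (den n E c s) M2" "\<forall>q<r. R2 q = R1 q"
    using Ite.IH(1)[OF Ite.prems(1,2) f(2), of R1 r, OF R10 Ite.prems(5)] by blast
  obtain R3 M3 where 3: "runs W (cc d r) (R1, M) (tc n d) (R3, M3)" "rep n E (den n E d s) M3" "\<forall>q<r. R3 q = R1 q"
    using Ite.IH(2)[OF Ite.prems(1,2) f(3), of R1 r, OF R10 Ite.prems(5)] by blast
  have 4: "tx b + Suc (tc n c + tc n d) \<le> tc n (Ite b c d)"
    by simp
  show ?case
  proof (cases "ev n E b s = 0")
    case True
    have "runs W (IfNZ r (cc c r) (cc d r)) (R1, M) (Suc (tc n c + tc n d)) (R3, M3)"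
      by (rule runs_If[OF _ _ order_refl]) (use True R1 runs_mono[OF 3(1)] in auto)
    then have "runs W (cc (Ite b c d) r) (R, M) (tc n (Ite b c d)) (R3, M3)"
      unfolding cc.simps by (rule runs_Seq[OF R1(1) _ 4])
    then show ?thesis
      using True R1 3 by (intro exI[of _ R3] exI[of _ M3]) auto
  next
    case False
    have "runs W (IfNZ r (cc c r) (cc d r)) (R1, M) (Suc (tc n c + tc n d)) (R2, M2)"
      by (rule runs_If[OF _ _ order_refl]) (use False R1 runs_mono[OF 2(1)] in auto)
    then have "runs W (cc (Ite b c d) r) (R, M) (tc n (Ite b c d)) (R2, M2)"
      unfolding cc.simps by (rule runs_Seq[OF R1(1) _ 4])
    then show ?thesis
      using False R1 2 by (intro exI[of _ R2] exI[of _ M2]) auto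
  qed
next
  case (For a c)
  have f: "fits W n a" "fits W n (bc c)"
    using fits_mono[OF For.prems(3)] by simp_all
  note F = fitsD[OF f(1)]
  define body where "body = Seq (Const (r + 1) 0) (Seq (addr a (r + 1)) (Seq (Store (r + 1) r)
    (Seq (cc c (r + 1)) (Seq (Const (r + 1) 1) (Seq (Add r r (r + 1)) (Sub (r + 1) 0 r))))))"
  define g where "g j s = den n E c (put a 0 j s)" for j s
  \<comment> \<open>The loop is entered with counter \<open>j\<close> and \<open>k\<close> rounds
    left; \<open>j + k = n\<close> relates the two registers.\<close>
  have loop: "\<exists>R' M'. runs W (WhileNZ (r + 1) body) (R, M) (k * (tc n c + 14) + 1) (R', M') \<and>
      rep n E (fold g [j..<n] s) M' \<and> (\<forall>q<r. R' q = R q)"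
    if "rep n E s M" "bounded n s" "R 0 = n" "R r = j" "R (r + 1) = k" "j + k = n" for j k s R M
    using that
  proof (induction k arbitrary: j s R M)
    case 0
    then show ?case
      using runs_While_exit[of R "r + 1" "0 * (tc n c + 14) + 1" W body M] by auto
  next
    case (Suc k)
    have jn: "j < n" using Suc.prems by simp
    let ?R0 = "R(r + 1 := 0)"
    have r0: "?R0 0 = n" "?R0 (r + 1) = 0"
      using Suc.prems For.prems by auto
    obtain R1 where R1: "runs W (addr a (r + 1)) (?R0, M) 8 (R1, M)"
      "R1 (r + 1) = n * n + a * (n + 2) + 0" "\<forall>q<r + 1. R1 q = ?R0 q"
      using addr_runs[of W n a ?R0 "r + 1" 0 M, OF f(1) r0] by auto
    let ?M = "M(n * n + a * (n + 2) + 0 := j)"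
    have R1': "R1 r = j" "R1 0 = n"
      using R1(3) Suc.prems by auto
    have b: "bounded n (put a 0 j s)"
      using Suc.prems jn by (simp add: bounded_put)
    obtain R2 M2 where R2: "runs W (cc c (r + 1)) (R1, ?M) (tc n c) (R2, M2)"
      "rep n E (g j s) M2" "\<forall>q<r + 1. R2 q = R1 q"
      unfolding g_def
      using For.IH[OF rep_put[OF Suc.prems(1) le0] b f(2), of R1 "r + 1", OF R1'(2) le_add2] by blast
    let ?R3 = "R2(r + 1 := n - Suc j, r := Suc j)"
    have R2': "R2 r = j" "R2 0 = n"
      using R2(3) R1' For.prems(5) by auto
    have t: "runs W (Seq (Const (r + 1) 1) (Seq (Add r r (r + 1)) (Sub (r + 1) 0 r))) (R2, M2)
      (Suc (Suc (Suc 0))) (?R3, M2)"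
      apply (rule runs_cons, use F in simp)
      apply (rule runs_cons, use R2' jn F(7) in simp)
      apply (rule runs_last)
      apply (use R2' For.prems(5) F(7) jn in \<open>auto simp: fun_eq_iff\<close>)
      done
    have bg: "bounded n (g j s)"
      unfolding g_def by (rule bounded_den[OF b])
    have pre: "?R3 0 = n" "?R3 r = Suc j" "?R3 (r + 1) = k" "Suc j + k = n"
      using Suc.prems R2' For.prems(5) by auto
    have st: "M(R1 (r + 1) := R1 r) = ?M"
      using R1(2) R1'(1) by simp
    have "runs W body (R, M) (Suc (8 + Suc (tc n c + Suc (Suc (Suc 0))))) (?R3, M2)"
      unfolding body_def
      by (rule runs_cons(1), simp, rule runs_Seq[OF R1(1) _ order_refl], rule runs_cons(5),
        unfold st, rule runs_Seq[OF R2(1) t order_refl])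
    moreover obtain R4 M4 where 4: "runs W (WhileNZ (r + 1) body) (?R3, M2) (k * (tc n c + 14) + 1) (R4, M4)"
      "rep n E (fold g [Suc j..<n] (g j s)) M4" "\<forall>q<r. R4 q = ?R3 q"
      using Suc.IH[OF R2(2) bg pre] by blast
    ultimately have "runs W (WhileNZ (r + 1) body) (R, M) (Suc k * (tc n c + 14) + 1) (R4, M4)"
      using Suc.prems by (intro runs_While[OF _ _ 4(1)]) auto
    moreover have "fold g [j..<n] s = fold g [Suc j..<n] (g j s)"
      using jn by (simp add: upt_conv_Cons)
    moreover have "\<forall>q<r. R4 q = R q"
      using 4(3) R2(3) R1(3) by auto
    ultimately show ?case
      using 4(2) by metis
  qed
  let ?R = "R(r := 0, r + 1 := n)"
  obtain R' M' where L: "runs W (WhileNZ (r + 1) body) (?R, M) (n * (tc n c + 14) + 1) (R', M')"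
      "rep n E (fold g [0..<n] s) M'" "\<forall>q<r. R' q = ?R q"
    using loop[OF For.prems(1,2), of ?R 0 n] For.prems by auto
  have "runs W (cc (For a c) r) (R, M) (Suc (Suc (n * (tc n c + 14) + 1))) (R', M')"
    unfolding cc.simps body_def[symmetric]
    apply (rule runs_cons, simp)
    apply (rule runs_cons, use For.prems F(7) in simp)
    apply (use L(1) For.prems in simp)
    done
  then have "runs W (cc (For a c) r) (R, M) (tc n (For a c)) (R', M')"
    by (rule runs_mono) simp
  then show ?case
    using L(2,3) unfolding den.simps g_def by (intro exI[of _ R'] exI[of _ M']) auto
qed

section \<open>From nesting depth to running time\<close>

fun depth :: "cmd \<Rightarrow> nat" where
  "depth (Then c d) = max (depth c) (depth d)"
| "depth (Ite b c d) = max (depth c) (depth d)"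
| "depth (For a c) = Suc (depth c)"
| "depth _ = 0"

text \<open>The base is \<open>n + 1\<close>, so that the power also absorbs additive constants when
  \<open>n = 0\<close>.\<close>

lemma tc_bound: "\<exists>k. \<forall>n. tc n c \<le> k * (n + 1) ^ depth c"
proof (induction c)
  case (Then c d)
  then obtain k k' where k: "\<And>n. tc n c \<le> k * (n + 1) ^ depth c" "\<And>n. tc n d \<le> k' * (n + 1) ^ depth d"
    by blast
  have "tc n (Then c d) \<le> (k + k') * (n + 1) ^ depth (Then c d)" for n
  proof -
    have "(n + 1) ^ depth c \<le> (n + 1) ^ depth (Then c d)" "(n + 1) ^ depth d \<le> (n + 1) ^ depth (Then c d)"
      by (auto intro!: power_increasing)
    then have "k * (n + 1) ^ depth c \<le> k * (n + 1) ^ depth (Then c d)"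
      "k' * (n + 1) ^ depth d \<le> k' * (n + 1) ^ depth (Then c d)"
      by - (rule mult_le_mono2, assumption)+
    then show ?thesis
      using k(1)[of n] k(2)[of n] unfolding tc.simps add_mult_distrib by linarith
  qed
  then show ?case by blast
next
  case (Ite b c d)
  then obtain k k' where k: "\<And>n. tc n c \<le> k * (n + 1) ^ depth c" "\<And>n. tc n d \<le> k' * (n + 1) ^ depth d"
    by blast
  have "tc n (Ite b c d) \<le> (k + k' + tx b + 1) * (n + 1) ^ depth (Ite b c d)" for n
  proof -
    have "(n + 1) ^ depth c \<le> (n + 1) ^ depth (Ite b c d)" "(n + 1) ^ depth d \<le> (n + 1) ^ depth (Ite b c d)"
      by (auto intro!: power_increasing)
    then have "k * (n + 1) ^ depth c \<le> k * (n + 1) ^ depth (Ite b c d)"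
      "k' * (n + 1) ^ depth d \<le> k' * (n + 1) ^ depth (Ite b c d)"
      by - (rule mult_le_mono2, assumption)+
    moreover have "(tx b + 1) * 1 \<le> (tx b + 1) * (n + 1) ^ depth (Ite b c d)"
      by (intro mult_left_mono) auto
    ultimately show ?thesis
      using k(1)[of n] k(2)[of n] unfolding tc.simps add_mult_distrib by linarith
  qed
  then show ?case by blast
next
  case (For a c)
  then obtain k where k: "\<And>n. tc n c \<le> k * (n + 1) ^ depth c"
    by blast
  have "tc n (For a c) \<le> (k + 17) * (n + 1) ^ depth (For a c)" for n
  proof -
    have 1: "1 \<le> (n + 1) ^ depth c"
      by simp
    have "n * (tc n c + 14) \<le> n * ((k + 14) * (n + 1) ^ depth c)"
      using k[of n] 1 unfolding add_mult_distrib by (intro mult_left_mono add_mono) simp_all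
    moreover have "1 \<le> (n + 1) ^ Suc (depth c)"
      by (rule one_le_power) simp
    moreover have "(k + 17) * (n + 1) ^ Suc (depth c) = n * ((k + 14) * (n + 1) ^ depth c) +
        (k + 14) * (n + 1) ^ depth c + 3 * (n + 1) ^ Suc (depth c)"
      by (simp add: algebra_simps)
    ultimately show ?thesis
      unfolding tc.simps depth.simps by linarith
  qed
  then show ?case by blast
next
  case Nop
  then show ?case by auto
next
  case (Put a x y)
  then show ?case by auto
qed

text \<open>The answer is the variable 0, which is copied only at the very end into register 0,
  since that register holds \<open>n\<close> until then. For \<open>n \<ge> 1\<close> the base
  \<open>n + 1\<close> of the time bound is at most \<open>2 * n\<close>, whence the factor
  \<open>2 ^ depth c\<close>.\<close>

lemma decides_in_timeI:
  assumes "\<And>n G. graph G \<Longrightarrow> verts G = {..<n} \<Longrightarrow> Pre G \<Longrightarrow>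
    den n (\<lambda>x y. x \<rightarrow>\<^bsub>G\<^esub> y) c (\<lambda>_ _. 0) 0 0 = (if Q G then 1 else 0)"
  shows "\<exists>p T. (\<lambda>n. real (T n)) \<in> O(\<lambda>n. real n ^ depth c) \<and> decides_in_time p Pre Q T"
proof -
  define p where "p = Seq (cc c 1) (Seq (cx (Arr 0 Zero) 1) (Seq (Const 2 0) (Add 0 1 2)))"
  \<comment> \<open>Reading the variable 0 takes at most 10 steps, and two more instructions copy
    it.\<close>
  define T where "T n = tc n c + 12" for n
  obtain k where k: "\<And>n. tc n c \<le> k * (n + 1) ^ depth c"
    using tc_bound by blast
  have "real (T n) \<le> (real k + 12) * 2 ^ depth c * real n ^ depth c" if "1 \<le> n" for n
  proof -
    have "T n \<le> k * (n + 1) ^ depth c + 12 * (n + 1) ^ depth c"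
      unfolding T_def using k[of n] by (intro add_mono) auto
    also have "\<dots> \<le> (k + 12) * (2 * n) ^ depth c"
      unfolding add_mult_distrib[symmetric] using that by (intro mult_left_mono power_mono) auto
    finally have "real (T n) \<le> real ((k + 12) * (2 * n) ^ depth c)"
      by linarith
    then show ?thesis
      by (simp add: power_mult_distrib algebra_simps)
  qed
  then have "(\<lambda>n. real (T n)) \<in> O(\<lambda>n. real n ^ depth c)"
    by (intro bigoI[of _ "(real k + 12) * 2 ^ depth c"] eventually_sequentiallyI[of 1]) auto
  moreover have "decides_in_time p Pre Q T"
    unfolding decides_in_time_def
  \<comment> \<open>As \<open>(n + 2)\<^sup>2 \<le> 4 * (n + 1)\<^sup>2\<close>, the values stay
    below \<open>4 * Suc (bc c) * (n + 1)\<^sup>2\<close>; one number has to serve both as factor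
    and as exponent.\<close>
  proof (rule exI[of _ "4 * Suc (bc c) + 2"], intro allI impI)
    fix n and G :: "(nat, nat \<times> nat) pre_digraph"
    assume G: "graph G" "verts G = {..<n}" "Pre G"
    define E where "E x y \<longleftrightarrow> x \<rightarrow>\<^bsub>G\<^esub> y" for x y
    define W where "W = (4 * Suc (bc c) + 2) * (n + 1) ^ (4 * Suc (bc c) + 2)"
    have "(n + 2)\<^sup>2 \<le> (2 * (n + 1))\<^sup>2"
      by (intro power_mono) auto
    also have "\<dots> = 4 * (n + 1)\<^sup>2"
      by (simp add: power2_eq_square)
    finally have "Suc (bc c) * (n + 2)\<^sup>2 \<le> Suc (bc c) * (4 * (n + 1)\<^sup>2)"
      by (rule mult_le_mono2)
    also have "\<dots> = 4 * Suc (bc c) * (n + 1)\<^sup>2"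
      by (simp only: ac_simps)
    also have "\<dots> \<le> (4 * Suc (bc c) + 2) * (n + 1) ^ (4 * Suc (bc c) + 2)"
      by (intro mult_mono power_increasing) auto
    finally have W: "fits W n (bc c)"
      unfolding fits_def W_def .
    obtain R M where RM: "input_config n G = (R, M)"
      by fastforce
    have R: "R 0 = n"
      using RM unfolding input_config_def by auto
    have "rep n E (\<lambda>_ _. 0) M"
    proof -
      have "M (x * n + y) = of_bool (E x y)" if "x < n" "y < n" for x y
        using RM that pair_lt[OF that] unfolding input_config_def E_def by auto
      moreover have "M (n * n + a * (n + 2) + i) = 0" for a i
        using RM unfolding input_config_def by auto
      ultimately show ?thesis
        unfolding rep_def by simp
    qed
    then obtain R1 M1 where 1: "runs W (cc c 1) (R, M) (tc n c) (R1, M1)"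
      "rep n E (den n E c (\<lambda>_ _. 0)) M1" "\<forall>q<1. R1 q = R q"
      using cc_runs[of n E "\<lambda>_ _. 0" M W c R 1] W R by (auto simp: bounded_def)
    have b: "bounded n (den n E c (\<lambda>_ _. 0))"
      by (rule bounded_den) (simp add: bounded_def)
    have W0: "fits W n (bx (Arr 0 Zero))"
      by (rule fits_mono[OF W]) simp
    obtain R2 where 2: "runs W (cx (Arr 0 Zero) 1) (R1, M1) (tx (Arr 0 Zero)) (R2, M1)"
      "R2 1 = ev n E (Arr 0 Zero) (den n E c (\<lambda>_ _. 0))" "\<forall>q<1. R2 q = R1 q"
      using cx_runs[OF 1(2) b W0, of R1 1] 1(3) R by auto
    have v: "R2 1 \<le> W"
      using 2(2) ev_le[OF b, of E "Arr 0 Zero"] fitsD(7)[OF W] by simp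
    have "runs W (Seq (Const 2 0) (Add 0 1 2)) (R2, M1) (Suc (Suc 0)) (R2(2 := 0, 0 := R2 1), M1)"
      apply (rule runs_cons, simp)
      apply (rule runs_last)
      apply (use v in \<open>auto simp: fun_eq_iff\<close>)
      done
    then have "runs W p (R, M) (T n) (R2(2 := 0, 0 := R2 1), M1)"
      unfolding p_def T_def by (intro runs_Seq[OF 1(1) runs_Seq[OF 2(1)]]) auto
    then obtain t where "t \<le> T n" "exec W p (input_config n G) t (R2(2 := 0, 0 := R2 1), M1)"
      unfolding runs_def RM by blast
    moreover have "R2 1 = (if Q G then 1 else 0)"
      using 2(2) assms[OF G] unfolding E_def by simp
    ultimately show "\<exists>t R M. exec ((4 * Suc (bc c) + 2) * (n + 1) ^ (4 * Suc (bc c) + 2)) p (input_config n G) t (R, M) \<and>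
        t \<le> T n \<and> R 0 = (if Q G then 1 else 0)"
      unfolding W_def by (metis fun_upd_same)
  qed
  ultimately show ?thesis
    by blast
qed

section \<open>The search as a program\<close>

abbreviation "Var a \<equiv> Arr a Zero"
abbreviation "NotE b \<equiv> Cond b Zero One"
abbreviation "AndE b c \<equiv> Cond b c Zero"
abbreviation "OrE b c \<equiv> Cond b One c"
abbreviation "EqE x y \<equiv> AndE (Le x y) (Le y x)"
abbreviation "LtE x y \<equiv> NotE (Le y x)"
abbreviation "Assign a x \<equiv> Put a Zero x"

lemma put_apply [simp]: "put a i v s b j = (if b = a \<and> j = i then v else s b j)"
  unfolding put_def by simp

lemma put_other: "b \<noteq> a \<Longrightarrow> put a i v s b = s b"
  unfolding put_def by simp

fun modified :: "cmd \<Rightarrow> nat set" where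
  "modified Nop = {}"
| "modified (Put a x y) = {a}"
| "modified (Then c d) = modified c \<union> modified d"
| "modified (Ite b c d) = modified c \<union> modified d"
| "modified (For a c) = insert a (modified c)"

lemma fold_upt_inv:
  assumes "I 0 s" "\<And>j s. j < n \<Longrightarrow> I j s \<Longrightarrow> I (Suc j) (f j s)"
  shows "I n (fold f [0..<n] s)"
proof -
  have "k \<le> n \<Longrightarrow> I k (fold f [0..<k] s)" for k
    by (induction k) (use assms in auto)
  then show ?thesis by simp
qed

lemma For_inv:
  assumes "I 0 s" "\<And>j s. j < n \<Longrightarrow> I j s \<Longrightarrow> I (Suc j) (den n E c (put a 0 j s))"
  shows "I n (den n E (For a c) s)"
  unfolding den.simps using assms by (rule fold_upt_inv[of I])

lemma den_other: "a \<notin> modified c \<Longrightarrow> den n E c s a = s a"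
proof (induction c arbitrary: s)
  case (For b c)
  show ?case
    by (rule For_inv[where I = "\<lambda>_ t. t a = s a"]) (use For in \<open>auto simp: put_other\<close>)
qed (auto simp: put_other)

text \<open>
  Arrays: 3 \<open>W\<close>, 4 \<open>U\<close>, 5 the index \<open>nu\<close>, 6 discovered, 7 processed, 8 parent; variables: 9 \<open>th\<close>,
  10 the selected vertex, 11 and 12 the sources.
\<close>

definition select :: cmd where
  "select = Then (Assign 10 Inf) (For 1 (Ite (AndE (Arr 3 (Var 1)) (AndE (Arr 6 (Var 1))
     (OrE (LtE (Arr 5 (Var 1)) (Var 9)) (AndE (LtE (Var 9) (Arr 5 (Var 1))) (NotE (Arr 7 (Var 1)))))))
     (Assign 10 (Var 1)) Nop))"

definition scan :: cmd where
  "scan = For 2 (Ite (AndE (Adj (Var 10) (Var 2)) (AndE (OrE (Arr 3 (Var 2)) (Arr 4 (Var 2))) (NotE (Arr 6 (Var 2)))))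
     (Then (Put 6 (Var 2) One) (Put 8 (Var 2) (Var 10))) Nop)"

definition advance :: cmd where
  "advance = Then select (Ite (Le Inf (Var 10)) Nop
     (Ite (LtE (Arr 5 (Var 10)) (Var 9)) (Assign 9 (Arr 5 (Var 10))) (Then (Put 7 (Var 10) One) scan)))"

definition search :: cmd where
  "search = For 16 (Then advance advance)"

text \<open>The pending vertices: those whose first contact lies before the threshold, and the
  unprocessed ones whose first contact lies beyond it. A contact exactly at the threshold asks for
  nothing, as such a vertex is attached to the end of the prefix.\<close>

definition cand :: "store \<Rightarrow> nat \<Rightarrow> bool" where
  "cand s x \<longleftrightarrow> s 3 x \<noteq> 0 \<and> s 6 x \<noteq> 0 \<and> (s 5 x < s 9 0 \<or> s 9 0 < s 5 x \<and> s 7 x = 0)"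

lemma select_spec:
  fixes s :: store and n :: nat and E :: "nat \<Rightarrow> nat \<Rightarrow> bool"
  defines "s' \<equiv> den n E select s"
  shows "s' 10 0 = Suc n \<and> (\<forall>x<n. \<not> cand s x) \<or> s' 10 0 < n \<and> cand s (s' 10 0)"
proof -
  let ?I = "\<lambda>j t. (\<forall>a. a \<notin> {1, 10} \<longrightarrow> t a = s a) \<and>
    (t 10 0 = Suc n \<and> (\<forall>x<j. \<not> cand s x) \<or> t 10 0 < n \<and> cand s (t 10 0))"
  have "?I n (s')"
    unfolding s'_def select_def den.simps(3)
  proof (rule For_inv[where I = ?I], goal_cases)
    case 1
    show ?case
      by (simp add: put_other)
  next
    case (2 j t)
    then have "\<forall>a. a \<notin> {1, 10} \<longrightarrow> t a = s a"
      by (elim conjE)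
    then have "t 3 = s 3" "t 5 = s 5" "t 6 = s 6" "t 7 = s 7" "t 9 = s 9"
      by simp_all
    then have *: "den n E (Ite (AndE (Arr 3 (Var 1)) (AndE (Arr 6 (Var 1))
      (OrE (LtE (Arr 5 (Var 1)) (Var 9)) (AndE (LtE (Var 9) (Arr 5 (Var 1))) (NotE (Arr 7 (Var 1)))))))
      (Assign 10 (Var 1)) Nop) (put 1 0 j t) = (if cand s j then put 10 0 j (put 1 0 j t) else put 1 0 j t)"
      by (simp add: cand_def put_other)
    show ?case
      unfolding * using 2 by (auto simp: put_other less_Suc_eq)
  qed
  then show ?thesis by blast
qed

lemma select_other: "a \<noteq> 1 \<Longrightarrow> a \<noteq> 10 \<Longrightarrow> den n E select s a = s a"
  by (rule den_other) (simp add: select_def)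

lemma scan_spec:
  fixes E :: "nat \<Rightarrow> nat \<Rightarrow> bool"
  assumes "s 10 0 < n"
  defines "C y \<equiv> E (s 10 0) y \<and> (s 3 y \<noteq> 0 \<or> s 4 y \<noteq> 0) \<and> s 6 y = 0"
  shows "den n E scan s 6 = (\<lambda>y. if y < n \<and> C y then 1 else s 6 y)"
    "den n E scan s 8 = (\<lambda>y. if y < n \<and> C y then s 10 0 else s 8 y)"
proof -
  let ?I = "\<lambda>j t. (\<forall>a. a \<notin> {2, 6, 8} \<longrightarrow> t a = s a) \<and>
    t 6 = (\<lambda>y. if y < j \<and> C y then 1 else s 6 y) \<and> t 8 = (\<lambda>y. if y < j \<and> C y then s 10 0 else s 8 y)"
  have "?I n (den n E scan s)"
    unfolding scan_def
  proof (rule For_inv[where I = ?I], goal_cases)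
    case 1
    show ?case by simp
  next
    case (2 j t)
    then have fr: "\<forall>a. a \<notin> {2, 6, 8} \<longrightarrow> t a = s a" and
      t6: "t 6 = (\<lambda>y. if y < j \<and> C y then 1 else s 6 y)" and
      t8: "t 8 = (\<lambda>y. if y < j \<and> C y then s 10 0 else s 8 y)"
      by - (elim conjE; assumption)+
    then have t: "t 3 = s 3" "t 4 = s 4" "t 10 = s 10"
      by simp_all
    have *: "den n E (Ite (AndE (Adj (Var 10) (Var 2)) (AndE (OrE (Arr 3 (Var 2)) (Arr 4 (Var 2))) (NotE (Arr 6 (Var 2)))))
       (Then (Put 6 (Var 2) One) (Put 8 (Var 2) (Var 10))) Nop) (put 2 0 j t) =
       (if C j then put 8 j (s 10 0) (put 6 j 1 (put 2 0 j t)) else put 2 0 j t)"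
      using 2(1) assms(1) t by (simp add: put_other C_def t6)
    show ?case
      unfolding * using 2 t6 t8 by (auto simp: put_other fun_eq_iff less_Suc_eq)
  qed
  then show "den n E scan s 6 = (\<lambda>y. if y < n \<and> C y then 1 else s 6 y)"
    "den n E scan s 8 = (\<lambda>y. if y < n \<and> C y then s 10 0 else s 8 y)"
    by blast+
qed

lemma scan_other: "a \<noteq> 2 \<Longrightarrow> a \<noteq> 6 \<Longrightarrow> a \<noteq> 8 \<Longrightarrow> den n E scan s a = s a"
  by (rule den_other) (simp add: scan_def)

definition marked :: "nat \<Rightarrow> store \<Rightarrow> nat \<Rightarrow> nat set" where
  "marked n s a = {x. x < n \<and> s a x \<noteq> 0}"

text \<open>The outcomes of one round in terms of sets, detached from the loop variables. Parents
  are set only for vertices discovered in this round, so that earlier tree paths persist.\<close>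

lemma advance_cases:
  fixes s :: store and n :: nat and E :: "nat \<Rightarrow> nat \<Rightarrow> bool"
  defines "s' \<equiv> den n E advance s"
  obtains
    (stable) "\<forall>x<n. \<not> cand s x" "\<forall>a\<in>{6, 7, 8, 9}. s' a = s a"
  | (lower) x where "x \<in> marked n s 3" "x \<in> marked n s 6" "s 5 x < s 9 0" "s' 9 0 = s 5 x"
      "\<forall>a\<in>{6, 7, 8}. s' a = s a"
  | (process) x where "x \<in> marked n s 3" "x \<in> marked n s 6" "s 9 0 < s 5 x" "x \<notin> marked n s 7"
      "s' 9 = s 9" "marked n (s') 7 = insert x (marked n s 7)"
      "marked n (s') 6 = marked n s 6 \<union> {y \<in> marked n s 3 \<union> marked n s 4. E x y}"
      "s' 8 = (\<lambda>y. if y \<in> {y \<in> marked n s 3 \<union> marked n s 4. E x y} - marked n s 6 then x else s 8 y)"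
proof -
  define t where "t = den n E select s"
  have t: "t a = s a" if "a \<noteq> 1" "a \<noteq> 10" for a
    unfolding t_def by (rule select_other[OF that])
  have sel: "t 10 0 = Suc n \<and> (\<forall>x<n. \<not> cand s x) \<or> t 10 0 < n \<and> cand s (t 10 0)"
    unfolding t_def by (rule select_spec)
  then consider "t 10 0 = Suc n" "\<forall>x<n. \<not> cand s x" | "t 10 0 < n" "cand s (t 10 0)" "s 5 (t 10 0) < s 9 0"
    | "t 10 0 < n" "cand s (t 10 0)" "\<not> s 5 (t 10 0) < s 9 0"
    by blast
  then show thesis
  proof cases
    case 1
    then have "s' = t"
      unfolding s'_def advance_def t_def by simp
    then show thesis
      using stable 1 t by simp
  next
    case 2
    then have "s' = put 9 0 (s 5 (t 10 0)) t"
      unfolding s'_def advance_def using t t_def[symmetric] by simp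
    then show thesis
      using lower[of "t 10 0"] 2 t unfolding marked_def cand_def by (simp add: put_other)
  next
    case 3
    define x where "x = t 10 0"
    define r where "r = put 7 x 1 t"
    have s': "s' = den n E scan r"
      unfolding s'_def advance_def r_def x_def using 3 t t_def[symmetric] by simp
    have r: "r 10 0 = x" "r 3 = s 3" "r 4 = s 4" "r 6 = s 6" "r 8 = s 8" "r 9 = s 9"
      unfolding r_def x_def using t by (simp_all add: put_other)
    have r7: "r 7 y = (if y = x then 1 else s 7 y)" for y
      unfolding r_def using t by simp
    have x: "x < n" "s 3 x \<noteq> 0" "s 6 x \<noteq> 0" "s 9 0 < s 5 x" "s 7 x = 0"
      using 3 unfolding x_def cand_def by auto
    note scan = scan_spec[of r n E, unfolded r(1), OF x(1), unfolded r]
    show thesis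
    proof (rule process[of x])
      show "marked n (s') 6 = marked n s 6 \<union> {y \<in> marked n s 3 \<union> marked n s 4. E x y}"
        unfolding s' marked_def scan(1) by auto
      show "s' 8 = (\<lambda>y. if y \<in> {y \<in> marked n s 3 \<union> marked n s 4. E x y} - marked n s 6 then x else s 8 y)"
        unfolding s' marked_def scan(2) by (auto simp: fun_eq_iff)
      show "marked n (s') 7 = insert x (marked n s 7)"
        unfolding s' marked_def using x(1) by (auto simp: scan_other r7)
      show "s' 9 = s 9"
        unfolding s' by (simp add: scan_other r)
    qed (use x in \<open>auto simp: marked_def\<close>)
  qed
qed

lemma search_other: "a \<notin> {1, 2, 6, 7, 8, 9, 10, 16} \<Longrightarrow> den n E search s a = s a"
  by (rule den_other) (auto simp: search_def advance_def select_def scan_def)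

lemma advance_other: "a \<notin> {1, 2, 6, 7, 8, 9, 10} \<Longrightarrow> den n E advance s a = s a"
  by (rule den_other) (auto simp: advance_def select_def scan_def)

text \<open>
  Every call of \<open>advance\<close> that does not find the search complete lowers \<open>th\<close> or processes a new
  vertex, so \<open>2 * n\<close> calls suffice.
\<close>

lemma search_rule:
  fixes s :: store and n :: nat and E :: "nat \<Rightarrow> nat \<Rightarrow> bool"
  defines "W \<equiv> marked n s 3" and "U \<equiv> marked n s 4"
  assumes init: "J (marked n s 6) (marked n s 7) (s 9 0) (s 8)" and th: "s 9 0 \<le> n"
    and process: "\<And>D P th par x. \<lbrakk>J D P th par; x \<in> D; x \<in> W; th < s 5 x; x \<notin> P\<rbrakk> \<Longrightarrow>
      J (D \<union> {y \<in> W \<union> U. E x y}) (insert x P) th (\<lambda>y. if y \<in> {y \<in> W \<union> U. E x y} - D then x else par y)"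
    and lower: "\<And>D P th par x. \<lbrakk>J D P th par; x \<in> D; x \<in> W; s 5 x < th\<rbrakk> \<Longrightarrow> J D P (s 5 x) par"
  shows "J (marked n (den n E search s) 6) (marked n (den n E search s) 7) (den n E search s 9 0) (den n E search s 8)"
    and "\<And>x. x \<in> marked n (den n E search s) 6 \<Longrightarrow> x \<in> W \<Longrightarrow>
      den n E search s 9 0 \<le> s 5 x \<and> (den n E search s 9 0 < s 5 x \<longrightarrow> x \<in> marked n (den n E search s) 7)"
proof -
  \<comment> \<open>The potential is the threshold plus the number of unprocessed vertices. It is at
    most \<open>2 * n\<close> at the start, and each round that finds a pending vertex lowers it;
    \<open>k\<close> counts the rounds.\<close>
  define Q where "Q k t \<longleftrightarrow> t 3 = s 3 \<and> t 4 = s 4 \<and> t 5 = s 5 \<and>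
    J (marked n t 6) (marked n t 7) (t 9 0) (t 8) \<and>
    ((\<forall>x<n. \<not> cand t x) \<or> t 9 0 + (n - card (marked n t 7)) + k \<le> 2 * n)" for k t
  have step: "Q (Suc k) (den n E advance t)" if "Q k t" for k t
  proof -
    let ?t' = "den n E advance t"
    have t: "t 3 = s 3" "t 4 = s 4" "t 5 = s 5"
      and J: "J (marked n t 6) (marked n t 7) (t 9 0) (t 8)"
      and k: "(\<forall>x<n. \<not> cand t x) \<or> t 9 0 + (n - card (marked n t 7)) + k \<le> 2 * n"
      using that unfolding Q_def by auto
    have t': "?t' 3 = s 3" "?t' 4 = s 4" "?t' 5 = s 5"
      using t by (simp_all add: advance_other)
    have WU: "marked n t 3 = W" "marked n t 4 = U"
      unfolding W_def U_def marked_def t by auto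
    show ?thesis
    proof (cases rule: advance_cases[where n = n and s = t and E = E])
      case stable
      then have "marked n ?t' 6 = marked n t 6" "marked n ?t' 7 = marked n t 7" "?t' 8 = t 8" "?t' 9 = t 9"
        and "\<And>x. cand ?t' x = cand t x"
        unfolding marked_def cand_def t t' by auto
      then show ?thesis
        unfolding Q_def using t' J stable(1) by simp
    next
      case (lower x)
      then have m: "marked n ?t' 6 = marked n t 6" "marked n ?t' 7 = marked n t 7" "?t' 8 = t 8"
        unfolding marked_def by auto
      have "cand t x" "x < n"
        using lower unfolding cand_def marked_def by auto
      then have "t 9 0 + (n - card (marked n t 7)) + k \<le> 2 * n"
        using k by blast
      moreover have "J (marked n t 6) (marked n t 7) (s 5 x) (t 8)"
        using assms(6)[OF J] lower(1-3) WU t by simp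
      ultimately show ?thesis
        unfolding Q_def m using t' lower(3,4) t by simp
    next
      case (process x)
      have "cand t x" "x < n"
        using process unfolding cand_def marked_def by auto
      then have "t 9 0 + (n - card (marked n t 7)) + k \<le> 2 * n"
        using k by blast
      moreover have c: "card (insert x (marked n t 7)) = Suc (card (marked n t 7))"
        using process(4) by (simp add: marked_def)
      moreover have "card (insert x (marked n t 7)) \<le> card {..<n}"
        by (rule card_mono) (use \<open>x < n\<close> in \<open>auto simp: marked_def\<close>)
      ultimately have "t 9 0 + (n - card (insert x (marked n t 7))) + Suc k \<le> 2 * n"
        unfolding c card_lessThan by arith
      moreover have "J (marked n ?t' 6) (marked n ?t' 7) (?t' 9 0) (?t' 8)"
        using assms(5)[OF J] process WU t by simp
      ultimately show ?thesis
        unfolding Q_def process(5,6) using t' by blast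
    qed
  qed
  let ?s' = "den n E search s"
  have "Q (2 * n) ?s'"
    unfolding search_def
  proof (rule For_inv[where I = "\<lambda>j. Q (2 * j)"])
    have "s 9 0 + (n - card (marked n s 7)) + 2 * 0 \<le> 2 * n"
      using th by arith
    then show "Q (2 * 0) s"
      unfolding Q_def using init by blast
  next
    fix j t
    assume "Q (2 * j) t"
    then have "Q (2 * j) (put 16 0 j t)"
      unfolding Q_def marked_def cand_def by (auto simp: put_other)
    then show "Q (2 * Suc j) (den n E (Then advance advance) (put 16 0 j t))"
      using step by simp
  qed
  then have Q: "?s' 3 = s 3" "?s' 5 = s 5" "J (marked n ?s' 6) (marked n ?s' 7) (?s' 9 0) (?s' 8)"
    "(\<forall>x<n. \<not> cand ?s' x) \<or> ?s' 9 0 + (n - card (marked n ?s' 7)) + 2 * n \<le> 2 * n"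
    unfolding Q_def by - (elim conjE; assumption)+
  have "\<not> cand ?s' x" if "x < n" for x
    using Q(4)
  proof
    \<comment> \<open>With potential 0 the threshold is 0 and every vertex is processed, so nothing
      is pending.\<close>
    assume "?s' 9 0 + (n - card (marked n ?s' 7)) + 2 * n \<le> 2 * n"
    then have *: "?s' 9 0 + (n - card (marked n ?s' 7)) = 0"
      by arith
    have "marked n ?s' 7 = {..<n}"
    proof (rule card_subset_eq)
      show sub: "marked n ?s' 7 \<subseteq> {..<n}"
        unfolding marked_def by auto
      show "card (marked n ?s' 7) = card {..<n}"
        using * card_mono[OF _ sub] by simp
    qed simp
    then have "?s' 7 x \<noteq> 0"
      using that unfolding marked_def by blast
    moreover have "?s' 9 0 = 0"
      using * by simp
    ultimately show ?thesis
      unfolding cand_def by simp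
  qed (use that in blast)
  then show "?s' 9 0 \<le> s 5 x \<and> (?s' 9 0 < s 5 x \<longrightarrow> x \<in> marked n ?s' 7)"
    if "x \<in> marked n ?s' 6" "x \<in> W" for x
    using that Q(1,2) unfolding cand_def marked_def W_def by force
  show "J (marked n ?s' 6) (marked n ?s' 7) (?s' 9 0) (?s' 8)"
    by (rule Q(3))
qed

section \<open>Induced paths and search forests\<close>

context adjacency
begin

text \<open>Adjacency is prescribed only from a vertex to later ones, which suits induction;
  symmetry supplies the rest in \<open>ipath_nth\<close>.\<close>

fun ipath :: "'a list \<Rightarrow> bool" where
  "ipath [] \<longleftrightarrow> True"
| "ipath (x # xs) \<longleftrightarrow> ipath xs \<and> x \<notin> set xs \<and> (\<forall>y\<in>set xs. adj x y \<longleftrightarrow> y = hd xs)"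

lemma ipath_distinct: "ipath xs \<Longrightarrow> distinct xs"
  by (induction xs) auto

lemma ipath_nth:
  "ipath xs \<Longrightarrow> i < length xs \<Longrightarrow> j < length xs \<Longrightarrow> adj (xs ! i) (xs ! j) \<longleftrightarrow> j = Suc i \<or> i = Suc j"
proof (induction xs arbitrary: i j)
  case (Cons x xs)
  have x: "adj x (xs ! k) \<longleftrightarrow> k = 0" "adj (xs ! k) x \<longleftrightarrow> k = 0" if "k < length xs" for k
  proof -
    have "xs \<noteq> []"
      using that by auto
    then have "xs ! k = hd xs \<longleftrightarrow> k = 0"
      using that nth_eq_iff_index_eq[OF ipath_distinct, of xs k 0] Cons.prems(1) by (simp add: hd_conv_nth)
    then show "adj x (xs ! k) \<longleftrightarrow> k = 0"
      using Cons.prems(1) that by simp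
    then show "adj (xs ! k) x \<longleftrightarrow> k = 0"
      using adj_sym[of x "xs ! k"] adj_sym[of "xs ! k" x] by blast
  qed
  show ?case
    using Cons.IH[of "i - 1" "j - 1"] Cons.prems x adj_irrefl by (cases i; cases j) auto
qed simp

section \<open>Tree paths along parent pointers\<close>

fun tree_path :: "'a set \<Rightarrow> ('a \<Rightarrow> 'a) \<Rightarrow> 'a list \<Rightarrow> bool" where
  "tree_path Src par [] \<longleftrightarrow> False"
| "tree_path Src par [x] \<longleftrightarrow> x \<in> Src"
| "tree_path Src par (x # y # ys) \<longleftrightarrow> x \<notin> Src \<and> par x = y \<and> tree_path Src par (y # ys)"

lemma tree_path_cong: "tree_path Src par xs \<Longrightarrow> (\<And>x. x \<in> set xs \<Longrightarrow> par' x = par x) \<Longrightarrow> tree_path Src par' xs"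
  by (induction Src par xs rule: tree_path.induct) auto

lemma tree_path_last: "tree_path Src par xs \<Longrightarrow> xs \<noteq> [] \<and> last xs \<in> Src"
  by (induction Src par xs rule: tree_path.induct) auto

lemma tree_path_nth:
  "tree_path Src par xs \<Longrightarrow> Suc i < length xs \<Longrightarrow> xs ! i \<notin> Src \<and> par (xs ! i) = xs ! Suc i"
proof (induction Src par xs arbitrary: i rule: tree_path.induct)
  case (3 Src par x y ys)
  then show ?case
    by (cases i) auto
qed auto

text \<open>
  In the forest grown from \<open>Src\<close>, the tree paths are induced, because a processed vertex has no
  undiscovered neighbours.
\<close>

definition branch :: "'a set \<Rightarrow> 'a set \<Rightarrow> 'a set \<Rightarrow> ('a \<Rightarrow> 'a) \<Rightarrow> 'a \<Rightarrow> 'a list \<Rightarrow> bool" where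
  "branch W Src P par x xs \<longleftrightarrow> tree_path Src par xs \<and> hd xs = x \<and> ipath xs \<and> set (tl xs) \<subseteq> P \<inter> W \<and>
     (\<forall>p\<in>set xs. \<forall>s\<in>Src. adj p s \<longrightarrow> s = last xs)"

definition forest_inv :: "'a set \<Rightarrow> 'a set \<Rightarrow> 'a set \<Rightarrow> 'a set \<Rightarrow> 'a set \<Rightarrow> ('a \<Rightarrow> 'a) \<Rightarrow> bool" where
  "forest_inv W U Src D P par \<longleftrightarrow> Src \<subseteq> P \<and> P \<subseteq> D \<and> D \<subseteq> W \<union> U \<and>
     (\<forall>x\<in>P. \<forall>y\<in>W \<union> U. adj x y \<longrightarrow> y \<in> D) \<and> (\<forall>x\<in>D. \<exists>xs. branch W Src P par x xs)"

lemma forest_process: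
  assumes inv: "forest_inv W U Src D P par" and x: "x \<in> D" "x \<in> W"
  defines "N \<equiv> {y \<in> W \<union> U. adj x y}"
  shows "forest_inv W U Src (D \<union> N) (insert x P) (\<lambda>y. if y \<in> N - D then x else par y)"
proof -
  let ?par = "\<lambda>y. if y \<in> N - D then x else par y"
  have P: "Src \<subseteq> P" "P \<subseteq> D" "D \<subseteq> W \<union> U" "\<forall>x\<in>P. \<forall>y\<in>W \<union> U. adj x y \<longrightarrow> y \<in> D"
    using inv unfolding forest_inv_def by auto
  \<comment> \<open>Parents change only outside \<open>D\<close>, and the branches of discovered
    vertices stay inside \<open>D\<close>.\<close>
  have old: "\<exists>xs. branch W Src (insert x P) ?par y xs \<and> set xs \<subseteq> D" if y: "y \<in> D" for y
  proof -
    obtain xs where xs: "branch W Src P par y xs"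
      using inv y unfolding forest_inv_def by blast
    then have ne: "xs \<noteq> []" "hd xs = y" "set (tl xs) \<subseteq> P"
      using tree_path_last unfolding branch_def by auto
    then have D: "set xs \<subseteq> D"
      using P(2) y by (cases xs) auto
    have "tree_path Src ?par xs"
      by (rule tree_path_cong[of Src par]) (use xs D in \<open>auto simp: branch_def\<close>)
    then show ?thesis
      using xs D unfolding branch_def by blast
  qed
  have "\<exists>xs. branch W Src (insert x P) ?par y xs" if y: "y \<in> D \<union> N" for y
  proof (cases "y \<in> D")
    case True
    then show ?thesis using old by blast
  next
    case False
    then have yN: "y \<in> W \<union> U" "adj x y" "adj y x" "y \<in> N"
      using y adj_sym unfolding N_def by auto
    obtain xs where xs: "branch W Src (insert x P) ?par x xs" "set xs \<subseteq> D"
      using old[OF x(1)] by blast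
    then obtain zs where zs: "xs = x # zs"
      using tree_path_last unfolding branch_def by (metis list.exhaust_sel)
    have far: "\<not> adj y p" if "p \<in> P" for p
      using P(4) that yN(1) False adj_sym by blast
    have "x \<notin> set zs"
      using xs(1) unfolding branch_def zs by simp
    then have "set zs \<subseteq> P"
      using xs(1) unfolding branch_def zs by auto
    then have "ipath (y # xs)"
      using xs False yN(3) far unfolding branch_def zs by auto
    moreover have "tree_path Src ?par (y # xs)"
      using xs(1) False yN(4) P(1,2) unfolding branch_def zs by auto
    moreover have "\<forall>p\<in>set (y # xs). \<forall>s\<in>Src. adj p s \<longrightarrow> s = last (y # xs)"
      using xs(1) far P(1) unfolding branch_def zs by auto
    moreover have "set (tl (y # xs)) \<subseteq> insert x P \<inter> W"
      using xs(1) x(2) unfolding branch_def zs by auto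
    ultimately show ?thesis
      unfolding branch_def by (intro exI[of _ "y # xs"]) simp
  qed
  moreover have "\<forall>z\<in>insert x P. \<forall>y\<in>W \<union> U. adj z y \<longrightarrow> y \<in> D \<union> N"
    using P(4) unfolding N_def by auto
  ultimately show ?thesis
    unfolding forest_inv_def using P x unfolding N_def by auto
qed

lemma forest_final:
  assumes inv: "forest_inv W U Src D P par" and fin: "D \<inter> W \<subseteq> P" and "Src \<subseteq> W" "W \<inter> U = {}" "u \<in> U"
  shows "u \<in> D \<longleftrightarrow> (\<exists>s\<in>Src. \<exists>x. (inside W)\<^sup>*\<^sup>* s x \<and> adj u x)"
proof
  assume "u \<in> D"
  then obtain xs where xs: "branch W Src P par u xs"
    using inv unfolding forest_inv_def by blast
  then obtain zs where zs: "xs = u # zs"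
    using tree_path_last unfolding branch_def by (metis list.exhaust_sel)
  have zs_ne: "zs \<noteq> []"
    using xs assms(3-5) unfolding branch_def zs by auto
  have path: "(inside W)\<^sup>*\<^sup>* (last ys) (hd ys)" if "ipath ys" "ys \<noteq> []" "set ys \<subseteq> W" for ys
    using that
  proof (induction ys rule: induct_list012)
    case (3 x y ys)
    have "adj x y"
      using 3(3) by simp
    then have "inside W y x"
      using 3(5) adj_sym unfolding inside_def by auto
    moreover have "(inside W)\<^sup>*\<^sup>* (last (x # y # ys)) y"
      using 3(2)[of] 3(3,5) by simp
    ultimately show ?case
      by (simp add: rtranclp.rtrancl_into_rtrancl)
  qed auto
  have "(inside W)\<^sup>*\<^sup>* (last zs) (hd zs)"
    using xs zs_ne unfolding branch_def zs by (intro path) auto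
  moreover have "ipath (u # zs)" "tree_path Src par (u # zs)"
    using xs unfolding branch_def zs by - (elim conjE; assumption)+
  then have "adj u (hd zs)" "last zs \<in> Src"
    using hd_in_set[OF zs_ne] zs_ne tree_path_last[of Src par "u # zs"] by simp_all
  ultimately show "\<exists>s\<in>Src. \<exists>x. (inside W)\<^sup>*\<^sup>* s x \<and> adj u x"
    by blast
next
  have P: "Src \<subseteq> P" "P \<subseteq> D" "\<And>x y. x \<in> P \<Longrightarrow> y \<in> W \<union> U \<Longrightarrow> adj x y \<Longrightarrow> y \<in> D"
    using inv unfolding forest_inv_def by auto
  assume "\<exists>s\<in>Src. \<exists>x. (inside W)\<^sup>*\<^sup>* s x \<and> adj u x"
  then obtain s x where sx: "s \<in> Src" "(inside W)\<^sup>*\<^sup>* s x" "adj u x" by blast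
  from sx(2) have "x \<in> P"
  proof (induction rule: rtranclp_induct)
    case (step y z)
    then show ?case
      using P(3)[of y z] fin unfolding inside_def by blast
  qed (use sx P in blast)
  then show "u \<in> D"
    using P(3)[of x u] sx(3) adj_sym assms(5) by blast
qed

end

text \<open>The variables 17 and 18 hold the neighbours of the sources.\<close>

definition forest :: cmd where
  "forest = Then (For 1 (Then (Put 6 (Var 1) Zero) (Then (Put 7 (Var 1) Zero) (Put 5 (Var 1) Inf))))
    (Then (Assign 9 Zero) (Then (Put 6 (Var 11) One) (Then (Put 6 (Var 12) One) (Then (Put 6 (Var 17) One)
    (Then (Put 6 (Var 18) One) (Then (Put 7 (Var 11) One) (Then (Put 7 (Var 12) One)
    (Then (Put 8 (Var 17) (Var 11)) (Then (Put 8 (Var 18) (Var 12)) search)))))))))"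

text \<open>The sources start as processed and their only neighbours as discovered, so that no
  vertex found later is adjacent to a source, as the last clause of \<open>branch\<close> demands.
  The case \<open>s\<^sub>1 = s\<^sub>2\<close> serves the search for a single arm.\<close>

lemma (in adjacency) forest_init:
  assumes "s\<^sub>1 \<in> W" "s\<^sub>2 \<in> W" "\<not> adj s\<^sub>1 s\<^sub>2" "a\<^sub>1 \<in> W \<union> U" "a\<^sub>2 \<in> W \<union> U"
    and "\<And>x. x \<in> W \<union> U \<Longrightarrow> adj s\<^sub>1 x \<longleftrightarrow> x = a\<^sub>1" "\<And>x. x \<in> W \<union> U \<Longrightarrow> adj s\<^sub>2 x \<longleftrightarrow> x = a\<^sub>2"
    and "s\<^sub>1 \<noteq> s\<^sub>2 \<Longrightarrow> a\<^sub>1 \<noteq> a\<^sub>2" and "par a\<^sub>1 = s\<^sub>1" "par a\<^sub>2 = s\<^sub>2"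
  shows "forest_inv W U {s\<^sub>1, s\<^sub>2} {s\<^sub>1, s\<^sub>2, a\<^sub>1, a\<^sub>2} {s\<^sub>1, s\<^sub>2} par"
proof -
  let ?b = "branch W {s\<^sub>1, s\<^sub>2} {s\<^sub>1, s\<^sub>2} par"
  have adj: "adj s\<^sub>1 a\<^sub>1" "adj s\<^sub>2 a\<^sub>2" "adj a\<^sub>1 s\<^sub>1" "adj a\<^sub>2 s\<^sub>2"
    using assms(4-7) adj_sym by blast+
  have nadj: "\<not> adj s\<^sub>2 s\<^sub>1" "\<not> adj s\<^sub>1 s\<^sub>1" "\<not> adj s\<^sub>2 s\<^sub>2"
    using assms(3) adj_sym adj_irrefl by blast+
  have ne: "a\<^sub>1 \<noteq> s\<^sub>1" "a\<^sub>1 \<noteq> s\<^sub>2" "a\<^sub>2 \<noteq> s\<^sub>1" "a\<^sub>2 \<noteq> s\<^sub>2"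
    using adj nadj assms(3) by auto
  have "s\<^sub>1 \<noteq> s\<^sub>2 \<longrightarrow> \<not> adj a\<^sub>1 s\<^sub>2 \<and> \<not> adj a\<^sub>2 s\<^sub>1"
    using assms(4-8) adj_sym by blast
  then have "?b a\<^sub>1 [a\<^sub>1, s\<^sub>1]" "?b a\<^sub>2 [a\<^sub>2, s\<^sub>2]"
    unfolding branch_def using assms(1-3,9,10) nadj adj ne by auto
  moreover have "?b s\<^sub>1 [s\<^sub>1]" "?b s\<^sub>2 [s\<^sub>2]"
    unfolding branch_def using assms(1-3) nadj by simp_all
  ultimately have "\<exists>xs. ?b x xs" if "x \<in> {s\<^sub>1, s\<^sub>2, a\<^sub>1, a\<^sub>2}" for x
    using that by blast
  moreover have "\<forall>x\<in>{s\<^sub>1, s\<^sub>2}. \<forall>y\<in>W \<union> U. adj x y \<longrightarrow> y \<in> {s\<^sub>1, s\<^sub>2, a\<^sub>1, a\<^sub>2}"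
    using assms(6,7) by auto
  ultimately show ?thesis
    unfolding forest_inv_def using assms(1-5) by auto
qed

lemma forest_spec:
  fixes s :: store and n :: nat and E :: "nat \<Rightarrow> nat \<Rightarrow> bool"
  defines "W \<equiv> marked n s 3" and "U \<equiv> marked n s 4" and "Src \<equiv> {s 11 0, s 12 0}"
  assumes "adjacency E" "s 11 0 \<in> W" "s 12 0 \<in> W" "\<not> E (s 11 0) (s 12 0)" "s 17 0 \<in> W \<union> U" "s 18 0 \<in> W \<union> U"
    and "\<And>x. x \<in> W \<union> U \<Longrightarrow> E (s 11 0) x \<longleftrightarrow> x = s 17 0" "\<And>x. x \<in> W \<union> U \<Longrightarrow> E (s 12 0) x \<longleftrightarrow> x = s 18 0"
    and "s 11 0 \<noteq> s 12 0 \<longleftrightarrow> s 17 0 \<noteq> s 18 0"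
  obtains s' where "s' = den n E forest s"
    "adjacency.forest_inv E W U Src (marked n s' 6) (marked n s' 7) (s' 8)"
    "marked n s' 6 \<inter> W \<subseteq> marked n s' 7" "\<And>x. x < n \<Longrightarrow> s' 5 x = Suc n"
    "\<And>a. a \<notin> {1, 2, 5, 6, 7, 8, 9, 10, 16} \<Longrightarrow> s' a = s a"
proof -
  interpret adjacency E by fact
  define r where "r = den n E (For 1 (Then (Put 6 (Var 1) Zero) (Then (Put 7 (Var 1) Zero) (Put 5 (Var 1) Inf)))) s"
  have r_other: "r a = s a" if "a \<notin> {1, 5, 6, 7}" for a
    unfolding r_def by (rule den_other) (use that in auto)
  have "\<forall>x<n. r 6 x = 0 \<and> r 7 x = 0 \<and> r 5 x = Suc n"
    unfolding r_def
    by (rule For_inv[where I = "\<lambda>j t. \<forall>x<j. t 6 x = 0 \<and> t 7 x = 0 \<and> t 5 x = Suc n"]) (auto simp: less_Suc_eq)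
  then have r: "r 6 x = 0" "r 7 x = 0" "r 5 x = Suc n" if "x < n" for x
    using that by auto
  define t where "t = put 8 (s 18 0) (s 12 0) (put 8 (s 17 0) (s 11 0) (put 7 (s 12 0) 1 (put 7 (s 11 0) 1
    (put 6 (s 18 0) 1 (put 6 (s 17 0) 1 (put 6 (s 12 0) 1 (put 6 (s 11 0) 1 (put 9 0 0 r))))))))"
  have den: "den n E forest s = den n E search t"
    unfolding forest_def den.simps(3) r_def[symmetric] t_def by (simp add: r_other put_other)
  have t_other: "t a = s a" if "a \<notin> {1, 5, 6, 7, 8, 9}" for a
    unfolding t_def using that by (simp add: put_other r_other)
  have t5: "t 5 = r 5"
    unfolding t_def by (simp add: put_other)
  have lt: "s 11 0 < n" "s 12 0 < n" "s 17 0 < n" "s 18 0 < n"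
    using assms(5,6,8,9) unfolding W_def U_def marked_def by auto
  have m: "marked n t 6 = {s 11 0, s 12 0, s 17 0, s 18 0}" "marked n t 7 = Src"
    unfolding marked_def t_def Src_def using lt r by auto
  have WU: "marked n t 3 = W" "marked n t 4 = U"
    unfolding W_def U_def marked_def by (simp_all add: t_other)
  have init: "forest_inv W U Src (marked n t 6) (marked n t 7) (t 8)"
    unfolding m unfolding Src_def
    by (rule forest_init) (use assms(5-12) in \<open>auto simp: t_def\<close>)
  \<comment> \<open>A threshold of 0 is never lowered, and the value \<open>n + 1\<close> in array 5
    lets every discovered vertex of \<open>W\<close> be processed, so \<open>search\<close> becomes
    an ordinary graph search.\<close>
  define J where "J D P th par \<longleftrightarrow> th = 0 \<and> forest_inv W U Src D P par" for D P :: "nat set" and th :: nat and par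
  have 1: "J (marked n t 6) (marked n t 7) (t 9 0) (t 8)" "t 9 0 \<le> n"
    unfolding J_def using init by (simp_all add: t_def)
  have 2: "J (D \<union> {y \<in> W \<union> U. E x y}) (insert x P) th (\<lambda>y. if y \<in> {y \<in> W \<union> U. E x y} - D then x else par y)"
    if "J D P th par" "x \<in> D" "x \<in> W" "th < t 5 x" "x \<notin> P" for D P th par x
    using that(1-3) forest_process[of W U Src D P par x] unfolding J_def by blast
  have 3: "J D P (t 5 x) par" if "J D P th par" "x \<in> D" "x \<in> W" "t 5 x < th" for D P th par x
    using that(1,4) unfolding J_def by simp
  define s' where "s' = den n E search t"
  note search = search_rule[where J = J and s = t and n = n and E = E, folded s'_def, unfolded WU]
  have s': "J (marked n s' 6) (marked n s' 7) (s' 9 0) (s' 8)"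
    by (rule search(1)) (fact 1 2 3)+
  have s'_fin: "s' 9 0 \<le> t 5 x \<and> (s' 9 0 < t 5 x \<longrightarrow> x \<in> marked n s' 7)"
    if "x \<in> marked n s' 6" "x \<in> W" for x
    by (rule search(2)[OF _ _ _ _ that]) (fact 1 2 3)+
  show thesis
  proof (rule that[of s'])
    show "s' = den n E forest s"
      unfolding den s'_def ..
    have "x \<in> marked n s' 7" if "x \<in> marked n s' 6" "x \<in> W" for x
    proof -
      have "t 5 x = Suc n" "s' 9 0 = 0"
        using that s' r(3) t5 unfolding J_def marked_def by auto
      then show ?thesis
        using s'_fin[OF that] by simp
    qed
    then show "marked n s' 6 \<inter> W \<subseteq> marked n s' 7"
      by blast
  qed (use s' r t5 t_other in \<open>auto simp: J_def s'_def search_other\<close>)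
qed

section \<open>Deciding whether there is a non-adjacent linked pair\<close>

text \<open>Array 13 marks \<open>K\<close>, and variable 15 is an element of \<open>K\<close> or \<open>Inf\<close>.\<close>

definition find_K :: cmd where
  "find_K = Then (Assign 15 Inf) (For 1 (Then (Put 13 (Var 1) Zero) (For 2
     (Ite (AndE (Arr 4 (Var 1)) (AndE (Arr 6 (Var 1)) (AndE (Arr 4 (Var 2)) (AndE (Arr 6 (Var 2))
       (AndE (NotE (EqE (Var 1) (Var 2))) (NotE (Adj (Var 1) (Var 2))))))))
       (Then (Put 13 (Var 1) One) (Assign 15 (Var 1))) Nop))))"

text \<open>Variable 14 runs along the tree path from \<open>c\<close> to its root, which yields the indices \<open>nu\<close>.\<close>

definition mark_nu :: cmd where
  "mark_nu = For 2 (Ite (AndE (Le Inf (Arr 5 (Var 2))) (OrE (Adj (Var 14) (Var 2)) (EqE (Var 14) (Var 2))))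
     (Put 5 (Var 2) (Var 16)) Nop)"

text \<open>\<open>mark_nu\<close> writes only undefined entries, so the first index on the path
  prevails. At the root, the threshold is set to the entry of the root itself, which stems from its
  predecessor on the path and hence is \<open>m - 1\<close>.\<close>

definition walk :: cmd where
  "walk = Then (Assign 14 (Var 15)) (For 16 (Ite (Le Inf (Var 14)) Nop (Then mark_nu
     (Ite (OrE (EqE (Var 14) (Var 11)) (EqE (Var 14) (Var 12)))
       (Then (Assign 9 (Arr 5 (Var 14))) (Assign 14 Inf)) (Assign 14 (Arr 8 (Var 14)))))))"

text \<open>Unlike in \<open>forest\<close>, no source starts as processed, since the root of the
  path lies outside \<open>S (m - 1)\<close>.\<close>

definition restart :: cmd where
  "restart = Then (For 1 (Then (Put 6 (Var 1) Zero) (Put 7 (Var 1) Zero)))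
     (Then (Put 6 (Var 11) One) (Put 6 (Var 12) One))"

definition check_K :: cmd where
  "check_K = For 1 (Ite (AndE (Arr 13 (Var 1)) (AndE (Arr 6 (Var 1)) (NotE (EqE (Var 1) (Var 15)))))
     (Assign 0 One) Nop)"

definition decide :: cmd where
  "decide = Then forest (Then find_K (Ite (Le Inf (Var 15)) Nop
     (Then walk (Then restart (Then search check_K)))))"

lemma find_K_spec:
  fixes s :: store and n :: nat and E :: "nat \<Rightarrow> nat \<Rightarrow> bool"
  defines "V \<equiv> marked n s 4 \<inter> marked n s 6"
  defines "L \<equiv> {x \<in> V. \<exists>y\<in>V. y \<noteq> x \<and> \<not> E x y}"
  shows "\<And>x. x < n \<Longrightarrow> den n E find_K s 13 x \<noteq> 0 \<longleftrightarrow> x \<in> L"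
    "den n E find_K s 15 0 = Suc n \<and> L = {} \<or> den n E find_K s 15 0 \<in> L"
proof -
  let ?c = "Ite (AndE (Arr 4 (Var 1)) (AndE (Arr 6 (Var 1)) (AndE (Arr 4 (Var 2)) (AndE (Arr 6 (Var 2))
       (AndE (NotE (EqE (Var 1) (Var 2))) (NotE (Adj (Var 1) (Var 2))))))))
       (Then (Put 13 (Var 1) One) (Assign 15 (Var 1))) Nop"
  define B where "B x j \<longleftrightarrow> (\<exists>y<j. x \<in> V \<and> y \<in> V \<and> x \<noteq> y \<and> \<not> E x y)" for x j
  have BL: "B x n \<longleftrightarrow> x \<in> L" for x
    unfolding B_def L_def V_def marked_def by auto
  have inner: "den n E (For 2 ?c) t 13 = (\<lambda>x. if x = t 1 0 \<and> B (t 1 0) n then 1 else t 13 x) \<and>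
      den n E (For 2 ?c) t 15 0 = (if B (t 1 0) n then t 1 0 else t 15 0)"
    if t: "t 4 = s 4" "t 6 = s 6" "t 1 0 < n" for t
  proof -
    let ?I = "\<lambda>j r. r 1 = t 1 \<and> r 4 = s 4 \<and> r 6 = s 6 \<and>
      r 13 = (\<lambda>x. if x = t 1 0 \<and> B (t 1 0) j then 1 else t 13 x) \<and> r 15 0 = (if B (t 1 0) j then t 1 0 else t 15 0)"
    have "?I n (den n E (For 2 ?c) t)"
    proof (rule For_inv[where I = ?I], goal_cases)
      case 1
      show ?case
        using t by (simp add: B_def)
    next
      case (2 j r)
      have S: "B (t 1 0) (Suc j) \<longleftrightarrow> B (t 1 0) j \<or> t 1 0 \<in> V \<and> j \<in> V \<and> t 1 0 \<noteq> j \<and> \<not> E (t 1 0) j"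
        unfolding B_def less_Suc_eq by blast
      have V: "t 1 0 \<in> V \<longleftrightarrow> s 4 (t 1 0) \<noteq> 0 \<and> s 6 (t 1 0) \<noteq> 0" "j \<in> V \<longleftrightarrow> s 4 j \<noteq> 0 \<and> s 6 j \<noteq> 0"
        unfolding V_def marked_def using t 2(1) by auto
      have *: "den n E ?c (put 2 0 j r) = (if t 1 0 \<in> V \<and> j \<in> V \<and> t 1 0 \<noteq> j \<and> \<not> E (t 1 0) j
          then put 15 0 (t 1 0) (put 13 (t 1 0) 1 (put 2 0 j r)) else put 2 0 j r)"
        using 2 t(3) unfolding V by (simp add: put_other)
      show ?case
        unfolding * S using 2(2) by (auto simp: put_other fun_eq_iff)
    qed
    then show ?thesis by blast
  qed
  let ?J = "\<lambda>j t. t 4 = s 4 \<and> t 6 = s 6 \<and> (\<forall>x<j. t 13 x \<noteq> 0 \<longleftrightarrow> x \<in> L) \<and>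
    (t 15 0 = Suc n \<and> (\<forall>x<j. x \<notin> L) \<or> t 15 0 \<in> L)"
  have "?J n (den n E find_K s)"
    unfolding find_K_def den.simps(3)
  proof (rule For_inv[where I = ?J], goal_cases)
    case 1
    show ?case
      by (simp add: put_other)
  next
    case (2 j t)
    define r where "r = put 13 j 0 (put 1 0 j t)"
    have r: "r 4 = s 4" "r 6 = s 6" "r 1 0 = j" "r 13 = (t 13)(j := 0)" "r 15 = t 15"
      unfolding r_def using 2(2) by (auto simp: put_other fun_eq_iff)
    have *: "den n E (Then (Put 13 (Var 1) Zero) (For 2 ?c)) (put 1 0 j t) = den n E (For 2 ?c) r"
      unfolding r_def by simp
    have o: "den n E (For 2 ?c) r 4 = s 4" "den n E (For 2 ?c) r 6 = s 6"
      using den_other[of 4 "For 2 ?c" n E r] den_other[of 6 "For 2 ?c" n E r] r by simp_all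
    have "r 1 0 < n"
      using r(3) 2(1) by simp
    note in_r = inner[OF r(1,2) this, unfolded r(3-5) BL]
    show ?case
      unfolding * using o in_r 2(2) by (auto simp: less_Suc_eq)
  qed
  then show "\<And>x. x < n \<Longrightarrow> den n E find_K s 13 x \<noteq> 0 \<longleftrightarrow> x \<in> L"
    "den n E find_K s 15 0 = Suc n \<and> L = {} \<or> den n E find_K s 15 0 \<in> L"
    unfolding L_def V_def marked_def by auto
qed

lemma mark_nu_spec:
  fixes s :: store
  assumes "s 14 0 < n"
  shows "den n E mark_nu s 5 =
    (\<lambda>y. if y < n \<and> Suc n \<le> s 5 y \<and> (E (s 14 0) y \<or> y = s 14 0) then s 16 0 else s 5 y)"
proof -
  let ?I = "\<lambda>j t. t 14 = s 14 \<and> t 16 = s 16 \<and>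
    t 5 = (\<lambda>y. if y < j \<and> Suc n \<le> s 5 y \<and> (E (s 14 0) y \<or> y = s 14 0) then s 16 0 else s 5 y)"
  have "?I n (den n E mark_nu s)"
    unfolding mark_nu_def
  proof (rule For_inv[where I = ?I], goal_cases)
    case 1
    show ?case by simp
  next
    case (2 j t)
    have *: "den n E (Ite (AndE (Le Inf (Arr 5 (Var 2))) (OrE (Adj (Var 14) (Var 2)) (EqE (Var 14) (Var 2))))
        (Put 5 (Var 2) (Var 16)) Nop) (put 2 0 j t) =
      (if Suc n \<le> s 5 j \<and> (E (s 14 0) j \<or> j = s 14 0) then put 5 j (s 16 0) (put 2 0 j t) else put 2 0 j t)"
      using 2 assms by (auto simp: put_other)
    show ?case
      unfolding * using 2(2) by (auto simp: put_other fun_eq_iff less_Suc_eq)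
  qed
  then show ?thesis by blast
qed

lemma mark_nu_other: "a \<notin> {2, 5} \<Longrightarrow> den n E mark_nu s a = s a"
  by (rule den_other) (simp add: mark_nu_def)

lemma walk_spec:
  fixes s :: store
  assumes "adjacency E" "adjacency.tree_path {s 11 0, s 12 0} (s 8) xs" "set xs \<subseteq> {..<n}" "distinct xs"
    "hd xs = s 15 0" "\<forall>x<n. s 5 x = Suc n"
  defines "t \<equiv> den n E walk s"
  shows "\<And>y k. y < n \<Longrightarrow> k < length xs \<Longrightarrow> E (xs ! k) y \<or> y = xs ! k \<Longrightarrow> t 5 y \<le> k"
    "\<And>y. y < n \<Longrightarrow> t 5 y = Suc n \<or> t 5 y < length xs \<and> (E (xs ! t 5 y) y \<or> y = xs ! t 5 y)"
    "t 9 0 = t 5 (last xs)"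
proof -
  interpret adjacency E by fact
  have ne: "xs \<noteq> []" "last xs \<in> {s 11 0, s 12 0}"
    using tree_path_last assms(2) by blast+
  have len: "length xs \<le> n"
    using card_mono[OF _ assms(3)] distinct_card[OF assms(4)] by simp
  define hit where "hit k y \<longleftrightarrow> E (xs ! k) y \<or> y = xs ! k" for k y
  let ?I = "\<lambda>j t. t 8 = s 8 \<and> t 11 = s 11 \<and> t 12 = s 12 \<and>
    t 14 0 = (if j < length xs then xs ! j else Suc n) \<and>
    (\<forall>y<n. \<forall>k<j. k < length xs \<longrightarrow> hit k y \<longrightarrow> t 5 y \<le> k) \<and>
    (\<forall>y<n. t 5 y = Suc n \<or> t 5 y < j \<and> t 5 y < length xs \<and> hit (t 5 y) y) \<and>
    (length xs \<le> j \<longrightarrow> t 9 0 = t 5 (last xs))"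
  have "?I n t"
    unfolding t_def walk_def den.simps(3)
  proof (rule For_inv[where I = ?I], goal_cases)
    case 1
    show ?case
      using ne assms(5,6) by (simp add: put_other hd_conv_nth)
  next
    case (2 j r)
    define r' where "r' = put 16 0 j r"
    have r': "r' 8 = s 8" "r' 11 = s 11" "r' 12 = s 12" "r' 5 = r 5" "r' 9 = r 9" "r' 14 = r 14" "r' 16 0 = j"
      unfolding r'_def using 2(2) by (simp_all add: put_other)
    have A: "r 5 y \<le> k" if "y < n" "k < j" "k < length xs" "hit k y" for y k
      using 2(2) that by blast
    have B: "r 5 y = Suc n \<or> r 5 y < j \<and> r 5 y < length xs \<and> hit (r 5 y) y" if "y < n" for y
      using 2(2) that by blast
    show ?case
    proof (cases "j < length xs")
      case False
      then have "r' 14 0 = Suc n"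
        using 2(2) r' by simp
      then have *: "den n E (Ite (Le Inf (Var 14)) Nop (Then mark_nu
         (Ite (OrE (EqE (Var 14) (Var 11)) (EqE (Var 14) (Var 12)))
         (Then (Assign 9 (Arr 5 (Var 14))) (Assign 14 Inf)) (Assign 14 (Arr 8 (Var 14)))))) r' = r'"
        by simp
      have "r' 5 y \<le> k" if "y < n" "k < Suc j" "k < length xs" "hit k y" for y k
        using A[of y k] that False r' by simp
      moreover have "r' 5 y = Suc n \<or> r' 5 y < Suc j \<and> r' 5 y < length xs \<and> hit (r' 5 y) y" if "y < n" for y
        using B[of y] that r' by auto
      ultimately show ?thesis
        unfolding r'_def[symmetric] * using 2(2) r' False by simp
    next
      case True
      define x where "x = xs ! j"
      have x: "r' 14 0 = x" "x < n"
        using 2(2) r' True assms(3) unfolding x_def by (auto dest: nth_mem)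
      define q where "q = den n E mark_nu r'"
      have q5: "q 5 = (\<lambda>y. if y < n \<and> Suc n \<le> r 5 y \<and> hit j y then j else r 5 y)"
        unfolding q_def using mark_nu_spec[of r' n E] x r' unfolding hit_def x_def by (simp cong: if_cong)
      have q: "q 8 = s 8" "q 11 = s 11" "q 12 = s 12" "q 9 = r 9" "q 14 0 = x"
        unfolding q_def using r' x by (simp_all add: mark_nu_other)
      have *: "den n E (Ite (Le Inf (Var 14)) Nop (Then mark_nu
         (Ite (OrE (EqE (Var 14) (Var 11)) (EqE (Var 14) (Var 12)))
         (Then (Assign 9 (Arr 5 (Var 14))) (Assign 14 Inf)) (Assign 14 (Arr 8 (Var 14)))))) r' =
         (if x \<in> {s 11 0, s 12 0} then put 14 0 (Suc n) (put 9 0 (q 5 x) q) else put 14 0 (s 8 x) q)"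
        using x q q_def[symmetric] by auto
      have A': "q 5 y \<le> k" if "y < n" "k < Suc j" "k < length xs" "hit k y" for y k
      proof (cases "k = j")
        case True
        then show ?thesis
          using B[OF that(1)] that unfolding q5 by auto
      next
        case False
        then show ?thesis
          using A[of y k] that 2(1) unfolding q5 by auto
      qed
      have B': "q 5 y = Suc n \<or> q 5 y < Suc j \<and> q 5 y < length xs \<and> hit (q 5 y) y" if "y < n" for y
        using B[OF that] True unfolding q5 by auto
      have last_iff: "x \<in> {s 11 0, s 12 0} \<longleftrightarrow> Suc j = length xs"
      proof
        assume "x \<in> {s 11 0, s 12 0}"
        then show "Suc j = length xs"
          using tree_path_nth[OF assms(2), of j] True unfolding x_def by fastforce
      next
        assume "Suc j = length xs"
        then have "x = last xs"
          unfolding x_def using ne(1) by (simp add: last_conv_nth flip: \<open>Suc j = length xs\<close>)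
        then show "x \<in> {s 11 0, s 12 0}"
          using ne(2) by simp
      qed
      show ?thesis
      proof (cases "Suc j = length xs")
        case l: True
        then have "x = last xs"
          unfolding x_def using ne(1) by (simp add: last_conv_nth flip: \<open>Suc j = length xs\<close>)
        then show ?thesis
          unfolding r'_def[symmetric] * using l last_iff q A' B' by (simp add: put_other)
      next
        case l: False
        then have "s 8 x = xs ! Suc j"
          using tree_path_nth[OF assms(2), of j] True unfolding x_def by simp
        then show ?thesis
          unfolding r'_def[symmetric] * using l True last_iff q A' B' by (simp add: put_other)
      qed
    qed
  qed
  then have A: "\<forall>y<n. \<forall>k<n. k < length xs \<longrightarrow> hit k y \<longrightarrow> t 5 y \<le> k"
    and B: "\<forall>y<n. t 5 y = Suc n \<or> t 5 y < n \<and> t 5 y < length xs \<and> hit (t 5 y) y"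
    and C: "length xs \<le> n \<longrightarrow> t 9 0 = t 5 (last xs)"
    by - (elim conjE; assumption)+
  show "t 5 y \<le> k" if "y < n" "k < length xs" "E (xs ! k) y \<or> y = xs ! k" for y k
    using A that less_le_trans[OF that(2) len] unfolding hit_def by blast
  show "t 5 y = Suc n \<or> t 5 y < length xs \<and> (E (xs ! t 5 y) y \<or> y = xs ! t 5 y)" if "y < n" for y
    using B that unfolding hit_def by blast
  show "t 9 0 = t 5 (last xs)"
    using C len by blast
qed

lemma walk_other: "a \<notin> {2, 5, 9, 14, 16} \<Longrightarrow> den n E walk s a = s a"
  by (rule den_other) (auto simp: walk_def mark_nu_def)

lemma restart_spec:
  fixes s :: store
  assumes "s 11 0 < n" "s 12 0 < n"
  shows "marked n (den n E restart s) 6 = {s 11 0, s 12 0}" "marked n (den n E restart s) 7 = {}"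
    "\<And>a. a \<notin> {1, 6, 7} \<Longrightarrow> den n E restart s a = s a"
proof -
  define r where "r = den n E (For 1 (Then (Put 6 (Var 1) Zero) (Put 7 (Var 1) Zero))) s"
  have r_other: "r a = s a" if "a \<notin> {1, 6, 7}" for a
    unfolding r_def by (rule den_other) (use that in auto)
  have "\<forall>x<n. r 6 x = 0 \<and> r 7 x = 0"
    unfolding r_def by (rule For_inv[where I = "\<lambda>j t. \<forall>x<j. t 6 x = 0 \<and> t 7 x = 0"]) (auto simp: less_Suc_eq)
  moreover have "den n E restart s = put 6 (s 12 0) 1 (put 6 (s 11 0) 1 r)"
    unfolding restart_def den.simps(3) r_def[symmetric] by (simp add: r_other put_other)
  ultimately show "marked n (den n E restart s) 6 = {s 11 0, s 12 0}" "marked n (den n E restart s) 7 = {}"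
    unfolding marked_def using assms by auto
  show "den n E restart s a = s a" if "a \<notin> {1, 6, 7}" for a
    by (rule den_other) (use that in \<open>auto simp: restart_def\<close>)
qed

lemma check_K_spec:
  "den n E check_K s 0 0 = (if \<exists>x<n. s 13 x \<noteq> 0 \<and> s 6 x \<noteq> 0 \<and> x \<noteq> s 15 0 then 1 else s 0 0)"
proof -
  let ?I = "\<lambda>j t. t 13 = s 13 \<and> t 6 = s 6 \<and> t 15 = s 15 \<and>
    t 0 0 = (if \<exists>x<j. s 13 x \<noteq> 0 \<and> s 6 x \<noteq> 0 \<and> x \<noteq> s 15 0 then 1 else s 0 0)"
  have "?I n (den n E check_K s)"
    unfolding check_K_def
  proof (rule For_inv[where I = ?I], goal_cases)
    case 1
    show ?case by simp
  next
    case (2 j t)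
    have *: "den n E (Ite (AndE (Arr 13 (Var 1)) (AndE (Arr 6 (Var 1)) (NotE (EqE (Var 1) (Var 15)))))
        (Assign 0 One) Nop) (put 1 0 j t) =
      (if s 13 j \<noteq> 0 \<and> s 6 j \<noteq> 0 \<and> j \<noteq> s 15 0 then put 0 0 1 (put 1 0 j t) else put 1 0 j t)"
      using 2 by (auto simp: put_other)
    have S: "(\<exists>x<Suc j. s 13 x \<noteq> 0 \<and> s 6 x \<noteq> 0 \<and> x \<noteq> s 15 0) \<longleftrightarrow>
        (\<exists>x<j. s 13 x \<noteq> 0 \<and> s 6 x \<noteq> 0 \<and> x \<noteq> s 15 0) \<or> s 13 j \<noteq> 0 \<and> s 6 j \<noteq> 0 \<and> j \<noteq> s 15 0"
      unfolding less_Suc_eq by blast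
    show ?case
      unfolding * S using 2(2) by (simp add: put_other)
  qed
  then show ?thesis by blast
qed


text \<open>That each source has a single neighbour in \<open>W \<union> U\<close> is achieved by
  guessing one vertex beyond the source on each arm and excluding all other neighbours of the
  source.\<close>

locale linkage_program = linkage E W U w s\<^sub>1 s\<^sub>2
  for E :: "nat \<Rightarrow> nat \<Rightarrow> bool" and W U w s\<^sub>1 s\<^sub>2 +
  fixes n a\<^sub>1 a\<^sub>2 :: nat
  assumes a: "a\<^sub>1 \<in> W \<union> U" "a\<^sub>2 \<in> W \<union> U" "a\<^sub>1 \<noteq> a\<^sub>2"
    and pendant\<^sub>1: "x \<in> W \<union> U \<Longrightarrow> E s\<^sub>1 x \<longleftrightarrow> x = a\<^sub>1" and pendant\<^sub>2: "x \<in> W \<union> U \<Longrightarrow> E s\<^sub>2 x \<longleftrightarrow> x = a\<^sub>2"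
    and nonadjacent: "\<not> E s\<^sub>1 s\<^sub>2"
    and no_C4: "\<lbrakk>E a b; E b c; E c d; E d a; \<not> E a c; \<not> E b d; a \<noteq> c; b \<noteq> d\<rbrakk> \<Longrightarrow> False"
begin

lemma decide_spec:
  assumes s: "marked n s 3 = W" "marked n s 4 = U" "s 11 0 = s\<^sub>1" "s 12 0 = s\<^sub>2" "s 17 0 = a\<^sub>1" "s 18 0 = a\<^sub>2"
  shows "den n E decide s 0 0 = (if \<exists>a b. linked a b \<and> \<not> E a b then 1 else s 0 0)"
proof -
  let ?Src = "{s\<^sub>1, s\<^sub>2}"
  have WU: "W \<subseteq> {..<n}" "U \<subseteq> {..<n}"
    using s unfolding marked_def by auto
  have adjE: "adjacency E" ..
  define t1 where "t1 = den n E forest s"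
  have "adjacency.forest_inv E W U ?Src (marked n t1 6) (marked n t1 7) (t1 8) \<and> marked n t1 6 \<inter> W \<subseteq> marked n t1 7 \<and>
    (\<forall>x<n. t1 5 x = Suc n) \<and> (\<forall>a. a \<notin> {1, 2, 5, 6, 7, 8, 9, 10, 16} \<longrightarrow> t1 a = s a)"
    by (rule forest_spec[where s = s and n = n and E = E, unfolded s, folded t1_def])
      (use sources a pendant\<^sub>1 pendant\<^sub>2 nonadjacent adjE in auto)
  then have f: "forest_inv W U ?Src (marked n t1 6) (marked n t1 7) (t1 8)"
    and f7: "marked n t1 6 \<inter> W \<subseteq> marked n t1 7" and f5: "\<And>x. x < n \<Longrightarrow> t1 5 x = Suc n"
    and t1: "\<And>a. a \<notin> {1, 2, 5, 6, 7, 8, 9, 10, 16} \<Longrightarrow> t1 a = s a"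
    by blast+
  have t1_4: "marked n t1 4 = U"
    using s(2) t1[of 4] unfolding marked_def by simp
  have U': "U \<inter> marked n t1 6 = U'"
  proof -
    have "u \<in> marked n t1 6 \<longleftrightarrow> touches u (reach W)" if "u \<in> U" for u
      using forest_final[OF f f7 _ W_U that] sources unfolding touches_def reach_def by auto
    then show ?thesis
      unfolding U'_def by blast
  qed
  define t2 where "t2 = den n E find_K t1"
  note K_spec = find_K_spec[where s = t1 and n = n and E = E, folded t2_def, unfolded t1_4 U']
  have K_eq: "{x \<in> U'. \<exists>y\<in>U'. y \<noteq> x \<and> \<not> E x y} = K"
    unfolding K_def ..
  have K13: "t2 13 x \<noteq> 0 \<longleftrightarrow> x \<in> K" if "x < n" for x
    using K_spec(1)[OF that] unfolding K_eq .
  have c: "t2 15 0 = Suc n \<and> K = {} \<or> t2 15 0 \<in> K"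
    using K_spec(2) unfolding K_eq .
  have t2: "t2 a = t1 a" if "a \<notin> {1, 2, 13, 15}" for a
    unfolding t2_def by (rule den_other) (use that in \<open>auto simp: find_K_def\<close>)
  have K_U: "K \<subseteq> U"
    unfolding K_def U'_def by blast
  define t3 where "t3 = den n E walk t2"
  define t4 where "t4 = den n E restart t3"
  define t5 where "t5 = den n E search t4"
  have den: "den n E decide s = (if Suc n \<le> t2 15 0 then t2 else den n E check_K t5)"
    unfolding decide_def t5_def t4_def t3_def t2_def t1_def by simp
  have t2_0: "t2 0 = s 0"
    using t2[of 0] t1[of 0] by simp
  from c show ?thesis
  proof
    assume e: "t2 15 0 = Suc n \<and> K = {}"
    have "\<not> (\<exists>a b. linked a b \<and> \<not> E a b)"
      using linked_in_U' e adj_sym unfolding K_def by blast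
    then show ?thesis
      unfolding den using e t2_0 by auto
  next
    assume c: "t2 15 0 \<in> K"
    define c where "c = t2 15 0"
    have cU: "c \<in> U" "c \<in> marked n t1 6" "c < n"
      using c K_U U' WU unfolding K_def c_def by auto
    obtain xs where xs: "branch W ?Src (marked n t1 7) (t1 8) c xs"
      using f cU(2) unfolding forest_inv_def by blast
    have tree: "tree_path ?Src (t1 8) xs" and hd: "hd xs = c" and ip: "ipath xs" and
      tl: "set (tl xs) \<subseteq> W" and far: "\<And>p s. p \<in> set xs \<Longrightarrow> s \<in> ?Src \<Longrightarrow> E p s \<Longrightarrow> s = last xs"
      using xs unfolding branch_def by auto
    have ne: "xs \<noteq> []" "last xs \<in> ?Src"
      using tree_path_last[OF tree] by auto
    define m where "m = length xs - 1"
    have len: "length xs = Suc m"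
      unfolding m_def using ne(1) by simp
    have W_nth: "xs ! i \<in> W" if "1 \<le> i" "i \<le> m" for i
    proof -
      have "xs ! i = tl xs ! (i - 1)" "i - 1 < length (tl xs)"
        using that len by (simp_all add: nth_tl)
      then show ?thesis
        using tl nth_mem by fastforce
    qed
    have p0: "xs ! 0 = c"
      using hd ne(1) by (simp add: hd_conv_nth)
    have pm: "xs ! m = last xs"
      unfolding m_def using ne(1) by (simp add: last_conv_nth)
    have "m \<noteq> 0"
      using p0 pm ne(2) cU(1) W_U sources by auto
    have set_n: "set xs \<subseteq> {..<n}"
    proof
      fix x
      assume "x \<in> set xs"
      then obtain i where "x = xs ! i" "i \<le> m"
        using len by (auto simp: in_set_conv_nth)
      then show "x \<in> {..<n}"
        using W_nth[of i] p0 cU(3) WU by (cases "i = 0") auto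
    qed
    obtain other where other: "srcs (last xs) other" "other \<in> ?Src" "other \<noteq> last xs"
      using ne(2) sources(3) unfolding srcs_def by blast
    note walk = walk_spec[where s = t2 and n = n and E = E and xs = xs, folded t3_def, OF adjE]
    have w_pre: "tree_path {t2 11 0, t2 12 0} (t2 8) xs" "hd xs = t2 15 0" "\<forall>x<n. t2 5 x = Suc n"
      using tree hd f5 t2[of 8] t2[of 11] t2[of 12] t2[of 5] t1[of 11] t1[of 12] s unfolding c_def by simp_all
    note walk = walk[OF w_pre(1) set_n ipath_distinct[OF ip] w_pre(2,3)]
    have m_n: "m < n"
      using card_mono[OF _ set_n] distinct_card[OF ipath_distinct[OF ip]] len by simp
    \<comment> \<open>The path is the branch of \<open>c\<close> in the forest: it is induced, and
      its vertices see no source except the last vertex, as \<open>p_adj\<close> and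
      \<open>p_other\<close> require.\<close>
    interpret P: indexed_path_linkage E W U w s\<^sub>1 s\<^sub>2 "(!) xs" m "last xs" other "t3 5"
    proof unfold_locales
      show "srcs (last xs) other" "xs ! m = last xs" "1 \<le> m" "xs ! 0 \<in> U"
        using other pm \<open>m \<noteq> 0\<close> p0 cU by auto
      show "xs ! i \<in> W" if "1 \<le> i" "i \<le> m" for i
        by (rule W_nth[OF that])
      show "E (xs ! i) (xs ! j) \<longleftrightarrow> j = Suc i \<or> i = Suc j" if "i \<le> m" "j \<le> m" for i j
        using ipath_nth[OF ip] that len by simp
      show "inj_on ((!) xs) {..m}"
        using ipath_distinct[OF ip] len by (auto simp: inj_on_def nth_eq_iff_index_eq)
      show "\<not> E (xs ! i) other" if "i \<le> m" for i
        using far[of "xs ! i" other] other that len by auto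
      show "x = xs ! (m - 1)" if "x \<in> W \<union> U" "E (last xs) x" for x
      proof -
        have "E (last xs) (xs ! (m - 1))"
          using ipath_nth[OF ip, of m "m - 1"] len \<open>m \<noteq> 0\<close> pm by simp
        moreover have "xs ! (m - 1) \<in> W \<union> U"
          by (cases "m - 1 = 0") (use W_nth[of "m - 1"] p0 cU in auto)
        ultimately show ?thesis
          using that ne(2) pendant\<^sub>1 pendant\<^sub>2 by auto
      qed
      show "x \<noteq> xs ! i \<and> \<not> E x (xs ! i)" if "x \<in> W" "i \<le> m" "i < t3 5 x" for x i
        using walk(1)[of x i] that len WU adj_sym[of x "xs ! i"] by auto
      show "x = xs ! t3 5 x \<or> E x (xs ! t3 5 x)" if "x \<in> W" "t3 5 x \<le> m" for x
        using walk(2)[of x] that m_n WU adj_sym by auto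
    qed
    \<comment> \<open>The only neighbour of the root on the path is its predecessor, so
      \<open>walk\<close> leaves the initial threshold \<open>m - 1\<close>.\<close>
    have root_nu: "t3 5 (last xs) = m - 1"
    proof -
      have l: "last xs < n" "last xs \<in> W"
        using ne(2) sources WU by auto
      have "E (xs ! (m - 1)) (last xs)"
        using ipath_nth[OF ip, of "m - 1" m] len pm \<open>m \<noteq> 0\<close> by simp
      then have le: "t3 5 (last xs) \<le> m - 1"
        using walk(1)[OF l(1), of "m - 1"] len by simp
      then have "last xs = xs ! t3 5 (last xs) \<or> E (last xs) (xs ! t3 5 (last xs))"
        using P.nu'[OF l(2)] by simp
      moreover have "last xs \<noteq> xs ! t3 5 (last xs)"
        using le \<open>m \<noteq> 0\<close> pm ipath_distinct[OF ip] len nth_eq_iff_index_eq[of xs m "t3 5 (last xs)"] by auto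
      ultimately show ?thesis
        using ipath_nth[OF ip, of m "t3 5 (last xs)"] le len pm \<open>m \<noteq> 0\<close> by simp arith
    qed
    have t3: "t3 a = t2 a" if "a \<notin> {2, 5, 9, 14, 16}" for a
      unfolding t3_def by (rule walk_other[OF that])
    have src3: "t3 11 0 = s\<^sub>1" "t3 12 0 = s\<^sub>2"
      using t3[of 11] t3[of 12] t2[of 11] t2[of 12] t1[of 11] t1[of 12] s by simp_all
    have src_n: "s\<^sub>1 < n" "s\<^sub>2 < n"
      using sources WU by auto
    note restart = restart_spec[where s = t3 and n = n and E = E, unfolded src3, OF src_n, folded t4_def]
    have t4: "t4 a = t3 a" if "a \<notin> {1, 6, 7}" for a
      by (rule restart(3)[OF that])
    have t4_WU: "marked n t4 3 = W" "marked n t4 4 = U"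
      using s(1,2) t4[of 3] t4[of 4] t3[of 3] t3[of 4] t2[of 3] t2[of 4] t1[of 3] t1[of 4] unfolding marked_def by simp_all
    have t4_5: "t4 5 = t3 5" "t4 9 0 = m - 1"
      using t4[of 5] t4[of 9] walk(3) root_nu by simp_all
    \<comment> \<open>The second search has no use for tree paths, so its invariant ignores the
      parents.\<close>
    define J where "J D Q th par \<longleftrightarrow> P.search_inv D Q th" for D Q th and par :: "nat \<Rightarrow> nat"
    note search = search_rule[where J = J and s = t4 and n = n and E = E, folded t5_def, unfolded t4_WU t4_5 restart(1,2)]
    have "P.valid (m - 1)"
      unfolding P.valid_def by simp
    then have 1: "J ?Src {} (m - 1) (t4 8)" "m - 1 \<le> n"
      using sources m_n unfolding J_def P.search_inv_def by auto
    have 2: "J (D \<union> {y \<in> W \<union> U. E x y}) (insert x Q) th par'"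
      if "J D Q th par" "x \<in> D" "x \<in> W" "th < t3 5 x" "x \<notin> Q" for D Q th par par' x
      using P.search_process that(1-4) unfolding J_def by blast
    have 3: "J D Q (t3 5 x) par" if "J D Q th par" "x \<in> D" "x \<in> W" "t3 5 x < th" for D Q th par x
      using P.search_lower that unfolding J_def by blast
    have inv: "J (marked n t5 6) (marked n t5 7) (t5 9 0) (t5 8)"
      by (rule search(1)) (fact 1 2 3)+
    have fin: "t5 9 0 \<le> t3 5 x \<and> (t5 9 0 < t3 5 x \<longrightarrow> x \<in> marked n t5 7)"
      if "x \<in> marked n t5 6" "x \<in> W" for x
      by (rule search(2)[OF _ _ _ _ that]) (fact 1 2 3)+
    have linked_iff: "u \<in> marked n t5 6 \<longleftrightarrow> linked c u" if "u \<in> U" "u \<noteq> c" for u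
      using P.search_final[OF inv[unfolded J_def] fin that(1)] that(2) p0 by simp
    have t5: "t5 a = t4 a" if "a \<notin> {1, 2, 6, 7, 8, 9, 10, 16}" for a
      unfolding t5_def by (rule search_other[OF that])
    have t5_s: "t5 13 = t2 13" "t5 15 0 = c" "t5 0 = s 0"
      using t5[of 13] t5[of 15] t5[of 0] t4[of 13] t4[of 15] t4[of 0] t3[of 13] t3[of 15] t3[of 0] t2_0
      unfolding c_def by simp_all
    have "(\<exists>x<n. t5 13 x \<noteq> 0 \<and> t5 6 x \<noteq> 0 \<and> x \<noteq> t5 15 0) \<longleftrightarrow> (\<exists>u\<in>K. linked c u)"
    proof
      assume "\<exists>x<n. t5 13 x \<noteq> 0 \<and> t5 6 x \<noteq> 0 \<and> x \<noteq> t5 15 0"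
      then obtain x where x: "x < n" "x \<in> K" "x \<in> marked n t5 6" "x \<noteq> c"
        using K13 unfolding t5_s marked_def by blast
      then show "\<exists>u\<in>K. linked c u"
        using linked_iff[of x] K_U by blast
    next
      assume "\<exists>u\<in>K. linked c u"
      then obtain u where u: "u \<in> K" "linked c u" by blast
      then have "u \<noteq> c" "u < n" "u \<in> U"
        using linked_in_U'(3) K_U WU by blast+
      then show "\<exists>x<n. t5 13 x \<noteq> 0 \<and> t5 6 x \<noteq> 0 \<and> x \<noteq> t5 15 0"
        using u linked_iff[of u] K13[of u] unfolding t5_s marked_def by blast
    qed
    also have "\<dots> \<longleftrightarrow> (\<exists>a b. linked a b \<and> \<not> E a b)"
    proof (rule sym, rule linked_nonadjacent_iff)
      show False if "E a b" "E b c" "E c d" "E d a" "\<not> E a c" "\<not> E b d" "a \<noteq> c" "b \<noteq> d" for a b c d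
        by (rule no_C4[OF that])
      show "c \<in> K"
        unfolding c_def by fact
    qed
    finally have iff: "(\<exists>x<n. t5 13 x \<noteq> 0 \<and> t5 6 x \<noteq> 0 \<and> x \<noteq> t5 15 0) \<longleftrightarrow> (\<exists>a b. linked a b \<and> \<not> E a b)" .
    have "den n E decide s = den n E check_K t5"
      unfolding den using cU(3) c_def by simp
    then show ?thesis
      by (simp only: check_K_spec iff t5_s(3))
  qed
qed

end

section \<open>Induced paths and cycles\<close>

context adjacency
begin

lemma adj_commute: "adj a b \<longleftrightarrow> adj b a"
  using adj_sym by blast

lemma ipath_append:
  "ipath (xs @ ys) \<longleftrightarrow> ipath xs \<and> ipath ys \<and>
    (\<forall>x\<in>set xs. \<forall>y\<in>set ys. x \<noteq> y \<and> (adj x y \<longleftrightarrow> x = last xs \<and> y = hd ys))"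
proof (induction xs)
  case (Cons a xs)
  show ?case
  proof (cases "xs = []")
    case False
    then have "hd (xs @ ys) = hd xs" "hd xs \<in> set xs" "last xs \<in> set xs"
      by auto
    then show ?thesis
      using Cons.IH False by (auto simp: ball_Un)
  qed auto
qed simp

lemma ipath_rev: "ipath xs \<Longrightarrow> ipath (rev xs)"
proof (induction xs)
  case (Cons x xs)
  have "adj y x \<longleftrightarrow> y = hd xs" if "y \<in> set xs" for y
    using Cons.prems that adj_commute[of x y] by simp
  then show ?case
    using Cons by (auto simp: ipath_append last_rev)
qed simp

lemma ipath_cn: "ipath xs \<Longrightarrow> cn (set xs)"
proof (induction xs)
  case (Cons x xs)
  then show ?case
    by (cases "xs = []") (auto simp: cn_singleton intro!: cn_insert touches_mem[of _ "hd xs"])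
qed (simp add: cn_empty)

text \<open>Induction along a walk: the new vertex is put in front of the last of its neighbours on
  the induced path so far, or the path is cut at this vertex if it lies on it.\<close>

lemma ipath_exists:
  assumes "cn S" "a \<in> S" "b \<in> S"
  obtains xs where "ipath xs" "xs \<noteq> []" "hd xs = a" "last xs = b" "set xs \<subseteq> S"
proof -
  have "(inside S)\<^sup>*\<^sup>* a b"
    using assms unfolding cn_def by blast
  then have "\<exists>xs. ipath xs \<and> xs \<noteq> [] \<and> hd xs = a \<and> last xs = b \<and> set xs \<subseteq> S"
  proof (induction rule: converse_rtranclp_induct)
    case base
    show ?case
      using assms(3) by (intro exI[of _ "[b]"]) simp
  next
    case (step a y)
    then obtain xs where xs: "ipath xs" "xs \<noteq> []" "hd xs = y" "last xs = b" "set xs \<subseteq> S"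
      by blast
    have a: "a \<in> S" "adj a y" "y \<in> set xs"
      using step.hyps(1) xs(2,3) unfolding inside_def by auto
    show ?case
    proof (cases "a \<in> set xs")
      case True
      then obtain us vs where "xs = us @ a # vs"
        by (meson split_list)
      then show ?thesis
        using xs by (intro exI[of _ "a # vs"]) (auto simp: ipath_append)
    next
      case False
      obtain us z vs where "xs = us @ z # vs" "adj a z" "\<forall>v\<in>set vs. \<not> adj a v"
        using split_list_last_prop[of xs "adj a"] a by blast
      then show ?thesis
        using xs a False by (intro exI[of _ "a # z # vs"]) (auto simp: ipath_append)
    qed
  qed
  then show thesis
    using that by blast
qed

lemma ipathI:
  assumes "distinct xs"
    and "\<And>i j. i < j \<Longrightarrow> j < length xs \<Longrightarrow> adj (xs ! i) (xs ! j) \<longleftrightarrow> j = Suc i"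
  shows "ipath xs"
  using assms
proof (induction xs)
  case (Cons x xs)
  have "adj (xs ! i) (xs ! j) \<longleftrightarrow> j = Suc i" if "i < j" "j < length xs" for i j
    using Cons.prems(2)[of "Suc i" "Suc j"] that by simp
  then have "ipath xs"
    using Cons by simp
  moreover have "adj x y \<longleftrightarrow> y = hd xs" if y: "y \<in> set xs" for y
  proof -
    obtain j where j: "y = xs ! j" "j < length xs"
      using y by (auto simp: in_set_conv_nth)
    then have "xs \<noteq> []"
      by auto
    have "adj x y \<longleftrightarrow> j = 0"
      using Cons.prems(2)[of 0 "Suc j"] j by simp
    moreover have "y = hd xs \<longleftrightarrow> j = 0"
      using j Cons.prems(1) nth_eq_iff_index_eq[of xs j 0] \<open>xs \<noteq> []\<close> by (simp add: hd_conv_nth)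
    ultimately show ?thesis by simp
  qed
  ultimately show ?case
    using Cons.prems(1) by simp
qed simp

section \<open>Induced cycles\<close>

definition cycle :: "'a list \<Rightarrow> bool" where
  "cycle C \<longleftrightarrow> 4 \<le> length C \<and> distinct C \<and> (\<forall>i<length C. \<forall>j<length C.
     adj (C ! i) (C ! j) \<longleftrightarrow> j = Suc i mod length C \<or> i = Suc j mod length C)"

lemma mod_Suc_less: "i < n \<Longrightarrow> Suc i mod n = (if Suc i = n then 0 else Suc i)"
  by auto

text \<open>Opening a cycle at \<open>y\<close> trades the modular index conditions for the
  recursive form of \<open>ipath\<close>, in which arms can be split off by
  \<open>ipath_append\<close>.\<close>

lemma cycle_Cons:
  "cycle (y # L) \<longleftrightarrow> ipath L \<and> 3 \<le> length L \<and> y \<notin> set L \<and> (\<forall>c\<in>set L. adj y c \<longleftrightarrow> c = hd L \<or> c = last L)"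
    (is "_ \<longleftrightarrow> ?R")
proof
  assume C: "cycle (y # L)"
  let ?n = "length L"
  have n: "3 \<le> ?n" and d: "distinct L" "y \<notin> set L"
    using C unfolding cycle_def by auto
  have a: "adj ((y # L) ! i) ((y # L) ! j) \<longleftrightarrow> j = Suc i mod Suc ?n \<or> i = Suc j mod Suc ?n"
    if "i \<le> ?n" "j \<le> ?n" for i j
    using C that unfolding cycle_def by simp
  have "ipath L"
  proof (rule ipathI[OF d(1)])
    fix i j
    assume "i < j" "j < ?n"
    then show "adj (L ! i) (L ! j) \<longleftrightarrow> j = Suc i"
      using a[of "Suc i" "Suc j"] by (auto simp: mod_Suc_less)
  qed
  moreover have "adj y c \<longleftrightarrow> c = hd L \<or> c = last L" if c: "c \<in> set L" for c
  proof -
    obtain j where j: "c = L ! j" "j < ?n"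
      using c by (auto simp: in_set_conv_nth)
    have "L \<noteq> []"
      using n by auto
    then have "c = hd L \<longleftrightarrow> j = 0" "c = last L \<longleftrightarrow> j = ?n - 1"
      using j n d(1) by (auto simp: hd_conv_nth last_conv_nth nth_eq_iff_index_eq)
    moreover have "adj y c \<longleftrightarrow> j = 0 \<or> j = ?n - 1"
      using a[of 0 "Suc j"] j n by (auto simp: mod_Suc_less)
    ultimately show ?thesis by simp
  qed
  ultimately show ?R
    using n d by blast
next
  assume R: ?R
  let ?n = "length L"
  have n: "3 \<le> ?n" "L \<noteq> []" and ip: "ipath L"
    using R by auto
  note d = ipath_distinct[OF ip]
  have y: "adj y (L ! j) \<longleftrightarrow> j = 0 \<or> j = ?n - 1" if "j < ?n" for j
    using R that n d by (auto simp: hd_conv_nth last_conv_nth nth_eq_iff_index_eq)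
  have m: "Suc i mod Suc ?n = (if i = ?n then 0 else Suc i)" if "i \<le> ?n" for i
    using that by (simp add: mod_Suc_less)
  have "adj ((y # L) ! i) ((y # L) ! j) \<longleftrightarrow> j = Suc i mod Suc ?n \<or> i = Suc j mod Suc ?n"
    if ij: "i \<le> ?n" "j \<le> ?n" for i j
    unfolding m[OF ij(1)] m[OF ij(2)]
  proof (cases i; cases j)
    fix j'
    assume "i = 0" "j = Suc j'"
    then show "adj ((y # L) ! i) ((y # L) ! j) \<longleftrightarrow>
        j = (if i = ?n then 0 else Suc i) \<or> i = (if j = ?n then 0 else Suc j)"
      using y[of j'] ij n(1) by (cases "j = ?n") auto
  next
    fix i'
    assume "i = Suc i'" "j = 0"
    then show "adj ((y # L) ! i) ((y # L) ! j) \<longleftrightarrow>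
        j = (if i = ?n then 0 else Suc i) \<or> i = (if j = ?n then 0 else Suc j)"
      using y[of i'] ij n(1) adj_commute[of "L ! i'" y] by (cases "i = ?n") auto
  next
    fix i' j'
    assume ij': "i = Suc i'" "j = Suc j'"
    then have A: "i' < ?n" "j' < ?n"
      using ij by simp_all
    show "adj ((y # L) ! i) ((y # L) ! j) \<longleftrightarrow>
        j = (if i = ?n then 0 else Suc i) \<or> i = (if j = ?n then 0 else Suc j)"
      unfolding ij' nth_Cons_Suc ipath_nth[OF ip A] using A by arith
  qed (use adj_irrefl n in auto)
  then show "cycle (y # L)"
    unfolding cycle_def using n d R by (auto simp: less_Suc_eq_le)
qed

lemma cycle_rotate: "cycle C \<Longrightarrow> cycle (rotate k C)"
proof (induction k)
  case (Suc k)
  let ?C = "rotate k C"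
  have C: "cycle ?C"
    using Suc by simp
  let ?n = "length ?C"
  have n: "4 \<le> ?n"
    using C unfolding cycle_def by simp
  have "adj (rotate1 ?C ! i) (rotate1 ?C ! j) \<longleftrightarrow> j = Suc i mod ?n \<or> i = Suc j mod ?n"
    if ij: "i < ?n" "j < ?n" for i j
  proof -
    have "Suc i mod ?n < ?n" "Suc j mod ?n < ?n"
      by (rule mod_less_divisor, use n in linarith)+
    then have "adj (?C ! (Suc i mod ?n)) (?C ! (Suc j mod ?n)) \<longleftrightarrow>
        Suc j mod ?n = Suc (Suc i mod ?n) mod ?n \<or> Suc i mod ?n = Suc (Suc j mod ?n) mod ?n"
      using C unfolding cycle_def by blast
    then show ?thesis
      using ij n by (simp add: nth_rotate1 mod_Suc_less split: if_splits)
  qed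
  then show ?case
    using C unfolding cycle_def by simp
qed simp

lemma cycle_from:
  assumes "cycle C" "y \<in> set C"
  obtains L where "cycle (y # L)" "set C = insert y (set L)" "length C = Suc (length L)"
proof -
  obtain us vs where "C = us @ y # vs"
    using assms(2) by (meson split_list)
  then have "rotate (length us) C = y # (vs @ us)"
    by (simp add: rotate_append)
  then show thesis
    using that[of "vs @ us"] cycle_rotate[OF assms(1), of "length us"] \<open>C = us @ y # vs\<close> by auto
qed

lemma cycle_degree:
  assumes "cycle C" "a \<in> set C" "{b, c, d} \<subseteq> set C" "adj a b" "adj a c" "adj a d" "b \<noteq> c" "b \<noteq> d" "c \<noteq> d"
  shows False
proof -
  obtain L where L: "cycle (a # L)" "set C = insert a (set L)"
    using cycle_from[OF assms(1,2)] by blast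
  then show False
    using assms adj_irrefl unfolding cycle_Cons by auto
qed

lemma cycle_neighbours:
  assumes "cycle C" "a \<in> set C"
  obtains b c where "b \<in> set C" "c \<in> set C" "b \<noteq> c" "adj a b" "adj a c" "\<not> adj b c"
proof -
  obtain L where L: "cycle (a # L)" "set C = insert a (set L)"
    using cycle_from[OF assms] by blast
  then have ip: "ipath L" and n: "3 \<le> length L" "L \<noteq> []" and a: "\<forall>c\<in>set L. adj a c \<longleftrightarrow> c = hd L \<or> c = last L"
    unfolding cycle_Cons by auto
  have "hd L = L ! 0" "last L = L ! (length L - 1)"
    using n by (simp_all add: hd_conv_nth last_conv_nth)
  then have "\<not> adj (hd L) (last L)" "hd L \<noteq> last L"
    using ipath_nth[OF ip, of 0 "length L - 1"] n nth_eq_iff_index_eq[OF ipath_distinct[OF ip], of 0 "length L - 1"] by auto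
  then show thesis
    using that[of "hd L" "last L"] a n L(2) by auto
qed

lemma closed_cn:
  assumes "cn S" "a \<in> S" "a \<in> T" "\<And>x y. x \<in> S \<Longrightarrow> x \<in> T \<Longrightarrow> y \<in> S \<Longrightarrow> adj x y \<Longrightarrow> y \<in> T"
  shows "S \<subseteq> T"
proof
  fix b
  assume "b \<in> S"
  then have "(inside S)\<^sup>*\<^sup>* a b"
    using assms(1,2) unfolding cn_def by blast
  then show "b \<in> T"
    by (induction rule: rtranclp_induct) (use assms in \<open>auto simp: inside_def\<close>)
qed

text \<open>
  The hole of a ban-the-bomb is \<open>y\<close>, followed by \<open>xs\<close> from \<open>x\<close> to a neighbour of \<open>w\<close>, then \<open>w\<close>,
  and then the reverse of \<open>zs\<close>, which starts in \<open>z\<close>. If there is no hole of length four, then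
  \<open>v\<close> is adjacent to \<open>y\<close>.
\<close>

definition bomb :: "'a \<Rightarrow> 'a \<Rightarrow> 'a \<Rightarrow> 'a list \<Rightarrow> 'a list \<Rightarrow> bool" where
  "bomb v y w xs zs \<longleftrightarrow> ipath (xs @ w # rev zs) \<and> 2 \<le> length xs \<and> zs \<noteq> [] \<and>
     y \<notin> set (xs @ w # rev zs) \<and> v \<notin> set (xs @ w # rev zs) \<and> adj v y \<and>
     (\<forall>c\<in>set (xs @ w # rev zs). (adj y c \<longleftrightarrow> c = hd xs \<or> c = hd zs) \<and> (adj v c \<longleftrightarrow> c = hd xs \<or> c = hd zs \<or> c = w))"

text \<open>The bounds are the lengths of the holes that \<open>v\<close> and \<open>w\<close> form
  with either arm. A one-vertex arm forms a triangle with \<open>v\<close> and \<open>w\<close>,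
  hence no hole.\<close>

definition long_bomb :: "nat \<Rightarrow> 'a \<Rightarrow> 'a \<Rightarrow> 'a \<Rightarrow> 'a list \<Rightarrow> 'a list \<Rightarrow> bool" where
  "long_bomb l v y w xs zs \<longleftrightarrow> bomb v y w xs zs \<and> l \<le> length xs + 2 \<and> (length zs = 1 \<or> l \<le> length zs + 2)"

section \<open>Holes inside a ban-the-bomb\<close>

lemma bomb_cycle:
  assumes "bomb v y w xs zs"
  shows "cycle (y # xs @ w # rev zs)"
proof -
  have "xs \<noteq> []" "zs \<noteq> []"
    using assms unfolding bomb_def by auto
  then have "hd (xs @ w # rev zs) = hd xs" "last (xs @ w # rev zs) = hd zs" "3 \<le> length (xs @ w # rev zs)"
    using assms unfolding bomb_def by (simp_all add: last_rev)
  then show ?thesis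
    unfolding cycle_Cons \<open>hd (xs @ w # rev zs) = hd xs\<close> \<open>last (xs @ w # rev zs) = hd zs\<close>
    using assms unfolding bomb_def by blast
qed

lemma bomb_arm_cycle:
  assumes "ipath (xs @ w # ys)" "2 \<le> length xs" "v \<notin> set (xs @ [w])"
    and "\<And>c. c \<in> set (xs @ [w]) \<Longrightarrow> adj v c \<longleftrightarrow> c = hd xs \<or> c = w"
  shows "cycle (v # xs @ [w])"
proof -
  have "ipath ((xs @ [w]) @ ys)"
    using assms(1) by simp
  then have "ipath (xs @ [w])"
    unfolding ipath_append[of "xs @ [w]"] by blast
  moreover have "xs \<noteq> []"
    using assms(2) by auto
  ultimately show ?thesis
    unfolding cycle_Cons using assms(2-4) by simp
qed

text \<open>A vertex of the arm that lies on \<open>D\<close> has two neighbours on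
  \<open>D\<close>, and these are its two neighbours on the cycle \<open>v # xs @ [w]\<close>. Hence
  \<open>D\<close> cannot leave the arm: from \<open>hd xs\<close> it runs through all of it and on
  to \<open>w\<close>.\<close>

lemma bomb_arm_length:
  assumes "ipath (xs @ w # ys)" "cycle (v # xs @ [w])" "cycle D" "v \<in> set D" "hd xs \<in> set D" "xs \<noteq> []"
    and nbrs: "\<And>a b. a \<in> set xs \<Longrightarrow> b \<in> set D \<Longrightarrow> adj a b \<Longrightarrow> b \<in> set (v # xs @ w # ys)"
  shows "length xs + 2 \<le> length D"
proof -
  have ip: "ipath xs" and sep: "\<forall>a\<in>set xs. \<forall>b\<in>set (w # ys). a \<noteq> b \<and> (adj a b \<longleftrightarrow> a = last xs \<and> b = w)"
    using assms(1) unfolding ipath_append by auto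
  have w: "w \<notin> set ys"
    using assms(1) unfolding ipath_append by auto
  have closed: "b \<in> set D" if a: "a \<in> set xs" "a \<in> set D" and b: "b \<in> set (xs @ [w])" "adj a b" for a b
  proof (rule ccontr)
    assume n: "b \<notin> set D"
    obtain c d where cd: "c \<in> set D" "d \<in> set D" "c \<noteq> d" "adj a c" "adj a d"
      using cycle_neighbours[OF assms(3) a(2)] by blast
    have "c \<in> set (v # xs @ [w])" "d \<in> set (v # xs @ [w])"
      using nbrs[OF a(1) cd(1,4)] nbrs[OF a(1) cd(2,5)] sep cd a(1) w by auto
    then show False
      using cycle_degree[OF assms(2), of a b c d] a b cd n by auto
  qed
  have "set xs \<subseteq> set D"
  proof (rule closed_cn[OF ipath_cn[OF ip] _ assms(5)])
    show "y \<in> set D" if "x \<in> set xs" "x \<in> set D" "y \<in> set xs" "adj x y" for x y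
      using closed[OF that(1,2) _ that(4)] that(3) by simp
  qed (use assms(6) in simp)
  moreover have "w \<in> set D"
  proof -
    have l: "last xs \<in> set xs" "last xs \<in> set D"
      using assms(6) \<open>set xs \<subseteq> set D\<close> by auto
    then have "adj (last xs) w"
      using sep by simp
    then show ?thesis
      using closed[OF l, of w] by simp
  qed
  ultimately have "set (v # xs @ [w]) \<subseteq> set D"
    using assms(4) by simp
  then have "card (set (v # xs @ [w])) \<le> length D"
    using card_mono[OF finite_set[of D], of "set (v # xs @ [w])"] card_length[of D] by linarith
  moreover have "distinct (v # xs @ [w])"
    using assms(2) unfolding cycle_def by blast
  ultimately show ?thesis
    using distinct_card[of "v # xs @ [w]"] by simp
qed

text \<open>A cycle that avoids \<open>v\<close> covers the hole through \<open>y\<close>. A cycle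
  through \<open>v\<close> avoids \<open>y\<close> and then traverses one of the arms completely, so
  the bounds on the arms apply.\<close>

lemma bomb_cycles_long:
  assumes "long_bomb l v y w xs zs" "cycle D" "set D \<subseteq> insert v (insert y (set (xs @ w # rev zs)))"
  shows "l \<le> length D"
proof -
  let ?L = "xs @ w # rev zs"
  have B: "bomb v y w xs zs" and lx: "l \<le> length xs + 2" and lz: "length zs = 1 \<or> l \<le> length zs + 2"
    using assms(1) unfolding long_bomb_def by auto
  have ip: "ipath ?L" and len: "2 \<le> length xs" "zs \<noteq> []" and yv: "y \<notin> set ?L" "v \<notin> set ?L" "adj v y"
    and y: "\<And>c. c \<in> set ?L \<Longrightarrow> adj y c \<longleftrightarrow> c = hd xs \<or> c = hd zs"
    and v: "\<And>c. c \<in> set ?L \<Longrightarrow> adj v c \<longleftrightarrow> c = hd xs \<or> c = hd zs \<or> c = w"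
    using B unfolding bomb_def by blast+
  have "xs \<noteq> []"
    using len by auto
  then have xs: "xs \<noteq> []" "hd xs \<in> set xs" "hd zs \<in> set zs"
    using len(2) by simp_all
  have sep: "\<And>a b. a \<in> set xs \<Longrightarrow> b \<in> set (w # rev zs) \<Longrightarrow> a \<noteq> b"
    using ip unfolding ipath_append[of xs] by blast
  have "v \<noteq> y"
    using yv(3) adj_irrefl by blast
  note cyc = bomb_cycle[OF B]
  show ?thesis
  proof (cases "v \<in> set D")
    case False
    then have D: "set D \<subseteq> set (y # ?L)"
      using assms(3) by auto
    have closed: "b \<in> set D" if a: "a \<in> set D" and b: "b \<in> set (y # ?L)" "adj a b" for a b
    proof (rule ccontr)
      assume n: "b \<notin> set D"
      obtain c d where "c \<in> set D" "d \<in> set D" "c \<noteq> d" "adj a c" "adj a d"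
        using cycle_neighbours[OF assms(2) a] by blast
      then show False
        using cycle_degree[OF cyc, of a b c d] D a b n by blast
    qed
    have "set D \<noteq> {}"
      using assms(2) unfolding cycle_def by auto
    then obtain a where a: "a \<in> set D" "a \<in> set ?L"
    proof (cases "y \<in> set D")
      case True
      then show thesis
        using that[of "hd xs"] closed[OF True, of "hd xs"] y[of "hd xs"] xs by simp
    next
      case False
      then show thesis
        using that D \<open>set D \<noteq> {}\<close> by (metis all_not_in_conv set_ConsD subsetD)
    qed
    have "set ?L \<subseteq> set D"
    proof (rule closed_cn[OF ipath_cn[OF ip] a(2,1)])
      show "d \<in> set D" if "c \<in> set ?L" "c \<in> set D" "d \<in> set ?L" "adj c d" for c d
        by (rule closed[OF that(2) _ that(4)]) (use that(3) in auto)
    qed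
    then have "length ?L \<le> length D"
      using card_mono[OF finite_set[of D], of "set ?L"] card_length[of D] distinct_card[OF ipath_distinct[OF ip]]
      by linarith
    then show ?thesis
      using lx len(2) by (cases zs) auto
  next
    case True
    \<comment> \<open>Two non-adjacent neighbours of \<open>y\<close> on \<open>D\<close> must be
      the heads of the arms, as \<open>v\<close> is adjacent to both heads; but then
      \<open>v\<close> has three neighbours on \<open>D\<close>.\<close>
    have yD: "y \<notin> set D"
    proof
      assume "y \<in> set D"
      then obtain b c where bc: "b \<in> set D" "c \<in> set D" "b \<noteq> c" "adj y b" "adj y c" "\<not> adj b c"
        using cycle_neighbours[OF assms(2)] by blast
      have cand: "b = v \<or> b = hd xs \<or> b = hd zs" if "b \<in> set D" "adj y b" for b
        using that y assms(3) adj_irrefl by blast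
      have vx: "adj v (hd xs)" "adj v (hd zs)"
        using v xs by auto
      have "b = hd xs \<or> b = hd zs" "c = hd xs \<or> c = hd zs"
        using cand[OF bc(1,4)] cand[OF bc(2,5)] bc vx adj_sym by metis+
      then have "adj v b" "adj v c" "b \<noteq> y" "c \<noteq> y"
        using vx bc(4,5) adj_irrefl by auto
      then show False
        using cycle_degree[OF assms(2) True, of b c y] bc \<open>y \<in> set D\<close> yv(3) by blast
    qed
    have nbrs: "b \<in> set (v # ?L)" if "b \<in> set D" for b
      using that assms(3) yD by auto
    have cx: "cycle (v # xs @ [w])"
    proof (rule bomb_arm_cycle[OF ip len(1)])
      have "c \<noteq> hd zs" if "c \<in> set (xs @ [w])" for c
        using that sep xs(3) ip unfolding ipath_append[of xs] by auto
      then show "adj v c \<longleftrightarrow> c = hd xs \<or> c = w" if "c \<in> set (xs @ [w])" for c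
        using that v[of c] by auto
    qed (use yv in auto)
    obtain b c where bc: "b \<in> set D" "c \<in> set D" "b \<noteq> c" "adj v b" "adj v c" "\<not> adj b c"
      using cycle_neighbours[OF assms(2) True] by blast
    have cand: "b = hd xs \<or> b = hd zs \<or> b = w" if "b \<in> set D" "adj v b" for b
      using nbrs[OF that(1)] that(2) v adj_irrefl by auto
    \<comment> \<open>Two non-adjacent neighbours of \<open>v\<close> on \<open>D\<close> are among
      the two heads and \<open>w\<close>; if \<open>hd xs\<close> is not one of them, they are
      \<open>hd zs\<close> and \<open>w\<close>.\<close>
    consider "hd xs \<in> set D" | "hd zs \<in> set D" "w \<in> set D" "\<not> adj w (hd zs)"
      using cand[OF bc(1,4)] cand[OF bc(2,5)] bc adj_sym by metis
    then show ?thesis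
    proof cases
      case 1
      have "length xs + 2 \<le> length D"
        by (rule bomb_arm_length[OF ip cx assms(2) True 1 xs(1)]) (use nbrs in auto)
      then show ?thesis
        using lx by simp
    next
      case 2
      have ip': "ipath (zs @ w # rev xs)"
        using ipath_rev[OF ip] by simp
      have "length zs \<noteq> 1"
      proof
        assume "length zs = 1"
        then obtain z where "zs = [z]"
          by (auto simp: length_Suc_conv)
        then show False
          using ip 2(3) unfolding ipath_append[of xs] by simp
      qed
      moreover have "length zs \<noteq> 0"
        using len(2) by simp
      ultimately have lz': "2 \<le> length zs" "l \<le> length zs + 2"
        using lz by linarith+
      have "cycle (v # zs @ [w])"
      proof (rule bomb_arm_cycle[OF ip' lz'(1)])
        have "c \<noteq> hd xs" if "c \<in> set (zs @ [w])" for c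
          using that sep[OF xs(2), of c] by auto
        then show "adj v c \<longleftrightarrow> c = hd zs \<or> c = w" if "c \<in> set (zs @ [w])" for c
          using that v[of c] by auto
      qed (use yv in auto)
      then have "length zs + 2 \<le> length D"
        by (rule bomb_arm_length[OF ip' _ assms(2) True 2(1) len(2)]) (use nbrs in auto)
      then show ?thesis
        using lz' by simp
    qed
  qed
qed

end

section \<open>Long thetas and long ban-the-bombs in graphs\<close>

lemma graph_adjacency:
  assumes "graph G"
  shows "adjacency (dominates G)"
proof
  interpret graph G by fact
  show "b \<rightarrow>\<^bsub>G\<^esub> a" if "a \<rightarrow>\<^bsub>G\<^esub> b" for a b
    using arcs_ends_symmetric[OF sym_arcs that] .
  show "\<not> a \<rightarrow>\<^bsub>G\<^esub> a" for a
    using adj_not_same by blast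
qed

lemma induced_dominates:
  assumes "induced_subgraph H G"
  shows "a \<rightarrow>\<^bsub>H\<^esub> b \<longleftrightarrow> a \<in> verts H \<and> b \<in> verts H \<and> a \<rightarrow>\<^bsub>G\<^esub> b"
  using assms unfolding induced_subgraph_def subgraph_def compatible_def arcs_ends_conv by auto

lemma induced_verts: "induced_subgraph H G \<Longrightarrow> verts H \<subseteq> verts G"
  unfolding induced_subgraph_def subgraph_def by blast

lemma hole_iff_cycle:
  assumes "graph G"
  shows "hole G C \<longleftrightarrow> adjacency.cycle (dominates G) C \<and> set C \<subseteq> verts G"
  unfolding hole_def adjacency.cycle_def[OF graph_adjacency[OF assms]] by blast

lemma hole_induced:
  assumes "induced_subgraph H G"
  shows "hole H C \<longleftrightarrow> hole G C \<and> set C \<subseteq> verts H"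
  unfolding hole_def induced_dominates[OF assms] using induced_verts[OF assms] by (auto simp: subset_iff)

lemma no_hole4:
  assumes "graph G" "\<not> (\<exists>C. hole G C \<and> length C = 4)"
    and "a \<rightarrow>\<^bsub>G\<^esub> b" "b \<rightarrow>\<^bsub>G\<^esub> c" "c \<rightarrow>\<^bsub>G\<^esub> d" "d \<rightarrow>\<^bsub>G\<^esub> a" "\<not> a \<rightarrow>\<^bsub>G\<^esub> c" "\<not> b \<rightarrow>\<^bsub>G\<^esub> d" "a \<noteq> c" "b \<noteq> d"
  shows False
proof -
  interpret adjacency "dominates G"
    by (rule graph_adjacency) fact
  interpret G: wf_digraph G
    using assms(1) unfolding graph_def digraph_def fin_digraph_def by blast
  have "cycle [a, b, c, d]"
    unfolding cycle_Cons using assms(3-10) adj_irrefl adj_commute[of a] by auto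
  moreover have "set [a, b, c, d] \<subseteq> verts G"
    using assms(3-6) G.adj_in_verts by auto
  ultimately show False
    using assms(2) hole_iff_cycle[OF assms(1), of "[a, b, c, d]"] by auto
qed

text \<open>For an induced path, the edges along the list are all edges between its vertices; this
  connects the induced subgraph with the edge set demanded by \<open>theta\<close>.\<close>

lemma vwalk_arcs_ipath:
  assumes "adjacency (dominates G)" "adjacency.ipath (dominates G) P"
  shows "set (vwalk_arcs P) \<subseteq> arcs_ends G" "path_edges P = {(a, b). a \<in> set P \<and> b \<in> set P \<and> a \<rightarrow>\<^bsub>G\<^esub> b}"
proof -
  interpret adjacency "dominates G" by fact
  from assms(2) have "set (vwalk_arcs P) \<subseteq> arcs_ends G \<and> path_edges P = {(a, b). a \<in> set P \<and> b \<in> set P \<and> a \<rightarrow>\<^bsub>G\<^esub> b}"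
  proof (induction P)
    case Nil
    then show ?case by (simp add: path_edges_def)
  next
    case (Cons x P)
    show ?case
    proof (cases "P = []")
      case True
      then show ?thesis
        using adj_irrefl by (auto simp: path_edges_def)
    next
      case False
      have IH: "set (vwalk_arcs P) \<subseteq> arcs_ends G" "path_edges P = {(a, b). a \<in> set P \<and> b \<in> set P \<and> a \<rightarrow>\<^bsub>G\<^esub> b}"
        using Cons by auto
      have x: "x \<rightarrow>\<^bsub>G\<^esub> y \<longleftrightarrow> y = hd P" "y \<rightarrow>\<^bsub>G\<^esub> x \<longleftrightarrow> y = hd P" if "y \<in> set P" for y
        using Cons.prems that adj_commute[of x y] by auto
      have "path_edges (x # P) = {(x, hd P), (hd P, x)} \<union> path_edges P"
        using False by (auto simp: path_edges_def)
      also have "\<dots> = {(a, b). a \<in> set (x # P) \<and> b \<in> set (x # P) \<and> a \<rightarrow>\<^bsub>G\<^esub> b}"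
        unfolding IH(2) using x False adj_irrefl by auto
      finally show ?thesis
        using IH(1) x False by auto
    qed
  qed
  then show "set (vwalk_arcs P) \<subseteq> arcs_ends G" "path_edges P = {(a, b). a \<in> set P \<and> b \<in> set P \<and> a \<rightarrow>\<^bsub>G\<^esub> b}"
    by blast+
qed

text \<open>Induced paths from \<open>v\<close> to \<open>t\<close> through the three sets induce a
  theta, because anticompleteness forbids edges between their interiors. The first two have at least
  \<open>k\<^sub>1\<close> and \<open>k\<^sub>2\<close> edges, and the third has at least two, as
  \<open>v\<close> and \<open>t\<close> are not adjacent.\<close>

lemma no_long_theta:
  assumes "graph G" "\<not> contains_induced (long_theta l) G"
    and verts: "v \<in> verts G" "t \<in> verts G" "Y\<^sub>1 \<subseteq> verts G" "Y\<^sub>2 \<subseteq> verts G" "Y\<^sub>3 \<subseteq> verts G"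
    and vt: "v \<noteq> t" "\<not> v \<rightarrow>\<^bsub>G\<^esub> t" "v \<notin> Y\<^sub>1 \<union> Y\<^sub>2 \<union> Y\<^sub>3" "t \<notin> Y\<^sub>1 \<union> Y\<^sub>2 \<union> Y\<^sub>3"
    and cn: "adjacency.cn (dominates G) Y\<^sub>1" "adjacency.cn (dominates G) Y\<^sub>2" "adjacency.cn (dominates G) Y\<^sub>3"
    and sep: "adjacency.sep (dominates G) Y\<^sub>1 Y\<^sub>2" "adjacency.sep (dominates G) Y\<^sub>1 Y\<^sub>3" "adjacency.sep (dominates G) Y\<^sub>2 Y\<^sub>3"
    and v: "adjacency.touches (dominates G) v Y\<^sub>1" "adjacency.touches (dominates G) v Y\<^sub>2" "adjacency.touches (dominates G) v Y\<^sub>3"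
    and t: "adjacency.touches (dominates G) t Y\<^sub>1" "adjacency.touches (dominates G) t Y\<^sub>2" "adjacency.touches (dominates G) t Y\<^sub>3"
    and len: "\<And>P. \<lbrakk>adjacency.ipath (dominates G) P; P \<noteq> []; hd P = v; last P = t; set P \<subseteq> insert v (insert t Y\<^sub>1)\<rbrakk> \<Longrightarrow> k\<^sub>1 < length P"
      "\<And>P. \<lbrakk>adjacency.ipath (dominates G) P; P \<noteq> []; hd P = v; last P = t; set P \<subseteq> insert v (insert t Y\<^sub>2)\<rbrakk> \<Longrightarrow> k\<^sub>2 < length P"
    and l: "l \<le> k\<^sub>1 + k\<^sub>2" "l \<le> k\<^sub>1 + 2" "l \<le> k\<^sub>2 + 2"
  shows False
proof -
  interpret adjacency "dominates G"
    by (rule graph_adjacency) fact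
  interpret G: wf_digraph G
    using assms(1) unfolding graph_def digraph_def fin_digraph_def by blast
  have cn': "cn (insert v (insert t Y))" if "cn Y" "touches v Y" "touches t Y" for Y
    by (intro cn_insert that) (use that touches_mono in blast)
  obtain P\<^sub>1 where P1: "ipath P\<^sub>1" "P\<^sub>1 \<noteq> []" "hd P\<^sub>1 = v" "last P\<^sub>1 = t" "set P\<^sub>1 \<subseteq> insert v (insert t Y\<^sub>1)"
    using ipath_exists[OF cn'[OF cn(1) v(1) t(1)], of v t] by blast
  obtain P\<^sub>2 where P2: "ipath P\<^sub>2" "P\<^sub>2 \<noteq> []" "hd P\<^sub>2 = v" "last P\<^sub>2 = t" "set P\<^sub>2 \<subseteq> insert v (insert t Y\<^sub>2)"
    using ipath_exists[OF cn'[OF cn(2) v(2) t(2)], of v t] by blast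
  obtain P\<^sub>3 where P3: "ipath P\<^sub>3" "P\<^sub>3 \<noteq> []" "hd P\<^sub>3 = v" "last P\<^sub>3 = t" "set P\<^sub>3 \<subseteq> insert v (insert t Y\<^sub>3)"
    using ipath_exists[OF cn'[OF cn(3) v(3) t(3)], of v t] by blast
  define S where "S = set P\<^sub>1 \<union> set P\<^sub>2 \<union> set P\<^sub>3"
  define H where "H = G \<restriction> S"
  have S: "S \<subseteq> verts G"
    unfolding S_def using P1(5) P2(5) P3(5) verts by blast
  have H: "induced_subgraph H G" "verts H = S"
    unfolding H_def using G.induced_induce[OF S] by auto
  note dom = induced_dominates[OF H(1), unfolded H(2)]
  have sub: "set P\<^sub>1 \<subseteq> S" "set P\<^sub>2 \<subseteq> S" "set P\<^sub>3 \<subseteq> S"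
    unfolding S_def by auto
  have path: "path_between H v t P" if "ipath P" "P \<noteq> []" "hd P = v" "last P = t" "set P \<subseteq> S" for P
  proof -
    have "set (vwalk_arcs P) \<subseteq> {(a, b). a \<in> set P \<and> b \<in> set P \<and> a \<rightarrow>\<^bsub>G\<^esub> b}"
      using vwalk_arcs_ipath(2)[OF adjacency_axioms that(1)] unfolding path_edges_def by blast
    then have "set (vwalk_arcs P) \<subseteq> arcs_ends H"
      using dom that(5) by auto
    then show ?thesis
      unfolding path_between_def vpath_def vwalk_def using that ipath_distinct H(2) by auto
  qed
  have vtP: "{v, t} \<subseteq> set P\<^sub>1" "{v, t} \<subseteq> set P\<^sub>2" "{v, t} \<subseteq> set P\<^sub>3"
    using P1(2-4) P2(2-4) P3(2-4) hd_in_set last_in_set by (metis empty_subsetI insert_subset)+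
  have I: "path_interior P\<^sub>1 \<subseteq> Y\<^sub>1" "path_interior P\<^sub>2 \<subseteq> Y\<^sub>2" "path_interior P\<^sub>3 \<subseteq> Y\<^sub>3"
    unfolding path_interior_def using P1 P2 P3 by auto
  have edge: "{a, b} \<subseteq> set P\<^sub>1 \<or> {a, b} \<subseteq> set P\<^sub>2 \<or> {a, b} \<subseteq> set P\<^sub>3" if "a \<in> S" "b \<in> S" "a \<rightarrow>\<^bsub>G\<^esub> b" for a b
  proof -
    have ns: "\<not> (a \<in> Y\<^sub>1 \<and> b \<in> Y\<^sub>2)" "\<not> (a \<in> Y\<^sub>2 \<and> b \<in> Y\<^sub>1)" "\<not> (a \<in> Y\<^sub>1 \<and> b \<in> Y\<^sub>3)"
      "\<not> (a \<in> Y\<^sub>3 \<and> b \<in> Y\<^sub>1)" "\<not> (a \<in> Y\<^sub>2 \<and> b \<in> Y\<^sub>3)" "\<not> (a \<in> Y\<^sub>3 \<and> b \<in> Y\<^sub>2)"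
      using sep that(3) adj_sym[OF that(3)] unfolding sep_def by blast+
    have c: "c \<in> set P\<^sub>1 \<and> c \<in> Y\<^sub>1 \<or> c \<in> set P\<^sub>2 \<and> c \<in> Y\<^sub>2 \<or> c \<in> set P\<^sub>3 \<and> c \<in> Y\<^sub>3"
      if "c \<in> S" "c \<notin> {v, t}" for c
      using that P1(5) P2(5) P3(5) unfolding S_def by blast
    show ?thesis
    \<comment> \<open>All three paths contain \<open>v\<close> and \<open>t\<close>, so an edge at
      one of these lies within the path that contains its other end.\<close>
    proof (cases "a \<in> {v, t} \<or> b \<in> {v, t}")
      case True
      then show ?thesis
        using that(1,2) vtP unfolding S_def by blast
    next
      case False
      then show ?thesis
        using c[OF that(1)] c[OF that(2)] ns by blast
    qed
  qed
  have "arcs_ends H = path_edges P\<^sub>1 \<union> path_edges P\<^sub>2 \<union> path_edges P\<^sub>3"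
    unfolding vwalk_arcs_ipath(2)[OF adjacency_axioms P1(1)] vwalk_arcs_ipath(2)[OF adjacency_axioms P2(1)]
      vwalk_arcs_ipath(2)[OF adjacency_axioms P3(1)]
  proof (rule equalityI; rule subrelI)
    fix a b
    assume "a \<rightarrow>\<^bsub>H\<^esub> b"
    then have "a \<in> S" "b \<in> S" "a \<rightarrow>\<^bsub>G\<^esub> b"
      using dom by blast+
    then show "(a, b) \<in> {(a, b). a \<in> set P\<^sub>1 \<and> b \<in> set P\<^sub>1 \<and> a \<rightarrow>\<^bsub>G\<^esub> b} \<union>
        {(a, b). a \<in> set P\<^sub>2 \<and> b \<in> set P\<^sub>2 \<and> a \<rightarrow>\<^bsub>G\<^esub> b} \<union>
        {(a, b). a \<in> set P\<^sub>3 \<and> b \<in> set P\<^sub>3 \<and> a \<rightarrow>\<^bsub>G\<^esub> b}"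
      using edge[of a b] by simp
  next
    fix a b
    assume "(a, b) \<in> {(a, b). a \<in> set P\<^sub>1 \<and> b \<in> set P\<^sub>1 \<and> a \<rightarrow>\<^bsub>G\<^esub> b} \<union>
        {(a, b). a \<in> set P\<^sub>2 \<and> b \<in> set P\<^sub>2 \<and> a \<rightarrow>\<^bsub>G\<^esub> b} \<union>
        {(a, b). a \<in> set P\<^sub>3 \<and> b \<in> set P\<^sub>3 \<and> a \<rightarrow>\<^bsub>G\<^esub> b}"
    then have "a \<in> S \<and> b \<in> S \<and> a \<rightarrow>\<^bsub>G\<^esub> b"
      unfolding S_def by blast
    then show "a \<rightarrow>\<^bsub>H\<^esub> b"
      using dom by simp
  qed
  moreover have "Y\<^sub>1 \<inter> Y\<^sub>2 = {}" "Y\<^sub>1 \<inter> Y\<^sub>3 = {}" "Y\<^sub>2 \<inter> Y\<^sub>3 = {}"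
    using sep unfolding sep_def by blast+
  then have "path_interior P\<^sub>1 \<inter> path_interior P\<^sub>2 = {}" "path_interior P\<^sub>1 \<inter> path_interior P\<^sub>3 = {}"
    "path_interior P\<^sub>2 \<inter> path_interior P\<^sub>3 = {}"
    using I by blast+
  moreover have "\<not> v \<rightarrow>\<^bsub>H\<^esub> t" "verts H = set P\<^sub>1 \<union> set P\<^sub>2 \<union> set P\<^sub>3"
    using dom vt(2) H(2) S_def by simp_all
  ultimately have "theta H v t P\<^sub>1 P\<^sub>2 P\<^sub>3"
    unfolding theta_def
    by (intro conjI vt(1) path[OF P1(1-4) sub(1)] path[OF P2(1-4) sub(2)] path[OF P3(1-4) sub(3)])
  moreover have "2 < length P\<^sub>3"
  proof (rule ccontr)
    assume "\<not> 2 < length P\<^sub>3"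
    then have "P\<^sub>3 = [v] \<or> P\<^sub>3 = [v, t]"
      using P3(2-4) by (cases P\<^sub>3; cases "tl P\<^sub>3"; cases "tl (tl P\<^sub>3)") auto
    then show False
      using P3(1,3,4) vt(1,2) by (elim disjE) simp_all
  qed
  moreover have "k\<^sub>1 < length P\<^sub>1" "k\<^sub>2 < length P\<^sub>2"
    using len(1)[OF P1] len(2)[OF P2] .
  ultimately have "long_theta l H"
    unfolding long_theta_def vwalk_length_simp using l
    by - (rule exI[of _ v], rule exI[of _ t], rule exI[of _ P\<^sub>1], rule exI[of _ P\<^sub>2], rule exI[of _ P\<^sub>3], linarith)
  then show False
    using assms(2) H(1) unfolding contains_induced_def by blast
qed

lemma long_bomb_contained:
  assumes "graph G" "adjacency.long_bomb (dominates G) l v y w xs zs" "insert v (insert y (set (xs @ w # rev zs))) \<subseteq> verts G"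
  shows "contains_induced (long_ban_the_bomb l) G"
proof -
  interpret adjacency "dominates G"
    by (rule graph_adjacency) fact
  interpret G: wf_digraph G
    using assms(1) unfolding graph_def digraph_def fin_digraph_def by blast
  let ?L = "xs @ w # rev zs"
  define S where "S = insert v (insert y (set ?L))"
  define H where "H = G \<restriction> S"
  have S: "S \<subseteq> verts G"
    unfolding S_def using assms(3) .
  have H: "induced_subgraph H G" "verts H = S"
    unfolding H_def using G.induced_induce[OF S] by auto
  note dom = induced_dominates[OF H(1), unfolded H(2)]
  have B: "bomb v y w xs zs"
    using assms(2) unfolding long_bomb_def by blast
  have ip: "ipath ?L" and len: "2 \<le> length xs" "zs \<noteq> []" and yv: "y \<notin> set ?L" "v \<notin> set ?L" "dominates G v y"
    and y: "\<And>c. c \<in> set ?L \<Longrightarrow> dominates G y c \<longleftrightarrow> c = hd xs \<or> c = hd zs"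
    and v: "\<And>c. c \<in> set ?L \<Longrightarrow> dominates G v c \<longleftrightarrow> c = hd xs \<or> c = hd zs \<or> c = w"
    using B unfolding bomb_def by blast+
  have "xs \<noteq> []"
    using len by auto
  then have mem: "hd xs \<in> set xs" "hd zs \<in> set zs"
    using len(2) by simp_all
  have hole: "hole H (y # ?L)"
    unfolding hole_induced[OF H(1)] hole_iff_cycle[OF assms(1)] H(2)
    using bomb_cycle[OF B] S unfolding S_def by auto
  have long: "l \<le> length D" if "hole H D" for D
    using that bomb_cycles_long[OF assms(2), of D]
    unfolding hole_induced[OF H(1)] hole_iff_cycle[OF assms(1)] H(2) S_def by blast
  have sep: "\<And>a b. a \<in> set xs \<Longrightarrow> b \<in> set (w # rev zs) \<Longrightarrow> a \<noteq> b \<and> (dominates G a b \<longleftrightarrow> a = last xs \<and> b = w)"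
    using ip unfolding ipath_append[of xs] by auto
  have "ipath xs"
    using ip unfolding ipath_append[of xs] by blast
  then have "hd xs \<noteq> last xs"
    using len(1) \<open>xs \<noteq> []\<close> nth_eq_iff_index_eq[OF ipath_distinct, of xs 0 "length xs - 1"]
    by (simp add: hd_conv_nth last_conv_nth)
  then have wx: "\<not> dominates G w (hd xs)"
    using sep[of "hd xs" w] mem adj_commute[of w] by simp
  have w: "w \<notin> set xs" "w \<notin> set zs"
    using ip sep[of w w] unfolding ipath_append[of xs] by auto
  then have wy: "\<not> dominates G w y"
    using y[of w] adj_commute[of w y] mem by auto
  have xz: "hd xs \<noteq> hd zs"
    using sep[of "hd xs" "hd zs"] mem by simp
  have a: "dominates G (hd xs) y" "dominates G y (hd zs)" "dominates G v w" "dominates G v (hd xs)" "dominates G v (hd zs)"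
    using y[of "hd xs"] y[of "hd zs"] v[of w] v[of "hd xs"] v[of "hd zs"] mem adj_commute[of "hd xs" y] by simp_all
  have "v \<noteq> y"
    using yv(3) adj_irrefl by blast
  then have C: "v \<notin> set (y # ?L)" "verts H = insert v (set (y # ?L))" "{hd xs, y, hd zs, w} \<subseteq> set (y # ?L)"
    using yv(2) H(2) S_def mem by auto
  have M: "hd xs \<in> S" "hd zs \<in> S" "y \<in> S" "v \<in> S" "w \<in> S"
    using mem unfolding S_def by auto
  have "\<not> dominates H (w) (hd xs)" "\<not> dominates H w y" "\<forall>c\<in>set (y # ?L) - {w, hd xs, y, hd zs}. \<not> dominates H v c"
    unfolding dom using wx wy v by auto
  moreover have "dominates H (hd xs) y" "dominates H y (hd zs)" "dominates H v w" "dominates H v (hd xs)" "dominates H v (hd zs)"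
    unfolding dom using a M by auto
  ultimately have "ban_the_bomb H"
    unfolding ban_the_bomb_def using hole C xz
    by - (rule exI[of _ "y # ?L"], rule exI[of _ v], rule exI[of _ "hd xs"], rule exI[of _ y], rule exI[of _ "hd zs"],
      rule exI[of _ w], intro conjI; assumption)
  then show ?thesis
    unfolding contains_induced_def long_ban_the_bomb_def using H(1) long by blast
qed

lemma long_bomb_exists:
  assumes "graph G" "\<not> (\<exists>C. hole G C \<and> length C = 4)" "contains_induced (long_ban_the_bomb l) G"
  obtains v y w xs zs where "adjacency.long_bomb (dominates G) l v y w xs zs"
    "insert v (insert y (set (xs @ w # rev zs))) \<subseteq> verts G"
proof -
  interpret adjacency "dominates G"
    by (rule graph_adjacency) fact
  obtain H where H: "induced_subgraph H G" "ban_the_bomb H" "\<And>C. hole H C \<Longrightarrow> l \<le> length C"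
    using assms(3) unfolding contains_induced_def long_ban_the_bomb_def by blast
  note dom = induced_dominates[OF H(1)]
  have hole: "hole H C \<longleftrightarrow> cycle C \<and> set C \<subseteq> verts H" for C
    unfolding hole_induced[OF H(1)] hole_iff_cycle[OF assms(1)] using induced_verts[OF H(1)] by blast
  obtain C v x y z w where C: "cycle C" "v \<notin> set C" "verts H = insert v (set C)" "{x, y, z, w} \<subseteq> set C" "x \<noteq> z"
    and "dominates H x y" "dominates H y z" "\<not> dominates H w x" "\<not> dominates H w y" "dominates H v w"
      "dominates H v x" "dominates H v z" "\<forall>c\<in>set C - {w, x, y, z}. \<not> dominates H v c"
    using H(2) unfolding ban_the_bomb_def hole by - (elim exE conjE, blast)
  then have a: "dominates G x y" "dominates G y z" "\<not> dominates G w x" "\<not> dominates G w y" "dominates G v w"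
      "dominates G v x" "dominates G v z" "\<forall>c\<in>set C - {w, x, y, z}. \<not> dominates G v c"
    unfolding dom by auto
  have "y \<in> set C"
    using C(4) by simp
  then obtain L' where L': "cycle (y # L')" "set C = insert y (set L')"
    by (rule cycle_from[OF C(1)]) blast
  then have ip': "ipath L'" "3 \<le> length L'" "y \<notin> set L'" "\<forall>c\<in>set L'. dominates G y c \<longleftrightarrow> c = hd L' \<or> c = last L'"
    unfolding cycle_Cons by auto
  have xz: "x \<in> set L'" "z \<in> set L'"
    using C(4) L'(2) a(1,2) adj_irrefl by auto
  then have "x = hd L' \<and> z = last L' \<or> x = last L' \<and> z = hd L'"
    using ip'(4) a(1,2) adj_commute[of x y] C(5) by auto
  \<comment> \<open>The opened cycle is reversed if necessary, so that it starts in
    \<open>x\<close>.\<close>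
  then obtain L where L: "ipath L" "set L = set L'" "hd L = x" "last L = z"
  proof
    assume "x = hd L' \<and> z = last L'"
    then show thesis using that ip'(1) by blast
  next
    assume "x = last L' \<and> z = hd L'"
    then show thesis
      using that[of "rev L'"] ipath_rev[OF ip'(1)] ip'(2) by (auto simp: hd_rev last_rev)
  qed
  have y: "dominates G y c \<longleftrightarrow> c = x \<or> c = z" if "c \<in> set L" for c
    using ip'(4) that L(2) \<open>x = hd L' \<and> z = last L' \<or> x = last L' \<and> z = hd L'\<close> by auto
  have "w \<noteq> y"
    using a(1,3) adj_commute[of x y] by auto
  then have "w \<in> set L"
    using C(4) L'(2) L(2) by auto
  then obtain xs ws where Lw: "L = xs @ w # ws"
    by (meson split_list)
  have "w \<noteq> x" "w \<noteq> z"
    using a(1,2,4) adj_commute[of y z] by auto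
  then have ne: "xs \<noteq> []" "ws \<noteq> []"
    using L(3,4) unfolding Lw by auto
  define zs where "zs = rev ws"
  have Lz: "L = xs @ w # rev zs" and zs: "zs \<noteq> []" "hd zs = z" and xs: "hd xs = x"
    using Lw ne L(3,4) unfolding zs_def by (auto simp: hd_rev)
  \<comment> \<open>\<open>w\<close> is adjacent to the last vertex of \<open>xs\<close>, but not to
    \<open>x\<close>.\<close>
  have "length xs \<noteq> 1"
  proof
    assume "length xs = 1"
    then have "xs = [x]"
      using xs by (auto simp: length_Suc_conv)
    then show False
      using L(1) a(3) adj_commute[of w x] unfolding Lz by auto
  qed
  then have len: "2 \<le> length xs"
    using ne(1) by (cases xs; cases "tl xs") auto
  have xz': "\<not> dominates G x z"
    using L(1) len zs xs C(5) unfolding Lz ipath_append[of xs]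
    by (metis (no_types, lifting) \<open>w \<noteq> z\<close> hd_in_set list.sel(1) list.set_intros(2) ne(1) set_rev)
  have vy: "dominates G v y"
  proof (rule ccontr)
    assume "\<not> dominates G v y"
    moreover have "v \<noteq> y"
      using C(2,4) by auto
    ultimately show False
      using no_hole4[OF assms(1,2), of v x y z] a(1,2,6,7) xz' C(5) adj_sym by blast
  qed
  have v: "dominates G v c \<longleftrightarrow> c = x \<or> c = z \<or> c = w" if "c \<in> set L" for c
    using that a(5-8) L(2) L'(2) ip'(3) by blast
  have yvL: "y \<notin> set L" "v \<notin> set L"
    using ip'(3) L(2) C(2) L'(2) by auto
  have B: "bomb v y w xs zs"
    unfolding bomb_def Lz[symmetric] xs zs(2) using L(1) len zs(1) yvL vy y v by blast
  have ipw: "ipath (xs @ w # rev zs)" "ipath (zs @ w # rev xs)"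
    using L(1) ipath_rev[OF L(1)] unfolding Lz by simp_all
  have sub: "set L \<subseteq> verts H" "v \<in> verts H" "y \<in> verts H"
    using C(3) L'(2) L(2) by auto
  have sep: "\<And>a b. a \<in> set xs \<Longrightarrow> b \<in> set (w # rev zs) \<Longrightarrow> a \<noteq> b"
    using ipw(1) unfolding ipath_append[of xs] by blast
  have xm: "x \<in> set xs" "z \<in> set zs"
    using xs zs ne(1) hd_in_set by blast+
  have "cycle (v # xs @ [w])"
  proof (rule bomb_arm_cycle[OF ipw(1) len])
    show "dominates G v c \<longleftrightarrow> c = hd xs \<or> c = w" if "c \<in> set (xs @ [w])" for c
      using v[of c] that sep[of z z] sep xm \<open>w \<noteq> z\<close> unfolding xs Lz by auto
  qed (use yvL in \<open>auto simp: Lz\<close>)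
  then have lx: "l \<le> length xs + 2"
    using H(3)[of "v # xs @ [w]"] sub unfolding hole Lz by auto
  have lz: "length zs = 1 \<or> l \<le> length zs + 2"
  proof (cases "2 \<le> length zs")
    case True
    have "cycle (v # zs @ [w])"
    proof (rule bomb_arm_cycle[OF ipw(2) True])
      show "dominates G v c \<longleftrightarrow> c = hd zs \<or> c = w" if "c \<in> set (zs @ [w])" for c
        using v[of c] that sep[of x c] xm \<open>w \<noteq> x\<close> unfolding zs Lz by auto
    qed (use yvL in \<open>auto simp: Lz\<close>)
    then show ?thesis
      using H(3)[of "v # zs @ [w]"] sub unfolding hole Lz by auto
  next
    case False
    then show ?thesis
      using zs(1) by (cases zs; cases "tl zs") auto
  qed
  show thesis
  proof (rule that)
    show "long_bomb l v y w xs zs"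
      unfolding long_bomb_def using B lx lz by blast
    show "insert v (insert y (set (xs @ w # rev zs))) \<subseteq> verts G"
      using sub induced_verts[OF H(1)] unfolding Lz by auto
  qed
qed

section \<open>Guessing the ends of the arms\<close>

context adjacency
begin

text \<open>A function rather than a list, since the guessed vertices are the values of numbered
  variables.\<close>

definition stem :: "nat \<Rightarrow> (nat \<Rightarrow> 'a) \<Rightarrow> bool" where
  "stem k x \<longleftrightarrow> (\<forall>i\<le>k. \<forall>j\<le>k. (x i = x j \<longrightarrow> i = j) \<and> (adj (x i) (x j) \<longleftrightarrow> j = Suc i \<or> i = Suc j))"

lemma stem_inj: "stem k x \<Longrightarrow> i \<le> k \<Longrightarrow> j \<le> k \<Longrightarrow> x i = x j \<longleftrightarrow> i = j"
  unfolding stem_def by blast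

lemma stem_adj: "stem k x \<Longrightarrow> i \<le> k \<Longrightarrow> j \<le> k \<Longrightarrow> adj (x i) (x j) \<longleftrightarrow> j = Suc i \<or> i = Suc j"
  unfolding stem_def by blast

lemma stem_ipath: "stem k x \<Longrightarrow> j \<le> Suc k \<Longrightarrow> ipath (map x [0..<j])"
  by (rule ipathI) (auto simp: distinct_map inj_on_def stem_inj stem_adj)

lemma ipath_stem: "ipath xs \<Longrightarrow> k < length xs \<Longrightarrow> stem k ((!) xs)"
  unfolding stem_def using ipath_nth nth_eq_iff_index_eq[OF ipath_distinct] by simp

text \<open>A function that rises by at most one along each edge bounds the length of a path from
  below; \<open>stem_length\<close> applies this to a distance from \<open>v\<close>.\<close>

lemma ipath_potential:
  assumes "ipath P" "P \<noteq> []" "\<And>a b. a \<in> set P \<Longrightarrow> b \<in> set P \<Longrightarrow> adj a b \<Longrightarrow> f b \<le> Suc (f a)"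
  shows "f (last P) < f (hd P) + length P"
  using assms
proof (induction P)
  case (Cons a P)
  show ?case
  proof (cases "P = []")
    case False
    then have "f (last P) < f (hd P) + length P"
      using Cons by simp
    moreover have "f (hd P) \<le> Suc (f a)"
      using Cons.prems False by simp
    ultimately show ?thesis
      using False by simp
  qed simp
qed simp

text \<open>The vertices \<open>x i\<close> with \<open>i < k - 1\<close> are followed by an induced
  path through \<open>A\<close> from \<open>x (k - 1)\<close> to \<open>u\<close>. As
  \<open>u\<close> lies outside \<open>A\<close>, this path has at least two vertices, which brings
  the length above \<open>k\<close>.\<close>

lemma stem_extend:
  assumes "stem k x" "1 \<le> k" "cn A" "x (k - 1) \<in> A" "touches u A" "u \<notin> A"
    and far: "\<And>a i. a \<in> insert u A \<Longrightarrow> a \<noteq> x (k - 1) \<Longrightarrow> i < k - 1 \<Longrightarrow> a \<noteq> x i \<and> \<not> adj a (x i)"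
  obtains xs where "ipath xs" "k < length xs" "hd xs = x 0" "last xs = u" "set xs \<subseteq> x ` {..<k} \<union> insert u A"
proof -
  obtain Q where Q: "ipath Q" "Q \<noteq> []" "hd Q = x (k - 1)" "last Q = u" "set Q \<subseteq> insert u A"
    using ipath_exists[OF cn_insert[OF assms(3,5)], of "x (k - 1)" u] assms(4) by blast
  let ?xs = "map x [0..<k - 1] @ Q"
  have "a \<noteq> b \<and> (adj a b \<longleftrightarrow> a = last (map x [0..<k - 1]) \<and> b = hd Q)"
    if ab: "a \<in> set (map x [0..<k - 1])" "b \<in> set Q" for a b
  proof -
    obtain i where i: "a = x i" "i < k - 1"
      using ab(1) by auto
    then have l: "last (map x [0..<k - 1]) = x (k - 2)"
      by (simp add: last_map numeral_2_eq_2)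
    show ?thesis
    proof (cases "b = x (k - 1)")
      case True
      then show ?thesis
        unfolding l Q(3) i(1) using stem_adj[OF assms(1), of i "k - 1"] stem_inj[OF assms(1), of i "k - 1"]
          stem_inj[OF assms(1), of i "k - 2"] i(2) by auto
    next
      case False
      then show ?thesis
        using far[of b i] ab(2) Q(3,5) i adj_commute[of a b] by auto
    qed
  qed
  then have "ipath ?xs"
    unfolding ipath_append using stem_ipath[OF assms(1), of "k - 1"] Q(1) by simp
  moreover have "length Q \<noteq> 1"
  proof
    assume "length Q = 1"
    then obtain q where "Q = [q]"
      by (auto simp: length_Suc_conv)
    then show False
      using Q(3,4) assms(4,6) by simp
  qed
  then have "2 \<le> length Q"
    using Q(2) by (cases Q; cases "tl Q") auto
  then have "k < length ?xs"
    using assms(2) by simp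
  moreover have "hd ?xs = x 0"
    using Q(2,3) by (cases "k - 1") (simp_all add: hd_append hd_map upt_conv_Cons)
  moreover have "set ?xs \<subseteq> x ` {..<k} \<union> insert u A"
    using Q(5) by auto
  ultimately show thesis
    using that[of ?xs] Q(2,4) by simp
qed

text \<open>The converse of \<open>stem_extend\<close>: from the source at index
  \<open>k - 1\<close> on, the arm without its last vertex is one side of a link, and the last
  vertex is the member of \<open>U\<close> that it carries.\<close>

lemma arm_split:
  assumes "ipath xs" "1 \<le> k" "k < length xs"
  defines "A \<equiv> set (drop (k - 1) (butlast xs))"
  shows "cn A" "xs ! (k - 1) \<in> A" "touches (last xs) A" "last xs \<notin> A"
    "\<And>a. a \<in> A \<Longrightarrow> \<exists>i\<ge>k - 1. i < length xs - 1 \<and> a = xs ! i"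
proof -
  have ne: "xs \<noteq> []"
    using assms(3) by auto
  have xs: "xs = take (k - 1) (butlast xs) @ drop (k - 1) (butlast xs) @ [last xs]"
    using ne by (simp flip: append_assoc)
  have ip: "ipath (drop (k - 1) (butlast xs) @ [last xs])"
    using assms(1) ipath_append xs by metis
  have ne': "drop (k - 1) (butlast xs) \<noteq> []"
    using assms(2,3) by simp
  show "cn A"
    unfolding A_def using ip ipath_append by (intro ipath_cn) blast
  have "last (drop (k - 1) (butlast xs)) \<in> A"
    unfolding A_def using ne' last_in_set by blast
  moreover have "adj (last (drop (k - 1) (butlast xs))) (last xs)" "last xs \<notin> A"
    using ip calculation unfolding ipath_append A_def by auto
  ultimately show "touches (last xs) A" "last xs \<notin> A"
    using touches_mem adj_sym by blast+
  have nth: "drop (k - 1) (butlast xs) ! i = xs ! (k - 1 + i)" if "k - 1 + i < length xs - 1" for i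
    using that by (simp add: nth_butlast)
  show "xs ! (k - 1) \<in> A"
    using nth[of 0] assms(2,3) nth_mem[of 0 "drop (k - 1) (butlast xs)"] unfolding A_def by simp
  show "\<exists>i\<ge>k - 1. i < length xs - 1 \<and> a = xs ! i" if a: "a \<in> A" for a
  proof -
    obtain i where "i < length (drop (k - 1) (butlast xs))" "a = drop (k - 1) (butlast xs) ! i"
      using a unfolding A_def by (metis in_set_conv_nth)
    then show ?thesis
      using nth[of i] by (intro exI[of _ "k - 1 + i"]) auto
  qed
qed

text \<open>
  If \<open>w\<close> is not adjacent to \<open>z\<close>, the vertices \<open>v\<close>, \<open>y\<close>, \<open>w\<close> and the first \<open>k + 1\<close> vertices of
  both arms are guessed.
\<close>

definition main_pattern :: "nat \<Rightarrow> 'a \<Rightarrow> 'a \<Rightarrow> 'a \<Rightarrow> (nat \<Rightarrow> 'a) \<Rightarrow> (nat \<Rightarrow> 'a) \<Rightarrow> bool" where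
  "main_pattern k v y w x z \<longleftrightarrow> stem k x \<and> stem k z \<and> (\<forall>i\<le>k. \<forall>j\<le>k. x i \<noteq> z j \<and> \<not> adj (x i) (z j)) \<and>
     (\<forall>i\<le>k. (adj v (x i) \<longleftrightarrow> i = 0) \<and> (adj v (z i) \<longleftrightarrow> i = 0) \<and> (adj y (x i) \<longleftrightarrow> i = 0) \<and> (adj y (z i) \<longleftrightarrow> i = 0) \<and>
       v \<noteq> x i \<and> v \<noteq> z i \<and> y \<noteq> x i \<and> y \<noteq> z i \<and> w \<noteq> x i \<and> w \<noteq> z i) \<and>
     (\<forall>i<k. \<not> adj w (x i) \<and> \<not> adj w (z i)) \<and> adj v y \<and> adj v w \<and> \<not> adj w y \<and> w \<noteq> y"

text \<open>\<open>S\<close> consists of the last two guessed vertices of an arm, which stay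
  available although they are adjacent to \<open>F\<close>. Excluding the neighbours of
  \<open>F\<close> also excludes the other vertices of \<open>F\<close> in both applications, since
  \<open>v\<close> and \<open>y\<close> are adjacent and \<open>x i\<close> is adjacent to
  \<open>x (Suc i)\<close>.\<close>

definition region :: "'a set \<Rightarrow> 'a set \<Rightarrow> 'a set \<Rightarrow> 'a set" where
  "region V S F = {a \<in> V. a \<in> S \<or> (\<forall>f\<in>F. \<not> adj a f)}"

definition main_region :: "'a set \<Rightarrow> nat \<Rightarrow> 'a \<Rightarrow> 'a \<Rightarrow> (nat \<Rightarrow> 'a) \<Rightarrow> (nat \<Rightarrow> 'a) \<Rightarrow> 'a set" where
  "main_region V k v y x z = region V {x (k - 1), x k, z (k - 1), z k} ({v, y} \<union> x ` {..<k} \<union> z ` {..<k})"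

lemma main_pattern_sym: "main_pattern k v y w x z \<Longrightarrow> main_pattern k v y w z x"
proof -
  assume a: "main_pattern k v y w x z"
  then have "\<forall>i\<le>k. \<forall>j\<le>k. x i \<noteq> z j \<and> \<not> adj (x i) (z j)"
    unfolding main_pattern_def by blast
  then have "\<forall>i\<le>k. \<forall>j\<le>k. z i \<noteq> x j \<and> \<not> adj (z i) (x j)"
    using adj_sym by metis
  then show ?thesis
    using a unfolding main_pattern_def by simp
qed

lemma main_region_sym: "main_region V k v y z x = main_region V k v y x z"
  unfolding main_region_def region_def by auto

lemma main_region_cases:
  assumes "a \<in> main_region V k v y x z"
  obtains "a = x (k - 1)" | "a = x k" | "a = z (k - 1)" | "a = z k"
    | "\<not> adj a v" "\<not> adj a y" "\<And>i. i < k \<Longrightarrow> \<not> adj a (x i)" "\<And>i. i < k \<Longrightarrow> \<not> adj a (z i)"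
  using assms unfolding main_region_def region_def by auto

lemma main_patternD:
  assumes "main_pattern k v y w x z"
  shows "stem k x" "stem k z" "\<And>i j. i \<le> k \<Longrightarrow> j \<le> k \<Longrightarrow> x i \<noteq> z j \<and> \<not> adj (x i) (z j) \<and> \<not> adj (z j) (x i)"
    "\<And>i. i \<le> k \<Longrightarrow> adj v (x i) \<longleftrightarrow> i = 0" "\<And>i. i \<le> k \<Longrightarrow> adj v (z i) \<longleftrightarrow> i = 0"
    "\<And>i. i \<le> k \<Longrightarrow> adj y (x i) \<longleftrightarrow> i = 0" "\<And>i. i \<le> k \<Longrightarrow> adj y (z i) \<longleftrightarrow> i = 0"
    "\<And>i. i \<le> k \<Longrightarrow> v \<noteq> x i \<and> v \<noteq> z i \<and> y \<noteq> x i \<and> y \<noteq> z i \<and> w \<noteq> x i \<and> w \<noteq> z i"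
    "\<And>i. i < k \<Longrightarrow> \<not> adj w (x i) \<and> \<not> adj w (z i)" "adj v y" "adj v w" "\<not> adj w y" "w \<noteq> y"
  using assms adj_commute unfolding main_pattern_def by auto

lemma main_region_far:
  assumes "main_pattern k v y w x z" "1 \<le> k" "a \<in> main_region V k v y x z" "a \<noteq> x (k - 1)" "i < k - 1"
  shows "a \<noteq> x i \<and> \<not> adj a (x i)"
proof -
  note D = main_patternD[OF assms(1)]
  have i: "i \<le> k" "Suc i < k" "i < k"
    using assms(5) by auto
  from assms(3) show ?thesis
  proof (cases rule: main_region_cases)
    case 5
    then have "\<not> adj a (x (Suc i))" "\<not> adj a (x i)"
      using i by auto
    then show ?thesis
      using stem_adj[OF D(1), of i "Suc i"] i by auto
  qed (use assms(4) stem_inj[OF D(1)] stem_adj[OF D(1)] D(3)[OF i(1), of k] D(3)[OF i(1), of "k - 1"] i in auto)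
qed

lemma main_region_v:
  assumes "main_pattern k v y w x z" "1 \<le> k" "a \<in> main_region V k v y x z"
  shows "adj v a \<longleftrightarrow> k = 1 \<and> (a = x 0 \<or> a = z 0)" "adj y a \<longleftrightarrow> k = 1 \<and> (a = x 0 \<or> a = z 0)" "a \<noteq> v" "a \<noteq> y" "a \<noteq> w"
proof -
  note D = main_patternD[OF assms(1)]
  have e: "x i = x j \<longleftrightarrow> i = j" "z i = z j \<longleftrightarrow> i = j" "x i \<noteq> z j" "z i \<noteq> x j" if "i \<le> k" "j \<le> k" for i j
    using that stem_inj[OF D(1)] stem_inj[OF D(2)] D(3)[of i j] D(3)[of j i] by auto
  have k: "k - 1 \<le> k" "k - 1 = 0 \<longleftrightarrow> k = 1" "k \<noteq> 0"
    using assms(2) by auto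
  have "(adj v a \<longleftrightarrow> k = 1 \<and> (a = x 0 \<or> a = z 0)) \<and> (adj y a \<longleftrightarrow> k = 1 \<and> (a = x 0 \<or> a = z 0)) \<and> a \<noteq> v \<and> a \<noteq> y \<and> a \<noteq> w"
    using assms(3)
  proof (cases rule: main_region_cases)
    case 1
    then show ?thesis
      using D(4,6,8)[OF k(1)] e[OF k(1), of 0] k by auto
  next
    case 2
    then show ?thesis
      using D(4,6,8)[of k] e[of k 0] k by auto
  next
    case 3
    then show ?thesis
      using D(5,7,8)[OF k(1)] e[OF k(1), of 0] k by auto
  next
    case 4
    then show ?thesis
      using D(5,7,8)[of k] e[of k 0] k by auto
  next
    case 5
    then have "a \<noteq> x 0" "a \<noteq> z 0"
      using D(4,5)[of 0] adj_commute[of a v] by auto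
    then show ?thesis
      using 5 D(10,11) adj_commute[of a v] adj_commute[of a y] adj_commute[of v y] adj_commute[of v w] by auto
  qed
  then show "adj v a \<longleftrightarrow> k = 1 \<and> (a = x 0 \<or> a = z 0)" "adj y a \<longleftrightarrow> k = 1 \<and> (a = x 0 \<or> a = z 0)" "a \<noteq> v" "a \<noteq> y" "a \<noteq> w"
    by blast+
qed

text \<open>This is why \<open>x k\<close> is guessed although it does not belong to
  \<open>F\<close>: all other neighbours of \<open>x (k - 1)\<close> can then be excluded from the
  region.\<close>

lemma main_pendant:
  assumes "main_pattern k v y w x z" "1 \<le> k" "a \<in> main_region V k v y x z"
  shows "adj (x (k - 1)) a \<longleftrightarrow> a = x k"
proof -
  note D = main_patternD[OF assms(1)]
  have k: "k - 1 \<le> k" "k \<le> k" "k - 1 < k" "Suc (k - 1) = k"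
    using assms(2) by auto
  have xk: "adj (x (k - 1)) (x k)"
    using stem_adj[OF D(1) k(1,2)] k(4) by simp
  from assms(3) show ?thesis
  proof (cases rule: main_region_cases)
    case 1
    then show ?thesis
      using adj_irrefl stem_inj[OF D(1) k(1,2)] k by auto
  next
    case 2
    then show ?thesis
      using xk by simp
  next
    case 3
    then show ?thesis
      using D(3)[OF k(1,1)] D(3)[OF k(2,1)] by auto
  next
    case 4
    then show ?thesis
      using D(3)[OF k(1,2)] D(3)[OF k(2,2)] by auto
  next
    case 5
    then show ?thesis
      using xk k(3) adj_commute[of a "x (k - 1)"] adj_commute[of "x k" "x (k - 1)"] by auto
  qed
qed

text \<open>The potential is 0 at \<open>v\<close>, \<open>i + 1\<close> at \<open>x i\<close> for
  \<open>i < k\<close>, and \<open>k + 1\<close> elsewhere. The region meets the stem only at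
  \<open>x (k - 1)\<close>, so no edge raises the potential by more than one. The other source is
  kept out because it is adjacent to \<open>v\<close> if \<open>k = 1\<close>.\<close>

lemma stem_length:
  assumes pat: "main_pattern k v y w x z" and k: "1 \<le> k"
    and Y: "Y \<subseteq> main_region V k v y x z" "z (k - 1) \<notin> Y" and t: "t \<in> main_region V k v y x z" "t \<noteq> x (k - 1)" "t \<noteq> z (k - 1)"
    and P: "ipath P" "P \<noteq> []" "hd P = v" "last P = t" "set P \<subseteq> insert v (insert t (x ` {..<k - 1} \<union> Y))"
  shows "k + 1 < length P"
proof -
  note D = main_patternD[OF pat]
  define f where "f a = (if a = v then 0 else if a \<in> x ` {..<k} then Suc (the_inv_into {..<k} x a) else Suc k)" for a
  have inj: "inj_on x {..<k}"
    using stem_inj[OF D(1)] by (auto simp: inj_on_def)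
  have fx: "f (x i) = Suc i" if "i < k" for i
    unfolding f_def using that D(8)[of i] the_inv_into_f_f[OF inj, of i] by auto
  have fo: "f a = Suc k" if "a \<noteq> v" "a \<notin> x ` {..<k}" for a
    unfolding f_def using that by simp
  have fv: "f v = 0"
    unfolding f_def by simp
  have f_le: "f a \<le> Suc k" for a
    by (cases "a = v"; cases "a \<in> x ` {..<k}") (use fx fo fv in auto)
  have tx: "t \<notin> x ` {..<k}"
  proof
    assume "t \<in> x ` {..<k}"
    then obtain i where "t = x i" "i < k" by blast
    moreover from this have "i < k - 1"
      using t(2) by (cases "i = k - 1") auto
    ultimately show False
      using main_region_far[OF pat k t(1,2)] by blast
  qed
  have step: "f b \<le> Suc (f a)" if ab: "a \<in> set P" "b \<in> set P" "adj a b" for a b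
  proof -
    have b: "b = v \<or> b \<in> x ` {..<k - 1} \<or> b \<in> main_region V k v y x z \<and> b \<noteq> z (k - 1)"
      using P(5) ab(2) Y t by auto
    consider "a = v" | i where "a = x i" "i < k" | "a \<noteq> v" "a \<notin> x ` {..<k}"
      by blast
    then show ?thesis
    proof cases
      case 1
      have "b = x 0"
        using b
      proof (elim disjE)
        assume "b \<in> x ` {..<k - 1}"
        then obtain i where "b = x i" "i < k - 1" by blast
        then show ?thesis
          using D(4)[of i] ab(3) 1 by simp
      next
        assume "b \<in> main_region V k v y x z \<and> b \<noteq> z (k - 1)"
        then show ?thesis
          using main_region_v(1)[OF pat k, of b] ab(3) 1 by auto
      qed (use 1 ab(3) adj_irrefl in auto)
      then show ?thesis
        using fx[of 0] k by simp
    next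
      case (2 i)
      show ?thesis
      proof (cases "b \<in> x ` {..<k}")
        case True
        then obtain j where "b = x j" "j < k" by blast
        then show ?thesis
          using 2 fx stem_adj[OF D(1), of i j] ab(3) by auto
      next
        case False
        show ?thesis
        proof (cases "b = v \<or> i = k - 1")
          case True
          then show ?thesis
            using fv f_le[of b] fx[of i] 2 k by auto
        next
          case bi: False
          have "b \<in> main_region V k v y x z" "b \<noteq> x (k - 1)" "i < k - 1"
            using b False bi 2 k by auto
          then show ?thesis
            using main_region_far[OF pat k, of b V i] ab(3) 2 adj_commute[of a b] by blast
        qed
      qed
    next
      case 3
      then show ?thesis
        using fo f_le[of b] by simp
    qed
  qed
  have "t \<noteq> v"
    using main_region_v(3)[OF pat k t(1)] .
  then have "f t = Suc k"
    using fo tx by blast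
  moreover have "f (last P) < f (hd P) + length P"
    by (rule ipath_potential[OF P(1,2) step])
  ultimately show ?thesis
    using P(3,4) fv by simp
qed

end

section \<open>Between bombs and guessed patterns\<close>

context adjacency
begin

lemma bomb_cross:
  assumes "bomb v y w xs zs"
  shows "\<And>c d. c \<in> set xs \<Longrightarrow> d \<in> set zs \<Longrightarrow> c \<noteq> d \<and> \<not> adj c d \<and> \<not> adj d c"
    "\<And>c. c \<in> set xs \<Longrightarrow> c \<noteq> w \<and> (adj c w \<longleftrightarrow> c = last xs)" "\<And>d. d \<in> set zs \<Longrightarrow> d \<noteq> w \<and> (adj d w \<longleftrightarrow> d = last zs)"
    "ipath xs" "ipath zs"
proof -
  have ip: "ipath (xs @ w # rev zs)" and ip': "ipath (zs @ w # rev xs)" and zs: "zs \<noteq> []"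
    using assms ipath_rev[of "xs @ w # rev zs"] unfolding bomb_def by auto
  have w: "w \<notin> set zs"
    using ip unfolding ipath_append[of xs] by auto
  show c: "c \<noteq> d \<and> \<not> adj c d \<and> \<not> adj d c" if "c \<in> set xs" "d \<in> set zs" for c d
    using ip that w adj_commute[of d c] unfolding ipath_append[of xs] by auto
  show "c \<noteq> w \<and> (adj c w \<longleftrightarrow> c = last xs)" if "c \<in> set xs" for c
    using ip that unfolding ipath_append[of xs] by auto
  show "d \<noteq> w \<and> (adj d w \<longleftrightarrow> d = last zs)" if "d \<in> set zs" for d
    using ip' that unfolding ipath_append[of zs] by auto
  show "ipath xs" "ipath zs"
    using ip ip' unfolding ipath_append[of xs] ipath_append[of zs] by blast+
qed

lemma bomb_heads:
  assumes "bomb v y w xs zs"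
  shows "\<And>c. c \<in> set xs \<Longrightarrow> (adj v c \<longleftrightarrow> c = hd xs) \<and> (adj y c \<longleftrightarrow> c = hd xs) \<and> v \<noteq> c \<and> y \<noteq> c"
    "\<And>c. c \<in> set zs \<Longrightarrow> (adj v c \<longleftrightarrow> c = hd zs) \<and> (adj y c \<longleftrightarrow> c = hd zs) \<and> v \<noteq> c \<and> y \<noteq> c"
    "adj v w" "\<not> adj y w" "adj v y" "w \<noteq> y"
proof -
  have b: "\<And>c. c \<in> set (xs @ w # rev zs) \<Longrightarrow> (adj y c \<longleftrightarrow> c = hd xs \<or> c = hd zs) \<and> (adj v c \<longleftrightarrow> c = hd xs \<or> c = hd zs \<or> c = w)"
    and yv: "y \<notin> set (xs @ w # rev zs)" "v \<notin> set (xs @ w # rev zs)" and len: "2 \<le> length xs" "zs \<noteq> []" and vy: "adj v y"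
    using assms unfolding bomb_def by blast+
  have "xs \<noteq> []"
    using len by auto
  then have m: "hd xs \<in> set xs" "hd zs \<in> set zs"
    using len(2) by simp_all
  note c = bomb_cross[OF assms]
  show "(adj v c \<longleftrightarrow> c = hd xs) \<and> (adj y c \<longleftrightarrow> c = hd xs) \<and> v \<noteq> c \<and> y \<noteq> c" if "c \<in> set xs" for c
    using b[of c] c(1)[OF that m(2)] c(2)[OF that] yv that by auto
  show "(adj v c \<longleftrightarrow> c = hd zs) \<and> (adj y c \<longleftrightarrow> c = hd zs) \<and> v \<noteq> c \<and> y \<noteq> c" if "c \<in> set zs" for c
    using b[of c] c(1)[OF m(1) that] c(3)[OF that] yv that by auto
  show "adj v w" "\<not> adj y w" "adj v y" "w \<noteq> y"
    using b[of w] c(2)[OF m(1)] c(3)[OF m(2)] vy yv by auto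
qed

lemma bomb_main_pattern:
  assumes B: "bomb v y w xs zs" and k: "k < length xs" "k < length zs"
  shows "main_pattern k v y w ((!) xs) ((!) zs)"
proof -
  note c = bomb_cross[OF B] and h = bomb_heads[OF B]
  have m: "xs ! i \<in> set xs" "zs ! i \<in> set zs" if "i \<le> k" for i
    using k that by auto
  have "xs \<noteq> []" "zs \<noteq> []"
    using k by auto
  then have hd: "xs ! i = hd xs \<longleftrightarrow> i = 0" "zs ! i = hd zs \<longleftrightarrow> i = 0" if "i \<le> k" for i
    using k that nth_eq_iff_index_eq[OF ipath_distinct[OF c(4)], of i 0]
      nth_eq_iff_index_eq[OF ipath_distinct[OF c(5)], of i 0] by (simp_all add: hd_conv_nth)
  have last: "xs ! i \<noteq> last xs" "zs ! i \<noteq> last zs" if "i < k" for i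
    using k that \<open>xs \<noteq> []\<close> \<open>zs \<noteq> []\<close> nth_eq_iff_index_eq[OF ipath_distinct[OF c(4)], of i "length xs - 1"]
      nth_eq_iff_index_eq[OF ipath_distinct[OF c(5)], of i "length zs - 1"] by (simp_all add: last_conv_nth)
  have 1: "(adj v (xs ! i) \<longleftrightarrow> i = 0) \<and> (adj v (zs ! i) \<longleftrightarrow> i = 0) \<and> (adj y (xs ! i) \<longleftrightarrow> i = 0) \<and> (adj y (zs ! i) \<longleftrightarrow> i = 0) \<and>
       v \<noteq> xs ! i \<and> v \<noteq> zs ! i \<and> y \<noteq> xs ! i \<and> y \<noteq> zs ! i \<and> w \<noteq> xs ! i \<and> w \<noteq> zs ! i" if "i \<le> k" for i
    using h(1)[OF m(1)[OF that]] h(2)[OF m(2)[OF that]] hd[OF that] c(2)[OF m(1)[OF that]] c(3)[OF m(2)[OF that]] by auto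
  have 2: "\<not> adj w (xs ! i) \<and> \<not> adj w (zs ! i)" if "i < k" for i
    using c(2)[OF m(1)[of i]] c(3)[OF m(2)[of i]] last[OF that] that adj_commute[of w] by auto
  have 3: "xs ! i \<noteq> zs ! j \<and> \<not> adj (xs ! i) (zs ! j)" if "i \<le> k" "j \<le> k" for i j
    using c(1) m that by blast
  show ?thesis
    unfolding main_pattern_def
    using ipath_stem[OF c(4) k(1)] ipath_stem[OF c(5) k(2)] 1 2 3 h(3-6) adj_commute[of w y] by blast
qed

lemma main_region_x0:
  assumes "main_pattern k v y w x z" "1 \<le> k" "a \<in> main_region V k v y x z" "a = x 0"
  shows "k = 1"
proof (rule ccontr)
  assume "k \<noteq> 1"
  then have "x 0 \<noteq> x (k - 1)"
    using stem_inj[OF main_patternD(1)[OF assms(1)], of 0 "k - 1"] assms(2) by auto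
  then show False
    using main_region_far[OF assms(1-3), of 0] assms(2,4) \<open>k \<noteq> 1\<close> by auto
qed

lemma main_adj_v:
  assumes "main_pattern k v y w x z" "1 \<le> k" "c \<in> x ` {..<k} \<union> z ` {..<k} \<union> main_region V k v y x z"
  shows "(adj v c \<longleftrightarrow> c = x 0 \<or> c = z 0) \<and> (adj y c \<longleftrightarrow> c = x 0 \<or> c = z 0) \<and> c \<noteq> v \<and> c \<noteq> y \<and> c \<noteq> w"
proof -
  note D = main_patternD[OF assms(1)]
  from assms(3) consider i where "c = x i" "i < k" | i where "c = z i" "i < k" | "c \<in> main_region V k v y x z"
    by blast
  then show ?thesis
  proof cases
    case (1 i)
    then show ?thesis
      using D(3)[of i 0] D(4,6,8)[of i] stem_inj[OF D(1), of i 0] by auto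
  next
    case (2 i)
    then show ?thesis
      using D(3)[of 0 i] D(5,7,8)[of i] stem_inj[OF D(2), of i 0] by auto
  next
    case 3
    then show ?thesis
      using main_region_v[OF assms(1,2) 3] main_region_x0[OF assms(1,2) 3]
        main_region_x0[OF main_pattern_sym[OF assms(1)] assms(2), of c V] main_region_sym[of V k v y z x] by auto
  qed
qed

text \<open>\<open>stem_extend\<close> turns the two connected sets into induced arms.
  Anticompleteness carries over to the arms, since the region sees the stems only at the
  sources.\<close>

lemma main_sound:
  assumes pat: "main_pattern k v y w x z" and k: "1 \<le> k"
    and A: "cn A" "A \<subseteq> main_region V k v y x z" "x (k - 1) \<in> A" "\<And>c. c \<in> A \<Longrightarrow> \<not> adj c w"
    and B: "cn B" "B \<subseteq> main_region V k v y x z" "z (k - 1) \<in> B" "\<And>c. c \<in> B \<Longrightarrow> \<not> adj c w"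
    and a: "a \<in> main_region V k v y x z" "adj a w" "touches a A"
    and b: "b \<in> main_region V k v y x z" "adj b w" "touches b B"
    and sep: "sep (insert a A) (insert b B)"
  obtains xs zs where "bomb v y w xs zs" "k < length xs" "k < length zs" "set xs \<union> set zs \<subseteq> x ` {..<k} \<union> z ` {..<k} \<union> V"
proof -
  let ?R = "main_region V k v y x z"
  note D = main_patternD[OF pat]
  have pat': "main_pattern k v y w z x"
    by (rule main_pattern_sym[OF pat])
  have R': "main_region V k v y z x = ?R"
    by (rule main_region_sym)
  have far': "c \<noteq> z i \<and> \<not> adj c (z i)" if "c \<in> ?R" "c \<noteq> z (k - 1)" "i < k - 1" for c i
    using main_region_far[OF pat' k, of c V i] that R' by simp
  have aA: "a \<notin> A" "b \<notin> B"
    using a(2) b(2) A(4) B(4) by blast+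
  have xA: "c \<noteq> x (k - 1)" if "c \<in> insert b B" for c
    using sep A(3) that unfolding sep_def by blast
  have zB: "c \<noteq> z (k - 1)" if "c \<in> insert a A" for c
    using sep B(3) that unfolding sep_def by blast
  have inA: "c \<in> ?R" if "c \<in> insert a A" for c
    using that A(2) a(1) by blast
  have inB: "c \<in> ?R" if "c \<in> insert b B" for c
    using that B(2) b(1) by blast
  obtain xs where xs: "ipath xs" "k < length xs" "hd xs = x 0" "last xs = a" "set xs \<subseteq> x ` {..<k} \<union> insert a A"
    by (rule stem_extend[OF D(1) k A(1,3) a(3) aA(1)]) (use main_region_far[OF pat k inA] in blast)+
  obtain zs where zs: "ipath zs" "k < length zs" "hd zs = z 0" "last zs = b" "set zs \<subseteq> z ` {..<k} \<union> insert b B"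
    by (rule stem_extend[OF D(2) k B(1,3) b(3) aA(2)]) (use far'[OF inB] in blast)+
  have split: "u ` {..<k} = insert (u (k - 1)) (u ` {..<k - 1})" for u :: "nat \<Rightarrow> 'a"
  proof -
    have "{..<k} = insert (k - 1) {..<k - 1}"
      using k by auto
    then show ?thesis by (metis image_insert)
  qed
  have 1: "sep (x ` {..<k - 1}) (z ` {..<k - 1})"
    unfolding sep_def using D(3) by auto
  have 2: "sep (x ` {..<k - 1}) (insert b B)"
    unfolding sep_def using main_region_far[OF pat k inB xA] adj_sym by blast
  have 3: "sep (insert a A) (z ` {..<k - 1})"
    unfolding sep_def using far'[OF inA zB] adj_sym by blast
  have "sep (x ` {..<k - 1} \<union> insert a A) (z ` {..<k - 1} \<union> insert b B)"
    unfolding sep_Un_left[of "x ` {..<k - 1}"] sep_Un_right[of _ "z ` {..<k - 1}"] using 1 2 3 sep by blast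
  moreover have "set xs \<subseteq> x ` {..<k - 1} \<union> insert a A" "set zs \<subseteq> z ` {..<k - 1} \<union> insert b B"
    using xs(5) zs(5) A(3) B(3) unfolding split by auto
  ultimately have sep': "sep (set xs) (set zs)"
    using sep_mono by blast
  have all: "(adj v c \<longleftrightarrow> c = x 0 \<or> c = z 0) \<and> (adj y c \<longleftrightarrow> c = x 0 \<or> c = z 0) \<and> c \<noteq> v \<and> c \<noteq> y \<and> c \<noteq> w"
    if "c \<in> set xs \<union> set zs" for c
  proof (rule main_adj_v[OF pat k, of c V])
    have "insert a A \<subseteq> ?R" "insert b B \<subseteq> ?R"
      using A(2) a(1) B(2) b(1) by simp_all
    then have "set xs \<subseteq> x ` {..<k} \<union> ?R" "set zs \<subseteq> z ` {..<k} \<union> ?R"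
      using subset_trans[OF xs(5) Un_mono[OF subset_refl]] subset_trans[OF zs(5) Un_mono[OF subset_refl]] by simp_all
    then show "c \<in> x ` {..<k} \<union> z ` {..<k} \<union> ?R"
      using that by (metis Un_iff subsetD)
  qed
  have xw: "c \<noteq> w \<and> (adj c w \<longleftrightarrow> c = a)" if c: "c \<in> set xs" for c
  proof -
    have "c \<noteq> w"
      using all[of c] c by blast
    moreover have "adj c w \<longleftrightarrow> c = a"
    proof -
      consider i where "c = x i" "i < k" | "c = a" | "c \<in> A"
        using xs(5) c by blast
      then show ?thesis
      proof cases
        case (1 i)
        then have "\<not> adj c w"
          using D(9)[of i] adj_commute[of w c] by blast
        then show ?thesis
          using a(2) by blast
      next
        case 3
        then show ?thesis
          using A(4) a(2) by blast
      qed (use a(2) in blast)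
    qed
    ultimately show ?thesis ..
  qed
  have zw: "c \<noteq> w \<and> (adj c w \<longleftrightarrow> c = b)" if c: "c \<in> set zs" for c
  proof -
    have "c \<noteq> w"
      using all[of c] c by blast
    moreover have "adj c w \<longleftrightarrow> c = b"
    proof -
      consider i where "c = z i" "i < k" | "c = b" | "c \<in> B"
        using zs(5) c by blast
      then show ?thesis
      proof cases
        case (1 i)
        then have "\<not> adj c w"
          using D(9)[of i] adj_commute[of w c] by blast
        then show ?thesis
          using b(2) by blast
      next
        case 3
        then show ?thesis
          using B(4) b(2) by blast
      qed (use b(2) in blast)
    qed
    ultimately show ?thesis ..
  qed
  have ne: "xs \<noteq> []" "zs \<noteq> []"
    using xs(2) zs(2) by auto
  have "adj w c \<longleftrightarrow> c = hd (rev zs)" if "c \<in> set (rev zs)" for c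
    using zw[of c] that adj_commute[of w c] zs(4) ne(2) by (simp add: hd_rev)
  then have "ipath (w # rev zs)"
    using ipath_rev[OF zs(1)] zw by auto
  moreover have "c \<noteq> d \<and> (adj c d \<longleftrightarrow> c = last xs \<and> d = hd (w # rev zs))"
    if "c \<in> set xs" "d \<in> set (w # rev zs)" for c d
  proof (cases "d = w")
    case True
    then show ?thesis
      using xw[OF that(1)] xs(4) by simp
  next
    case False
    then show ?thesis
      using sep' that unfolding sep_def by auto
  qed
  ultimately have ip: "ipath (xs @ w # rev zs)"
    unfolding ipath_append[of xs] using xs(1) by blast
  have w0: "w \<noteq> x 0" "w \<noteq> z 0" "w \<noteq> v"
    using D(8)[of 0] D(11) adj_irrefl by auto
  have "bomb v y w xs zs"
    unfolding bomb_def xs(3) zs(3)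
  proof (intro conjI ballI)
    show "ipath (xs @ w # rev zs)" "2 \<le> length xs" "zs \<noteq> []" "adj v y"
      using ip k xs(2) ne D(10) by auto
    show "y \<notin> set (xs @ w # rev zs)" "v \<notin> set (xs @ w # rev zs)"
      using all D(13) w0 by auto
    fix c
    assume c: "c \<in> set (xs @ w # rev zs)"
    show "adj y c \<longleftrightarrow> c = x 0 \<or> c = z 0" "adj v c \<longleftrightarrow> c = x 0 \<or> c = z 0 \<or> c = w"
      using c all[of c] w0 D(11,12) adj_commute[of w y] by auto
  qed
  moreover have "?R \<subseteq> V"
    unfolding main_region_def region_def by blast
  have un: "S \<subseteq> X \<union> V \<Longrightarrow> T \<subseteq> Z \<union> V \<Longrightarrow> S \<union> T \<subseteq> X \<union> Z \<union> V" for S T X Z :: "'a set"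
    by blast
  from \<open>?R \<subseteq> V\<close> have "insert a A \<subseteq> V" "insert b B \<subseteq> V"
    using A(2) a(1) B(2) b(1) by auto
  then have "set xs \<subseteq> x ` {..<k} \<union> V" "set zs \<subseteq> z ` {..<k} \<union> V"
    using subset_trans[OF xs(5) Un_mono[OF subset_refl]] subset_trans[OF zs(5) Un_mono[OF subset_refl]] by simp_all
  then have "set xs \<union> set zs \<subseteq> x ` {..<k} \<union> z ` {..<k} \<union> V"
    by (rule un)
  ultimately show thesis
    using that xs(2) zs(2) by blast
qed

text \<open>Only \<open>xs\<close> is treated; the other arm follows by exchanging the two with
  \<open>bomb_swap\<close>.\<close>

lemma main_complete:
  assumes B: "bomb v y w xs zs" and k: "1 \<le> k" "k < length xs" "k < length zs" and V: "set xs \<union> set zs \<subseteq> V"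
    and xz: "\<And>i. i \<le> k \<Longrightarrow> xs ! i = x i" "\<And>i. i \<le> k \<Longrightarrow> zs ! i = z i"
  shows "\<And>i. k - 1 \<le> i \<Longrightarrow> i < length xs \<Longrightarrow> xs ! i \<in> main_region V k v y x z"
proof -
  note c = bomb_cross[OF B] and h = bomb_heads[OF B]
  have "xs \<noteq> []"
    using k by auto
  fix i
  assume i: "k - 1 \<le> i" "i < length xs"
  then have m: "xs ! i \<in> set xs" "xs ! i \<in> V"
    using V by auto
  show "xs ! i \<in> main_region V k v y x z"
  proof (cases "i \<le> k")
    case True
    then have "i = k - 1 \<or> i = k"
      using i by auto
    then show ?thesis
      using m xz(1)[of i] True unfolding main_region_def region_def by auto
  next
    case False
    have "xs ! i \<noteq> hd xs"
      using False i(2) nth_eq_iff_index_eq[OF ipath_distinct[OF c(4)], of i 0] \<open>xs \<noteq> []\<close> by (simp add: hd_conv_nth)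
    then have "\<not> adj (xs ! i) v" "\<not> adj (xs ! i) y"
      using h(1)[OF m(1)] adj_commute[of "xs ! i"] by auto
    moreover have "\<not> adj (xs ! i) (x j)" "\<not> adj (xs ! i) (z j)" if "j < k" for j
    proof -
      have "z j \<in> set zs"
        using that k xz(2)[of j] nth_mem[of j zs] by simp
      then show "\<not> adj (xs ! i) (x j)" "\<not> adj (xs ! i) (z j)"
        using that ipath_nth[OF c(4) i(2), of j] False k xz(1)[of j] c(1)[OF m(1)] by auto
    qed
    ultimately show ?thesis
      using m(2) unfolding main_region_def region_def by auto
  qed
qed


text \<open>
  Otherwise \<open>w\<close> is adjacent to \<open>z\<close>, and only the first vertices of one arm are guessed.
\<close>

definition short_pattern :: "nat \<Rightarrow> 'a \<Rightarrow> 'a \<Rightarrow> 'a \<Rightarrow> 'a \<Rightarrow> (nat \<Rightarrow> 'a) \<Rightarrow> bool" where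
  "short_pattern k v y w z x \<longleftrightarrow> stem k x \<and>
     (\<forall>i\<le>k. (adj v (x i) \<longleftrightarrow> i = 0) \<and> (adj y (x i) \<longleftrightarrow> i = 0) \<and> v \<noteq> x i \<and> y \<noteq> x i \<and> w \<noteq> x i \<and> z \<noteq> x i \<and> \<not> adj z (x i)) \<and>
     (\<forall>i<k. \<not> adj w (x i)) \<and> adj v z \<and> adj y z \<and> adj v y \<and> adj v w \<and> adj w z \<and> \<not> adj w y \<and> w \<noteq> y"

definition short_region :: "'a set \<Rightarrow> nat \<Rightarrow> 'a \<Rightarrow> 'a \<Rightarrow> 'a \<Rightarrow> (nat \<Rightarrow> 'a) \<Rightarrow> 'a set" where
  "short_region V k v y z x = region V {x (k - 1), x k} ({v, y, z} \<union> x ` {..<k})"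

lemma short_patternD:
  assumes "short_pattern k v y w z x"
  shows "stem k x" "\<And>i. i \<le> k \<Longrightarrow> (adj v (x i) \<longleftrightarrow> i = 0) \<and> (adj y (x i) \<longleftrightarrow> i = 0) \<and> v \<noteq> x i \<and> y \<noteq> x i \<and>
      w \<noteq> x i \<and> z \<noteq> x i \<and> \<not> adj z (x i)"
    "\<And>i. i < k \<Longrightarrow> \<not> adj w (x i)" "adj v z" "adj y z" "adj v y" "adj v w" "adj w z" "\<not> adj w y" "w \<noteq> y"
  using assms unfolding short_pattern_def by auto

lemma short_region_cases:
  assumes "a \<in> short_region V k v y z x"
  obtains "a = x (k - 1)" | "a = x k"
    | "\<not> adj a v" "\<not> adj a y" "\<not> adj a z" "\<And>i. i < k \<Longrightarrow> \<not> adj a (x i)"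
  using assms unfolding short_region_def region_def by auto

lemma short_region_far:
  assumes "short_pattern k v y w z x" "1 \<le> k" "a \<in> short_region V k v y z x" "a \<noteq> x (k - 1)" "i < k - 1"
  shows "a \<noteq> x i \<and> \<not> adj a (x i)"
proof -
  note D = short_patternD[OF assms(1)]
  have i: "i \<le> k" "Suc i < k" "i < k"
    using assms(5) by auto
  from assms(3) show ?thesis
  proof (cases rule: short_region_cases)
    case 3
    then have "\<not> adj a (x (Suc i))" "\<not> adj a (x i)"
      using i by auto
    then show ?thesis
      using stem_adj[OF D(1), of i "Suc i"] i by auto
  qed (use assms(4) stem_inj[OF D(1)] stem_adj[OF D(1)] i in auto)
qed

lemma short_pendant:
  assumes "short_pattern k v y w z x" "1 \<le> k" "a \<in> short_region V k v y z x"
  shows "adj (x (k - 1)) a \<longleftrightarrow> a = x k"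
proof -
  note D = short_patternD[OF assms(1)]
  have k: "k - 1 \<le> k" "k \<le> k" "k - 1 < k" "Suc (k - 1) = k"
    using assms(2) by auto
  have xk: "adj (x (k - 1)) (x k)"
    using stem_adj[OF D(1) k(1,2)] k(4) by simp
  from assms(3) show ?thesis
  proof (cases rule: short_region_cases)
    case 1
    then show ?thesis
      using adj_irrefl stem_inj[OF D(1) k(1,2)] k by auto
  next
    case 2
    then show ?thesis
      using xk by simp
  next
    case 3
    then show ?thesis
      using xk k(3) adj_commute[of a "x (k - 1)"] adj_commute[of "x k" "x (k - 1)"] by auto
  qed
qed

lemma short_adj:
  assumes "short_pattern k v y w z x" "1 \<le> k" "c \<in> x ` {..<k} \<union> short_region V k v y z x"
  shows "(adj v c \<longleftrightarrow> c = x 0) \<and> (adj y c \<longleftrightarrow> c = x 0) \<and> \<not> adj z c \<and> c \<noteq> v \<and> c \<noteq> y \<and> c \<noteq> w \<and> c \<noteq> z"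
proof -
  note D = short_patternD[OF assms(1)]
  have x: "(adj v (x i) \<longleftrightarrow> x i = x 0) \<and> (adj y (x i) \<longleftrightarrow> x i = x 0) \<and> \<not> adj z (x i) \<and> x i \<noteq> v \<and> x i \<noteq> y \<and> x i \<noteq> w \<and> x i \<noteq> z"
    if "i \<le> k" for i
    using D(2)[OF that] stem_inj[OF D(1) that, of 0] by auto
  have far: ?thesis if "\<not> adj c v" "\<not> adj c y" "\<not> adj c z"
  proof -
    have "c \<noteq> x 0"
      using that(1) D(2)[of 0] adj_commute[of c v] by auto
    then show ?thesis
      using that D(4-8) adj_commute[of c] adj_commute[of y v] adj_commute[of w v] adj_commute[of z v] by auto
  qed
  show ?thesis
  proof (cases "c \<in> x ` {..<k}")
    case True
    then obtain i where "c = x i" "i \<le> k"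
      by auto
    then show ?thesis
      using x[of i] unfolding \<open>c = x i\<close> by blast
  next
    case False
    then have "c \<in> short_region V k v y z x"
      using assms(3) by blast
    then show ?thesis
      by (cases rule: short_region_cases) (use x[of "k - 1"] x[of k] far in auto)
  qed
qed

text \<open>The arm \<open>[z]\<close> is complete, and no vertex of the region is adjacent to
  \<open>z\<close>, so a single connected set decides.\<close>

lemma short_sound:
  assumes pat: "short_pattern k v y w z x" and k: "1 \<le> k"
    and A: "cn A" "A \<subseteq> short_region V k v y z x" "x (k - 1) \<in> A" "\<And>c. c \<in> A \<Longrightarrow> \<not> adj c w"
    and a: "a \<in> short_region V k v y z x" "adj a w" "touches a A"
  obtains xs where "bomb v y w xs [z]" "k < length xs" "set xs \<subseteq> x ` {..<k} \<union> V"
proof -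
  let ?R = "short_region V k v y z x"
  note D = short_patternD[OF pat]
  have aA: "a \<notin> A"
    using a(2) A(4) by blast
  have inA: "c \<in> ?R" if "c \<in> insert a A" for c
    using that A(2) a(1) by blast
  obtain xs where xs: "ipath xs" "k < length xs" "hd xs = x 0" "last xs = a" "set xs \<subseteq> x ` {..<k} \<union> insert a A"
    by (rule stem_extend[OF D(1) k A(1,3) a(3) aA]) (use short_region_far[OF pat k inA] in blast)+
  have all: "(adj v c \<longleftrightarrow> c = x 0) \<and> (adj y c \<longleftrightarrow> c = x 0) \<and> \<not> adj z c \<and> c \<noteq> v \<and> c \<noteq> y \<and> c \<noteq> w \<and> c \<noteq> z"
    if "c \<in> set xs" for c
  proof (rule short_adj[OF pat k, of c V])
    have "insert a A \<subseteq> ?R"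
      using A(2) a(1) by simp
    then show "c \<in> x ` {..<k} \<union> ?R"
      using that subset_trans[OF xs(5) Un_mono[OF subset_refl]] by (metis subsetD)
  qed
  have xw: "adj c w \<longleftrightarrow> c = a" if c: "c \<in> set xs" for c
  proof -
    consider i where "c = x i" "i < k" | "c = a" | "c \<in> A"
      using xs(5) c by blast
    then show ?thesis
    proof cases
      case (1 i)
      then have "\<not> adj c w"
        using D(3)[of i] adj_commute[of w c] by blast
      then show ?thesis
        using a(2) by blast
    next
      case 3
      then show ?thesis
        using A(4) a(2) by blast
    qed (use a(2) in blast)
  qed
  have ne: "xs \<noteq> []"
    using xs(2) by auto
  have wz: "w \<noteq> z" "adj w z"
    using D(8) adj_irrefl by auto
  have "c \<noteq> d \<and> (adj c d \<longleftrightarrow> c = last xs \<and> d = hd [w, z])" if "c \<in> set xs" "d \<in> set [w, z]" for c d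
    using that xw[OF that(1)] all[OF that(1)] xs(4) wz adj_commute[of c z] by auto
  then have ip: "ipath (xs @ w # rev [z])"
    unfolding ipath_append[of xs] using xs(1) wz by auto
  have "bomb v y w xs [z]"
    unfolding bomb_def xs(3)
  proof (intro conjI ballI)
    show "ipath (xs @ w # rev [z])" "2 \<le> length xs" "[z] \<noteq> []" "adj v y"
      using ip k xs(2) D(6) by auto
    show "y \<notin> set (xs @ w # rev [z])" "v \<notin> set (xs @ w # rev [z])"
      using all D(4,5,7,10) adj_irrefl by auto
    fix c
    assume c: "c \<in> set (xs @ w # rev [z])"
    show "adj y c \<longleftrightarrow> c = x 0 \<or> c = hd [z]" "adj v c \<longleftrightarrow> c = x 0 \<or> c = hd [z] \<or> c = w"
      using c all[of c] D(2)[of 0] D(4,5,7,9) wz adj_commute[of w y] by auto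
  qed
  moreover have "?R \<subseteq> V"
    unfolding short_region_def region_def by blast
  then have "insert a A \<subseteq> V"
    using A(2) a(1) by auto
  then have "set xs \<subseteq> x ` {..<k} \<union> V"
    using subset_trans[OF xs(5) Un_mono[OF subset_refl]] by simp
  ultimately show thesis
    using that xs(2) by blast
qed

lemma bomb_short_pattern:
  assumes B: "bomb v y w xs [z]" and k: "k < length xs"
  shows "short_pattern k v y w z ((!) xs)"
proof -
  note c = bomb_cross[OF B] and h = bomb_heads[OF B]
  have m: "xs ! i \<in> set xs" if "i \<le> k" for i
    using k that by auto
  have "xs \<noteq> []"
    using k by auto
  then have hd: "xs ! i = hd xs \<longleftrightarrow> i = 0" if "i \<le> k" for i
    using k that nth_eq_iff_index_eq[OF ipath_distinct[OF c(4)], of i 0] by (simp add: hd_conv_nth)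
  have last: "xs ! i \<noteq> last xs" if "i < k" for i
    using k that \<open>xs \<noteq> []\<close> nth_eq_iff_index_eq[OF ipath_distinct[OF c(4)], of i "length xs - 1"]
    by (simp add: last_conv_nth)
  have 1: "(adj v (xs ! i) \<longleftrightarrow> i = 0) \<and> (adj y (xs ! i) \<longleftrightarrow> i = 0) \<and> v \<noteq> xs ! i \<and> y \<noteq> xs ! i \<and> w \<noteq> xs ! i \<and> z \<noteq> xs ! i \<and> \<not> adj z (xs ! i)"
    if "i \<le> k" for i
    using h(1)[OF m[OF that]] hd[OF that] c(2)[OF m[OF that]] c(1)[OF m[OF that], of z] by auto
  have 2: "\<not> adj w (xs ! i)" if "i < k" for i
    using c(2)[OF m[of i]] last[OF that] that adj_commute[of w] by auto
  have 3: "adj v z" "adj y z" "adj w z"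
    using h(2)[of z] c(3)[of z] adj_commute[of w z] by auto
  show ?thesis
    unfolding short_pattern_def using ipath_stem[OF c(4) k] 1 2 3 h(3-6) adj_commute[of w y] by blast
qed

lemma short_complete:
  assumes B: "bomb v y w xs [z]" and k: "1 \<le> k" "k < length xs" and V: "set xs \<subseteq> V"
    and xz: "\<And>i. i \<le> k \<Longrightarrow> xs ! i = x i"
  shows "\<And>i. k - 1 \<le> i \<Longrightarrow> i < length xs \<Longrightarrow> xs ! i \<in> short_region V k v y z x"
proof -
  note c = bomb_cross[OF B] and h = bomb_heads[OF B]
  have "xs \<noteq> []"
    using k by auto
  fix i
  assume i: "k - 1 \<le> i" "i < length xs"
  then have m: "xs ! i \<in> set xs" "xs ! i \<in> V"
    using V by auto
  show "xs ! i \<in> short_region V k v y z x"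
  proof (cases "i \<le> k")
    case True
    then have "i = k - 1 \<or> i = k"
      using i by auto
    then show ?thesis
      using m xz[of i] True unfolding short_region_def region_def by auto
  next
    case False
    have "xs ! i \<noteq> hd xs"
      using False i(2) nth_eq_iff_index_eq[OF ipath_distinct[OF c(4)], of i 0] \<open>xs \<noteq> []\<close> by (simp add: hd_conv_nth)
    then have "\<not> adj (xs ! i) v" "\<not> adj (xs ! i) y"
      using h(1)[OF m(1)] adj_commute[of "xs ! i"] by auto
    moreover have "\<not> adj (xs ! i) (x j)" if "j < k" for j
      using that ipath_nth[OF c(4) i(2), of j] False k xz[of j] by auto
    moreover have "\<not> adj (xs ! i) z"
      using c(1)[OF m(1), of z] by simp
    ultimately show ?thesis
      using m(2) unfolding short_region_def region_def by auto
  qed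
qed

end

section \<open>From the absence of long thetas to the claw condition\<close>

lemma (in adjacency) stem_cn:
  assumes "stem k x" "1 \<le> k" "cn A" "x (k - 1) \<in> A"
  shows "cn (x ` {..<k - 1} \<union> A)"
proof (cases "k = 1")
  case False
  then have k: "k - 2 < k - 1" "Suc (k - 2) = k - 1" "k - 2 \<le> k" "k - 1 \<le> k"
    using assms(2) by auto
  have "cn (set (map x [0..<k - 1]))"
    by (rule ipath_cn[OF stem_ipath[OF assms(1)]]) simp
  then have "cn (x ` {..<k - 1})"
    by (simp add: lessThan_atLeast0)
  moreover have "adj (x (k - 2)) (x (k - 1))"
    using stem_adj[OF assms(1) k(3,4)] k(2) by simp
  ultimately show ?thesis
    using cn_Un[OF _ assms(3), of "x ` {..<k - 1}" "x (k - 2)"] touches_mem[OF _ assms(4)] k(1) by blast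
qed (use assms in simp)

text \<open>\<open>bomb\<close> asks for two vertices in its first arm but for one in its second,
  hence the hypothesis on \<open>zs\<close>.\<close>

lemma (in adjacency) bomb_swap:
  assumes "bomb v y w xs zs" "2 \<le> length zs"
  shows "bomb v y w zs xs"
proof -
  have "ipath (zs @ w # rev xs)"
    using ipath_rev[of "xs @ w # rev zs"] assms(1) unfolding bomb_def by simp
  moreover have "set (zs @ w # rev xs) = set (xs @ w # rev zs)"
    by auto
  moreover have "xs \<noteq> []"
    using assms(1) unfolding bomb_def by auto
  ultimately show ?thesis
    using assms unfolding bomb_def by metis
qed

text \<open>\<open>X\<^sub>1\<close> and \<open>X\<^sub>2\<close> are prolonged by the stems to the
  neighbours \<open>x 0\<close> and \<open>z 0\<close> of \<open>v\<close>, and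
  \<open>X\<^sub>3\<close> contains its neighbour \<open>w\<close>. So \<open>v\<close> and
  \<open>t\<close> would be the ends of a theta, whose first two paths are bounded by
  \<open>stem_length\<close>.\<close>

lemma main_claw:
  assumes G: "graph G" "\<not> contains_induced (long_theta l) G" and l: "l = k + 3" "1 \<le> k"
    and pat: "adjacency.main_pattern (dominates G) k v y w x z"
    and verts: "v \<in> verts G" "w \<in> verts G" "\<And>i. i \<le> k \<Longrightarrow> x i \<in> verts G" "\<And>i. i \<le> k \<Longrightarrow> z i \<in> verts G"
  defines "R \<equiv> adjacency.main_region (dominates G) (verts G) k v y x z"
  assumes t: "t \<in> R" "adjacency.touches (dominates G) t X\<^sub>1" "adjacency.touches (dominates G) t X\<^sub>2" "adjacency.touches (dominates G) t X\<^sub>3"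
    and X: "adjacency.cn (dominates G) X\<^sub>1" "X\<^sub>1 \<subseteq> R" "x (k - 1) \<in> X\<^sub>1"
      "adjacency.cn (dominates G) X\<^sub>2" "X\<^sub>2 \<subseteq> R" "z (k - 1) \<in> X\<^sub>2"
      "adjacency.cn (dominates G) X\<^sub>3" "X\<^sub>3 \<subseteq> insert w R" "w \<in> X\<^sub>3"
    and sep: "adjacency.sep (dominates G) X\<^sub>1 X\<^sub>2" "adjacency.sep (dominates G) X\<^sub>1 X\<^sub>3" "adjacency.sep (dominates G) X\<^sub>2 X\<^sub>3"
  shows False
proof -
  interpret adjacency "dominates G"
    by (rule graph_adjacency) fact
  note D = main_patternD[OF pat]
  have pat': "main_pattern k v y w z x"
    by (rule main_pattern_sym[OF pat])
  have R': "main_region (verts G) k v y z x = R"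
    unfolding R_def by (rule main_region_sym)
  have RV: "R \<subseteq> verts G"
    unfolding R_def main_region_def region_def by blast
  note far = main_region_far[OF pat l(2), of _ "verts G", folded R_def]
  note far' = main_region_far[OF pat' l(2), of _ "verts G", unfolded R']
  note Rv = main_region_v[OF pat l(2), of _ "verts G", folded R_def]
  have tX: "t \<notin> X\<^sub>1" "t \<notin> X\<^sub>2" "t \<notin> X\<^sub>3"
    using t not_touches_sep[OF sep(1)] not_touches_sep[OF sep(2)] not_touches_sep[OF sep_sym[OF sep(1)]]
      not_touches_sep[OF sep_sym[OF sep(2)]] by blast+
  then have tx: "t \<noteq> x (k - 1)" "t \<noteq> z (k - 1)"
    using X by blast+
  have nx: "x (k - 1) \<notin> X\<^sub>2" "x (k - 1) \<notin> X\<^sub>3" "z (k - 1) \<notin> X\<^sub>1" "z (k - 1) \<notin> X\<^sub>3"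
    using sep X(3,6) unfolding sep_def by blast+
  have ki: "i < k - 1 \<Longrightarrow> i \<le> k" "i < k - 1 \<Longrightarrow> i < k" for i
    by auto
  define Y\<^sub>1 where "Y\<^sub>1 = x ` {..<k - 1} \<union> X\<^sub>1"
  define Y\<^sub>2 where "Y\<^sub>2 = z ` {..<k - 1} \<union> X\<^sub>2"
  have x3: "sep (x ` {..<k - 1}) X\<^sub>3" "sep (z ` {..<k - 1}) X\<^sub>3"
  proof -
    have "a \<noteq> x i \<and> \<not> dominates G a (x i)" if "a \<in> X\<^sub>3" "i < k - 1" for a i
    proof (cases "a = w")
      case True
      then show ?thesis
        using D(8)[OF ki(1)[OF that(2)]] D(9)[OF ki(2)[OF that(2)]] by blast
    next
      case False
      then have "a \<in> R" "a \<noteq> x (k - 1)"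
        using that X(8) nx(2) by blast+
      then show ?thesis
        using far that(2) by blast
    qed
    then show "sep (x ` {..<k - 1}) X\<^sub>3"
      unfolding sep_def using adj_sym by blast
    have "a \<noteq> z i \<and> \<not> dominates G a (z i)" if "a \<in> X\<^sub>3" "i < k - 1" for a i
    proof (cases "a = w")
      case True
      then show ?thesis
        using D(8)[OF ki(1)[OF that(2)]] D(9)[OF ki(2)[OF that(2)]] by blast
    next
      case False
      then have "a \<in> R" "a \<noteq> z (k - 1)"
        using that X(8) nx(4) by blast+
      then show ?thesis
        using far' that(2) by blast
    qed
    then show "sep (z ` {..<k - 1}) X\<^sub>3"
      unfolding sep_def using adj_sym by blast
  qed
  have xz: "sep (x ` {..<k - 1}) (z ` {..<k - 1})"
    unfolding sep_def using D(3)[OF ki(1) ki(1)] by blast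
  have x2: "sep (x ` {..<k - 1}) X\<^sub>2"
  proof -
    have "a \<noteq> x i \<and> \<not> dominates G a (x i)" if "a \<in> X\<^sub>2" "i < k - 1" for a i
    proof -
      have "a \<in> R" "a \<noteq> x (k - 1)"
        using that(1) X(5) nx(1) by blast+
      then show ?thesis
        using far that(2) by blast
    qed
    then show ?thesis
      unfolding sep_def using adj_sym by blast
  qed
  have z1: "sep X\<^sub>1 (z ` {..<k - 1})"
  proof -
    have "a \<noteq> z i \<and> \<not> dominates G a (z i)" if "a \<in> X\<^sub>1" "i < k - 1" for a i
    proof -
      have "a \<in> R" "a \<noteq> z (k - 1)"
        using that(1) X(2) nx(3) by blast+
      then show ?thesis
        using far' that(2) by blast
    qed
    then show ?thesis
      unfolding sep_def using adj_sym by blast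
  qed
  have sepY: "sep Y\<^sub>1 Y\<^sub>2" "sep Y\<^sub>1 X\<^sub>3" "sep Y\<^sub>2 X\<^sub>3"
    unfolding Y\<^sub>1_def Y\<^sub>2_def sep_Un_left sep_Un_right using x3 xz x2 z1 sep by blast+
  have xv: "x ` {..<k - 1} \<subseteq> verts G" "z ` {..<k - 1} \<subseteq> verts G"
    using verts(3,4) ki(1) by blast+
  have YV: "Y\<^sub>1 \<subseteq> verts G" "Y\<^sub>2 \<subseteq> verts G" "X\<^sub>3 \<subseteq> verts G"
    unfolding Y\<^sub>1_def Y\<^sub>2_def using xv X(2,5,8) RV verts(2) by auto
  have cnY: "cn Y\<^sub>1" "cn Y\<^sub>2"
    unfolding Y\<^sub>1_def Y\<^sub>2_def using stem_cn[OF D(1) l(2) X(1,3)] stem_cn[OF D(2) l(2) X(4,6)] .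
  have vR: "v \<notin> R"
    using Rv(3) by blast
  have "v \<notin> x ` {..<k - 1}" "v \<notin> z ` {..<k - 1}"
    using D(8)[OF ki(1)] by blast+
  moreover have "v \<noteq> w"
    using D(11) adj_irrefl by metis
  ultimately have vY: "v \<notin> Y\<^sub>1 \<union> Y\<^sub>2 \<union> X\<^sub>3"
    unfolding Y\<^sub>1_def Y\<^sub>2_def using vR X(2,5,8) by auto
  have "t \<notin> x ` {..<k - 1}" "t \<notin> z ` {..<k - 1}"
    using far[OF t(1) tx(1)] far'[OF t(1) tx(2)] by blast+
  then have tY: "t \<notin> Y\<^sub>1 \<union> Y\<^sub>2 \<union> X\<^sub>3"
    unfolding Y\<^sub>1_def Y\<^sub>2_def using tX by auto
  have "x 0 \<in> Y\<^sub>1" "z 0 \<in> Y\<^sub>2"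
    unfolding Y\<^sub>1_def Y\<^sub>2_def using X(3,6) l(2) by (cases "k = 1"; auto)+
  moreover have "dominates G v (x 0)" "dominates G v (z 0)"
    using D(4,5)[of 0] by simp_all
  ultimately have tv: "touches v Y\<^sub>1" "touches v Y\<^sub>2" "touches v X\<^sub>3"
    using touches_mem D(11) X(9) by blast+
  have tt: "touches t Y\<^sub>1" "touches t Y\<^sub>2"
    unfolding Y\<^sub>1_def Y\<^sub>2_def touches_Un using t by blast+
  have vt: "v \<noteq> t" "\<not> dominates G v t"
  proof -
    show "v \<noteq> t"
      using vR t(1) by blast
    show "\<not> dominates G v t"
      using Rv(1)[OF t(1)] tx by auto
  qed
  have len1: "k + 1 < length P" if "ipath P" "P \<noteq> []" "hd P = v" "last P = t" "set P \<subseteq> insert v (insert t Y\<^sub>1)" for P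
    by (rule stem_length[OF pat l(2) X(2)[unfolded R_def] nx(3) t(1)[unfolded R_def] tx that[unfolded Y\<^sub>1_def]])
  have len2: "k + 1 < length P" if "ipath P" "P \<noteq> []" "hd P = v" "last P = t" "set P \<subseteq> insert v (insert t Y\<^sub>2)" for P
    by (rule stem_length[OF pat' l(2) X(5)[folded R'] nx(1) t(1)[folded R'] tx(2,1) that[unfolded Y\<^sub>2_def]])
  have tV: "t \<in> verts G"
    using t(1) RV by blast
  show False
    by (rule no_long_theta[OF G verts(1) tV YV vt vY tY cnY X(7) sepY tv tt t(4) len1 len2]) (use l in auto)
qed

lemma main_linkage:
  assumes G: "graph G" "\<not> contains_induced (long_theta l) G" "\<not> (\<exists>C. hole G C \<and> length C = 4)" and l: "l = k + 3" "1 \<le> k"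
    and pat: "adjacency.main_pattern (dominates G) k v y w x z"
    and verts: "v \<in> verts G" "w \<in> verts G" "\<And>i. i \<le> k \<Longrightarrow> x i \<in> verts G" "\<And>i. i \<le> k \<Longrightarrow> z i \<in> verts G"
  defines "R \<equiv> adjacency.main_region (dominates G) (verts G) k v y x z"
  shows "linkage_program (dominates G) {a \<in> R. \<not> a \<rightarrow>\<^bsub>G\<^esub> w} {a \<in> R. a \<rightarrow>\<^bsub>G\<^esub> w} w (x (k - 1)) (z (k - 1)) (x k) (z k)"
proof -
  interpret adjacency "dominates G"
    by (rule graph_adjacency) fact
  note D = main_patternD[OF pat]
  have pat': "main_pattern k v y w z x"
    by (rule main_pattern_sym[OF pat])
  have R': "main_region (verts G) k v y z x = R"
    unfolding R_def by (rule main_region_sym)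
  have WU: "{a \<in> R. \<not> a \<rightarrow>\<^bsub>G\<^esub> w} \<union> {a \<in> R. a \<rightarrow>\<^bsub>G\<^esub> w} = R"
    by blast
  have k: "k - 1 \<le> k" "k \<le> k" "k - 1 < k"
    using l(2) by auto
  have inR: "x (k - 1) \<in> R" "z (k - 1) \<in> R" "x k \<in> R" "z k \<in> R"
    unfolding R_def main_region_def region_def using verts(3,4)[OF k(1)] verts(3,4)[OF k(2)] by auto
  have wR: "w \<notin> R"
    using main_region_v(5)[OF pat l(2), of _ "verts G", folded R_def] by blast
  show ?thesis
  proof (unfold_locales, unfold WU)
    show "{a \<in> R. \<not> a \<rightarrow>\<^bsub>G\<^esub> w} \<inter> {a \<in> R. a \<rightarrow>\<^bsub>G\<^esub> w} = {}"
      by blast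
    show "w \<notin> {a \<in> R. \<not> a \<rightarrow>\<^bsub>G\<^esub> w}" "w \<notin> {a \<in> R. a \<rightarrow>\<^bsub>G\<^esub> w}"
      using wR by blast+
    show "\<not> w \<rightarrow>\<^bsub>G\<^esub> a" if "a \<in> {a \<in> R. \<not> a \<rightarrow>\<^bsub>G\<^esub> w}" for a
      using that adj_sym by blast
    show "w \<rightarrow>\<^bsub>G\<^esub> a" if "a \<in> {a \<in> R. a \<rightarrow>\<^bsub>G\<^esub> w}" for a
      using that adj_sym by blast
    show "x (k - 1) \<in> {a \<in> R. \<not> a \<rightarrow>\<^bsub>G\<^esub> w}" "z (k - 1) \<in> {a \<in> R. \<not> a \<rightarrow>\<^bsub>G\<^esub> w}"
      using inR D(9)[OF k(3)] adj_sym by blast+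
    show "x (k - 1) \<noteq> z (k - 1)" "x k \<noteq> z k" "\<not> x (k - 1) \<rightarrow>\<^bsub>G\<^esub> z (k - 1)"
      using D(3)[OF k(1,1)] D(3)[OF k(2,2)] by blast+
    show "x k \<in> R" "z k \<in> R"
      by (fact inR)+
    show "x (k - 1) \<rightarrow>\<^bsub>G\<^esub> a \<longleftrightarrow> a = x k" if "a \<in> R" for a
      by (rule main_pendant[OF pat l(2) that[unfolded R_def]])
    show "z (k - 1) \<rightarrow>\<^bsub>G\<^esub> a \<longleftrightarrow> a = z k" if "a \<in> R" for a
      by (rule main_pendant[OF pat' l(2) that[folded R']])
    show False if "a \<rightarrow>\<^bsub>G\<^esub> b" "b \<rightarrow>\<^bsub>G\<^esub> c" "c \<rightarrow>\<^bsub>G\<^esub> d" "d \<rightarrow>\<^bsub>G\<^esub> a" "\<not> a \<rightarrow>\<^bsub>G\<^esub> c" "\<not> b \<rightarrow>\<^bsub>G\<^esub> d" "a \<noteq> c" "b \<noteq> d" for a b c d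
      by (rule no_hole4[OF G(1,3) that])
    show False if "t \<in> R" "cn X\<^sub>1" "X\<^sub>1 \<subseteq> {a \<in> R. \<not> a \<rightarrow>\<^bsub>G\<^esub> w}" "x (k - 1) \<in> X\<^sub>1" "cn X\<^sub>2" "X\<^sub>2 \<subseteq> {a \<in> R. \<not> a \<rightarrow>\<^bsub>G\<^esub> w}"
      "z (k - 1) \<in> X\<^sub>2" "cn X\<^sub>3" "X\<^sub>3 \<subseteq> insert w R" "w \<in> X\<^sub>3" "sep X\<^sub>1 X\<^sub>2" "sep X\<^sub>1 X\<^sub>3" "sep X\<^sub>2 X\<^sub>3"
      "touches t X\<^sub>1" "touches t X\<^sub>2" "touches t X\<^sub>3" for t X\<^sub>1 X\<^sub>2 X\<^sub>3
    proof -
      have X: "X\<^sub>1 \<subseteq> R" "X\<^sub>2 \<subseteq> R"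
        using that(3,6) by blast+
      show False
        by (rule main_claw[OF G(1,2) l pat verts, folded R_def, OF _ _ that(1,14-16,2) X(1) that(4,5) X(2) that(7-13)])
    qed
  qed
qed

text \<open>The two outcomes are not complementary: a positive answer yields some bomb with these
  \<open>v\<close>, \<open>y\<close>, \<open>w\<close>, and a negative one excludes only bombs whose
  arms begin with the guessed vertices. Over all guesses this suffices, and as a negative answer
  leaves the variable 0 alone, a positive one persists.\<close>

lemma main_decide:
  assumes G: "graph G" "\<not> contains_induced (long_theta l) G" "\<not> (\<exists>C. hole G C \<and> length C = 4)" and l: "l = k + 3" "1 \<le> k"
    and pat: "adjacency.main_pattern (dominates G) k v y w x z"
    and verts: "v \<in> verts G" "w \<in> verts G" "\<And>i. i \<le> k \<Longrightarrow> x i \<in> verts G" "\<And>i. i \<le> k \<Longrightarrow> z i \<in> verts G"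
  defines "R \<equiv> adjacency.main_region (dominates G) (verts G) k v y x z"
  assumes s: "marked n s 3 = {a \<in> R. \<not> a \<rightarrow>\<^bsub>G\<^esub> w}" "marked n s 4 = {a \<in> R. a \<rightarrow>\<^bsub>G\<^esub> w}"
    "s 11 0 = x (k - 1)" "s 12 0 = z (k - 1)" "s 17 0 = x k" "s 18 0 = z k"
  shows "den n (dominates G) decide s 0 0 = 1 \<and>
      (\<exists>xs zs. adjacency.bomb (dominates G) v y w xs zs \<and> k < length xs \<and> k < length zs \<and> set xs \<union> set zs \<subseteq> verts G) \<or>
    den n (dominates G) decide s 0 0 = s 0 0 \<and>
      \<not> (\<exists>xs zs. adjacency.bomb (dominates G) v y w xs zs \<and> k < length xs \<and> k < length zs \<and> set xs \<union> set zs \<subseteq> verts G \<and>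
        (\<forall>i\<le>k. xs ! i = x i \<and> zs ! i = z i))"
proof -
  interpret L: linkage_program "dominates G" "{a \<in> R. \<not> a \<rightarrow>\<^bsub>G\<^esub> w}" "{a \<in> R. a \<rightarrow>\<^bsub>G\<^esub> w}" w "x (k - 1)" "z (k - 1)" n "x k" "z k"
    unfolding R_def by (rule main_linkage[OF G l pat verts])
  note dec = L.decide_spec[OF s]
  have pat': "L.main_pattern k v y w z x"
    by (rule L.main_pattern_sym[OF pat])
  have R': "L.main_region (verts G) k v y z x = R"
    unfolding R_def by (rule L.main_region_sym)
  have sound: "\<exists>xs zs. L.bomb v y w xs zs \<and> k < length xs \<and> k < length zs \<and> set xs \<union> set zs \<subseteq> verts G"
    if S: "L.sides A B" "x (k - 1) \<in> A" "z (k - 1) \<in> B" and a: "a \<in> {a \<in> R. a \<rightarrow>\<^bsub>G\<^esub> w}" "L.touches a A" "\<not> L.touches a B"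
      and b: "b \<in> {a \<in> R. a \<rightarrow>\<^bsub>G\<^esub> w}" "L.touches b B" "\<not> L.touches b A" and ab: "\<not> a \<rightarrow>\<^bsub>G\<^esub> b" for A B a b
  proof -
    note D = L.sidesD[OF S(1)]
    have A: "A \<subseteq> R" "\<And>c. c \<in> A \<Longrightarrow> \<not> c \<rightarrow>\<^bsub>G\<^esub> w" and B: "B \<subseteq> R" "\<And>c. c \<in> B \<Longrightarrow> \<not> c \<rightarrow>\<^bsub>G\<^esub> w"
      using D(2,5) by blast+
    have aR: "a \<in> R" "a \<rightarrow>\<^bsub>G\<^esub> w" "b \<in> R" "b \<rightarrow>\<^bsub>G\<^esub> w"
      using a(1) b(1) by blast+
    have "L.sep (insert a A) (insert b B)"
    proof (rule L.sep_touchesI)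
      have "a \<noteq> b"
        using a(2) b(3) by blast
      then show "insert a A \<inter> insert b B = {}"
        using aR A(2) B(2) D(3) unfolding L.sep_def by blast
      show "\<not> L.touches c (insert b B)" if "c \<in> insert a A" for c
      proof -
        have "\<not> c \<rightarrow>\<^bsub>G\<^esub> b"
          using that ab b(3) L.adj_sym unfolding L.touches_def by blast
        moreover have "\<not> L.touches c B"
          using that a(3) L.not_touches_sep[OF D(3)] by blast
        ultimately show ?thesis
          unfolding L.touches_def by blast
      qed
    qed
    note sepAB = this
    obtain xs zs where "L.bomb v y w xs zs" "k < length xs" "k < length zs"
        "set xs \<union> set zs \<subseteq> x ` {..<k} \<union> z ` {..<k} \<union> verts G"
      by (rule L.main_sound[OF pat l(2) D(1) A(1)[unfolded R_def] S(2) A(2) D(4) B(1)[unfolded R_def] S(3) B(2)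
        aR(1)[unfolded R_def] aR(2) a(2) aR(3)[unfolded R_def] aR(4) b(2) sepAB])
    moreover have "x ` {..<k} \<union> z ` {..<k} \<subseteq> verts G"
      using verts(3,4) by auto
    ultimately show ?thesis
      by blast
  qed
  have complete: "\<exists>a b. L.linked a b \<and> \<not> a \<rightarrow>\<^bsub>G\<^esub> b"
    if B: "L.bomb v y w xs zs" and k: "k < length xs" "k < length zs" and V: "set xs \<union> set zs \<subseteq> verts G"
      and xz: "\<And>i. i \<le> k \<Longrightarrow> xs ! i = x i" "\<And>i. i \<le> k \<Longrightarrow> zs ! i = z i" for xs zs
  proof -
    note c = L.bomb_cross[OF B]
    have B': "L.bomb v y w zs xs"
      by (rule L.bomb_swap[OF B]) (use k(2) l(2) in simp)
    have zR: "zs ! i \<in> R" if "k - 1 \<le> i" "i < length zs" for i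
      using L.main_complete[OF B' l(2) k(2,1), of "verts G" z x i] k(2) l(2) V xz that unfolding R' by auto
    have xR: "xs ! i \<in> R" if "k - 1 \<le> i" "i < length xs" for i
      unfolding R_def by (rule L.main_complete[OF B l(2) k V xz that])
    note SX = L.arm_split[OF c(4) l(2) k(1)] and SZ = L.arm_split[OF c(5) l(2) k(2)]
    define A where "A = set (drop (k - 1) (butlast xs))"
    define C where "C = set (drop (k - 1) (butlast zs))"
    have ne: "xs \<noteq> []" "zs \<noteq> []"
      using k by auto
    have last: "last xs = xs ! (length xs - 1)" "last zs = zs ! (length zs - 1)"
      using ne by (simp_all add: last_conv_nth)
    have AC: "A \<subseteq> set xs" "C \<subseteq> set zs"
      unfolding A_def C_def by (auto dest!: in_set_dropD in_set_butlastD)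
    have AW: "A \<subseteq> {a \<in> R. \<not> a \<rightarrow>\<^bsub>G\<^esub> w}"
    proof
      fix a
      assume a: "a \<in> A"
      then obtain i where "k - 1 \<le> i" "i < length xs - 1" "a = xs ! i"
        using SX(5) unfolding A_def by blast
      then have "a \<in> R"
        using xR[of i] by simp
      moreover have "a \<noteq> last xs"
        using a SX(4) unfolding A_def by blast
      ultimately show "a \<in> {a \<in> R. \<not> a \<rightarrow>\<^bsub>G\<^esub> w}"
        using c(2)[of a] a AC by blast
    qed
    have CW: "C \<subseteq> {a \<in> R. \<not> a \<rightarrow>\<^bsub>G\<^esub> w}"
    proof
      fix a
      assume a: "a \<in> C"
      then obtain i where "k - 1 \<le> i" "i < length zs - 1" "a = zs ! i"
        using SZ(5) unfolding C_def by blast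
      then have "a \<in> R"
        using zR[of i] by simp
      moreover have "a \<noteq> last zs"
        using a SZ(4) unfolding C_def by blast
      ultimately show "a \<in> {a \<in> R. \<not> a \<rightarrow>\<^bsub>G\<^esub> w}"
        using c(3)[of a] a AC by blast
    qed
    have "x (k - 1) \<in> A" "z (k - 1) \<in> C"
      using SX(2) SZ(2) xz[of "k - 1"] unfolding A_def C_def by simp_all
    moreover have "L.srcs (x (k - 1)) (z (k - 1))"
      unfolding L.srcs_def by blast
    moreover have "L.sep A C"
      unfolding L.sep_def using c(1) AC by blast
    ultimately have "L.sides A C"
      unfolding L.sides_def using SX(1) SZ(1) AW CW unfolding A_def C_def by blast
    moreover have "last xs \<in> set xs" "last zs \<in> set zs"
      using ne by simp_all
    then have "last xs \<rightarrow>\<^bsub>G\<^esub> w" "last zs \<rightarrow>\<^bsub>G\<^esub> w" and n: "\<not> last xs \<rightarrow>\<^bsub>G\<^esub> last zs"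
      using c(1-3) by blast+
    moreover have "last xs \<in> R" "last zs \<in> R"
      unfolding last using xR[of "length xs - 1"] zR[of "length zs - 1"] k by simp_all
    ultimately have "L.linked (last xs) (last zs)"
      using L.linkedI[of A C "last xs" "last zs"] SX(3) SZ(3) unfolding A_def C_def by blast
    then show ?thesis
      using n by blast
  qed
  show ?thesis
  proof (cases "\<exists>a b. L.linked a b \<and> \<not> a \<rightarrow>\<^bsub>G\<^esub> b")
    case True
    then obtain a b where ab: "L.linked a b" "\<not> a \<rightarrow>\<^bsub>G\<^esub> b" by blast
    then obtain A B where S: "L.sides A B" and aU: "a \<in> {a \<in> R. a \<rightarrow>\<^bsub>G\<^esub> w}" "L.touches a A" "\<not> L.touches a B"
      and bU: "b \<in> {a \<in> R. a \<rightarrow>\<^bsub>G\<^esub> w}" "L.touches b B" "\<not> L.touches b A"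
      unfolding L.linked_def by blast
    have "x (k - 1) \<in> A \<and> z (k - 1) \<in> B \<or> x (k - 1) \<in> B \<and> z (k - 1) \<in> A"
      using S unfolding L.sides_def L.srcs_def by blast
    then have "\<exists>xs zs. L.bomb v y w xs zs \<and> k < length xs \<and> k < length zs \<and> set xs \<union> set zs \<subseteq> verts G"
    proof
      assume "x (k - 1) \<in> A \<and> z (k - 1) \<in> B"
      then show ?thesis
        using sound[OF S _ _ aU bU ab(2)] by blast
    next
      assume *: "x (k - 1) \<in> B \<and> z (k - 1) \<in> A"
      have "\<not> b \<rightarrow>\<^bsub>G\<^esub> a"
        using ab(2) L.adj_sym by blast
      then show ?thesis
        using sound[OF L.sides_sym[OF S] _ _ bU aU] * by blast
    qed
    moreover have "den n (dominates G) decide s 0 0 = 1"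
      unfolding dec by (rule if_P[OF True])
    ultimately show ?thesis
      by blast
  next
    case False
    have "den n (dominates G) decide s 0 0 = s 0 0"
      unfolding dec by (rule if_not_P[OF False])
    then show ?thesis
      using complete False by blast
  qed
qed

definition short_decide :: cmd where
  "short_decide = Then forest (For 1 (Ite (AndE (Arr 4 (Var 1)) (Arr 6 (Var 1))) (Assign 0 One) Nop))"

lemma short_decide_spec:
  assumes G: "graph G" and k: "1 \<le> k"
    and pat: "adjacency.short_pattern (dominates G) k v y w z x"
    and verts: "verts G = {..<n}" "\<And>i. i \<le> k \<Longrightarrow> x i \<in> verts G"
  defines "R \<equiv> adjacency.short_region (dominates G) (verts G) k v y z x"
  assumes s: "marked n s 3 = {a \<in> R. \<not> a \<rightarrow>\<^bsub>G\<^esub> w}" "marked n s 4 = {a \<in> R. a \<rightarrow>\<^bsub>G\<^esub> w}"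
    "s 11 0 = x (k - 1)" "s 12 0 = x (k - 1)" "s 17 0 = x k" "s 18 0 = x k"
  shows "den n (dominates G) short_decide s 0 0 = 1 \<and>
      (\<exists>xs. adjacency.bomb (dominates G) v y w xs [z] \<and> k < length xs \<and> set xs \<subseteq> verts G) \<or>
    den n (dominates G) short_decide s 0 0 = s 0 0 \<and>
      \<not> (\<exists>xs. adjacency.bomb (dominates G) v y w xs [z] \<and> k < length xs \<and> set xs \<subseteq> verts G \<and> (\<forall>i\<le>k. xs ! i = x i))"
proof -
  interpret adjacency "dominates G"
    by (rule graph_adjacency) fact
  note D = short_patternD[OF pat]
  define W where "W = {a \<in> R. \<not> a \<rightarrow>\<^bsub>G\<^esub> w}"
  define U where "U = {a \<in> R. a \<rightarrow>\<^bsub>G\<^esub> w}"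
  have WU: "W \<union> U = R" "W \<inter> U = {}"
    unfolding W_def U_def by blast+
  have kk: "k - 1 \<le> k" "k \<le> k" "k - 1 < k"
    using k by auto
  have inR: "x (k - 1) \<in> R" "x k \<in> R"
    unfolding R_def short_region_def region_def using verts(2)[OF kk(1)] verts(2)[OF kk(2)] by auto
  have xW: "x (k - 1) \<in> W"
    using inR(1) D(3)[OF kk(3)] adj_sym unfolding W_def by blast
  have RV: "R \<subseteq> verts G"
    unfolding R_def short_region_def region_def by blast
  have pend: "x (k - 1) \<rightarrow>\<^bsub>G\<^esub> a \<longleftrightarrow> a = x k" if "a \<in> R" for a
    by (rule short_pendant[OF pat k that[unfolded R_def]])
  define t where "t = den n (dominates G) forest s"
  have "forest_inv W U {x (k - 1), x (k - 1)} (marked n t 6) (marked n t 7) (t 8) \<and> marked n t 6 \<inter> W \<subseteq> marked n t 7 \<and>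
    (\<forall>a. a \<notin> {1, 2, 5, 6, 7, 8, 9, 10, 16} \<longrightarrow> t a = s a)"
    by (rule forest_spec[where s = s and n = n and E = "dominates G", unfolded s, folded t_def W_def U_def])
      (use xW inR pend adj_irrefl adjacency_axioms in \<open>auto simp: WU(1)\<close>)
  then have f: "forest_inv W U {x (k - 1)} (marked n t 6) (marked n t 7) (t 8)" "marked n t 6 \<inter> W \<subseteq> marked n t 7"
    and t: "t 0 = s 0" "t 4 = s 4"
    by simp_all
  have u_iff: "u \<in> marked n t 6 \<longleftrightarrow> (\<exists>a. (inside W)\<^sup>*\<^sup>* (x (k - 1)) a \<and> u \<rightarrow>\<^bsub>G\<^esub> a)" if "u \<in> U" for u
    using forest_final[OF f _ WU(2) that] xW by simp
  have den: "den n (dominates G) short_decide s 0 0 = (if \<exists>u<n. t 4 u \<noteq> 0 \<and> t 6 u \<noteq> 0 then 1 else s 0 0)"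
  proof -
    let ?I = "\<lambda>j r. r 4 = t 4 \<and> r 6 = t 6 \<and> r 0 0 = (if \<exists>u<j. t 4 u \<noteq> 0 \<and> t 6 u \<noteq> 0 then 1 else s 0 0)"
    have "?I n (den n (dominates G) short_decide s)"
      unfolding short_decide_def den.simps(3) t_def[symmetric]
    proof (rule For_inv[where I = ?I], goal_cases)
      case 1
      show ?case
        using t by simp
    next
      case (2 j r)
      have S: "(\<exists>u<Suc j. t 4 u \<noteq> 0 \<and> t 6 u \<noteq> 0) \<longleftrightarrow> (\<exists>u<j. t 4 u \<noteq> 0 \<and> t 6 u \<noteq> 0) \<or> t 4 j \<noteq> 0 \<and> t 6 j \<noteq> 0"
        unfolding less_Suc_eq by blast
      show ?case
        unfolding S using 2 by (auto simp: put_other)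
    qed
    then show ?thesis by blast
  qed
  have ex: "(\<exists>u<n. t 4 u \<noteq> 0 \<and> t 6 u \<noteq> 0) \<longleftrightarrow> (\<exists>u\<in>U. \<exists>a. (inside W)\<^sup>*\<^sup>* (x (k - 1)) a \<and> u \<rightarrow>\<^bsub>G\<^esub> a)"
  proof -
    have "(\<exists>u<n. t 4 u \<noteq> 0 \<and> t 6 u \<noteq> 0) \<longleftrightarrow> (\<exists>u\<in>U. u \<in> marked n t 6)"
      using s(2) unfolding U_def[symmetric] t(2) marked_def by blast
    then show ?thesis
      using u_iff by blast
  qed
  show ?thesis
  proof (cases "\<exists>u\<in>U. \<exists>a. (inside W)\<^sup>*\<^sup>* (x (k - 1)) a \<and> u \<rightarrow>\<^bsub>G\<^esub> a")
    case True
    then obtain u a where u: "u \<in> U" "(inside W)\<^sup>*\<^sup>* (x (k - 1)) a" "u \<rightarrow>\<^bsub>G\<^esub> a"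
      by blast
    \<comment> \<open>The component of the source in \<open>W\<close> serves as the connected
      set.\<close>
    define A where "A = {b. (inside W)\<^sup>*\<^sup>* (x (k - 1)) b}"
    have AW: "A \<subseteq> W"
      unfolding A_def using inside_rtranclp_mem xW by blast
    have "(inside A)\<^sup>*\<^sup>* (x (k - 1)) b" if "b \<in> A" for b
    proof -
      have "(inside W)\<^sup>*\<^sup>* (x (k - 1)) b"
        using that unfolding A_def by blast
      then show ?thesis
      proof (induction rule: rtranclp_induct)
        case (step b c)
        then have "inside A b c"
          unfolding inside_def A_def by (auto intro: rtranclp.rtrancl_into_rtrancl)
        then show ?case
          using step.IH by (rule rtranclp.rtrancl_into_rtrancl[rotated])
      qed simp
    qed
    then have A: "cn A"
      by (rule cnI_base)
    have AR: "A \<subseteq> R" "x (k - 1) \<in> A" "\<And>c. c \<in> A \<Longrightarrow> \<not> c \<rightarrow>\<^bsub>G\<^esub> w"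
      using AW unfolding W_def A_def by blast+
    have uA: "u \<in> R" "u \<rightarrow>\<^bsub>G\<^esub> w" "touches u A"
      using u touches_mem[of u a A] unfolding U_def A_def by blast+
    obtain xs where "bomb v y w xs [z]" "k < length xs" "set xs \<subseteq> x ` {..<k} \<union> verts G"
      by (rule short_sound[OF pat k A AR(1)[unfolded R_def] AR(2,3) uA(1)[unfolded R_def] uA(2,3)])
    moreover have "x ` {..<k} \<subseteq> verts G"
      using verts(2) by auto
    ultimately have "\<exists>xs. bomb v y w xs [z] \<and> k < length xs \<and> set xs \<subseteq> verts G"
      by blast
    moreover have "den n (dominates G) short_decide s 0 0 = 1"
      unfolding den ex by (rule if_P[OF True])
    ultimately show ?thesis
      by blast
  next
    case False
    have "\<not> (\<exists>xs. bomb v y w xs [z] \<and> k < length xs \<and> set xs \<subseteq> verts G \<and> (\<forall>i\<le>k. xs ! i = x i))"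
    proof
      assume "\<exists>xs. bomb v y w xs [z] \<and> k < length xs \<and> set xs \<subseteq> verts G \<and> (\<forall>i\<le>k. xs ! i = x i)"
      then obtain xs where B: "bomb v y w xs [z]" and kx: "k < length xs" and V: "set xs \<subseteq> verts G"
        and xi: "\<And>i. i \<le> k \<Longrightarrow> xs ! i = x i"
        by blast
      note c = bomb_cross[OF B]
      note SX = arm_split[OF c(4) k kx]
      define A where "A = set (drop (k - 1) (butlast xs))"
      have xR: "xs ! i \<in> R" if "k - 1 \<le> i" "i < length xs" for i
        unfolding R_def by (rule short_complete[OF B k kx V xi that])
      have "xs \<noteq> []"
        using kx by auto
      then have l: "last xs = xs ! (length xs - 1)" "last xs \<in> set xs"
        by (simp_all add: last_conv_nth)
      have AW: "A \<subseteq> W"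
      proof
        fix a
        assume a: "a \<in> A"
        then obtain i where "k - 1 \<le> i" "i < length xs - 1" "a = xs ! i"
          using SX(5) unfolding A_def by blast
        then have "a \<in> R"
          using xR[of i] by simp
        moreover have "a \<noteq> last xs"
          using a SX(4) unfolding A_def by blast
        moreover have "a \<in> set xs"
          using a unfolding A_def by (auto dest!: in_set_dropD in_set_butlastD)
        ultimately show "a \<in> W"
          using c(2)[of a] unfolding W_def by blast
      qed
      have "last xs \<in> U"
        using xR[of "length xs - 1"] l c(2)[OF l(2)] kx unfolding U_def by auto
      moreover obtain a where a: "a \<in> A" "last xs \<rightarrow>\<^bsub>G\<^esub> a"
        using SX(3) unfolding A_def touches_def by blast
      moreover have "x (k - 1) \<in> A"
        using SX(2) xi[of "k - 1"] unfolding A_def by simp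
      then have "(inside W)\<^sup>*\<^sup>* (x (k - 1)) a"
        using cn_reach[OF SX(1)[folded A_def] _ a(1) AW] by blast
      ultimately show False
        using False by blast
    qed
    moreover have "den n (dominates G) short_decide s 0 0 = s 0 0"
      unfolding den ex by (rule if_not_P[OF False])
    ultimately show ?thesis
      by blast
  qed
qed

section \<open>The algorithm\<close>

text \<open>The guessed vertices are the variables \<open>20, 21, \<dots>\<close>.\<close>

fun guess :: "nat \<Rightarrow> cmd \<Rightarrow> cmd" where
  "guess 0 c = c"
| "guess (Suc j) c = For (20 + j) (guess j c)"

lemma modified_guess: "a \<in> modified (guess j c) \<Longrightarrow> a \<in> modified c \<or> (\<exists>i<j. a = 20 + i)"
  by (induction j) (auto simp: less_Suc_eq)

lemma depth_guess: "depth (guess j c) = j + depth c"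
  by (induction j) auto

text \<open>The variables from \<open>20 + j\<close> on are fixed by the outer loops, so
  \<open>g\<close> is prescribed there. Recording \<open>Q\<close> with the answer 1 keeps the
  answer justified in all later rounds, whatever their guesses.\<close>

lemma guess_spec:
  assumes body: "\<And>s. (\<And>i. i < m \<Longrightarrow> s (20 + i) 0 < n) \<Longrightarrow>
      den n E c s 0 0 = 1 \<and> Q \<or> den n E c s 0 0 = s 0 0 \<and> \<not> P (\<lambda>i. s (20 + i) 0)"
    and c: "\<And>i. 20 + i \<notin> modified c"
    and P: "\<And>g h. (\<And>i. i < m \<Longrightarrow> g i = h i) \<Longrightarrow> P g \<Longrightarrow> P h"
  shows "j \<le> m \<Longrightarrow> (\<And>i. j \<le> i \<Longrightarrow> i < m \<Longrightarrow> s (20 + i) 0 < n) \<Longrightarrow>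
    den n E (guess j c) s 0 0 = 1 \<and> Q \<or> den n E (guess j c) s 0 0 = s 0 0 \<and>
      \<not> (\<exists>g. (\<forall>i<m. g i < n) \<and> (\<forall>i<m. j \<le> i \<longrightarrow> g i = s (20 + i) 0) \<and> P g)"
proof (induction j arbitrary: s)
  case 0
  have no: "\<not> (\<exists>g. (\<forall>i<m. g i < n) \<and> (\<forall>i<m. 0 \<le> i \<longrightarrow> g i = s (20 + i) 0) \<and> P g)"
    if "\<not> P (\<lambda>i. s (20 + i) 0)"
  proof
    assume "\<exists>g. (\<forall>i<m. g i < n) \<and> (\<forall>i<m. 0 \<le> i \<longrightarrow> g i = s (20 + i) 0) \<and> P g"
    then obtain g where "\<And>i. i < m \<Longrightarrow> g i = s (20 + i) 0" "P g"
      by auto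
    then show False
      using P[of g "\<lambda>i. s (20 + i) 0"] that by simp
  qed
  have "den n E c s 0 0 = 1 \<and> Q \<or> den n E c s 0 0 = s 0 0 \<and> \<not> P (\<lambda>i. s (20 + i) 0)"
    by (rule body) (use 0 in simp)
  then show ?case
    unfolding guess.simps using no by (elim disjE) simp_all
next
  case (Suc j)
  let ?c = "guess j c"
  \<comment> \<open>As long as the answer is open, the rounds before \<open>a\<close> have excluded
    the guesses with \<open>g j < a\<close>.\<close>
  let ?I = "\<lambda>a t. (\<forall>i<m. Suc j \<le> i \<longrightarrow> t (20 + i) = s (20 + i)) \<and>
    (t 0 0 = 1 \<and> Q \<or> t 0 0 = s 0 0 \<and>
      \<not> (\<exists>g. (\<forall>i<m. g i < n) \<and> (\<forall>i<m. Suc j \<le> i \<longrightarrow> g i = s (20 + i) 0) \<and> g j < a \<and> P g))"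
  have "?I n (den n E (guess (Suc j) c) s)"
    unfolding guess.simps
  proof (rule For_inv[where I = ?I], goal_cases)
    case 1
    show ?case by simp
  next
    case (2 a t)
    define r where "r = put (20 + j) 0 a t"
    have t: "t (20 + i) = s (20 + i)" if "i < m" "Suc j \<le> i" for i
      using 2(2) that by blast
    have r: "r (20 + i) 0 = (if i = j then a else s (20 + i) 0)" if "i < m" "j \<le> i" for i
      unfolding r_def using t[of i] that by auto
    have r0: "r 0 0 = t 0 0"
      unfolding r_def by simp
    have keep: "den n E ?c r (20 + i) = r (20 + i)" if "j \<le> i" for i
      by (rule den_other) (use modified_guess[of "20 + i" j c] c that in auto)
    have "den n E ?c r (20 + i) = s (20 + i)" if "i < m" "Suc j \<le> i" for i
      using keep[of i] t[OF that] that(2) unfolding r_def by (simp add: put_other)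
    moreover have IH: "den n E ?c r 0 0 = 1 \<and> Q \<or> den n E ?c r 0 0 = t 0 0 \<and>
      \<not> (\<exists>g. (\<forall>i<m. g i < n) \<and> (\<forall>i<m. j \<le> i \<longrightarrow> g i = r (20 + i) 0) \<and> P g)"
      using Suc.IH[of r] Suc.prems 2(1) r unfolding r0 by simp
    have "den n E ?c r 0 0 = 1 \<and> Q \<or> den n E ?c r 0 0 = s 0 0 \<and>
      \<not> (\<exists>g. (\<forall>i<m. g i < n) \<and> (\<forall>i<m. Suc j \<le> i \<longrightarrow> g i = s (20 + i) 0) \<and> g j < Suc a \<and> P g)"
    proof (cases "t 0 0 = 1 \<and> Q")
      case True
      then show ?thesis
        using IH by auto
    next
      case False
      then have t0: "t 0 0 = s 0 0"
        and no: "\<not> (\<exists>g. (\<forall>i<m. g i < n) \<and> (\<forall>i<m. Suc j \<le> i \<longrightarrow> g i = s (20 + i) 0) \<and> g j < a \<and> P g)"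
        using 2(2) by blast+
      show ?thesis
      proof (cases "den n E ?c r 0 0 = 1 \<and> Q")
        case False
        then have d: "den n E ?c r 0 0 = s 0 0"
          and no': "\<not> (\<exists>g. (\<forall>i<m. g i < n) \<and> (\<forall>i<m. j \<le> i \<longrightarrow> g i = r (20 + i) 0) \<and> P g)"
          using IH t0 by auto
        have False if g: "\<forall>i<m. g i < n" "\<forall>i<m. Suc j \<le> i \<longrightarrow> g i = s (20 + i) 0" "g j < Suc a" "P g" for g
        proof (cases "g j < a")
          case True
          then show ?thesis
            using no g by blast
        next
          case False
          then have "g j = a"
            using g(3) by simp
          then have "\<forall>i<m. j \<le> i \<longrightarrow> g i = r (20 + i) 0"
            using g(2) r by (auto simp: Suc_le_eq)
          then show ?thesis
            using no' g by blast
        qed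
        then show ?thesis
          using d by blast
      qed blast
    qed
    ultimately show ?case
      unfolding r_def[symmetric] by blast
  qed
  moreover have "g j < n" if "\<forall>i<m. g i < n" for g
    using that Suc.prems(1) by simp
  ultimately show ?case
    by blast
qed

lemma guess_all:
  assumes body: "\<And>s. (\<And>i. i < m \<Longrightarrow> s (20 + i) 0 < n) \<Longrightarrow>
      den n E c s 0 0 = 1 \<and> Q \<or> den n E c s 0 0 = s 0 0 \<and> \<not> P (\<lambda>i. s (20 + i) 0)"
    and c: "\<And>i. 20 + i \<notin> modified c"
    and P: "\<And>g h. (\<And>i. i < m \<Longrightarrow> g i = h i) \<Longrightarrow> P g \<Longrightarrow> P h"
  shows "den n E (guess m c) s 0 0 = 1 \<and> Q \<or> den n E (guess m c) s 0 0 = s 0 0 \<and>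
    \<not> (\<exists>g. (\<forall>i<m. g i < n) \<and> P g)"
proof -
  have "den n E (guess m c) s 0 0 = 1 \<and> Q \<or> den n E (guess m c) s 0 0 = s 0 0 \<and>
      \<not> (\<exists>g. (\<forall>i<m. g i < n) \<and> (\<forall>i<m. m \<le> i \<longrightarrow> g i = s (20 + i) 0) \<and> P g)"
    by (rule guess_spec, fact body, fact c, fact P) simp_all
  then show ?thesis
    by (simp add: leD)
qed

section \<open>Testing patterns and marking regions\<close>

fun allE :: "nat \<Rightarrow> (nat \<Rightarrow> ex) \<Rightarrow> ex" where
  "allE 0 f = One"
| "allE (Suc k) f = AndE (allE k f) (f k)"

lemma ev_allE: "ev n E (allE k f) s \<noteq> 0 \<longleftrightarrow> (\<forall>i<k. ev n E (f i) s \<noteq> 0)"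
  by (induction k) (auto simp: less_Suc_eq)

abbreviation Gv :: "nat \<Rightarrow> ex" where
  "Gv i \<equiv> Var (20 + i)"

definition Lit :: "bool \<Rightarrow> ex \<Rightarrow> ex \<Rightarrow> ex" where
  "Lit b x y = (if b then Adj x y else NotE (Adj x y))"

definition NeE :: "ex \<Rightarrow> ex \<Rightarrow> ex" where
  "NeE x y = NotE (EqE x y)"

definition holds :: "nat \<Rightarrow> (nat \<Rightarrow> nat \<Rightarrow> bool) \<Rightarrow> store \<Rightarrow> ex \<Rightarrow> bool" where
  "holds n E s x \<longleftrightarrow> ev n E x s \<noteq> 0"

lemma holds_simps:
  "holds n E s (AndE x y) \<longleftrightarrow> holds n E s x \<and> holds n E s y"
  "holds n E s (OrE x y) \<longleftrightarrow> holds n E s x \<or> holds n E s y"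
  "holds n E s (NotE x) \<longleftrightarrow> \<not> holds n E s x"
  "holds n E s (allE k f) \<longleftrightarrow> (\<forall>i<k. holds n E s (f i))"
  "holds n E s One"
  "holds n E s (NeE x y) \<longleftrightarrow> ev n E x s \<noteq> ev n E y s"
  "holds n E s (EqE x y) \<longleftrightarrow> ev n E x s = ev n E y s"
  "ev n E x s < n \<Longrightarrow> ev n E y s < n \<Longrightarrow> holds n E s (Adj x y) \<longleftrightarrow> E (ev n E x s) (ev n E y s)"
  "ev n E x s < n \<Longrightarrow> ev n E y s < n \<Longrightarrow> holds n E s (Lit b x y) \<longleftrightarrow> (E (ev n E x s) (ev n E y s) \<longleftrightarrow> b)"
  unfolding holds_def Lit_def NeE_def ev_allE by auto

definition stem_test :: "nat \<Rightarrow> (nat \<Rightarrow> ex) \<Rightarrow> ex" where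
  "stem_test k X = allE (Suc k) (\<lambda>i. allE (Suc k) (\<lambda>j.
     AndE (if i = j then One else NeE (X i) (X j)) (Lit (j = Suc i \<or> i = Suc j) (X i) (X j))))"

definition main_test :: "nat \<Rightarrow> ex \<Rightarrow> ex \<Rightarrow> ex \<Rightarrow> (nat \<Rightarrow> ex) \<Rightarrow> (nat \<Rightarrow> ex) \<Rightarrow> ex" where
  "main_test k v y w X Z = AndE (stem_test k X) (AndE (stem_test k Z)
     (AndE (allE (Suc k) (\<lambda>i. allE (Suc k) (\<lambda>j. AndE (NeE (X i) (Z j)) (Lit False (X i) (Z j)))))
     (AndE (allE (Suc k) (\<lambda>i. AndE (Lit (i = 0) v (X i)) (AndE (Lit (i = 0) v (Z i)) (AndE (Lit (i = 0) y (X i))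
       (AndE (Lit (i = 0) y (Z i)) (AndE (NeE v (X i)) (AndE (NeE v (Z i)) (AndE (NeE y (X i)) (AndE (NeE y (Z i))
       (AndE (NeE w (X i)) (NeE w (Z i))))))))))))
     (AndE (allE k (\<lambda>i. AndE (Lit False w (X i)) (Lit False w (Z i))))
     (AndE (Lit True v y) (AndE (Lit True v w) (AndE (Lit False w y) (NeE w y))))))))"

definition short_test :: "nat \<Rightarrow> ex \<Rightarrow> ex \<Rightarrow> ex \<Rightarrow> ex \<Rightarrow> (nat \<Rightarrow> ex) \<Rightarrow> ex" where
  "short_test k v y w z X = AndE (stem_test k X)
     (AndE (allE (Suc k) (\<lambda>i. AndE (Lit (i = 0) v (X i)) (AndE (Lit (i = 0) y (X i)) (AndE (NeE v (X i))
       (AndE (NeE y (X i)) (AndE (NeE w (X i)) (AndE (NeE z (X i)) (Lit False z (X i)))))))))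
     (AndE (allE k (\<lambda>i. Lit False w (X i))) (AndE (Lit True v z) (AndE (Lit True y z) (AndE (Lit True v y)
     (AndE (Lit True v w) (AndE (Lit True w z) (AndE (Lit False w y) (NeE w y)))))))))"

lemma stem_test_iff:
  assumes adj: "adjacency adj" and "\<And>i. i \<le> k \<Longrightarrow> ev n adj (X i) s = x i \<and> x i < n"
  shows "holds n adj s (stem_test k X) \<longleftrightarrow> adjacency.stem adj k x"
proof -
  have "holds n adj s (if i = j then One else NeE (X i) (X j)) \<longleftrightarrow> (x i = x j \<longrightarrow> i = j)" if "i \<le> k" "j \<le> k" for i j
    using assms(2) that by (simp add: holds_simps)
  moreover have "holds n adj s (Lit (j = Suc i \<or> i = Suc j) (X i) (X j)) \<longleftrightarrow> (adj (x i) (x j) \<longleftrightarrow> j = Suc i \<or> i = Suc j)"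
    if "i \<le> k" "j \<le> k" for i j
    using assms(2) that by (simp add: holds_simps)
  ultimately show ?thesis
    unfolding stem_test_def adjacency.stem_def[OF adj] holds_simps less_Suc_eq_le by simp
qed

lemma main_test_iff:
  assumes adj: "adjacency adj" and X: "\<And>i. i \<le> k \<Longrightarrow> ev n adj (X i) s = x i \<and> x i < n" and Z: "\<And>i. i \<le> k \<Longrightarrow> ev n adj (Z i) s = z i \<and> z i < n"
    and "ev n adj v' s = v" "ev n adj y' s = y" "ev n adj w' s = w" "v < n" "y < n" "w < n"
  shows "holds n adj s (main_test k v' y' w' X Z) \<longleftrightarrow> adjacency.main_pattern adj k v y w x z"
proof -
  have "holds n adj s (stem_test k X) \<longleftrightarrow> adjacency.stem adj k x" "holds n adj s (stem_test k Z) \<longleftrightarrow> adjacency.stem adj k z"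
    by (rule stem_test_iff[OF adj], fact X) (rule stem_test_iff[OF adj], fact Z)
  then show ?thesis
    unfolding main_test_def adjacency.main_pattern_def[OF adj] holds_simps(1,4) less_Suc_eq_le
    using X Z assms(4-9) by (simp add: holds_simps(5-9))
qed

lemma short_test_iff:
  assumes adj: "adjacency adj" and X: "\<And>i. i \<le> k \<Longrightarrow> ev n adj (X i) s = x i \<and> x i < n"
    and "ev n adj v' s = v" "ev n adj y' s = y" "ev n adj w' s = w" "ev n adj z' s = z" "v < n" "y < n" "w < n" "z < n"
  shows "holds n adj s (short_test k v' y' w' z' X) \<longleftrightarrow> adjacency.short_pattern adj k v y w z x"
proof -
  have "holds n adj s (stem_test k X) \<longleftrightarrow> adjacency.stem adj k x"
    by (rule stem_test_iff[OF adj], fact X)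
  then show ?thesis
    unfolding short_test_def adjacency.short_pattern_def[OF adj] holds_simps(1,4) less_Suc_eq_le
    using X assms(3-10) by (simp add: holds_simps(5-9))
qed

definition mark :: "ex \<Rightarrow> ex \<Rightarrow> cmd" where
  "mark r w = For 1 (Then (Put 3 (Var 1) (AndE r (NotE (Adj (Var 1) w)))) (Put 4 (Var 1) (AndE r (Adj (Var 1) w))))"

text \<open>The expressions are evaluated in stores that change during the loop, but they read only
  the guessed vertices, in variables from 20 on, and the loop variable; the hypotheses prescribe the
  stores only there.\<close>

lemma mark_spec:
  assumes r: "\<And>j t. j < n \<Longrightarrow> (\<And>a. 20 \<le> a \<Longrightarrow> t a = s a) \<Longrightarrow> t 1 0 = j \<Longrightarrow> holds n E t r \<longleftrightarrow> j \<in> R"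
    and w: "\<And>t. (\<And>a. 20 \<le> a \<Longrightarrow> t a = s a) \<Longrightarrow> ev n E w' t = w" "w < n" and R: "R \<subseteq> {..<n}"
  shows "marked n (den n E (mark r w') s) 3 = {a \<in> R. \<not> E a w}" "marked n (den n E (mark r w') s) 4 = {a \<in> R. E a w}"
proof -
  let ?I = "\<lambda>j t. (\<forall>a\<ge>20. t a = s a) \<and> (\<forall>a<j. t 3 a \<noteq> 0 \<longleftrightarrow> a \<in> R \<and> \<not> E a w) \<and> (\<forall>a<j. t 4 a \<noteq> 0 \<longleftrightarrow> a \<in> R \<and> E a w)"
  have I: "?I n (den n E (mark r w') s)"
    unfolding mark_def
  proof (rule For_inv[where I = ?I], goal_cases)
    case (2 j t)
    define t' where "t' = put 1 0 j t"
    define p where "p = ev n E (AndE r (NotE (Adj (Var 1) w'))) t'"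
    define t'' where "t'' = put 3 j p t'"
    define q where "q = ev n E (AndE r (Adj (Var 1) w')) t''"
    have t': "t' a = s a" if "20 \<le> a" for a
      unfolding t'_def using 2(2) that by (simp add: put_other)
    have t'': "t'' a = s a" if "20 \<le> a" for a
      unfolding t''_def using t'[OF that] that by (simp add: put_other)
    have t1: "t' 1 0 = j" "t'' 1 0 = j"
      unfolding t''_def t'_def by simp_all
    have "holds n E t' (AndE r (NotE (Adj (Var 1) w'))) \<longleftrightarrow> j \<in> R \<and> \<not> E j w"
      using r[OF 2(1) t' t1(1)] w(1)[OF t'] w(2) t1 2(1) by (simp add: holds_simps)
    then have p: "p \<noteq> 0 \<longleftrightarrow> j \<in> R \<and> \<not> E j w"
      unfolding p_def holds_def .
    have "holds n E t'' (AndE r (Adj (Var 1) w')) \<longleftrightarrow> j \<in> R \<and> E j w"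
      using r[OF 2(1) t'' t1(2)] w(1)[OF t''] w(2) t1 2(1) by (simp add: holds_simps)
    then have q: "q \<noteq> 0 \<longleftrightarrow> j \<in> R \<and> E j w"
      unfolding q_def holds_def .
    have den: "den n E (Then (Put 3 (Var 1) (AndE r (NotE (Adj (Var 1) w')))) (Put 4 (Var 1) (AndE r (Adj (Var 1) w')))) t' = put 4 j q t''"
      unfolding den.simps q_def p_def t''_def using t1 by (simp add: t''_def p_def del: ev.simps(7) cong: if_cong)
    have f: "put 4 j q t'' a = s a" if "20 \<le> a" for a
      using t''[OF that] that by (simp add: put_other)
    have g: "put 4 j q t'' 3 = (t 3)(j := p)" "put 4 j q t'' 4 = (t 4)(j := q)"
      unfolding t''_def t'_def by (auto simp: fun_eq_iff)
    show ?case
      unfolding t'_def[symmetric] den g using f 2(2) p q by (auto simp: less_Suc_eq)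
  qed simp
  then show "marked n (den n E (mark r w') s) 3 = {a \<in> R. \<not> E a w}" "marked n (den n E (mark r w') s) 4 = {a \<in> R. E a w}"
    unfolding marked_def using R by auto
qed

definition main_reg :: "nat \<Rightarrow> ex \<Rightarrow> ex \<Rightarrow> (nat \<Rightarrow> ex) \<Rightarrow> (nat \<Rightarrow> ex) \<Rightarrow> ex" where
  "main_reg k v y X Z = OrE (OrE (EqE (Var 1) (X (k - 1))) (OrE (EqE (Var 1) (X k)) (OrE (EqE (Var 1) (Z (k - 1))) (EqE (Var 1) (Z k)))))
     (AndE (Lit False (Var 1) v) (AndE (Lit False (Var 1) y)
       (allE k (\<lambda>i. AndE (Lit False (Var 1) (X i)) (Lit False (Var 1) (Z i))))))"

definition short_reg :: "nat \<Rightarrow> ex \<Rightarrow> ex \<Rightarrow> ex \<Rightarrow> (nat \<Rightarrow> ex) \<Rightarrow> ex" where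
  "short_reg k v y z X = OrE (OrE (EqE (Var 1) (X (k - 1))) (EqE (Var 1) (X k)))
     (AndE (Lit False (Var 1) v) (AndE (Lit False (Var 1) y) (AndE (Lit False (Var 1) z)
       (allE k (\<lambda>i. Lit False (Var 1) (X i))))))"

lemma main_reg_iff:
  assumes adj: "adjacency adj" and X: "\<And>i. i \<le> k \<Longrightarrow> ev n adj (X i) s = x i \<and> x i < n"
    and Z: "\<And>i. i \<le> k \<Longrightarrow> ev n adj (Z i) s = z i \<and> z i < n"
    and vy: "ev n adj v' s = v" "ev n adj y' s = y" "v < n" "y < n" and j: "s 1 0 = j" "j < n"
  shows "holds n adj s (main_reg k v' y' X Z) \<longleftrightarrow> j \<in> adjacency.main_region adj {..<n} k v y x z"
proof -
  have k: "k - 1 \<le> k" "k \<le> k"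
    by simp_all
  have ex: "holds n adj s (Lit False (Var 1) (X i)) \<longleftrightarrow> \<not> adj j (x i)" "holds n adj s (Lit False (Var 1) (Z i)) \<longleftrightarrow> \<not> adj j (z i)"
    if "i < k" for i
    using X[of i] Z[of i] j that by (simp_all add: holds_simps)
  have anti: "p \<le> q \<and> q \<le> p \<longleftrightarrow> p = q" for p q :: nat
    by auto
  have le: "holds n adj s (Le a b) \<longleftrightarrow> ev n adj a s \<le> ev n adj b s" for a b
    unfolding holds_def by simp
  have "holds n adj s (main_reg k v' y' X Z) \<longleftrightarrow> (j = x (k - 1) \<or> j = x k \<or> j = z (k - 1) \<or> j = z k) \<or>
      \<not> adj j v \<and> \<not> adj j y \<and> (\<forall>i<k. \<not> adj j (x i) \<and> \<not> adj j (z i))"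
    unfolding main_reg_def holds_simps(1,2,4,7)
    using X[OF k(1)] X[OF k(2)] Z[OF k(1)] Z[OF k(2)] vy j by (simp add: holds_simps(9) ex le anti del: One_nat_def)
  moreover have "j \<in> adjacency.main_region adj {..<n} k v y x z \<longleftrightarrow> j \<in> {x (k - 1), x k, z (k - 1), z k} \<or>
      (\<forall>f\<in>{v, y} \<union> x ` {..<k} \<union> z ` {..<k}. \<not> adj j f)"
    unfolding adjacency.main_region_def[OF adj] adjacency.region_def[OF adj] using j(2) by simp
  moreover have "(\<forall>f\<in>{v, y} \<union> x ` {..<k} \<union> z ` {..<k}. \<not> adj j f) \<longleftrightarrow>
      \<not> adj j v \<and> \<not> adj j y \<and> (\<forall>i<k. \<not> adj j (x i) \<and> \<not> adj j (z i))"
    unfolding ball_Un ball_simps Ball_def lessThan_iff by blast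
  ultimately show ?thesis
    by simp
qed

lemma short_reg_iff:
  assumes adj: "adjacency adj" and X: "\<And>i. i \<le> k \<Longrightarrow> ev n adj (X i) s = x i \<and> x i < n"
    and vy: "ev n adj v' s = v" "ev n adj y' s = y" "ev n adj z' s = z" "v < n" "y < n" "z < n" and j: "s 1 0 = j" "j < n"
  shows "holds n adj s (short_reg k v' y' z' X) \<longleftrightarrow> j \<in> adjacency.short_region adj {..<n} k v y z x"
proof -
  have k: "k - 1 \<le> k" "k \<le> k"
    by simp_all
  have ex: "holds n adj s (Lit False (Var 1) (X i)) \<longleftrightarrow> \<not> adj j (x i)" if "i < k" for i
    using X[of i] j that by (simp add: holds_simps)
  have anti: "p \<le> q \<and> q \<le> p \<longleftrightarrow> p = q" for p q :: nat
    by auto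
  have le: "holds n adj s (Le a b) \<longleftrightarrow> ev n adj a s \<le> ev n adj b s" for a b
    unfolding holds_def by simp
  have "holds n adj s (short_reg k v' y' z' X) \<longleftrightarrow> (j = x (k - 1) \<or> j = x k) \<or>
      \<not> adj j v \<and> \<not> adj j y \<and> \<not> adj j z \<and> (\<forall>i<k. \<not> adj j (x i))"
    unfolding short_reg_def holds_simps(1,2,4,7)
    using X[OF k(1)] X[OF k(2)] vy j by (simp add: holds_simps(9) ex le anti del: One_nat_def)
  moreover have "j \<in> adjacency.short_region adj {..<n} k v y z x \<longleftrightarrow> j \<in> {x (k - 1), x k} \<or>
      (\<forall>f\<in>{v, y, z} \<union> x ` {..<k}. \<not> adj j f)"
    unfolding adjacency.short_region_def[OF adj] adjacency.region_def[OF adj] using j(2) by simp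
  moreover have "(\<forall>f\<in>{v, y, z} \<union> x ` {..<k}. \<not> adj j f) \<longleftrightarrow>
      \<not> adj j v \<and> \<not> adj j y \<and> \<not> adj j z \<and> (\<forall>i<k. \<not> adj j (x i))"
    unfolding ball_Un ball_simps Ball_def lessThan_iff by blast
  ultimately show ?thesis
    by simp
qed

definition init :: "ex \<Rightarrow> ex \<Rightarrow> ex \<Rightarrow> ex \<Rightarrow> cmd" where
  "init a b c d = Then (Assign 11 a) (Then (Assign 12 b) (Then (Assign 17 c) (Assign 18 d)))"

lemma init_spec:
  fixes s :: store and n a b c d :: nat and E :: "nat \<Rightarrow> nat \<Rightarrow> bool"
  defines "t \<equiv> den n E (init (Gv a) (Gv b) (Gv c) (Gv d)) s"
  shows "t 11 0 = s (20 + a) 0" "t 12 0 = s (20 + b) 0" "t 17 0 = s (20 + c) 0" "t 18 0 = s (20 + d) 0"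
    "t 0 = s 0" "marked n t 3 = marked n s 3" "marked n t 4 = marked n s 4"
  unfolding t_def init_def marked_def by (simp_all add: put_other)

lemma modified_mark: "modified (mark r w) = {1, 3, 4}"
  unfolding mark_def by auto

lemma mark_other: "a \<notin> {1, 3, 4} \<Longrightarrow> den n E (mark r w) s a = s a"
  by (rule den_other) (simp add: modified_mark)

text \<open>Layout of the guess: \<open>v\<close>, \<open>y\<close>, \<open>w\<close> at 0, 1, 2,
  then \<open>x 0\<close>, ..., \<open>x k\<close> from 3 on and \<open>z 0\<close>, ...,
  \<open>z k\<close> from \<open>4 + k\<close> on, which makes \<open>2 * k + 5\<close>
  variables.\<close>

definition main_body :: "nat \<Rightarrow> cmd" where
  "main_body k = Ite (main_test k (Gv 0) (Gv 1) (Gv 2) (\<lambda>i. Gv (3 + i)) (\<lambda>i. Gv (4 + k + i)))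
     (Then (mark (main_reg k (Gv 0) (Gv 1) (\<lambda>i. Gv (3 + i)) (\<lambda>i. Gv (4 + k + i))) (Gv 2))
     (Then (init (Gv (3 + (k - 1))) (Gv (4 + k + (k - 1))) (Gv (3 + k)) (Gv (4 + k + k))) decide)) Nop"

text \<open>Layout of the guess: \<open>v\<close>, \<open>y\<close>, \<open>w\<close>,
  \<open>z\<close> at 0 to 3 and \<open>x 0\<close>, ..., \<open>x k\<close> from 4 on, which makes
  \<open>k + 5\<close> variables.\<close>

definition short_body :: "nat \<Rightarrow> cmd" where
  "short_body k = Ite (short_test k (Gv 0) (Gv 1) (Gv 2) (Gv 3) (\<lambda>i. Gv (4 + i)))
     (Then (mark (short_reg k (Gv 0) (Gv 1) (Gv 3) (\<lambda>i. Gv (4 + i))) (Gv 2))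
     (Then (init (Gv (4 + (k - 1))) (Gv (4 + (k - 1))) (Gv (4 + k)) (Gv (4 + k))) short_decide)) Nop"

lemma modified_body: "20 + i \<notin> modified (main_body k)" "20 + i \<notin> modified (short_body k)"
  unfolding main_body_def short_body_def init_def modified.simps modified_mark decide_def short_decide_def check_K_def restart_def walk_def mark_nu_def find_K_def forest_def search_def advance_def scan_def select_def by auto

text \<open>Each guess is handled in quadratic time. The pattern tests unroll their quantifiers over
  indices up to \<open>k\<close> into expressions, so they contribute no loop.\<close>

lemma depth_body: "depth (main_body k) = 2" "depth (short_body k) = 2"
  unfolding main_body_def short_body_def init_def mark_def decide_def short_decide_def check_K_def restart_def walk_def mark_nu_def find_K_def forest_def search_def advance_def scan_def select_def by simp_all

definition main_guess :: "(nat, 'b) pre_digraph \<Rightarrow> nat \<Rightarrow> (nat \<Rightarrow> nat) \<Rightarrow> bool" where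
  "main_guess G k g \<longleftrightarrow> (\<exists>xs zs. adjacency.bomb (dominates G) (g 0) (g 1) (g 2) xs zs \<and> k < length xs \<and> k < length zs \<and>
     set xs \<union> set zs \<subseteq> verts G \<and> (\<forall>i\<le>k. xs ! i = g (3 + i) \<and> zs ! i = g (4 + k + i)))"

definition short_guess :: "(nat, 'b) pre_digraph \<Rightarrow> nat \<Rightarrow> (nat \<Rightarrow> nat) \<Rightarrow> bool" where
  "short_guess G k g \<longleftrightarrow> (\<exists>xs. adjacency.bomb (dominates G) (g 0) (g 1) (g 2) xs [g 3] \<and> k < length xs \<and>
     set xs \<subseteq> verts G \<and> (\<forall>i\<le>k. xs ! i = g (4 + i)))"

lemma main_body_spec:
  assumes G: "graph G" "\<not> contains_induced (long_theta l) G" "\<not> (\<exists>C. hole G C \<and> length C = 4)" and l: "l = k + 3" "1 \<le> k"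
    and V: "verts G = {..<n}" and s: "\<And>i. i < 2 * k + 5 \<Longrightarrow> s (20 + i) 0 < n"
  shows "den n (dominates G) (main_body k) s 0 0 = 1 \<and> contains_induced (long_ban_the_bomb l) G \<or>
    den n (dominates G) (main_body k) s 0 0 = s 0 0 \<and> \<not> main_guess G k (\<lambda>i. s (20 + i) 0)"
proof -
  interpret adjacency "dominates G"
    by (rule graph_adjacency) fact
  note adj = adjacency_axioms
  define g where "g i = s (20 + i) 0" for i
  have g: "g i < n" if "i < 2 * k + 5" for i
    unfolding g_def using s[OF that] .
  have ev: "ev n (dominates G) (Gv i) t = g i" if "\<And>a. 20 \<le> a \<Longrightarrow> t a = s a" for i t
    using that[of "20 + i"] unfolding g_def by simp
  have evX: "ev n (dominates G) (Gv (3 + i)) t = g (3 + i) \<and> g (3 + i) < n"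
    and evZ: "ev n (dominates G) (Gv (4 + k + i)) t = g (4 + k + i) \<and> g (4 + k + i) < n"
    if "\<And>a. 20 \<le> a \<Longrightarrow> t a = s a" "i \<le> k" for i t
    using ev[of t "3 + i", OF that(1)] ev[of t "4 + k + i", OF that(1)] g[of "3 + i"] g[of "4 + k + i"] that(2) by auto
  have g3: "g 0 < n" "g 1 < n" "g 2 < n"
    using g by simp_all
  let ?test = "main_test k (Gv 0) (Gv 1) (Gv 2) (\<lambda>i. Gv (3 + i)) (\<lambda>i. Gv (4 + k + i))"
  have iff: "holds n (dominates G) s ?test \<longleftrightarrow> main_pattern k (g 0) (g 1) (g 2) x z"
    if "\<And>i. i \<le> k \<Longrightarrow> x i = g (3 + i) \<and> z i = g (4 + k + i)" for x z
    by (rule main_test_iff[OF adj])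
      (use evX[of s] evZ[of s] ev[of s 0] ev[of s 1] ev[of s 2] g3 that in auto)
  show ?thesis
  proof (cases "holds n (dominates G) s ?test")
    case False
    have "\<not> main_guess G k g"
    proof
      assume "main_guess G k g"
      then obtain xs zs where B: "bomb (g 0) (g 1) (g 2) xs zs" "k < length xs" "k < length zs"
        and e: "\<And>i. i \<le> k \<Longrightarrow> xs ! i = g (3 + i) \<and> zs ! i = g (4 + k + i)"
        unfolding main_guess_def by blast
      show False
        using False iff[OF e] bomb_main_pattern[OF B] by blast
    qed
    moreover have "den n (dominates G) (main_body k) s = s"
      using False unfolding main_body_def holds_def den.simps by simp
    ultimately show ?thesis
      unfolding g_def[abs_def] by simp
  next
    case True
    define x where "x i = g (3 + i)" for i
    define z where "z i = g (4 + k + i)" for i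
    define R where "R = main_region (verts G) k (g 0) (g 1) x z"
    have pat: "main_pattern k (g 0) (g 1) (g 2) x z"
      using True iff[of x z] unfolding x_def z_def by blast
    define t where "t = den n (dominates G) (mark (main_reg k (Gv 0) (Gv 1) (\<lambda>i. Gv (3 + i)) (\<lambda>i. Gv (4 + k + i))) (Gv 2)) s"
    define u where "u = den n (dominates G) (init (Gv (3 + (k - 1))) (Gv (4 + k + (k - 1))) (Gv (3 + k)) (Gv (4 + k + k))) t"
    have R: "R \<subseteq> {..<n}"
      unfolding R_def main_region_def region_def V by blast
    have reg: "holds n (dominates G) t' (main_reg k (Gv 0) (Gv 1) (\<lambda>i. Gv (3 + i)) (\<lambda>i. Gv (4 + k + i))) \<longleftrightarrow> j \<in> R"
      if "j < n" "\<And>a. 20 \<le> a \<Longrightarrow> t' a = s a" "t' 1 0 = j" for j t'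
      unfolding R_def V
      by (rule main_reg_iff[OF adj])
        (use evX[OF that(2)] evZ[OF that(2)] ev[OF that(2), of 0] ev[OF that(2), of 1] g3 that(1,3) in \<open>auto simp: x_def z_def\<close>)
    have w: "ev n (dominates G) (Gv 2) t' = g 2" if "\<And>a. 20 \<le> a \<Longrightarrow> t' a = s a" for t'
      by (rule ev[OF that])
    have m3: "marked n t 3 = {a \<in> R. \<not> a \<rightarrow>\<^bsub>G\<^esub> g 2}"
      unfolding t_def by (rule mark_spec(1), fact reg, fact w, fact g3(3), fact R)
    have m4: "marked n t 4 = {a \<in> R. a \<rightarrow>\<^bsub>G\<^esub> g 2}"
      unfolding t_def by (rule mark_spec(2), fact reg, fact w, fact g3(3), fact R)
    have t: "t a = s a" if "a \<notin> {1, 3, 4}" for a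
      unfolding t_def by (rule mark_other[OF that])
    note i = init_spec[where E = "dominates G" and s = t and n = n, of "3 + (k - 1)" "4 + k + (k - 1)" "3 + k" "4 + k + k", folded u_def]
    have tg: "t (20 + i) 0 = g i" for i
      unfolding g_def using t[of "20 + i"] by simp
    have u: "u 11 0 = x (k - 1)" "u 12 0 = z (k - 1)" "u 17 0 = x k" "u 18 0 = z k" "u 0 0 = s 0 0"
      unfolding i(1-5) tg x_def z_def using t[of 0] by simp_all
    have mu: "marked n u 3 = {a \<in> R. \<not> a \<rightarrow>\<^bsub>G\<^esub> g 2}" "marked n u 4 = {a \<in> R. a \<rightarrow>\<^bsub>G\<^esub> g 2}"
      unfolding i(6,7) using m3 m4 by this
    have den: "den n (dominates G) (main_body k) s = den n (dominates G) decide u"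
      using True unfolding main_body_def holds_def den.simps u_def t_def by simp
    have xz: "x i \<in> verts G" "z i \<in> verts G" if "i \<le> k" for i
      using g[of "3 + i"] g[of "4 + k + i"] that unfolding V x_def z_def by auto
    have v: "g 0 \<in> verts G" "g 1 \<in> verts G" "g 2 \<in> verts G"
      using g3 unfolding V by simp_all
    have "\<not> main_guess G k g" if "\<not> (\<exists>xs zs. bomb (g 0) (g 1) (g 2) xs zs \<and> k < length xs \<and> k < length zs \<and>
        set xs \<union> set zs \<subseteq> verts G \<and> (\<forall>i\<le>k. xs ! i = x i \<and> zs ! i = z i))"
      using that unfolding main_guess_def x_def z_def .
    moreover have "contains_induced (long_ban_the_bomb l) G" if ex: "\<exists>xs zs. bomb (g 0) (g 1) (g 2) xs zs \<and> k < length xs \<and>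
        k < length zs \<and> set xs \<union> set zs \<subseteq> verts G"
    proof -
      obtain xs zs where B: "bomb (g 0) (g 1) (g 2) xs zs" "k < length xs" "k < length zs" "set xs \<union> set zs \<subseteq> verts G"
        using ex by blast
      have "long_bomb l (g 0) (g 1) (g 2) xs zs"
        unfolding long_bomb_def using B l by simp
      then show ?thesis
        by (rule long_bomb_contained[OF G(1)]) (use B(4) v in auto)
    qed
    ultimately show ?thesis
      using main_decide[OF G l pat v(1,3) xz mu[unfolded R_def] u(1-4)]
      unfolding den u(5) g_def[abs_def, symmetric] by blast
  qed
qed

lemma short_body_spec:
  assumes G: "graph G" and l: "l = k + 3" "1 \<le> k"
    and V: "verts G = {..<n}" and s: "\<And>i. i < k + 5 \<Longrightarrow> s (20 + i) 0 < n"
  shows "den n (dominates G) (short_body k) s 0 0 = 1 \<and> contains_induced (long_ban_the_bomb l) G \<or>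
    den n (dominates G) (short_body k) s 0 0 = s 0 0 \<and> \<not> short_guess G k (\<lambda>i. s (20 + i) 0)"
proof -
  interpret adjacency "dominates G"
    by (rule graph_adjacency) fact
  note adj = adjacency_axioms
  define g where "g i = s (20 + i) 0" for i
  have g: "g i < n" if "i < k + 5" for i
    unfolding g_def using s[OF that] .
  have ev: "ev n (dominates G) (Gv i) t = g i" if "\<And>a. 20 \<le> a \<Longrightarrow> t a = s a" for i t
    using that[of "20 + i"] unfolding g_def by simp
  have evX: "ev n (dominates G) (Gv (4 + i)) t = g (4 + i) \<and> g (4 + i) < n"
    if "\<And>a. 20 \<le> a \<Longrightarrow> t a = s a" "i \<le> k" for i t
    using ev[of t "4 + i", OF that(1)] g[of "4 + i"] that(2) by auto
  have g4: "g 0 < n" "g 1 < n" "g 2 < n" "g 3 < n"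
    using g by simp_all
  let ?test = "short_test k (Gv 0) (Gv 1) (Gv 2) (Gv 3) (\<lambda>i. Gv (4 + i))"
  have iff: "holds n (dominates G) s ?test \<longleftrightarrow> short_pattern k (g 0) (g 1) (g 2) (g 3) x"
    if "\<And>i. i \<le> k \<Longrightarrow> x i = g (4 + i)" for x
    by (rule short_test_iff[OF adj])
      (use evX[of s] ev[of s 0] ev[of s 1] ev[of s 2] ev[of s 3] g4 that in auto)
  show ?thesis
  proof (cases "holds n (dominates G) s ?test")
    case False
    have "\<not> short_guess G k g"
    proof
      assume "short_guess G k g"
      then obtain xs where B: "bomb (g 0) (g 1) (g 2) xs [g 3]" "k < length xs"
        and e: "\<And>i. i \<le> k \<Longrightarrow> xs ! i = g (4 + i)"
        unfolding short_guess_def by blast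
      show False
        using False iff[OF e] bomb_short_pattern[OF B] by blast
    qed
    moreover have "den n (dominates G) (short_body k) s = s"
      using False unfolding short_body_def holds_def den.simps by simp
    ultimately show ?thesis
      unfolding g_def[abs_def] by simp
  next
    case True
    define x where "x i = g (4 + i)" for i
    define R where "R = short_region (verts G) k (g 0) (g 1) (g 3) x"
    have pat: "short_pattern k (g 0) (g 1) (g 2) (g 3) x"
      using True iff[of x] unfolding x_def by blast
    define t where "t = den n (dominates G) (mark (short_reg k (Gv 0) (Gv 1) (Gv 3) (\<lambda>i. Gv (4 + i))) (Gv 2)) s"
    define u where "u = den n (dominates G) (init (Gv (4 + (k - 1))) (Gv (4 + (k - 1))) (Gv (4 + k)) (Gv (4 + k))) t"
    have R: "R \<subseteq> {..<n}"
      unfolding R_def short_region_def region_def V by blast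
    have reg: "holds n (dominates G) t' (short_reg k (Gv 0) (Gv 1) (Gv 3) (\<lambda>i. Gv (4 + i))) \<longleftrightarrow> j \<in> R"
      if "j < n" "\<And>a. 20 \<le> a \<Longrightarrow> t' a = s a" "t' 1 0 = j" for j t'
      unfolding R_def V
      by (rule short_reg_iff[OF adj])
        (use evX[OF that(2)] ev[OF that(2), of 0] ev[OF that(2), of 1] ev[OF that(2), of 3] g4 that(1,3) in \<open>auto simp: x_def\<close>)
    have w: "ev n (dominates G) (Gv 2) t' = g 2" if "\<And>a. 20 \<le> a \<Longrightarrow> t' a = s a" for t'
      by (rule ev[OF that])
    have m3: "marked n t 3 = {a \<in> R. \<not> a \<rightarrow>\<^bsub>G\<^esub> g 2}"
      unfolding t_def by (rule mark_spec(1), fact reg, fact w, fact g4(3), fact R)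
    have m4: "marked n t 4 = {a \<in> R. a \<rightarrow>\<^bsub>G\<^esub> g 2}"
      unfolding t_def by (rule mark_spec(2), fact reg, fact w, fact g4(3), fact R)
    have t: "t a = s a" if "a \<notin> {1, 3, 4}" for a
      unfolding t_def by (rule mark_other[OF that])
    note i = init_spec[where E = "dominates G" and s = t and n = n, of "4 + (k - 1)" "4 + (k - 1)" "4 + k" "4 + k", folded u_def]
    have tg: "t (20 + i) 0 = g i" for i
      unfolding g_def using t[of "20 + i"] by simp
    have u: "u 11 0 = x (k - 1)" "u 12 0 = x (k - 1)" "u 17 0 = x k" "u 18 0 = x k" "u 0 0 = s 0 0"
      unfolding i(1-5) tg x_def using t[of 0] by simp_all
    have mu: "marked n u 3 = {a \<in> R. \<not> a \<rightarrow>\<^bsub>G\<^esub> g 2}" "marked n u 4 = {a \<in> R. a \<rightarrow>\<^bsub>G\<^esub> g 2}"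
      unfolding i(6,7) using m3 m4 by this
    have den: "den n (dominates G) (short_body k) s = den n (dominates G) short_decide u"
      using True unfolding short_body_def holds_def den.simps u_def t_def by simp
    have xz: "x i \<in> verts G" if "i \<le> k" for i
      using g[of "4 + i"] that unfolding V x_def by auto
    have v: "g 0 \<in> verts G" "g 1 \<in> verts G" "g 2 \<in> verts G" "g 3 \<in> verts G"
      using g4 unfolding V by simp_all
    have "\<not> short_guess G k g" if "\<not> (\<exists>xs. bomb (g 0) (g 1) (g 2) xs [g 3] \<and> k < length xs \<and>
        set xs \<subseteq> verts G \<and> (\<forall>i\<le>k. xs ! i = x i))"
      using that unfolding short_guess_def x_def .
    moreover have "contains_induced (long_ban_the_bomb l) G" if ex: "\<exists>xs. bomb (g 0) (g 1) (g 2) xs [g 3] \<and> k < length xs \<and>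
        set xs \<subseteq> verts G"
    proof -
      obtain xs where B: "bomb (g 0) (g 1) (g 2) xs [g 3]" "k < length xs" "set xs \<subseteq> verts G"
        using ex by blast
      have "long_bomb l (g 0) (g 1) (g 2) xs [g 3]"
        unfolding long_bomb_def using B l by simp
      then show ?thesis
        by (rule long_bomb_contained[OF G(1)]) (use B(3) v in auto)
    qed
    ultimately show ?thesis
      using short_decide_spec[OF G l(2) pat V xz mu[unfolded R_def] u(1-4)]
      unfolding den u(5) g_def[abs_def, symmetric] by blast
  qed
qed

lemma main_guess_cong: "(\<And>i. i < 2 * k + 5 \<Longrightarrow> g i = h i) \<Longrightarrow> main_guess G k g \<Longrightarrow> main_guess G k h"
proof -
  assume e: "\<And>i. i < 2 * k + 5 \<Longrightarrow> g i = h i" and g: "main_guess G k g"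
  have 0: "g 0 = h 0" "g 1 = h 1" "g 2 = h 2"
    using e[of 0] e[of 1] e[of 2] by auto
  have 1: "g (3 + i) = h (3 + i) \<and> g (4 + k + i) = h (4 + k + i)" if "i \<le> k" for i
    using e[of "3 + i"] e[of "4 + k + i"] e[of 0] e[of 1] e[of 2] that by auto
  show ?thesis
    using g unfolding main_guess_def 0 by (simp add: 1 cong: conj_cong)
qed

lemma short_guess_cong: "(\<And>i. i < k + 5 \<Longrightarrow> g i = h i) \<Longrightarrow> short_guess G k g \<Longrightarrow> short_guess G k h"
proof -
  assume e: "\<And>i. i < k + 5 \<Longrightarrow> g i = h i" and g: "short_guess G k g"
  have 0: "g 0 = h 0" "g 1 = h 1" "g 2 = h 2" "g 3 = h 3"
    using e[of 0] e[of 1] e[of 2] e[of 3] by auto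
  have 1: "g (4 + i) = h (4 + i)" if "i \<le> k" for i
    using e[of "4 + i"] e[of 0] e[of 1] e[of 2] e[of 3] that by auto
  show ?thesis
    using g unfolding short_guess_def 0 by (simp add: 1 cong: conj_cong)
qed

lemma guess_exists:
  assumes G: "graph G" "\<not> (\<exists>C. hole G C \<and> length C = 4)" and l: "l = k + 3"
    and V: "verts G = {..<n}" and Q: "contains_induced (long_ban_the_bomb l) G"
  shows "(\<exists>g. (\<forall>i<2 * k + 5. g i < n) \<and> main_guess G k g) \<or> (\<exists>g. (\<forall>i<k + 5. g i < n) \<and> short_guess G k g)"
proof -
  interpret adjacency "dominates G"
    by (rule graph_adjacency) fact
  obtain v y w xs zs where B: "long_bomb l v y w xs zs" and L: "insert v (insert y (set (xs @ w # rev zs))) \<subseteq> verts G"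
    by (rule long_bomb_exists[OF G Q])
  \<comment> \<open>Since \<open>l = k + 3\<close>, the bound \<open>l \<le> length xs + 2\<close>
    says \<open>k < length xs\<close>: the arm is long enough for the guess.\<close>
  have b: "bomb v y w xs zs" and kx: "k < length xs" and z: "length zs = 1 \<or> k < length zs"
    using B l unfolding long_bomb_def by auto
  have m: "v < n" "y < n" "w < n" "set xs \<subseteq> {..<n}" "set zs \<subseteq> {..<n}"
    using L unfolding V by auto
  have x: "xs ! i < n" if "i < length xs" for i
    using m(4) nth_mem[OF that] by blast
  have z': "zs ! i < n" if "i < length zs" for i
    using m(5) nth_mem[OF that] by blast
  from z show ?thesis
  proof
    assume "length zs = 1"
    then obtain c where c: "zs = [c]"
      by (auto simp: length_Suc_conv)
    let ?g = "(\<lambda>i. if i = 0 then v else if i = 1 then y else if i = 2 then w else if i = 3 then c else xs ! (i - 4))"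
    have a: "short_guess G k ?g"
      unfolding short_guess_def using b kx m(4) c V by auto
    have b: "\<forall>i<k + 5. ?g i < n"
      using m(1-3,5) c x kx by auto
    show ?thesis
      by (rule disjI2, rule exI[of _ ?g], rule conjI, fact b, fact a)
  next
    assume kz: "k < length zs"
    \<comment> \<open>The initial parts of the arms, placed according to the layout of
      \<open>main_body\<close>.\<close>
    let ?g = "(\<lambda>i. if i = 0 then v else if i = 1 then y else if i = 2 then w else if i < 4 + k then xs ! (i - 3) else zs ! (i - (4 + k)))"
    have a: "main_guess G k ?g"
      unfolding main_guess_def using b kx kz m(4,5) V by (intro exI[of _ xs] exI[of _ zs]) auto
    have b: "\<forall>i<2 * k + 5. ?g i < n"
      using m(1-3) x z' kx kz by auto
    show ?thesis
      by (rule disjI1, rule exI[of _ ?g], rule conjI, fact b, fact a)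
  qed
qed

text \<open>The case of a one-vertex arm takes only \<open>k + 5\<close> guesses, so the exponent is
  that of the first part.\<close>

definition detect :: "nat \<Rightarrow> cmd" where
  "detect k = Then (guess (2 * k + 5) (main_body k)) (guess (k + 5) (short_body k))"

lemma depth_detect: "depth (detect k) = 2 * k + 7"
  unfolding detect_def depth.simps depth_guess depth_body by simp

lemma detect_spec:
  assumes G: "graph G" "\<not> contains_induced (long_theta l) G" "\<not> (\<exists>C. hole G C \<and> length C = 4)" and l: "l = k + 3" "1 \<le> k"
    and V: "verts G = {..<n}"
  shows "den n (dominates G) (detect k) (\<lambda>_ _. 0) 0 0 = (if contains_induced (long_ban_the_bomb l) G then 1 else 0)"
proof -
  let ?Q = "contains_induced (long_ban_the_bomb l) G"
  define t where "t = den n (dominates G) (guess (2 * k + 5) (main_body k)) (\<lambda>_ _. 0)"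
  define u where "u = den n (dominates G) (guess (k + 5) (short_body k)) t"
  have "t 0 0 = 1 \<and> ?Q \<or> t 0 0 = 0 \<and> \<not> (\<exists>g. (\<forall>i<2 * k + 5. g i < n) \<and> main_guess G k g)"
    unfolding t_def by (rule guess_all[where s = "\<lambda>_ _. 0"], fact main_body_spec[OF G l V], fact modified_body(1), fact main_guess_cong)
  moreover have "u 0 0 = 1 \<and> ?Q \<or> u 0 0 = t 0 0 \<and> \<not> (\<exists>g. (\<forall>i<k + 5. g i < n) \<and> short_guess G k g)"
    unfolding u_def by (rule guess_all, fact short_body_spec[OF G(1) l V], fact modified_body(2), fact short_guess_cong)
  moreover have "den n (dominates G) (detect k) (\<lambda>_ _. 0) = u"
    unfolding detect_def u_def t_def by simp
  ultimately show ?thesis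
    using guess_exists[OF G(1,3) l(1) V] by auto
qed

theorem theorem2p8:
  fixes l :: nat
  assumes "4 \<le> l"
  shows "\<exists>p T.
    (\<lambda>n. real (T n)) \<in> O(\<lambda>n. real n ^ (2 * l + 1)) \<and>
    decides_in_time p
      (\<lambda>G. \<not> contains_induced (long_theta l) G \<and> \<not> (\<exists>C. hole G C \<and> length C = 4))
      (contains_induced (long_ban_the_bomb l)) T"
proof -
  define k where "k = l - 3"
  have k: "l = k + 3" "1 \<le> k"
    unfolding k_def using assms by simp_all
  \<comment> \<open>\<open>2 * k + 5\<close> guessing loops around a body of depth 2 give
    \<open>2 * k + 7\<close>, which is \<open>2 * l + 1\<close> because
    \<open>k = l - 3\<close>.\<close>
  have "depth (detect k) = 2 * l + 1"
    unfolding depth_detect k(1) by simp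
  moreover have "\<exists>p T. (\<lambda>n. real (T n)) \<in> O(\<lambda>n. real n ^ depth (detect k)) \<and>
    decides_in_time p (\<lambda>G. \<not> contains_induced (long_theta l) G \<and> \<not> (\<exists>C. hole G C \<and> length C = 4))
      (contains_induced (long_ban_the_bomb l)) T"
  proof (rule decides_in_timeI)
    fix n and G :: "(nat, nat \<times> nat) pre_digraph"
    assume "graph G" "verts G = {..<n}" "\<not> contains_induced (long_theta l) G \<and> \<not> (\<exists>C. hole G C \<and> length C = 4)"
    then show "den n (dominates G) (detect k) (\<lambda>_ _. 0) 0 0 = (if contains_induced (long_ban_the_bomb l) G then 1 else 0)"
      using detect_spec[OF _ _ _ k] by blast
  qed
  ultimately show ?thesis
    by simp
qed

end
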